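(* Assume $\sigma\in C^2(\mathbb{R})$ and let $\bar u\in L^2(\mathbb{R})$ be deterministic with compact support, such that the computational domain contains the support of the exact solution $u(t)$ of $du-\tfrac12\partial_x(\sigma\partial_x(\sigma u))dt+\partial_x(\sigma u)dW_t=0$, $u(0)=\bar u$, for all $t\in[0,T]$. Let $(u_h,q_h)$ be the LDG approximation defined in the context with the fluxes given there (parameters $\gamma,\theta\in[0,1]$, $\widetilde\gamma,\eta_u,\eta_q\ge0$; well-posedness of the LDG system is only known for $\eta_u=0$, so for $\eta_u>0$ existence of the LDG solution is presupposed). Then for every $t\in(0,T]$, $$\begin{aligned}\mathbb{E}\bigl[\|u_h(t)\|_2^2\bigr]&+\tfrac14\sum_{j}(\gamma+2\widetilde\gamma)\Bigl(|(\sigma^2)'|\int_0^t\mathbb{E}\bigl[\llbracket u_h(s)\rrbracket^2\bigr]ds\Bigr)_{j-\frac12}\\&+\sum_{j}\Bigl(|\sigma|\int_0^t\bigl(\eta_u\mathbb{E}[\llbracket q_h(s)\rrbracket^2]+\eta_q\mathbb{E}[\llbracket u_h(s)\rrbracket^2]\bigr)ds\Bigr)_{j-\frac12}\\&=\|u_h(0)\|_2^2+\int_0^t\int_{\mathbb{R}}\Bigl((\sigma')^2-\tfrac14(\sigma^2)''\Bigr)\mathbb{E}\bigl[u_h^2(s)\bigr]dx\,ds,\end{aligned}$$ where the sums run over all cells. Consequently, if in addition $\sigma',\sigma'',(\sigma^2)''\in L^\infty(\mathbb{R})$, then $$\mathbb{E}\bigl[\|u_h(t)\|_2^2\bigr]\le\|\bar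 u\|_2^2\exp\Bigl(\bigl(\|\sigma'\|_\infty^2+\tfrac14\|(\sigma^2)''\|_\infty\bigr)t\Bigr).$$
   Context: Setting. $T>0$; $W$ is a one-dimensional Brownian motion on a filtered probability space satisfying the usual conditions. $\|\cdot\|_2$ is the $L^2(\mathbb{R})$ norm; $u_h$ is extended by zero outside the computational domain. Mesh. A bounded computational interval is partitioned into finitely many cells $I_j=[x_{j-\frac12},x_{j+\frac12}]$; $\mathcal{V}^k$ is the space of functions whose restriction to each $I_j$ is a polynomial of degree $\le k$ ($k\ge0$). $v^\pm_{j+\frac12}$ are right/left traces at $x_{j+\frac12}$, $\llbracket v\rrbracket=v^+-v^-$, $\{\!\{v\}\!\}=\tfrac12(v^++v^-)$; $(\cdot)_{j\pm\frac12}$ denotes evaluation at $x_{j\pm\frac12}$. At the two end points of the domain zeroth-order extrapolation is used (the exterior trace is taken equal to the interior trace, so numerical fluxes reduce to the interior trace). LDG scheme. $(u_h,q_h)$ are adapted continuous $\mathcal{V}^k$-valued processes such that for all $j$ and $\varphi,\psi\in\mathcal{V}^k$ $$d\int_{I_j}\varphi u_h\,dx=\bigl(a_j(u_h,\varphi)+b_j(q_h,\varphi)\bigr)dt-\int_{I_j}\varphi q_h\,dx\,dW_t,$$ $$\int_{I_j}\psi q_h\,dx=-\int_{I_j}(\partial_x\psi)\sigma u_h\,dx+(\sigma\widetilde{\mathcal{F}}_u\psi^-)_{j+\frac12}-(\sigma\widetilde{\mathcal{F}}_u\psi^+)_{j-\frac12},$$ $$a_j(u_h,\varphi)=-\tfrac12\int_{I_j}\partial_x(\sigma'\varphi)\sigma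 u_h\,dx+\tfrac14\Bigl(((\sigma^2)'\mathcal{F}_u\varphi^-)_{j+\frac12}-((\sigma^2)'\mathcal{F}_u\varphi^+)_{j-\frac12}\Bigr),$$ $$b_j(q_h,\varphi)=-\tfrac12\int_{I_j}\partial_x(\sigma\varphi)q_h\,dx+\tfrac12\Bigl((\sigma\widetilde{\mathcal{F}}_q\varphi^-)_{j+\frac12}-(\sigma\widetilde{\mathcal{F}}_q\varphi^+)_{j-\frac12}\Bigr),$$ and $u_h(0)$ is the $L^2$-projection of $\bar u$ onto $\mathcal{V}^k$. Fluxes. $\mathcal{F}_u=\gamma\check{\mathcal{F}}(u_h;(\sigma^2)')+(1-\gamma)\{\!\{u_h\}\!\}+\widetilde\gamma\,\mathrm{sgn}((\sigma^2)')\llbracket u_h\rrbracket$, where $\check{\mathcal{F}}(u;b)=u^+$ if $b\ge0$ and $u^-$ if $b<0$; $\widetilde{\mathcal{F}}_u=\theta u_h^-+(1-\theta)u_h^++\eta_u\,\mathrm{sgn}(\sigma)\llbracket q_h\rrbracket$; $\widetilde{\mathcal{F}}_q=(1-\theta)q_h^-+\theta q_h^++\eta_q\,\mathrm{sgn}(\sigma)\llbracket u_h\rrbracket$.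
   Formalization: It is additionally assumed that σu_h vanishes at both end points of the computational domain, almost surely for all t in [0,T]; with only the support of the exact solution contained in the domain, the stated identity can fail. *)

theory Defs
  imports "HOL-Probability.Probability" "HOL-Computational_Algebra.Polynomial"
begin

section \<open>Filtered probability space, Brownian motion\<close>

text \<open>The library locale \<^locale>\<open>filtration\<close> is indexed by all of \<^typ>\<open>real\<close>; only times
  \<open>t \<ge> 0\<close> matter, and a filtration on \<open>[0,\<infinity>)\<close> extends by \<open>F t = F 0\<close> for \<open>t < 0\<close>.\<close>

locale usual_filtered_prob_space = prob_space M + filtration "space M" F
  for M :: "'w measure" and F :: "real \<Rightarrow> 'w measure" +
  assumes sub_F: "\<And>t. subalgebra M (F t)"
    and right_continuous_F: "\<And>t. 0 \<le> t \<Longrightarrow> sets (F t) = (\<Inter>s\<in>{t<..}. sets (F s))"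
    and complete_F: "\<And>A B. A \<in> null_sets M \<Longrightarrow> B \<subseteq> A \<Longrightarrow> B \<in> sets (F 0)"

locale brownian_motion = usual_filtered_prob_space M F
  for M :: "'w measure" and F :: "real \<Rightarrow> 'w measure" +
  fixes W :: "real \<Rightarrow> 'w \<Rightarrow> real"
  assumes adapted_W: "\<And>t. 0 \<le> t \<Longrightarrow> W t \<in> borel_measurable (F t)"
    and start_W: "AE \<omega> in M. W 0 \<omega> = 0"
    and continuous_W: "AE \<omega> in M. continuous_on {0..} (\<lambda>t. W t \<omega>)"
    and normal_W: "\<And>s t. 0 \<le> s \<Longrightarrow> s < t \<Longrightarrow>
      distributed M lborel (\<lambda>\<omega>. W t \<omega> - W s \<omega>) (normal_density 0 (sqrt (t - s)))"
    and indep_W: "\<And>s t. 0 \<le> s \<Longrightarrow> s < t \<Longrightarrow>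
      indep_set (sets (F s)) {(\<lambda>\<omega>. W t \<omega> - W s \<omega>) -` B \<inter> space M | B. B \<in> sets borel}"

text \<open>Real-valued adapted process on \<open>[0,T]\<close> with almost surely continuous paths.\<close>

definition continuous_adapted ::
  "'w measure \<Rightarrow> (real \<Rightarrow> 'w measure) \<Rightarrow> real \<Rightarrow> (real \<Rightarrow> 'w \<Rightarrow> real) \<Rightarrow> bool" where
  "continuous_adapted M F T Y \<longleftrightarrow>
     (\<forall>t\<in>{0..T}. Y t \<in> borel_measurable (F t)) \<and>
     (AE \<omega> in M. continuous_on {0..T} (\<lambda>t. Y t \<omega>))"

section \<open>Ito integral\<close>

text \<open>Bounded elementary integrands \<open>\<Sum>i<n. H i * 1_(\<tau> i, \<tau> (i+1)]\<close> and their stochastic integrals.\<close>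

definition elementary_integrand ::
  "'w measure \<Rightarrow> (real \<Rightarrow> 'w measure) \<Rightarrow> real \<Rightarrow> nat \<Rightarrow> (nat \<Rightarrow> real) \<Rightarrow> (nat \<Rightarrow> 'w \<Rightarrow> real) \<Rightarrow> bool" where
  "elementary_integrand M F T n \<tau> H \<longleftrightarrow>
     0 \<le> \<tau> 0 \<and> (\<forall>i<n. \<tau> i \<le> \<tau> (Suc i)) \<and> \<tau> n \<le> T \<and>
     (\<forall>i<n. H i \<in> borel_measurable (F (\<tau> i)) \<and> (\<exists>C. \<forall>\<omega>\<in>space M. \<bar>H i \<omega>\<bar> \<le> C))"

definition elementary_process ::
  "nat \<Rightarrow> (nat \<Rightarrow> real) \<Rightarrow> (nat \<Rightarrow> 'w \<Rightarrow> real) \<Rightarrow> real \<Rightarrow> 'w \<Rightarrow> real" where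
  "elementary_process n \<tau> H s \<omega> = (\<Sum>i<n. H i \<omega> * indicator {\<tau> i<..\<tau> (Suc i)} s)"

definition elementary_integral ::
  "(real \<Rightarrow> 'w \<Rightarrow> real) \<Rightarrow> nat \<Rightarrow> (nat \<Rightarrow> real) \<Rightarrow> (nat \<Rightarrow> 'w \<Rightarrow> real) \<Rightarrow> real \<Rightarrow> 'w \<Rightarrow> real" where
  "elementary_integral W n \<tau> H t \<omega> =
     (\<Sum>i<n. H i \<omega> * (W (min (\<tau> (Suc i)) t) \<omega> - W (min (\<tau> i) t) \<omega>))"

text \<open>Measurability is demanded because \<^const>\<open>measure\<close> is 0 on non-measurable sets.\<close>

definition null_in_probability :: "'w measure \<Rightarrow> (nat \<Rightarrow> 'w \<Rightarrow> ennreal) \<Rightarrow> bool" where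
  "null_in_probability M D \<longleftrightarrow>
     (\<forall>m. D m \<in> borel_measurable M) \<and>
     (\<forall>\<epsilon>::real. \<epsilon> > 0 \<longrightarrow> (\<lambda>m. measure M {\<omega>\<in>space M. ennreal \<epsilon> < D m \<omega>}) \<longlonglongrightarrow> 0)"

text \<open>\<open>Y t = \<integral>\<^sub>0\<^sup>t Z s dW s\<close> for \<open>t \<in> [0,T]\<close>: \<open>Y\<close> is the continuous version of the limit in
  probability of the integrals of elementary processes that converge to \<open>Z\<close> in \<open>L\<^sup>2(0,T)\<close>,
  in probability. No integrability over the probability space is required.\<close>

definition ito_integral ::
  "'w measure \<Rightarrow> (real \<Rightarrow> 'w measure) \<Rightarrow> (real \<Rightarrow> 'w \<Rightarrow> real) \<Rightarrow> real \<Rightarrow>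
   (real \<Rightarrow> 'w \<Rightarrow> real) \<Rightarrow> (real \<Rightarrow> 'w \<Rightarrow> real) \<Rightarrow> bool" where
  "ito_integral M F W T Z Y \<longleftrightarrow>
     continuous_adapted M F T Y \<and>
     (\<exists>n \<tau> H. (\<forall>m::nat. elementary_integrand M F T (n m) (\<tau> m) (H m)) \<and>
        null_in_probability M (\<lambda>m \<omega>.
          \<integral>\<^sup>+s\<in>{0..T}. ennreal ((elementary_process (n m) (\<tau> m) (H m) s \<omega> - Z s \<omega>)\<^sup>2) \<partial>lborel) \<and>
        (\<forall>t\<in>{0..T}. null_in_probability M (\<lambda>m \<omega>.
          ennreal \<bar>elementary_integral W (n m) (\<tau> m) (H m) t \<omega> - Y t \<omega>\<bar>)))"

section \<open>Function spaces and the exact solution\<close>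

definition C2 :: "(real \<Rightarrow> real) \<Rightarrow> bool" where
  "C2 f \<longleftrightarrow> (\<forall>x. f differentiable at x) \<and> (\<forall>x. deriv f differentiable at x) \<and>
     continuous_on UNIV (deriv (deriv f))"

definition L2 :: "(real \<Rightarrow> real) \<Rightarrow> bool" where
  "L2 f \<longleftrightarrow> f \<in> borel_measurable borel \<and> integrable lborel (\<lambda>x. (f x)\<^sup>2)"

definition L2_norm :: "(real \<Rightarrow> real) \<Rightarrow> real" where
  "L2_norm f = sqrt (\<integral>x. (f x)\<^sup>2 \<partial>lborel)"

definition Linf :: "(real \<Rightarrow> real) \<Rightarrow> bool" where
  "Linf f \<longleftrightarrow> f \<in> borel_measurable borel \<and> esssup lborel (\<lambda>x. ereal \<bar>f x\<bar>) < \<infinity>"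

definition Linf_norm :: "(real \<Rightarrow> real) \<Rightarrow> real" where
  "Linf_norm f = real_of_ereal (esssup lborel (\<lambda>x. ereal \<bar>f x\<bar>))"

definition compactly_supported :: "(real \<Rightarrow> real) \<Rightarrow> bool" where
  "compactly_supported f \<longleftrightarrow> (\<exists>K. compact K \<and> (\<forall>x. x \<notin> K \<longrightarrow> f x = 0))"

definition test_function :: "(real \<Rightarrow> real) \<Rightarrow> bool" where
  "test_function \<phi> \<longleftrightarrow> (\<forall>n x. (deriv ^^ n) \<phi> differentiable at x) \<and> compactly_supported \<phi>"

text \<open>\<open>u t \<omega> x\<close> solves \<open>du - 1/2 \<partial>\<^sub>x(\<sigma> \<partial>\<^sub>x(\<sigma> u)) dt + \<partial>\<^sub>x(\<sigma> u) dW = 0\<close>, \<open>u 0 = ubar\<close> on \<open>[0,T]\<close>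
  in the sense of distributions, as an adapted weakly continuous \<open>L\<^sup>2\<close>-valued process; all
  spatial derivatives are moved to the test function by parts.\<close>

definition exact_solution ::
  "'w measure \<Rightarrow> (real \<Rightarrow> 'w measure) \<Rightarrow> (real \<Rightarrow> 'w \<Rightarrow> real) \<Rightarrow> real \<Rightarrow> (real \<Rightarrow> real) \<Rightarrow>
   (real \<Rightarrow> real) \<Rightarrow> (real \<Rightarrow> 'w \<Rightarrow> real \<Rightarrow> real) \<Rightarrow> bool" where
  "exact_solution M F W T \<sigma> ubar u \<longleftrightarrow>
     (\<forall>t\<in>{0..T}. \<forall>\<omega>\<in>space M. L2 (u t \<omega>)) \<and>
     (\<forall>g. L2 g \<longrightarrow> (\<forall>t\<in>{0..T}. (\<lambda>\<omega>. LBINT x. u t \<omega> x * g x) \<in> borel_measurable (F t))) \<and>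
     (AE \<omega> in M. \<forall>g. L2 g \<longrightarrow> continuous_on {0..T} (\<lambda>t. LBINT x. u t \<omega> x * g x)) \<and>
     (AE \<omega> in M. AE x in lborel. u 0 \<omega> x = ubar x) \<and>
     (\<forall>\<phi>. test_function \<phi> \<longrightarrow>
       (\<exists>Y. ito_integral M F W T (\<lambda>s \<omega>. LBINT x. u s \<omega> x * (\<sigma> x * deriv \<phi> x)) Y \<and>
         (AE \<omega> in M. \<forall>t\<in>{0..T}.
            (LBINT x. u t \<omega> x * \<phi> x) = (LBINT x. ubar x * \<phi> x)
              + 1/2 * (LBINT s:{0..t}. LBINT x. u s \<omega> x * (\<sigma> x * deriv (\<lambda>y. \<sigma> y * deriv \<phi> y) x))
              + Y t \<omega>)))"

section \<open>Mesh and broken polynomials\<close>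

text \<open>Nodes \<open>X 0 < \<dots> < X N\<close>; cell \<open>j < N\<close> is \<open>[X j, X (j+1)]\<close>, so that the interfaces
  \<open>x\<^sub>j\<^sub>-\<^sub>1\<^sub>/\<^sub>2\<close> and \<open>x\<^sub>j\<^sub>+\<^sub>1\<^sub>/\<^sub>2\<close> of cell \<open>j\<close> are \<open>X j\<close> and \<open>X (j+1)\<close>.\<close>

definition mesh :: "nat \<Rightarrow> (nat \<Rightarrow> real) \<Rightarrow> bool" where
  "mesh N X \<longleftrightarrow> 0 < N \<and> (\<forall>i<N. X i < X (Suc i))"

text \<open>A piecewise polynomial is double-valued at interfaces, so it is given by the polynomial
  \<open>v j\<close> it equals on each cell \<open>j < N\<close>; values \<open>v j\<close> for \<open>j \<ge> N\<close> are irrelevant.\<close>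

type_synonym bpoly = "nat \<Rightarrow> real poly"

definition dg_space :: "nat \<Rightarrow> nat \<Rightarrow> bpoly set" where
  "dg_space N k = {v. \<forall>j<N. degree (v j) \<le> k}"

text \<open>The function on the real line, extended by zero outside the computational domain.\<close>

definition dg_fun :: "nat \<Rightarrow> (nat \<Rightarrow> real) \<Rightarrow> bpoly \<Rightarrow> real \<Rightarrow> real" where
  "dg_fun N X v x = (\<Sum>j<N. indicator {X j..<X (Suc j)} x * poly (v j) x)"

text \<open>Left and right traces at interface \<open>i \<le> N\<close>. At \<open>i = 0\<close> and \<open>i = N\<close> the exterior trace is
  the interior one (zeroth-order extrapolation), so jumps vanish there.\<close>

definition tr_minus :: "(nat \<Rightarrow> real) \<Rightarrow> bpoly \<Rightarrow> nat \<Rightarrow> real" where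
  "tr_minus X v i = (if i = 0 then poly (v 0) (X 0) else poly (v (i - 1)) (X i))"

definition tr_plus :: "nat \<Rightarrow> (nat \<Rightarrow> real) \<Rightarrow> bpoly \<Rightarrow> nat \<Rightarrow> real" where
  "tr_plus N X v i = (if i = N then poly (v (N - 1)) (X N) else poly (v i) (X i))"

definition jump :: "nat \<Rightarrow> (nat \<Rightarrow> real) \<Rightarrow> bpoly \<Rightarrow> nat \<Rightarrow> real" where
  "jump N X v i = tr_plus N X v i - tr_minus X v i"

definition average :: "nat \<Rightarrow> (nat \<Rightarrow> real) \<Rightarrow> bpoly \<Rightarrow> nat \<Rightarrow> real" where
  "average N X v i = 1/2 * (tr_plus N X v i + tr_minus X v i)"

definition L2_projection :: "nat \<Rightarrow> (nat \<Rightarrow> real) \<Rightarrow> nat \<Rightarrow> (real \<Rightarrow> real) \<Rightarrow> bpoly \<Rightarrow> bool" where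
  "L2_projection N X k f v \<longleftrightarrow> v \<in> dg_space N k \<and>
     (\<forall>\<phi>\<in>dg_space N k. (LBINT x. (f x - dg_fun N X v x) * dg_fun N X \<phi> x) = 0)"

section \<open>Numerical fluxes and the LDG scheme\<close>

definition upwind :: "nat \<Rightarrow> (nat \<Rightarrow> real) \<Rightarrow> bpoly \<Rightarrow> real \<Rightarrow> nat \<Rightarrow> real" where
  "upwind N X u b i = (if b \<ge> 0 then tr_plus N X u i else tr_minus X u i)"

definition flux_a ::
  "(real \<Rightarrow> real) \<Rightarrow> real \<Rightarrow> real \<Rightarrow> nat \<Rightarrow> (nat \<Rightarrow> real) \<Rightarrow> bpoly \<Rightarrow> nat \<Rightarrow> real" where
  "flux_a \<sigma> \<gamma> \<gamma>t N X u i =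
     \<gamma> * upwind N X u (deriv (\<lambda>x. (\<sigma> x)\<^sup>2) (X i)) i + (1 - \<gamma>) * average N X u i
     + \<gamma>t * sgn (deriv (\<lambda>x. (\<sigma> x)\<^sup>2) (X i)) * jump N X u i"

definition flux_u ::
  "(real \<Rightarrow> real) \<Rightarrow> real \<Rightarrow> real \<Rightarrow> nat \<Rightarrow> (nat \<Rightarrow> real) \<Rightarrow> bpoly \<Rightarrow> bpoly \<Rightarrow> nat \<Rightarrow> real" where
  "flux_u \<sigma> \<theta> \<eta>u N X u q i =
     \<theta> * tr_minus X u i + (1 - \<theta>) * tr_plus N X u i + \<eta>u * sgn (\<sigma> (X i)) * jump N X q i"

definition flux_q ::
  "(real \<Rightarrow> real) \<Rightarrow> real \<Rightarrow> real \<Rightarrow> nat \<Rightarrow> (nat \<Rightarrow> real) \<Rightarrow> bpoly \<Rightarrow> bpoly \<Rightarrow> nat \<Rightarrow> real" where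
  "flux_q \<sigma> \<theta> \<eta>q N X u q i =
     (1 - \<theta>) * tr_minus X q i + \<theta> * tr_plus N X q i + \<eta>q * sgn (\<sigma> (X i)) * jump N X u i"

definition form_a ::
  "(real \<Rightarrow> real) \<Rightarrow> real \<Rightarrow> real \<Rightarrow> nat \<Rightarrow> (nat \<Rightarrow> real) \<Rightarrow> nat \<Rightarrow> bpoly \<Rightarrow> bpoly \<Rightarrow> real" where
  "form_a \<sigma> \<gamma> \<gamma>t N X j u \<phi> =
     - 1/2 * (LBINT x:{X j..X (Suc j)}.
               deriv (\<lambda>y. deriv \<sigma> y * poly (\<phi> j) y) x * \<sigma> x * poly (u j) x)
     + 1/4 * (deriv (\<lambda>x. (\<sigma> x)\<^sup>2) (X (Suc j)) * flux_a \<sigma> \<gamma> \<gamma>t N X u (Suc j) * tr_minus X \<phi> (Suc j)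
              - deriv (\<lambda>x. (\<sigma> x)\<^sup>2) (X j) * flux_a \<sigma> \<gamma> \<gamma>t N X u j * tr_plus N X \<phi> j)"

text \<open>\<open>form_b\<close> depends on \<open>u\<close> through the stabilisation term of its flux.\<close>

definition form_b ::
  "(real \<Rightarrow> real) \<Rightarrow> real \<Rightarrow> real \<Rightarrow> nat \<Rightarrow> (nat \<Rightarrow> real) \<Rightarrow> nat \<Rightarrow> bpoly \<Rightarrow> bpoly \<Rightarrow> bpoly \<Rightarrow> real" where
  "form_b \<sigma> \<theta> \<eta>q N X j u q \<phi> =
     - 1/2 * (LBINT x:{X j..X (Suc j)}. deriv (\<lambda>y. \<sigma> y * poly (\<phi> j) y) x * poly (q j) x)
     + 1/2 * (\<sigma> (X (Suc j)) * flux_q \<sigma> \<theta> \<eta>q N X u q (Suc j) * tr_minus X \<phi> (Suc j)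
              - \<sigma> (X j) * flux_q \<sigma> \<theta> \<eta>q N X u q j * tr_plus N X \<phi> j)"

definition dg_process ::
  "'w measure \<Rightarrow> (real \<Rightarrow> 'w measure) \<Rightarrow> real \<Rightarrow> nat \<Rightarrow> nat \<Rightarrow> (real \<Rightarrow> 'w \<Rightarrow> bpoly) \<Rightarrow> bool" where
  "dg_process M F T N k v \<longleftrightarrow>
     (\<forall>t\<in>{0..T}. \<forall>\<omega>\<in>space M. v t \<omega> \<in> dg_space N k) \<and>
     (\<forall>j<N. \<forall>i\<le>k. continuous_adapted M F T (\<lambda>t \<omega>. coeff (v t \<omega> j) i))"

definition ldg_solution ::
  "'w measure \<Rightarrow> (real \<Rightarrow> 'w measure) \<Rightarrow> (real \<Rightarrow> 'w \<Rightarrow> real) \<Rightarrow> real \<Rightarrow> (real \<Rightarrow> real) \<Rightarrow>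
   nat \<Rightarrow> (nat \<Rightarrow> real) \<Rightarrow> nat \<Rightarrow> real \<Rightarrow> real \<Rightarrow> real \<Rightarrow> real \<Rightarrow> real \<Rightarrow>
   bpoly \<Rightarrow> (real \<Rightarrow> 'w \<Rightarrow> bpoly) \<Rightarrow> (real \<Rightarrow> 'w \<Rightarrow> bpoly) \<Rightarrow> bool" where
  "ldg_solution M F W T \<sigma> N X k \<gamma> \<gamma>t \<theta> \<eta>u \<eta>q uh0 uh qh \<longleftrightarrow>
     dg_process M F T N k uh \<and> dg_process M F T N k qh \<and>
     (AE \<omega> in M. \<forall>j<N. uh 0 \<omega> j = uh0 j) \<and>
     (\<forall>\<phi>\<in>dg_space N k. \<forall>j<N.
        \<exists>Y. ito_integral M F W T
              (\<lambda>s \<omega>. LBINT x:{X j..X (Suc j)}. poly (\<phi> j) x * poly (qh s \<omega> j) x) Y \<and>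
          (AE \<omega> in M. \<forall>t\<in>{0..T}.
             (LBINT x:{X j..X (Suc j)}. poly (\<phi> j) x * poly (uh t \<omega> j) x)
             = (LBINT x:{X j..X (Suc j)}. poly (\<phi> j) x * poly (uh 0 \<omega> j) x)
               + (LBINT s:{0..t}. form_a \<sigma> \<gamma> \<gamma>t N X j (uh s \<omega>) \<phi>
                                + form_b \<sigma> \<theta> \<eta>q N X j (uh s \<omega>) (qh s \<omega>) \<phi>)
               - Y t \<omega>)) \<and>
     (AE \<omega> in M. \<forall>t\<in>{0..T}. \<forall>\<psi>\<in>dg_space N k. \<forall>j<N.
        (LBINT x:{X j..X (Suc j)}. poly (\<psi> j) x * poly (qh t \<omega> j) x)
        = - (LBINT x:{X j..X (Suc j)}. poly (pderiv (\<psi> j)) x * \<sigma> x * poly (uh t \<omega> j) x)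
          + \<sigma> (X (Suc j)) * flux_u \<sigma> \<theta> \<eta>u N X (uh t \<omega>) (qh t \<omega>) (Suc j) * tr_minus X \<psi> (Suc j)
          - \<sigma> (X j) * flux_u \<sigma> \<theta> \<eta>u N X (uh t \<omega>) (qh t \<omega>) j * tr_plus N X \<psi> j)"

text \<open>Summing the cellwise energy balances leaves the end-point contribution
  \<open>\<sigma> uh (qh + \<sigma>' uh / 2)\<close> taken between \<open>X 0\<close> and \<open>X N\<close>. The following is the discrete counterpart
  of the exact solution staying inside the computational domain: nothing is transported through
  the end points. It holds if \<open>uh\<close> vanishes at the end points, or if \<open>\<sigma>\<close> does.\<close>

definition no_boundary_transport ::
  "'w measure \<Rightarrow> real \<Rightarrow> (real \<Rightarrow> real) \<Rightarrow> nat \<Rightarrow> (nat \<Rightarrow> real) \<Rightarrow> (real \<Rightarrow> 'w \<Rightarrow> bpoly) \<Rightarrow> bool" where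
  "no_boundary_transport M T \<sigma> N X uh \<longleftrightarrow>
     (AE \<omega> in M. \<forall>t\<in>{0..T}.
        \<sigma> (X 0) * tr_plus N X (uh t \<omega>) 0 = 0 \<and> \<sigma> (X N) * tr_minus X (uh t \<omega>) N = 0)"

end

(* In coordinates with respect to a Parseval frame of the broken polynomials, the scheme is a
   finite-dimensional linear Ito system dU = D dt - Q dW, where Q and D are bounded by U because the
   equation for q_h determines q_h from u_h. Testing with u_h, and the equation for q_h with q_h, the
   volume terms and the consistent fluxes telescope, so that 2 U.D + |Q|^2 equals the integral of
   ((sigma')^2 - (sigma^2)''/4) u_h^2 minus the jump terms. Ito's formula is needed only for squares and
   only in expectation: it follows from the isometry and the martingale property of the integral, which
   pass from step processes to continuous square-integrable ones by approximation. Square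
   integrability itself comes from localising on the decreasing events that |U|^2 has stayed below R and
   applying Gronwall's lemma with a bound independent of R. Dropping the jump terms, Gronwall's
   lemma also gives the exponential estimate. *)
theory Submission
  imports Defs
begin

section \<open>Stochastic integrals of step processes\<close>

text \<open>The hypothesis supplies the stochastic integral only as a limit in probability along
  some unspecified step processes, with no moments. Hence the central tool of the first half is a
  Lenglart inequality for step processes: any step processes that converge to the integrand in
  \<open>L2(0,T)\<close>, in probability, have integrals with the same limit, so Riemann sums and
  truncated Riemann sums may be used instead. The isometry needs a finite second moment of the
  integrand, which is itself to be proved; this circle is why the localised estimate is only an
  inequality and why the identity comes after the bound. A second obstacle is that the scheme is
  posed for deterministic test functions, whereas the energy argument tests with the random
  \<open>u_h\<close>; coordinates bridge this, as the forms are linear in the test function. The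
  weight in the identity comes from one integration by parts:
  \<open>- (\<sigma>' u)' \<sigma> u\<close> equals
  \<open>((\<sigma>')^2 - (\<sigma>^2)''/4) u^2\<close> minus the derivative of
  \<open>(\<sigma>^2)' u^2 / 4\<close>.\<close>

definition stieltjes_sum :: "nat \<Rightarrow> (nat \<Rightarrow> real) \<Rightarrow> (nat \<Rightarrow> real) \<Rightarrow> (real \<Rightarrow> real) \<Rightarrow> real" where
  "stieltjes_sum n \<tau> H h = (\<Sum>i<n. H i * (h (\<tau> (Suc i)) - h (\<tau> i)))"

lemma elementary_integral_stieltjes:
  "elementary_integral W n \<tau> H t \<omega> = stieltjes_sum n \<tau> (\<lambda>i. H i \<omega>) (\<lambda>x. W (min x t) \<omega>)"
  by (simp add: elementary_integral_def stieltjes_sum_def)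

text \<open>Over an interval \<open>(a, b]\<close> the integrator
  \<open>\<lambda>x. - of_bool (x < s)\<close> increases by
  \<open>of_bool (a < s) - of_bool (b < s)\<close>, which is 1 exactly for
  \<open>a < s \<le> b\<close>. Process and integral are thus the same Stieltjes sum with different
  integrators, and one refinement argument serves both.\<close>

lemma elementary_process_stieltjes:
  assumes "\<And>i. i < n \<Longrightarrow> \<tau> i \<le> \<tau> (Suc i)"
  shows "elementary_process n \<tau> H s \<omega> = stieltjes_sum n \<tau> (\<lambda>i. H i \<omega>) (\<lambda>x. - of_bool (x < s))"
  unfolding elementary_process_def stieltjes_sum_def
  using assms by (intro sum.cong refl) (fastforce simp: indicator_def of_bool_def)

lemma strict_grid_less:
  fixes p :: "nat \<Rightarrow> real"
  assumes "\<And>i. i < m \<Longrightarrow> p i < p (Suc i)" "i < j" "j \<le> m"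
  shows "p i < p j"
  using assms(2,3)
proof (induction j)
  case (Suc j)
  then show ?case using assms(1)[of j] by (cases "i = j") auto
qed simp

lemma weak_grid_le:
  fixes p :: "nat \<Rightarrow> real"
  assumes "\<And>i. i < m \<Longrightarrow> p i \<le> p (Suc i)" "i \<le> j" "j \<le> m"
  shows "p i \<le> p j"
  using assms(2,3)
proof (induction j)
  case (Suc j)
  then show ?case using assms(1)[of j] by (cases "i = Suc j") auto
qed simp

lemma elementary_process_eq:
  assumes "\<And>i. i < m \<Longrightarrow> p i \<le> p (Suc i)" and i: "i < m" "s \<in> {p i<..p (Suc i)}"
  shows "elementary_process m p K s \<omega> = K i \<omega>"
proof -
  have 0: "s \<notin> {p j<..p (Suc j)}" if "j < m" "j \<noteq> i" for j
  proof (cases "j < i")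
    case True
    then have "p (Suc j) \<le> p i" using weak_grid_le[of m p "Suc j" i, OF assms(1)] i by auto
    then show ?thesis using i by auto
  next
    case False
    then have "p (Suc i) \<le> p j" using weak_grid_le[of m p "Suc i" j, OF assms(1)] that by auto
    then show ?thesis using i by auto
  qed
  have "(\<Sum>j<m. K j \<omega> * indicator {p j<..p (Suc j)} s) = (\<Sum>j\<in>{i}. K j \<omega> * indicator {p j<..p (Suc j)} s)"
    using i 0 by (intro sum.mono_neutral_right) (auto simp: indicator_def)
  also have "\<dots> = K i \<omega> * indicator {p i<..p (Suc i)} s" by (subst sum.insert) simp_all
  finally show ?thesis using i by (simp add: elementary_process_def)
qed

text \<open>At most one of the intervals contains \<open>s\<close>, so no cross terms occur.\<close>

lemma elementary_process_sq:
  assumes "\<And>i. i < m \<Longrightarrow> p i \<le> p (Suc i)"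
  shows "(elementary_process m p K s \<omega>)\<^sup>2 = (\<Sum>i<m. (K i \<omega>)\<^sup>2 * indicator {p i<..p (Suc i)} s)"
proof (cases "\<exists>i<m. s \<in> {p i<..p (Suc i)}")
  case True
  then obtain i where i: "i < m" "s \<in> {p i<..p (Suc i)}" by auto
  show ?thesis
    using elementary_process_eq[OF assms i, of K \<omega>] elementary_process_eq[OF assms i, of "\<lambda>i \<omega>. (K i \<omega>)\<^sup>2" \<omega>]
    by (simp add: elementary_process_def[of _ _ "\<lambda>i \<omega>. (K i \<omega>)\<^sup>2"])
next
  case False
  then have "indicator {p i<..p (Suc i)} s = (0::real)" if "i < m" for i using that by (auto simp: indicator_def)
  then show ?thesis unfolding elementary_process_def by simp
qed

text \<open>On a finer grid each cell inherits the coefficients of the old intervals that contain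
  it; within one old interval the finer increments telescope. An old interval of length zero
  contains no cell of the strict grid \<open>p\<close> and contributes zero on both sides.\<close>

lemma stieltjes_sum_refine:
  assumes \<tau>: "\<And>i. i < n \<Longrightarrow> \<tau> i \<le> \<tau> (Suc i)"
    and p: "\<And>i. i < m \<Longrightarrow> p i < p (Suc i)"
    and sub: "\<tau> ` {..n} \<subseteq> p ` {..m}"
  shows "stieltjes_sum n \<tau> H h
    = stieltjes_sum m p (\<lambda>i. \<Sum>l<n. of_bool (\<tau> l \<le> p i \<and> p (Suc i) \<le> \<tau> (Suc l)) * H l) h"
proof -
  have le_iff: "p i \<le> p j \<longleftrightarrow> i \<le> j" if "i \<le> m" "j \<le> m" for i j
    using strict_grid_less[of m p i j, OF p] strict_grid_less[of m p j i, OF p] that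
    by (metis linorder_not_less nle_le order_less_le)
  have tel: "(\<Sum>i<m. of_bool (\<tau> l \<le> p i \<and> p (Suc i) \<le> \<tau> (Suc l)) * (h (p (Suc i)) - h (p i)))
      = h (\<tau> (Suc l)) - h (\<tau> l)" if l: "l < n" for l
  proof -
    obtain a where a: "a \<le> m" "\<tau> l = p a" using sub l by (force simp: image_subset_iff)
    obtain b where b: "b \<le> m" "\<tau> (Suc l) = p b"
      using sub l by (force simp: image_subset_iff Suc_le_eq)
    have ab: "a \<le> b" using \<tau>[OF l] a b le_iff by auto
    have "(\<Sum>i<m. of_bool (\<tau> l \<le> p i \<and> p (Suc i) \<le> \<tau> (Suc l)) * (h (p (Suc i)) - h (p i)))
        = (\<Sum>i<m. if i \<in> {a..<b} then h (p (Suc i)) - h (p i) else 0)"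
      using a b by (intro sum.cong refl) (auto simp: le_iff)
    also have "\<dots> = (\<Sum>i\<in>{a..<b}. h (p (Suc i)) - h (p i))"
      using b by (subst sum.inter_restrict[symmetric]) (auto intro!: sum.cong)
    also have "\<dots> = h (p b) - h (p a)" using sum_Suc_diff'[OF ab, of "\<lambda>i. h (p i)"] .
    finally show ?thesis using a b by simp
  qed
  have "stieltjes_sum m p (\<lambda>i. \<Sum>l<n. of_bool (\<tau> l \<le> p i \<and> p (Suc i) \<le> \<tau> (Suc l)) * H l) h
     = (\<Sum>i<m. \<Sum>l<n. H l * (of_bool (\<tau> l \<le> p i \<and> p (Suc i) \<le> \<tau> (Suc l)) * (h (p (Suc i)) - h (p i))))"
    unfolding stieltjes_sum_def sum_distrib_right by (simp only: mult_ac)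
  also have "\<dots> = (\<Sum>l<n. H l * (\<Sum>i<m. of_bool (\<tau> l \<le> p i \<and> p (Suc i) \<le> \<tau> (Suc l)) * (h (p (Suc i)) - h (p i))))"
    by (subst sum.swap) (simp only: sum_distrib_left)
  also have "\<dots> = stieltjes_sum n \<tau> H h"
    unfolding stieltjes_sum_def by (intro sum.cong refl) (subst tel, auto)
  finally show ?thesis by simp
qed

lemma finite_set_grid:
  fixes P :: "real set"
  assumes "finite P" "P \<noteq> {}"
  obtains m p where "p ` {..m} = P" "\<And>i. i < m \<Longrightarrow> p i < p (Suc i)"
proof
  let ?l = "sorted_list_of_set P"
  have len: "length ?l = card P" by simp
  have pos: "card P > 0" using assms by (simp add: card_gt_0_iff)
  then have "{..card P - 1} = {..<length ?l}" by auto
  then show "(!) ?l ` {..card P - 1} = P"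
    using assms by (metis nth_image lessThan_atLeast0 order_refl take_all set_sorted_list_of_set)
  show "?l ! i < ?l ! Suc i" if "i < card P - 1" for i
    using sorted_list_of_set.strict_sorted_key_list_of_set[of P] sorted_wrt_nth_less[of "(<)" ?l i "Suc i"] that pos
    by simp
qed

lemma abs_mult_le_squares: "\<bar>a * b\<bar> \<le> a\<^sup>2 + b\<^sup>2" for a b :: real
proof -
  have "2 * \<bar>a * b\<bar> \<le> a\<^sup>2 + b\<^sup>2"
    using sum_squares_bound[of "\<bar>a\<bar>" "\<bar>b\<bar>"] by (simp add: abs_mult)
  then show ?thesis using abs_ge_zero[of "a * b"] by linarith
qed

section \<open>Square-integrable random variables\<close>

context prob_space begin

text \<open>Measurability of \<open>f\<close> is a separate demand because it does not follow from
  that of the square.\<close>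

definition sq_int :: "('a \<Rightarrow> real) \<Rightarrow> bool" where
  "sq_int f \<longleftrightarrow> f \<in> borel_measurable M \<and> integrable M (\<lambda>\<omega>. (f \<omega>)\<^sup>2)"

lemma sq_int_measurable: "sq_int f \<Longrightarrow> f \<in> borel_measurable M"
  and sq_int_square: "sq_int f \<Longrightarrow> integrable M (\<lambda>\<omega>. (f \<omega>)\<^sup>2)"
  by (auto simp: sq_int_def)

lemma sq_int_mult:
  assumes "sq_int f" "sq_int g" shows "integrable M (\<lambda>\<omega>. f \<omega> * g \<omega>)"
proof (rule Bochner_Integration.integrable_bound)
  show "integrable M (\<lambda>\<omega>. (f \<omega>)\<^sup>2 + (g \<omega>)\<^sup>2)" using assms by (auto simp: sq_int_def)
  show "(\<lambda>\<omega>. f \<omega> * g \<omega>) \<in> borel_measurable M" using assms by (auto simp: sq_int_def)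
  show "AE \<omega> in M. norm (f \<omega> * g \<omega>) \<le> norm ((f \<omega>)\<^sup>2 + (g \<omega>)\<^sup>2)" by (simp add: abs_mult_le_squares)
qed

lemma sq_int_add:
  assumes "sq_int f" "sq_int g" shows "sq_int (\<lambda>\<omega>. f \<omega> + g \<omega>)"
  using assms sq_int_mult[OF assms] unfolding sq_int_def power2_sum
  by (auto simp: mult.assoc)

lemma sq_int_cmult:
  assumes "sq_int f" shows "sq_int (\<lambda>\<omega>. c * f \<omega>)"
  using assms unfolding sq_int_def by (auto simp: power_mult_distrib)

lemma sq_int_diff:
  assumes "sq_int f" "sq_int g" shows "sq_int (\<lambda>\<omega>. f \<omega> - g \<omega>)"
  using sq_int_add[OF assms(1) sq_int_cmult[OF assms(2), of "-1"]] by simp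

lemma sq_int_const: "sq_int (\<lambda>_. c)"
  by (simp add: sq_int_def)

lemma sq_int_sum:
  assumes "\<And>i. i \<in> I \<Longrightarrow> sq_int (f i)" shows "sq_int (\<lambda>\<omega>. \<Sum>i\<in>I. f i \<omega>)"
  using assms by (induction I rule: infinite_finite_induct) (auto intro: sq_int_add sq_int_const)

lemma sq_int_integrable: "sq_int f \<Longrightarrow> integrable M f"
  using sq_int_mult[of f "\<lambda>_. 1"] sq_int_const by simp

lemma sq_int_bounded:
  assumes "f \<in> borel_measurable M" "\<And>\<omega>. \<omega> \<in> space M \<Longrightarrow> \<bar>f \<omega>\<bar> \<le> C"
  shows "sq_int f"
  unfolding sq_int_def
proof
  show "integrable M (\<lambda>\<omega>. (f \<omega>)\<^sup>2)"
  proof (rule integrable_const_bound[of _ "C\<^sup>2"])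
    show "AE \<omega> in M. norm ((f \<omega>)\<^sup>2) \<le> C\<^sup>2"
    proof (rule AE_I2)
      fix \<omega> assume "\<omega> \<in> space M"
      then have "\<bar>f \<omega>\<bar> ^ 2 \<le> C ^ 2" by (intro power_mono assms(2)) auto
      then show "norm ((f \<omega>)\<^sup>2) \<le> C\<^sup>2" by simp
    qed
  qed (use assms in auto)
qed fact

end

section \<open>Brownian increments and integrals of step processes\<close>

context brownian_motion begin

lemma measurable_F_M: "f \<in> borel_measurable (F t) \<Longrightarrow> f \<in> borel_measurable M"
  using sub_F measurable_from_subalg by blast

lemma measurable_F_mono: "f \<in> borel_measurable (F s) \<Longrightarrow> s \<le> t \<Longrightarrow> f \<in> borel_measurable (F t)"
  using sets_F_mono[of s t] space_F[of s] space_F[of t] unfolding measurable_def by auto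

lemma W_measurable: "0 \<le> t \<Longrightarrow> W t \<in> borel_measurable M"
  using adapted_W measurable_F_M by blast

text \<open>\<open>indep_W\<close> speaks of the preimages of Borel sets under the increment. These
  already form a sigma-algebra, and the one generated by \<open>f\<close> lies inside
  \<open>F s\<close>, so the generated sigma-algebras that \<open>indep_var\<close> asks for are
  independent.\<close>

lemma indep_increment:
  assumes "0 \<le> s" "s < t" "f \<in> borel_measurable (F s)"
  shows "indep_var borel f borel (\<lambda>\<omega>. W t \<omega> - W s \<omega>)"
proof -
  let ?D = "\<lambda>\<omega>. W t \<omega> - W s \<omega>"
  have mD: "?D \<in> borel_measurable M" using W_measurable assms by auto
  have mf: "f \<in> borel_measurable M" using assms(3) measurable_F_M by blast
  have 1: "sigma_sets (space M) {f -` A \<inter> space M |A. A \<in> sets borel} \<subseteq> sets (F s)"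
    using sets.sigma_sets_subset[of "{f -` A \<inter> space M |A. A \<in> sets borel}" "F s"]
      measurable_sets[OF assms(3)] unfolding space_F by blast
  have 2: "sigma_sets (space M) {?D -` A \<inter> space M |A. A \<in> sets borel} = {?D -` A \<inter> space M |A. A \<in> sets borel}"
    using sets.sigma_sets_eq[of "vimage_algebra (space M) ?D borel"]
    by (simp add: sets_vimage_algebra2)
  show ?thesis unfolding indep_var_eq
  proof (intro conjI mf mD)
    have "indep_set (sets (F s)) {?D -` A \<inter> space M |A. A \<in> sets borel}"
      using indep_W[OF assms(1,2)] .
    then show "indep_set (sigma_sets (space M) {f -` A \<inter> space M |A. A \<in> sets borel})
      (sigma_sets (space M) {?D -` A \<inter> space M |A. A \<in> sets borel})"
      using 1 unfolding 2 indep_sets2_eq by blast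
  qed
qed

text \<open>The case \<open>s = t\<close> is split off because the normal law is available only for
  a positive variance \<open>t - s\<close>.\<close>

lemma increment_moments:
  assumes "0 \<le> s" "s \<le> t"
  shows "integrable M (\<lambda>\<omega>. W t \<omega> - W s \<omega>)" "(\<integral>\<omega>. W t \<omega> - W s \<omega> \<partial>M) = 0"
    "integrable M (\<lambda>\<omega>. (W t \<omega> - W s \<omega>)\<^sup>2)" "(\<integral>\<omega>. (W t \<omega> - W s \<omega>)\<^sup>2 \<partial>M) = t - s"
proof -
  let ?D = "\<lambda>\<omega>. W t \<omega> - W s \<omega>"
  have "integrable M ?D \<and> (\<integral>\<omega>. ?D \<omega> \<partial>M) = 0 \<and>
    integrable M (\<lambda>\<omega>. (?D \<omega>)\<^sup>2) \<and> (\<integral>\<omega>. (?D \<omega>)\<^sup>2 \<partial>M) = t - s"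
  proof (cases "s = t")
    case False
    then have st: "s < t" using assms by simp
    let ?\<sigma> = "sqrt (t - s)"
    have \<sigma>: "0 < ?\<sigma>" using st by simp
    have D: "distributed M lborel ?D (normal_density 0 ?\<sigma>)" using normal_W assms st by simp
    have E: "expectation ?D = 0" using normal_distributed_expectation[OF \<sigma> D] .
    have V: "variance ?D = t - s" using normal_distributed_variance[OF \<sigma> D] st by simp
    have i1: "integrable M ?D"
      using distributed_integrable[OF D, of "\<lambda>x. x"] integrable_normal_moment_nz_1[OF \<sigma>, of 0] by simp
    have i2: "integrable M (\<lambda>\<omega>. (?D \<omega>)\<^sup>2)"
      using distributed_integrable[OF D, of "\<lambda>x. x\<^sup>2"] integrable_normal_moment[OF \<sigma>, of 0 2] by simp
    show ?thesis using E V i1 i2 by simp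
  qed simp
  then show "integrable M ?D" "(\<integral>\<omega>. ?D \<omega> \<partial>M) = 0"
    "integrable M (\<lambda>\<omega>. (?D \<omega>)\<^sup>2)" "(\<integral>\<omega>. (?D \<omega>)\<^sup>2 \<partial>M) = t - s" by auto
qed

text \<open>Independence of the increment from \<open>F s\<close> factorises both expectations into
  that of \<open>f\<close> and a moment of the increment, namely 0 or \<open>t - s\<close>.\<close>

lemma mult_increment:
  assumes "0 \<le> s" "s \<le> t" "f \<in> borel_measurable (F s)" "integrable M f"
  shows "integrable M (\<lambda>\<omega>. f \<omega> * (W t \<omega> - W s \<omega>))" "(\<integral>\<omega>. f \<omega> * (W t \<omega> - W s \<omega>) \<partial>M) = 0"
    "integrable M (\<lambda>\<omega>. f \<omega> * (W t \<omega> - W s \<omega>)\<^sup>2)"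
    "(\<integral>\<omega>. f \<omega> * (W t \<omega> - W s \<omega>)\<^sup>2 \<partial>M) = (\<integral>\<omega>. f \<omega> \<partial>M) * (t - s)"
proof -
  let ?D = "\<lambda>\<omega>. W t \<omega> - W s \<omega>"
  have "integrable M (\<lambda>\<omega>. f \<omega> * ?D \<omega>) \<and> (\<integral>\<omega>. f \<omega> * ?D \<omega> \<partial>M) = 0 \<and>
    integrable M (\<lambda>\<omega>. f \<omega> * (?D \<omega>)\<^sup>2) \<and> (\<integral>\<omega>. f \<omega> * (?D \<omega>)\<^sup>2 \<partial>M) = (\<integral>\<omega>. f \<omega> \<partial>M) * (t - s)"
  proof (cases "s = t")
    case False
    then have st: "s < t" using assms by simp
    have i: "indep_var borel f borel ?D" using indep_increment assms st by simp
    have i2: "indep_var borel f borel (\<lambda>\<omega>. (?D \<omega>)\<^sup>2)"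
      using indep_var_compose[OF i, of "\<lambda>x. x" borel "\<lambda>x. x\<^sup>2" borel] by (simp add: comp_def)
    note m = increment_moments[OF assms(1,2)]
    show ?thesis
      using indep_var_lebesgue_integral[OF i assms(4) m(1)] indep_var_integrable[OF i assms(4) m(1)]
       indep_var_lebesgue_integral[OF i2 assms(4) m(3)] indep_var_integrable[OF i2 assms(4) m(3)] m
      by simp
  qed simp
  then show "integrable M (\<lambda>\<omega>. f \<omega> * ?D \<omega>)" "(\<integral>\<omega>. f \<omega> * ?D \<omega> \<partial>M) = 0"
    "integrable M (\<lambda>\<omega>. f \<omega> * (?D \<omega>)\<^sup>2)" "(\<integral>\<omega>. f \<omega> * (?D \<omega>)\<^sup>2 \<partial>M) = (\<integral>\<omega>. f \<omega> \<partial>M) * (t - s)" by auto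
qed

lemma sq_int_mult_increment:
  assumes "0 \<le> s" "s \<le> t" "f \<in> borel_measurable (F s)" "sq_int f"
  shows "sq_int (\<lambda>\<omega>. f \<omega> * (W t \<omega> - W s \<omega>))"
    "(\<integral>\<omega>. (f \<omega> * (W t \<omega> - W s \<omega>))\<^sup>2 \<partial>M) = (\<integral>\<omega>. (f \<omega>)\<^sup>2 \<partial>M) * (t - s)"
  using mult_increment[OF assms(1,2), of "\<lambda>\<omega>. (f \<omega>)\<^sup>2"] assms W_measurable[of t] W_measurable[of s]
  by (auto simp: sq_int_def power_mult_distrib)

text \<open>This is \<open>elementary_integrand\<close> without the bound on the coefficients: the
  Riemann sums of a continuous process have to qualify although the process may be unbounded. Square
  integrability is added where an isometry is wanted.\<close>

definition step_integrand :: "real \<Rightarrow> nat \<Rightarrow> (nat \<Rightarrow> real) \<Rightarrow> (nat \<Rightarrow> 'w \<Rightarrow> real) \<Rightarrow> bool" where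
  "step_integrand T n \<tau> H \<longleftrightarrow> 0 \<le> \<tau> 0 \<and> (\<forall>i<n. \<tau> i \<le> \<tau> (Suc i)) \<and> \<tau> n \<le> T \<and>
     (\<forall>i<n. H i \<in> borel_measurable (F (\<tau> i)))"

lemma step_integrand_bounds:
  assumes "step_integrand T n \<tau> H" "i \<le> n"
  shows "0 \<le> \<tau> i" "\<tau> i \<le> T" "i < n \<Longrightarrow> \<tau> i \<le> \<tau> (Suc i)"
  using weak_grid_le[of n \<tau> 0 i] weak_grid_le[of n \<tau> i n] assms
  by (auto simp: step_integrand_def intro: order_trans)

lemma step_integral_measurable:
  assumes "step_integrand T n \<tau> H" "0 \<le> t"
  shows "elementary_integral W n \<tau> H t \<in> borel_measurable (F t)"
  unfolding elementary_integral_def[abs_def]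
proof (rule borel_measurable_sum)
  fix i assume i: "i \<in> {..<n}"
  note b = step_integrand_bounds[OF assms(1), of i] step_integrand_bounds[OF assms(1), of "Suc i"]
  have *: "W (min (\<tau> j) t) \<in> borel_measurable (F t)" if "0 \<le> \<tau> j" for j
    using adapted_W[of "min (\<tau> j) t"] that assms(2) by (auto intro: measurable_F_mono)
  have H: "H i \<in> borel_measurable (F (\<tau> i))" using assms(1) i by (auto simp: step_integrand_def)
  show "(\<lambda>\<omega>. H i \<omega> * (W (min (\<tau> (Suc i)) t) \<omega> - W (min (\<tau> i) t) \<omega>)) \<in> borel_measurable (F t)"
  proof (cases "\<tau> i \<le> t")
    case True
    have "H i \<in> borel_measurable (F t)" using measurable_F_mono[OF H True] .
    then show ?thesis using *[of i] *[of "Suc i"] b i by auto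
  next
    case False
    then show ?thesis using b i by (auto simp: min_def)
  qed
qed

text \<open>A summand of the integral from \<open>s\<close> to \<open>t\<close> is
  \<open>H i\<close> times the increment of \<open>W\<close> between the clipped times
  \<open>c i\<close> and \<open>c (Suc i)\<close>. Either this clipped interval is degenerate or
  \<open>H i\<close> is known at its left end, so the facts about a single increment apply.\<close>

lemma step_integral_term:
  assumes S: "step_integrand T n \<tau> H" and sq: "\<forall>i<n. sq_int (H i)" and st: "0 \<le> s" "s \<le> t" and i: "i < n"
  defines "c \<equiv> \<lambda>i. max s (min (\<tau> i) t)"
  defines "X \<equiv> \<lambda>\<omega>. H i \<omega> * ((W (min (\<tau> (Suc i)) t) \<omega> - W (min (\<tau> i) t) \<omega>)
     - (W (min (\<tau> (Suc i)) s) \<omega> - W (min (\<tau> i) s) \<omega>))"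
  shows "sq_int X"
    "(\<integral>\<omega>. (X \<omega>)\<^sup>2 \<partial>M) = (\<integral>\<omega>. (H i \<omega>)\<^sup>2 \<partial>M) * (c (Suc i) - c i)"
    "\<And>f. f \<in> borel_measurable (F (c i)) \<Longrightarrow> sq_int f \<Longrightarrow> (\<integral>\<omega>. f \<omega> * X \<omega> \<partial>M) = 0"
    "X \<in> borel_measurable (F (c (Suc i)))"
proof -
  note b = step_integrand_bounds[OF S, of i] step_integrand_bounds[OF S, of "Suc i"]
  have X: "X \<omega> = H i \<omega> * (W (c (Suc i)) \<omega> - W (c i) \<omega>)" for \<omega>
  proof -
    \<comment> \<open>Clipping from below at \<open>s\<close> subtracts the path stopped at
      \<open>s\<close>; the common value \<open>W s\<close> drops out of differences.\<close>
    have "W (c j) \<omega> = W (min (\<tau> j) t) \<omega> - W (min (\<tau> j) s) \<omega> + W s \<omega>" for j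
      using st by (cases "\<tau> j \<le> s") (simp_all add: c_def min_def max_def)
    from this[of i] this[of "Suc i"] show ?thesis unfolding X_def by simp
  qed
  have c0: "0 \<le> c i" "c i \<le> c (Suc i)" using st b i by (auto simp: c_def)
  have H: "H i \<in> borel_measurable (F (\<tau> i))" "sq_int (H i)" using S sq i by (auto simp: step_integrand_def)
  \<comment> \<open>If \<open>\<tau> i > c i\<close>, then \<open>t \<le> \<tau> i\<close>, so that
    \<open>c i\<close> and \<open>c (Suc i)\<close> both equal \<open>t\<close> and the summand is
    zero.\<close>
  have Hc: "c i = c (Suc i) \<or> H i \<in> borel_measurable (F (c i))"
  proof (cases "\<tau> i \<le> c i")
    case True then show ?thesis using measurable_F_mono[OF H(1)] by simp
  next
    case False
    then have "t \<le> \<tau> i" using st by (simp add: c_def min_def max_def split: if_splits)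
    then show ?thesis using b i by (simp add: c_def)
  qed
  show "sq_int X"
    unfolding X using Hc sq_int_mult_increment(1)[OF c0 _ H(2)] sq_int_const by auto
  show "(\<integral>\<omega>. (X \<omega>)\<^sup>2 \<partial>M) = (\<integral>\<omega>. (H i \<omega>)\<^sup>2 \<partial>M) * (c (Suc i) - c i)"
    unfolding X using Hc sq_int_mult_increment(2)[OF c0 _ H(2)] by auto
  show "(\<integral>\<omega>. f \<omega> * X \<omega> \<partial>M) = 0" if "f \<in> borel_measurable (F (c i))" "sq_int f" for f
  proof (cases "c i = c (Suc i)")
    case False
    then have "(\<lambda>\<omega>. f \<omega> * H i \<omega>) \<in> borel_measurable (F (c i))" using Hc that by auto
    from mult_increment(2)[OF c0 this sq_int_mult[OF that(2) H(2)]]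
    show ?thesis unfolding X by (simp add: mult.assoc)
  qed (simp add: X)
  show "X \<in> borel_measurable (F (c (Suc i)))"
  proof (cases "c i = c (Suc i)")
    case False
    have "H i \<in> borel_measurable (F (c (Suc i)))" using Hc False measurable_F_mono[OF _ c0(2)] by auto
    moreover have "W (c i) \<in> borel_measurable (F (c (Suc i)))" using adapted_W c0 measurable_F_mono by blast
    moreover have "W (c (Suc i)) \<in> borel_measurable (F (c (Suc i)))" using adapted_W c0 by auto
    ultimately show ?thesis unfolding X[abs_def] by auto
  qed (simp add: X[abs_def])
qed

text \<open>Since \<open>f\<close> is known at time \<open>s\<close>, which precedes every clipped
  time, it is orthogonal to each summand of the increment.\<close>

lemma step_integral_martingale:
  assumes S: "step_integrand T n \<tau> H" and sq: "\<forall>i<n. sq_int (H i)" and st: "0 \<le> s" "s \<le> t"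
    and f: "f \<in> borel_measurable (F s)" "sq_int f"
  shows "sq_int (\<lambda>\<omega>. elementary_integral W n \<tau> H t \<omega> - elementary_integral W n \<tau> H s \<omega>)"
    "(\<integral>\<omega>. f \<omega> * (elementary_integral W n \<tau> H t \<omega> - elementary_integral W n \<tau> H s \<omega>) \<partial>M) = 0"
proof -
  let ?X = "\<lambda>i \<omega>. H i \<omega> * ((W (min (\<tau> (Suc i)) t) \<omega> - W (min (\<tau> i) t) \<omega>)
     - (W (min (\<tau> (Suc i)) s) \<omega> - W (min (\<tau> i) s) \<omega>))"
  have e: "elementary_integral W n \<tau> H t \<omega> - elementary_integral W n \<tau> H s \<omega> = (\<Sum>i<n. ?X i \<omega>)" for \<omega>
    by (simp add: elementary_integral_def sum_subtractf right_diff_distrib)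
  note X = step_integral_term[OF S sq st]
  show "sq_int (\<lambda>\<omega>. elementary_integral W n \<tau> H t \<omega> - elementary_integral W n \<tau> H s \<omega>)"
    unfolding e by (rule sq_int_sum) (use X(1) in auto)
  have "(\<integral>\<omega>. (\<Sum>i<n. f \<omega> * ?X i \<omega>) \<partial>M) = (\<Sum>i<n. (\<integral>\<omega>. f \<omega> * ?X i \<omega> \<partial>M))"
    by (rule Bochner_Integration.integral_sum) (use X(1) f in \<open>auto intro!: sq_int_mult\<close>)
  also have "\<dots> = 0"
    by (intro sum.neutral ballI X(3) measurable_F_mono[OF f(1)] f(2)) auto
  finally show "(\<integral>\<omega>. f \<omega> * (elementary_integral W n \<tau> H t \<omega> - elementary_integral W n \<tau> H s \<omega>) \<partial>M) = 0"
    unfolding e by (simp add: sum_distrib_left)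
qed

lemma step_integral_isometry:
  assumes S: "step_integrand T n \<tau> H" and sq: "\<forall>i<n. sq_int (H i)" and t: "0 \<le> t"
  shows "sq_int (elementary_integral W n \<tau> H t)"
    "(\<integral>\<omega>. (elementary_integral W n \<tau> H t \<omega>)\<^sup>2 \<partial>M)
       = (\<Sum>i<n. (\<integral>\<omega>. (H i \<omega>)\<^sup>2 \<partial>M) * (min (\<tau> (Suc i)) t - min (\<tau> i) t))"
proof -
  let ?c = "\<lambda>i. min (\<tau> i) t"
  define X where "X = (\<lambda>i \<omega>. H i \<omega> * (W (?c (Suc i)) \<omega> - W (?c i) \<omega>))"
  have \<tau>0: "0 \<le> \<tau> i" if "i \<le> n" for i using step_integrand_bounds[OF S that] by simp
  have X: "sq_int (X i)" "(\<integral>\<omega>. (X i \<omega>)\<^sup>2 \<partial>M) = (\<integral>\<omega>. (H i \<omega>)\<^sup>2 \<partial>M) * (?c (Suc i) - ?c i)"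
    "X i \<in> borel_measurable (F (?c (Suc i)))"
    "\<And>f. f \<in> borel_measurable (F (?c i)) \<Longrightarrow> sq_int f \<Longrightarrow> (\<integral>\<omega>. f \<omega> * X i \<omega> \<partial>M) = 0"
    if i: "i < n" for i
  proof -
    have m: "max 0 (min (\<tau> j) t) = min (\<tau> j) t" "min (\<tau> j) 0 = 0" if "j \<le> n" for j
      using \<tau>0[OF that] t by (auto simp: max_absorb2 min_absorb2)
    have e: "(\<lambda>\<omega>. H i \<omega> * ((W (?c (Suc i)) \<omega> - W (?c i) \<omega>)
       - (W (min (\<tau> (Suc i)) 0) \<omega> - W (min (\<tau> i) 0) \<omega>))) = X i"
      using i by (simp add: X_def m)
    note T = step_integral_term[OF S sq order_refl t i, unfolded e]
    show "sq_int (X i)" using T(1) .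
    show "(\<integral>\<omega>. (X i \<omega>)\<^sup>2 \<partial>M) = (\<integral>\<omega>. (H i \<omega>)\<^sup>2 \<partial>M) * (?c (Suc i) - ?c i)"
      using T(2) i fun_cong[OF e] by (simp add: m)
    show "X i \<in> borel_measurable (F (?c (Suc i)))" using T(4) i by (simp add: m)
    show "(\<integral>\<omega>. f \<omega> * X i \<omega> \<partial>M) = 0" if "f \<in> borel_measurable (F (?c i))" "sq_int f" for f
      using T(3)[of f] i that fun_cong[OF e] by (simp add: m)
  qed
  \<comment> \<open>The induction carries along that the partial sum is known at
    \<open>?c k\<close>: this makes its product with the next term integrate to zero, so the second
    moments add up.\<close>
  have *: "sq_int (\<lambda>\<omega>. \<Sum>i<k. X i \<omega>) \<and> (\<lambda>\<omega>. \<Sum>i<k. X i \<omega>) \<in> borel_measurable (F (?c k)) \<and>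
    (\<integral>\<omega>. (\<Sum>i<k. X i \<omega>)\<^sup>2 \<partial>M) = (\<Sum>i<k. (\<integral>\<omega>. (H i \<omega>)\<^sup>2 \<partial>M) * (?c (Suc i) - ?c i))" if "k \<le> n" for k
    using that
  proof (induction k)
    case (Suc k)
    let ?S = "\<lambda>\<omega>. \<Sum>i<k. X i \<omega>"
    have k: "k < n" using Suc by simp
    have IH: "sq_int ?S" "?S \<in> borel_measurable (F (?c k))"
     "(\<integral>\<omega>. (?S \<omega>)\<^sup>2 \<partial>M) = (\<Sum>i<k. (\<integral>\<omega>. (H i \<omega>)\<^sup>2 \<partial>M) * (?c (Suc i) - ?c i))" using Suc by auto
    have "(\<integral>\<omega>. (?S \<omega> + X k \<omega>)\<^sup>2 \<partial>M) = (\<integral>\<omega>. (?S \<omega>)\<^sup>2 + (X k \<omega>)\<^sup>2 + 2 * (?S \<omega> * X k \<omega>) \<partial>M)"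
      by (simp add: power2_sum mult.assoc)
    also have "\<dots> = (\<integral>\<omega>. (?S \<omega>)\<^sup>2 \<partial>M) + (\<integral>\<omega>. (X k \<omega>)\<^sup>2 \<partial>M) + 2 * (\<integral>\<omega>. ?S \<omega> * X k \<omega> \<partial>M)"
      using sq_int_square[OF IH(1)] sq_int_square[OF X(1)[OF k]] sq_int_mult[OF IH(1) X(1)[OF k]] by simp
    finally have e: "(\<integral>\<omega>. (?S \<omega> + X k \<omega>)\<^sup>2 \<partial>M) = (\<Sum>i<Suc k. (\<integral>\<omega>. (H i \<omega>)\<^sup>2 \<partial>M) * (?c (Suc i) - ?c i))"
      using IH X[OF k] X(4)[OF k IH(2,1)] by simp
    have "?S \<in> borel_measurable (F (?c (Suc k)))"
      by (rule measurable_F_mono[OF IH(2)]) (use step_integrand_bounds(3)[OF S _ k] k in auto)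
    then show ?case using e IH X[OF k] by (auto intro: sq_int_add)
  qed (simp add: sq_int_const)
  have e: "elementary_integral W n \<tau> H t = (\<lambda>\<omega>. \<Sum>i<n. X i \<omega>)"
    by (simp add: elementary_integral_def[abs_def] X_def)
  show "sq_int (elementary_integral W n \<tau> H t)"
    "(\<integral>\<omega>. (elementary_integral W n \<tau> H t \<omega>)\<^sup>2 \<partial>M)
       = (\<Sum>i<n. (\<integral>\<omega>. (H i \<omega>)\<^sup>2 \<partial>M) * (min (\<tau> (Suc i)) t - min (\<tau> i) t))"
    using * e by auto
qed

lemma elementary_integrand_step:
  "elementary_integrand M F T n \<tau> H \<Longrightarrow> step_integrand T n \<tau> H"
  by (auto simp: elementary_integrand_def step_integrand_def)

text \<open>Both integrands are rewritten on the union of their grid points. The difference is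
  stated for every integrator \<open>h\<close>, hence holds for processes and integrals alike; the
  grid is strict because the Lenglart estimate divides by the cell lengths.\<close>

lemma step_integrand_diff:
  assumes S1: "step_integrand T n1 \<tau>1 H1" and S2: "step_integrand T n2 \<tau>2 H2"
  obtains m p K where "step_integrand T m p K" "\<And>i. i < m \<Longrightarrow> p i < p (Suc i)"
    "\<And>\<omega> h. stieltjes_sum m p (\<lambda>i. K i \<omega>) h
       = stieltjes_sum n1 \<tau>1 (\<lambda>i. H1 i \<omega>) h - stieltjes_sum n2 \<tau>2 (\<lambda>i. H2 i \<omega>) h"
    "(\<forall>i<n1. sq_int (H1 i)) \<Longrightarrow> (\<forall>i<n2. sq_int (H2 i)) \<Longrightarrow> \<forall>i<m. sq_int (K i)"
proof -
  define P where "P = \<tau>1 ` {..n1} \<union> \<tau>2 ` {..n2}"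
  have "finite P" "P \<noteq> {}" by (auto simp: P_def)
  from finite_set_grid[OF this] obtain m p
    where p: "p ` {..m} = P" "\<And>i. i < m \<Longrightarrow> p i < p (Suc i)" by metis
  define R where "R = (\<lambda>n \<tau> (H :: nat \<Rightarrow> 'w \<Rightarrow> real) i \<omega>.
    \<Sum>l<n. of_bool (\<tau> l \<le> p i \<and> p (Suc i) \<le> \<tau> (Suc l)) * H l \<omega>)"
  have R_meas: "R n \<tau> H i \<in> borel_measurable (F (p i))" if "step_integrand T n \<tau> H" for n \<tau> H i
    unfolding R_def
  proof (rule borel_measurable_sum)
    fix l assume l: "l \<in> {..<n}"
    show "(\<lambda>\<omega>. of_bool (\<tau> l \<le> p i \<and> p (Suc i) \<le> \<tau> (Suc l)) * H l \<omega>) \<in> borel_measurable (F (p i))"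
    \<comment> \<open>If \<open>\<tau> l > p i\<close>, the coefficient \<open>H l\<close> need not
      be known at \<open>p i\<close>, but then its selector is 0.\<close>
    proof (cases "\<tau> l \<le> p i")
      case True
      have "H l \<in> borel_measurable (F (p i))"
        using measurable_F_mono[OF _ True] that l by (auto simp: step_integrand_def)
      then show ?thesis by auto
    qed auto
  qed
  have R_sq: "sq_int (R n \<tau> H i)" if "\<forall>i<n. sq_int (H i)" for n \<tau> H i
    unfolding R_def by (rule sq_int_sum, rule sq_int_cmult) (use that in auto)
  have Pb: "x \<in> {0..T}" if "x \<in> P" for x
    using that step_integrand_bounds(1,2)[OF S1] step_integrand_bounds(1,2)[OF S2] by (auto simp: P_def)
  have mem: "p j \<in> P" if "j \<le> m" for j using p(1) that by auto
  show thesis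
  proof
    show "step_integrand T m p (\<lambda>i \<omega>. R n1 \<tau>1 H1 i \<omega> - R n2 \<tau>2 H2 i \<omega>)"
      unfolding step_integrand_def
      using Pb[OF mem[of 0]] Pb[OF mem[of m]] p(2) R_meas[OF S1] R_meas[OF S2]
      by (auto intro: less_imp_le)
    show "stieltjes_sum m p (\<lambda>i. R n1 \<tau>1 H1 i \<omega> - R n2 \<tau>2 H2 i \<omega>) h
       = stieltjes_sum n1 \<tau>1 (\<lambda>i. H1 i \<omega>) h - stieltjes_sum n2 \<tau>2 (\<lambda>i. H2 i \<omega>) h" for \<omega> h
    proof -
      have "stieltjes_sum n1 \<tau>1 (\<lambda>i. H1 i \<omega>) h = stieltjes_sum m p (\<lambda>i. R n1 \<tau>1 H1 i \<omega>) h"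
        unfolding R_def by (rule stieltjes_sum_refine) (use S1 p in \<open>auto simp: step_integrand_def P_def\<close>)
      moreover have "stieltjes_sum n2 \<tau>2 (\<lambda>i. H2 i \<omega>) h = stieltjes_sum m p (\<lambda>i. R n2 \<tau>2 H2 i \<omega>) h"
        unfolding R_def by (rule stieltjes_sum_refine) (use S2 p in \<open>auto simp: step_integrand_def P_def\<close>)
      ultimately show ?thesis by (simp add: stieltjes_sum_def sum_subtractf left_diff_distrib)
    qed
    show "\<forall>i<m. sq_int (\<lambda>\<omega>. R n1 \<tau>1 H1 i \<omega> - R n2 \<tau>2 H2 i \<omega>)"
      if "\<forall>i<n1. sq_int (H1 i)" "\<forall>i<n2. sq_int (H2 i)"
      using R_sq[OF that(1)] R_sq[OF that(2)] by (auto intro: sq_int_diff)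
  qed (use p in auto)
qed

lemma elementary_process_sq_integral:
  assumes S: "step_integrand T m p K" and t: "t \<in> {0..T}"
  shows "(\<integral>\<^sup>+s\<in>{0..t}. ennreal ((elementary_process m p K s \<omega>)\<^sup>2) \<partial>lborel)
    = ennreal (\<Sum>i<m. (K i \<omega>)\<^sup>2 * (min (p (Suc i)) t - min (p i) t))"
proof -
  note b = step_integrand_bounds[OF S]
  have le: "p i \<le> p (Suc i)" if "i < m" for i using b(3)[of i] that by simp
  have "(\<integral>\<^sup>+s\<in>{0..t}. ennreal ((elementary_process m p K s \<omega>)\<^sup>2) \<partial>lborel)
    = (\<integral>\<^sup>+s. (\<Sum>i<m. ennreal ((K i \<omega>)\<^sup>2) * indicator {p i<..min (p (Suc i)) t} s) \<partial>lborel)"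
  proof (rule nn_integral_cong)
    fix s
    show "ennreal ((elementary_process m p K s \<omega>)\<^sup>2) * indicator {0..t} s
      = (\<Sum>i<m. ennreal ((K i \<omega>)\<^sup>2) * indicator {p i<..min (p (Suc i)) t} s)"
    proof -
      have "ennreal ((elementary_process m p K s \<omega>)\<^sup>2) = (\<Sum>i<m. ennreal ((K i \<omega>)\<^sup>2 * indicator {p i<..p (Suc i)} s))"
        by (subst elementary_process_sq[of m p, OF le]) (auto intro!: sum_ennreal[symmetric])
      also have "\<dots> * indicator {0..t} s = (\<Sum>i<m. ennreal ((K i \<omega>)\<^sup>2) * indicator {p i<..min (p (Suc i)) t} s)"
        unfolding sum_distrib_right
      proof (intro sum.cong refl)
        fix i assume "i \<in> {..<m}"
        then have "0 \<le> p i" using b(1)[of i] by simp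
        then show "ennreal ((K i \<omega>)\<^sup>2 * indicator {p i<..p (Suc i)} s) * indicator {0..t} s
          = ennreal ((K i \<omega>)\<^sup>2) * indicator {p i<..min (p (Suc i)) t} s"
          by (simp add: indicator_def)
      qed
      finally show ?thesis .
    qed
  qed
  also have "\<dots> = (\<Sum>i<m. \<integral>\<^sup>+s. ennreal ((K i \<omega>)\<^sup>2) * indicator {p i<..min (p (Suc i)) t} s \<partial>lborel)"
    by (rule nn_integral_sum) auto
  also have "\<dots> = (\<Sum>i<m. ennreal ((K i \<omega>)\<^sup>2 * (min (p (Suc i)) t - min (p i) t)))"
  proof (intro sum.cong refl)
    fix i assume i: "i \<in> {..<m}"
    have "emeasure lborel {p i<..min (p (Suc i)) t} = ennreal (min (p (Suc i)) t - min (p i) t)"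
      using le[of i] i by (cases "p i \<le> t") auto
    then show "(\<integral>\<^sup>+s. ennreal ((K i \<omega>)\<^sup>2) * indicator {p i<..min (p (Suc i)) t} s \<partial>lborel)
      = ennreal ((K i \<omega>)\<^sup>2 * (min (p (Suc i)) t - min (p i) t))"
      by (subst nn_integral_cmult_indicator) (auto simp: ennreal_mult')
  qed
  also have "\<dots> = ennreal (\<Sum>i<m. (K i \<omega>)\<^sup>2 * (min (p (Suc i)) t - min (p i) t))"
  proof (rule sum_ennreal, rule mult_nonneg_nonneg)
    fix i assume "i \<in> {..<m}"
    then have "min (p i) t \<le> min (p (Suc i)) t" by (intro min.mono le) auto
    then show "0 \<le> min (p (Suc i)) t - min (p i) t" by simp
  qed simp
  finally show ?thesis .
qed

text \<open>A discrete form of Lenglart's inequality: the step process is stopped once its quadratic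
  variation exceeds \<open>\<delta>\<close>.\<close>

lemma step_integral_lenglart:
  assumes S: "step_integrand T m p K" and strict: "\<And>i. i < m \<Longrightarrow> p i < p (Suc i)"
    and t: "t \<in> {0..T}" and \<delta>: "\<delta> > 0" and \<epsilon>: "\<epsilon> > 0"
  shows "prob {\<omega>\<in>space M. \<epsilon> < \<bar>elementary_integral W m p K t \<omega>\<bar>}
    \<le> prob {\<omega>\<in>space M. \<delta> < (\<Sum>i<m. (K i \<omega>)\<^sup>2 * (p (Suc i) - p i))} + \<delta> / \<epsilon>\<^sup>2"
proof -
  define G where "G = (\<lambda>k \<omega>. \<Sum>i<k. (K i \<omega>)\<^sup>2 * (p (Suc i) - p i))"
  \<comment> \<open>The test uses \<open>G (Suc i)\<close>, not \<open>G i\<close>: a cell that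
    would push the quadratic variation above \<open>\<delta>\<close> is itself dropped, so there is
    no overshoot. As only the coefficients up to index \<open>i\<close> enter, \<open>K' i\<close>
    is still known at \<open>p i\<close>.\<close>
  define K' where "K' = (\<lambda>i \<omega>. if G (Suc i) \<omega> \<le> \<delta> then K i \<omega> else 0)"
  have KF: "K i \<in> borel_measurable (F (p j))" if "i \<le> j" "j < m" for i j
  proof -
    have "p i \<le> p j" using weak_grid_le[of m p i j] strict that by (auto intro: less_imp_le)
    moreover have "K i \<in> borel_measurable (F (p i))" using S that by (auto simp: step_integrand_def)
    ultimately show ?thesis using measurable_F_mono by blast
  qed
  have GF: "G (Suc i) \<in> borel_measurable (F (p i))" if "i < m" for i
    unfolding G_def by (rule borel_measurable_sum) (use KF[of _ i] that in auto)
  have K'F: "K' i \<in> borel_measurable (F (p i))" if "i < m" for i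
    unfolding K'_def[abs_def] using GF[OF that] KF[of i i] that by measurable
  have KM: "K i \<in> borel_measurable M" if "i < m" for i using KF[of i i] that measurable_F_M by blast
  have GM: "G k \<in> borel_measurable M" if "k \<le> m" for k
    unfolding G_def by (rule borel_measurable_sum) (use KM that in auto)
  have G_mono: "G i \<omega> \<le> G j \<omega>" if "i \<le> j" "j \<le> m" for i j \<omega>
    unfolding G_def by (rule sum_mono2) (use that strict[THEN less_imp_le] in \<open>auto intro!: mult_nonneg_nonneg\<close>)
  have K'sum: "(\<Sum>i<k. (K' i \<omega>)\<^sup>2 * (p (Suc i) - p i)) \<le> min \<delta> (G k \<omega>)" if "k \<le> m" for k \<omega>
    using that
  proof (induction k)
    case (Suc k)
    then have IH: "(\<Sum>i<k. (K' i \<omega>)\<^sup>2 * (p (Suc i) - p i)) \<le> min \<delta> (G k \<omega>)" by simp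
    show ?case
    proof (cases "G (Suc k) \<omega> \<le> \<delta>")
      case True
      then show ?thesis using IH by (simp add: K'_def G_def)
    next
      case False
      then show ?thesis using IH G_mono[of k "Suc k" \<omega>] Suc.prems by (simp add: K'_def)
    qed
  qed (use \<delta> in \<open>simp add: G_def\<close>)
  \<comment> \<open>The bound on the whole sum bounds each coefficient, because the cells have
    positive length.\<close>
  have sq: "sq_int (K' i)" if i: "i < m" for i
  proof (rule sq_int_bounded)
    show "K' i \<in> borel_measurable M" using K'F[OF i] measurable_F_M by blast
    fix \<omega>
    have "(K' i \<omega>)\<^sup>2 * (p (Suc i) - p i) \<le> (\<Sum>i<m. (K' i \<omega>)\<^sup>2 * (p (Suc i) - p i))"
      by (rule member_le_sum) (use i strict[THEN less_imp_le] in \<open>auto intro!: mult_nonneg_nonneg\<close>)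
    also have "\<dots> \<le> \<delta>" using K'sum[of m \<omega>] by simp
    finally have "(K' i \<omega>)\<^sup>2 \<le> \<delta> / (p (Suc i) - p i)" using strict[OF i] by (simp add: field_simps)
    then show "\<bar>K' i \<omega>\<bar> \<le> sqrt (\<delta> / (p (Suc i) - p i))" by (simp add: real_le_rsqrt)
  qed
  have S': "step_integrand T m p K'" using S K'F by (auto simp: step_integrand_def)
  let ?I = "elementary_integral W m p K t" and ?I' = "elementary_integral W m p K' t"
  have t0: "0 \<le> t" using t by simp
  note iso = step_integral_isometry[OF S' _ t0]
  have E: "(\<integral>\<omega>. (?I' \<omega>)\<^sup>2 \<partial>M) \<le> \<delta>"
  proof -
    have "(\<integral>\<omega>. (?I' \<omega>)\<^sup>2 \<partial>M) = (\<Sum>i<m. (\<integral>\<omega>. (K' i \<omega>)\<^sup>2 \<partial>M) * (min (p (Suc i)) t - min (p i) t))"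
      using iso(2) sq by simp
    also have "\<dots> \<le> (\<Sum>i<m. (\<integral>\<omega>. (K' i \<omega>)\<^sup>2 \<partial>M) * (p (Suc i) - p i))"
    proof (intro sum_mono mult_left_mono)
      fix i assume "i \<in> {..<m}"
      then show "min (p (Suc i)) t - min (p i) t \<le> p (Suc i) - p i"
        using strict[of i] by (auto simp: min_def)
    qed auto
    also have "\<dots> = (\<integral>\<omega>. (\<Sum>i<m. (K' i \<omega>)\<^sup>2 * (p (Suc i) - p i)) \<partial>M)"
      by (subst Bochner_Integration.integral_sum) (use sq in \<open>auto simp: sq_int_def\<close>)
    also have "\<dots> \<le> (\<integral>\<omega>. \<delta> \<partial>M)"
      by (rule integral_mono) (use sq K'sum[of m] in \<open>auto simp: sq_int_def\<close>)
    finally show ?thesis by (simp add: prob_space)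
  qed
  have I'sq: "sq_int ?I'" using iso(1) sq by simp
  have IM: "?I \<in> borel_measurable M" using step_integral_measurable[OF S t0] measurable_F_M by blast
  let ?A = "{\<omega>\<in>space M. \<delta> < G m \<omega>}" and ?B = "{\<omega>\<in>space M. \<epsilon>\<^sup>2 \<le> (?I' \<omega>)\<^sup>2}"
  have mA: "?A \<in> events" using GM[of m] by measurable
  have mB: "?B \<in> events" using sq_int_measurable[OF I'sq] by measurable
  \<comment> \<open>Where the full quadratic variation is at most \<open>\<delta>\<close> nothing
    has been dropped and the two integrals agree. The second event is left to Markov's
    inequality.\<close>
  have "{\<omega>\<in>space M. \<epsilon> < \<bar>?I \<omega>\<bar>} \<subseteq> ?A \<union> ?B"
  proof safe
    fix \<omega> assume \<omega>: "\<omega> \<in> space M" "\<epsilon> < \<bar>?I \<omega>\<bar>" and "\<not> \<epsilon>\<^sup>2 \<le> (?I' \<omega>)\<^sup>2"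
    show "\<delta> < G m \<omega>"
    proof (rule ccontr)
      assume "\<not> \<delta> < G m \<omega>"
      then have "K' i \<omega> = K i \<omega>" if "i < m" for i
        using G_mono[of "Suc i" m \<omega>] that by (auto simp: K'_def)
      then have "?I' \<omega> = ?I \<omega>" by (simp add: elementary_integral_def)
      moreover have "\<epsilon>\<^sup>2 \<le> \<bar>?I \<omega>\<bar>\<^sup>2" using \<omega> \<epsilon> by (intro power_mono) auto
      ultimately show False using \<open>\<not> \<epsilon>\<^sup>2 \<le> (?I' \<omega>)\<^sup>2\<close> by simp
    qed
  qed
  then have "prob {\<omega>\<in>space M. \<epsilon> < \<bar>?I \<omega>\<bar>} \<le> prob (?A \<union> ?B)"
    using mA mB by (intro finite_measure_mono) auto
  also have "\<dots> \<le> prob ?A + prob ?B" using measure_Un_le[OF mA mB] .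
  also have "prob ?B \<le> (\<integral>\<omega>. (?I' \<omega>)\<^sup>2 \<partial>M) / \<epsilon>\<^sup>2"
    using integral_Markov_inequality_measure[OF sq_int_square[OF I'sq], of "{}" "\<epsilon>\<^sup>2"] \<epsilon> by simp
  also have "\<dots> \<le> \<delta> / \<epsilon>\<^sup>2" using E by (simp add: divide_right_mono)
  finally show ?thesis by (simp add: G_def)
qed

end

section \<open>Convergence in probability\<close>

context prob_space begin

lemma prob_gt_tendsto_0:
  fixes D :: "nat \<Rightarrow> 'a \<Rightarrow> ennreal"
  assumes [measurable]: "\<And>n. D n \<in> borel_measurable M"
    and D: "\<And>\<omega>. \<omega> \<in> space M \<Longrightarrow> (\<lambda>n. D n \<omega>) \<longlonglongrightarrow> 0" and \<delta>: "\<delta> > (0::real)"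
  shows "(\<lambda>n. prob {\<omega>\<in>space M. ennreal \<delta> < D n \<omega>}) \<longlonglongrightarrow> 0"
proof -
  have "(\<lambda>n. \<integral>\<omega>. indicator {\<omega>\<in>space M. ennreal \<delta> < D n \<omega>} \<omega> \<partial>M) \<longlonglongrightarrow> (\<integral>\<omega>. (0::real) \<partial>M)"
  proof (rule integral_dominated_convergence[where w="\<lambda>_. 1"])
    show "AE \<omega> in M. (\<lambda>n. indicator {\<omega>\<in>space M. ennreal \<delta> < D n \<omega>} \<omega>) \<longlonglongrightarrow> (0::real)"
    proof (rule AE_I2)
      fix \<omega> assume "\<omega> \<in> space M"
      have "eventually (\<lambda>n. D n \<omega> < ennreal \<delta>) sequentially"
        using order_tendstoD(2)[OF D[OF \<open>\<omega> \<in> space M\<close>], of "ennreal \<delta>"] \<delta> by simp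
      then have "eventually (\<lambda>n. indicator {\<omega>\<in>space M. ennreal \<delta> < D n \<omega>} \<omega> = (0::real)) sequentially"
        by eventually_elim (auto simp: indicator_def)
      then show "(\<lambda>n. indicator {\<omega>\<in>space M. ennreal \<delta> < D n \<omega>} \<omega>) \<longlonglongrightarrow> (0::real)"
        by (simp add: tendsto_eventually)
    qed
  qed (auto intro!: AE_I2 simp: indicator_def)
  then show ?thesis by simp
qed

text \<open>The truncated distance \<open>min 1 \<bar>X n \<omega> - Y \<omega>\<bar>\<close> tends
  to zero in mean, which yields an almost surely convergent subsequence; near zero the truncation is
  invisible.\<close>

lemma converge_in_prob_AE_subseq:
  fixes X :: "nat \<Rightarrow> 'a \<Rightarrow> real"
  assumes [measurable]: "\<And>n. X n \<in> borel_measurable M" "Y \<in> borel_measurable M"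
    and lim: "\<And>\<epsilon>. \<epsilon> > 0 \<Longrightarrow> (\<lambda>n. prob {\<omega>\<in>space M. \<epsilon> < \<bar>X n \<omega> - Y \<omega>\<bar>}) \<longlonglongrightarrow> 0"
  obtains r where "strict_mono r" "AE \<omega> in M. (\<lambda>n. X (r n) \<omega>) \<longlonglongrightarrow> Y \<omega>"
proof -
  define u where "u = (\<lambda>n \<omega>. min 1 \<bar>X n \<omega> - Y \<omega>\<bar>)"
  have [measurable]: "u n \<in> borel_measurable M" for n unfolding u_def by measurable
  have iu: "integrable M (u n)" for n
    by (rule integrable_const_bound[of _ 1]) (auto simp: u_def)
  have "(\<lambda>n. \<integral>\<omega>. norm (u n \<omega>) \<partial>M) \<longlonglongrightarrow> 0"
  proof (rule LIMSEQ_I)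
    fix e :: real assume e: "0 < e"
    obtain N where N: "\<And>n. n \<ge> N \<Longrightarrow> prob {\<omega>\<in>space M. e/2 < \<bar>X n \<omega> - Y \<omega>\<bar>} < e/2"
      using LIMSEQ_D[OF lim[of "e/2"], of "e/2"] e by auto
    have "(\<integral>\<omega>. norm (u n \<omega>) \<partial>M) < e" if "n \<ge> N" for n
    proof -
      define A where "A = {\<omega>\<in>space M. e/2 < \<bar>X n \<omega> - Y \<omega>\<bar>}"
      have A: "A \<in> events" unfolding A_def by measurable
      then have iA: "integrable M (indicator A :: 'a \<Rightarrow> real)" by (simp add: integrable_indicator_iff emeasure_eq_measure)
      have "(\<integral>\<omega>. norm (u n \<omega>) \<partial>M) \<le> (\<integral>\<omega>. e/2 + indicator A \<omega> \<partial>M)"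
      proof (rule integral_mono)
        show "integrable M (\<lambda>\<omega>. e/2 + indicator A \<omega> :: real)" using iA by auto
        show "norm (u n \<omega>) \<le> e/2 + indicator A \<omega>" if "\<omega> \<in> space M" for \<omega>
          using that e by (cases "\<omega> \<in> A") (auto simp: u_def A_def min_def)
      qed (use iu in auto)
      also have "\<dots> = e/2 + prob A" using iA A by (simp add: prob_space)
      finally show ?thesis using N[OF that] by (simp add: A_def)
    qed
    then show "\<exists>N. \<forall>n\<ge>N. norm ((\<integral>\<omega>. norm (u n \<omega>) \<partial>M) - 0) < e" by auto
  qed
  from tendsto_L1_AE_subseq[OF iu this] obtain r where r: "strict_mono r" "AE \<omega> in M. (\<lambda>n. u (r n) \<omega>) \<longlonglongrightarrow> 0"
    by auto
  have "AE \<omega> in M. (\<lambda>n. X (r n) \<omega>) \<longlonglongrightarrow> Y \<omega>"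
    using r(2)
  proof eventually_elim
    case (elim \<omega>)
    have "eventually (\<lambda>n. u (r n) \<omega> < 1) sequentially" using order_tendstoD(2)[OF elim, of 1] by simp
    then have "eventually (\<lambda>n. u (r n) \<omega> = \<bar>X (r n) \<omega> - Y \<omega>\<bar>) sequentially"
      by eventually_elim (auto simp: u_def)
    with elim have "(\<lambda>n. \<bar>X (r n) \<omega> - Y \<omega>\<bar>) \<longlonglongrightarrow> 0" by (rule Lim_transform_eventually)
    then show ?case using LIM_zero_cancel tendsto_rabs_zero_iff by blast
  qed
  with r(1) that show thesis by blast
qed

end

section \<open>The Ito integral of a continuous process\<close>

lemma ennreal_square_add_le: "ennreal ((a - c)\<^sup>2) \<le> 2 * ennreal ((a - b)\<^sup>2) + 2 * ennreal ((c - b)\<^sup>2)" for a b c :: real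
proof -
  have "(a - c)\<^sup>2 \<le> 2 * (a - b)\<^sup>2 + 2 * (c - b)\<^sup>2"
    using zero_le_power2[of "(a - b) + (c - b)"] by (simp add: power2_eq_square algebra_simps)
  then have "ennreal ((a - c)\<^sup>2) \<le> ennreal (2 * (a - b)\<^sup>2 + 2 * (c - b)\<^sup>2)" by (rule ennreal_leI)
  then show ?thesis by (simp add: ennreal_mult)
qed

lemma nn_integral_square_triangle:
  assumes [measurable]: "f \<in> borel_measurable N" "g \<in> borel_measurable N" "h \<in> borel_measurable N" "A \<in> sets N"
  shows "(\<integral>\<^sup>+s\<in>A. ennreal ((f s - h s)\<^sup>2) \<partial>N) \<le> 2 * (\<integral>\<^sup>+s\<in>A. ennreal ((f s - g s)\<^sup>2) \<partial>N) + 2 * (\<integral>\<^sup>+s\<in>A. ennreal ((h s - g s)\<^sup>2) \<partial>N)"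
proof -
  have "(\<integral>\<^sup>+s\<in>A. ennreal ((f s - h s)\<^sup>2) \<partial>N) \<le> (\<integral>\<^sup>+s. 2 * (ennreal ((f s - g s)\<^sup>2) * indicator A s) + 2 * (ennreal ((h s - g s)\<^sup>2) * indicator A s) \<partial>N)"
    by (rule nn_integral_mono) (use ennreal_square_add_le in \<open>auto simp: indicator_def\<close>)
  also have "\<dots> = 2 * (\<integral>\<^sup>+s\<in>A. ennreal ((f s - g s)\<^sup>2) \<partial>N) + 2 * (\<integral>\<^sup>+s\<in>A. ennreal ((h s - g s)\<^sup>2) \<partial>N)"
    by (subst nn_integral_add) (auto simp: nn_integral_cmult)
  finally show ?thesis .
qed

context brownian_motion begin

lemma elementary_process_measurable [measurable]:
  "(\<lambda>s. elementary_process n \<tau> H s \<omega>) \<in> borel_measurable borel"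
  unfolding elementary_process_def by measurable

lemma step_process_measurable:
  assumes "step_integrand T n \<tau> H"
  shows "case_prod (elementary_process n \<tau> H) \<in> borel_measurable (borel \<Otimes>\<^sub>M M)"
  unfolding elementary_process_def split_beta'
proof (rule borel_measurable_sum)
  fix i assume "i \<in> {..<n}"
  then have [measurable]: "H i \<in> borel_measurable M" using assms measurable_F_M by (auto simp: step_integrand_def)
  show "(\<lambda>x. H i (snd x) * indicator {\<tau> i<..\<tau> (Suc i)} (fst x)) \<in> borel_measurable (borel \<Otimes>\<^sub>M M)"
    by measurable
qed

lemma ito_integral_measurable:
  "ito_integral M F W T Z Y \<Longrightarrow> t \<in> {0..T} \<Longrightarrow> Y t \<in> borel_measurable (F t)"
  by (auto simp: ito_integral_def continuous_adapted_def)

text \<open>The step process is compared with the approximating sequence that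
  \<open>ito_integral\<close> supplies: Lenglart's estimate applies to the difference, and the index
  of that sequence tends to infinity. \<open>Z0\<close> is the integrand as given, \<open>Z\<close>
  a jointly measurable version of it, so that the distance to the step process is a random
  variable.\<close>

lemma ito_integral_lenglart:
  assumes ito: "ito_integral M F W T Z0 Y" and Z: "AE \<omega> in M. \<forall>s\<in>{0..T}. Z0 s \<omega> = Z s \<omega>"
    and [measurable]: "case_prod Z \<in> borel_measurable (borel \<Otimes>\<^sub>M M)"
    and S: "step_integrand T n \<tau> H"
    and t: "t \<in> {0..T}" and \<delta>: "\<delta> > 0" and \<epsilon>: "\<epsilon> > 0"
  shows "prob {\<omega>\<in>space M. 2 * \<epsilon> < \<bar>elementary_integral W n \<tau> H t \<omega> - Y t \<omega>\<bar>}
    \<le> prob {\<omega>\<in>space M. ennreal \<delta> < (\<integral>\<^sup>+s\<in>{0..T}. ennreal ((elementary_process n \<tau> H s \<omega> - Z s \<omega>)\<^sup>2) \<partial>lborel)} + 4 * \<delta> / \<epsilon>\<^sup>2"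
    (is "prob ?L \<le> prob ?G + _")
proof -
  have t0: "0 \<le> t" "0 \<le> T" using t by auto
  from ito obtain n' \<tau>' H' where el: "\<And>m. elementary_integrand M F T (n' m) (\<tau>' m) (H' m)"
    and n1: "null_in_probability M (\<lambda>m \<omega>. \<integral>\<^sup>+s\<in>{0..T}. ennreal ((elementary_process (n' m) (\<tau>' m) (H' m) s \<omega> - Z0 s \<omega>)\<^sup>2) \<partial>lborel)"
    and n2: "null_in_probability M (\<lambda>m \<omega>. ennreal \<bar>elementary_integral W (n' m) (\<tau>' m) (H' m) t \<omega> - Y t \<omega>\<bar>)"
    using t unfolding ito_integral_def by blast
  define D where "D = (\<lambda>m \<omega>. \<integral>\<^sup>+s\<in>{0..T}. ennreal ((elementary_process (n' m) (\<tau>' m) (H' m) s \<omega> - Z0 s \<omega>)\<^sup>2) \<partial>lborel)"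
  have D_meas: "D m \<in> borel_measurable M" for m using n1 by (simp add: null_in_probability_def D_def)
  have D_lim: "(\<lambda>m. prob {\<omega>\<in>space M. ennreal \<delta> < D m \<omega>}) \<longlonglongrightarrow> 0"
    using n1 \<delta> by (simp add: null_in_probability_def D_def)
  define E where "E = (\<lambda>m \<omega>. ennreal \<bar>elementary_integral W (n' m) (\<tau>' m) (H' m) t \<omega> - Y t \<omega>\<bar>)"
  have E_meas: "E m \<in> borel_measurable M" for m using n2 by (simp add: null_in_probability_def E_def)
  have E_lim: "(\<lambda>m. prob {\<omega>\<in>space M. ennreal \<epsilon> < E m \<omega>}) \<longlonglongrightarrow> 0"
    using n2 \<epsilon> by (simp add: null_in_probability_def E_def)
  note [measurable] = step_process_measurable[OF S] D_meas E_meas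
  have G_meas: "?G \<in> events" by measurable
  have bound: "prob ?L \<le> prob ?G + 4 * \<delta> / \<epsilon>\<^sup>2 + (prob {\<omega>\<in>space M. ennreal \<delta> < D m \<omega>} + prob {\<omega>\<in>space M. ennreal \<epsilon> < E m \<omega>})" for m
  proof -
    have S2: "step_integrand T (n' m) (\<tau>' m) (H' m)" using el elementary_integrand_step by blast
    obtain l p K where K: "step_integrand T l p K" and p: "\<And>i. i < l \<Longrightarrow> p i < p (Suc i)"
      and eq: "\<And>\<omega> h. stieltjes_sum l p (\<lambda>i. K i \<omega>) h
       = stieltjes_sum n \<tau> (\<lambda>i. H i \<omega>) h - stieltjes_sum (n' m) (\<tau>' m) (\<lambda>i. H' m i \<omega>) h"
      using step_integrand_diff[OF S S2] by metis
    have eqI: "elementary_integral W l p K t \<omega> = elementary_integral W n \<tau> H t \<omega> - elementary_integral W (n' m) (\<tau>' m) (H' m) t \<omega>" for \<omega>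
      unfolding elementary_integral_stieltjes by (rule eq)
    have eqP: "elementary_process l p K s \<omega> = elementary_process n \<tau> H s \<omega> - elementary_process (n' m) (\<tau>' m) (H' m) s \<omega>" for s \<omega>
      using eq S S2 p by (simp add: elementary_process_stieltjes step_integrand_def less_imp_le)
    let ?Q = "\<lambda>\<omega>. \<Sum>i<l. (K i \<omega>)\<^sup>2 * (p (Suc i) - p i)"
    have Q: "(\<integral>\<^sup>+s\<in>{0..T}. ennreal ((elementary_process l p K s \<omega>)\<^sup>2) \<partial>lborel) = ennreal (?Q \<omega>)" for \<omega>
    proof -
      have "p i \<le> T" if "i \<le> l" for i using step_integrand_bounds(2)[OF K that] .
      then have "?Q \<omega> = (\<Sum>i<l. (K i \<omega>)\<^sup>2 * (min (p (Suc i)) T - min (p i) T))"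
        by (intro sum.cong refl) (simp add: min_absorb1 less_imp_le)
      then show ?thesis using elementary_process_sq_integral[OF K, of T \<omega>] t by simp
    qed
    have KM: "K i \<in> borel_measurable M" if "i < l" for i
      using K that measurable_F_M by (auto simp: step_integrand_def)
    have Q_meas: "?Q \<in> borel_measurable M" by (rule borel_measurable_sum) (use KM in auto)
    have IM: "elementary_integral W l p K t \<in> borel_measurable M"
      using step_integral_measurable[OF K t0(1)] measurable_F_M by blast
    let ?I = "{\<omega>\<in>space M. \<epsilon> < \<bar>elementary_integral W l p K t \<omega>\<bar>}"
    let ?D = "{\<omega>\<in>space M. ennreal \<delta> < D m \<omega>}" and ?E = "{\<omega>\<in>space M. ennreal \<epsilon> < E m \<omega>}"
    have mI: "?I \<in> events" using IM by measurable
    have mD: "?D \<in> events" and mE: "?E \<in> events" by measurable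
    \<comment> \<open>If both step processes are within \<open>\<delta>\<close> of \<open>Z\<close>
      in squared distance, their own squared distance is at most
      \<open>2 * \<delta> + 2 * \<delta>\<close>; this is the origin of the 4.\<close>
    have "prob {\<omega>\<in>space M. 4 * \<delta> < ?Q \<omega>} \<le> prob (?G \<union> ?D)"
    proof (rule finite_measure_mono_AE)
      show "AE \<omega> in M. \<omega> \<in> {\<omega>\<in>space M. 4 * \<delta> < ?Q \<omega>} \<longrightarrow> \<omega> \<in> ?G \<union> ?D"
        using Z AE_space
      proof eventually_elim
        case (elim \<omega>)
        have zm: "(\<lambda>s. Z s \<omega>) \<in> borel_measurable lborel" using elim(2) by measurable
        have D': "D m \<omega> = (\<integral>\<^sup>+s\<in>{0..T}. ennreal ((elementary_process (n' m) (\<tau>' m) (H' m) s \<omega> - Z s \<omega>)\<^sup>2) \<partial>lborel)"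
          unfolding D_def using elim(1) by (intro nn_integral_cong) (auto simp: indicator_def)
        let ?g = "\<integral>\<^sup>+s\<in>{0..T}. ennreal ((elementary_process n \<tau> H s \<omega> - Z s \<omega>)\<^sup>2) \<partial>lborel"
        have "ennreal (?Q \<omega>) \<le> 2 * ?g + 2 * D m \<omega>"
          unfolding Q[symmetric] eqP D' by (rule nn_integral_square_triangle) (use zm in auto)
        moreover have "2 * ?g + 2 * D m \<omega> \<le> ennreal (4 * \<delta>)" if "\<not> ennreal \<delta> < ?g" "\<not> ennreal \<delta> < D m \<omega>"
        proof -
          have "2 * ?g + 2 * D m \<omega> \<le> 2 * ennreal \<delta> + 2 * ennreal \<delta>"
            using that by (intro add_mono mult_left_mono) auto
          also have "\<dots> = ennreal (4 * \<delta>)" using \<delta>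
            by (simp flip: ennreal_plus ennreal_numeral ennreal_mult)
          finally show ?thesis .
        qed
        moreover have "\<not> ennreal (?Q \<omega>) \<le> ennreal (4 * \<delta>)" if "4 * \<delta> < ?Q \<omega>"
          using that \<delta> by (simp add: ennreal_le_iff2)
        ultimately show ?case using elim(2) order_trans by blast
      qed
    qed (use G_meas mD in auto)
    also have "\<dots> \<le> prob ?G + prob ?D" using measure_Un_le[OF G_meas mD] .
    finally have 1: "prob {\<omega>\<in>space M. 4 * \<delta> < ?Q \<omega>} \<le> prob ?G + prob ?D" .
    have 2: "prob ?I \<le> prob {\<omega>\<in>space M. 4 * \<delta> < ?Q \<omega>} + 4 * \<delta> / \<epsilon>\<^sup>2"
      using step_integral_lenglart[OF K p t _ \<epsilon>, of "4 * \<delta>"] \<delta> by simp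
    have "prob ?L \<le> prob (?I \<union> ?E)"
    proof (rule finite_measure_mono)
      show "?L \<subseteq> ?I \<union> ?E"
      proof safe
        fix \<omega> assume \<omega>: "\<omega> \<in> space M" "2 * \<epsilon> < \<bar>elementary_integral W n \<tau> H t \<omega> - Y t \<omega>\<bar>" "\<not> ennreal \<epsilon> < E m \<omega>"
        then have "\<bar>elementary_integral W (n' m) (\<tau>' m) (H' m) t \<omega> - Y t \<omega>\<bar> \<le> \<epsilon>"
          using \<epsilon> by (simp add: E_def not_less)
        then show "\<epsilon> < \<bar>elementary_integral W l p K t \<omega>\<bar>" using \<omega>(2) unfolding eqI by linarith
      qed
    qed (use mI mE in auto)
    also have "\<dots> \<le> prob ?I + prob ?E" using measure_Un_le[OF mI mE] .
    finally show ?thesis using 1 2 by linarith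
  qed
  \<comment> \<open>The left-hand side of \<open>bound\<close> is free of \<open>m\<close>, so the
    two error probabilities disappear in the limit.\<close>
  have "(\<lambda>m. prob ?G + 4 * \<delta> / \<epsilon>\<^sup>2 + (prob {\<omega>\<in>space M. ennreal \<delta> < D m \<omega>} + prob {\<omega>\<in>space M. ennreal \<epsilon> < E m \<omega>}))
     \<longlonglongrightarrow> prob ?G + 4 * \<delta> / \<epsilon>\<^sup>2 + (0 + 0)"
    by (intro tendsto_intros D_lim E_lim)
  from LIMSEQ_le_const[OF this, of "prob ?L"] bound show ?thesis by auto
qed

text \<open>The integral does not depend on the approximating sequence. This frees the later
  arguments from the sequence hidden in the definition.\<close>

lemma ito_integral_in_prob:
  assumes ito: "ito_integral M F W T Z0 Y" and Z: "AE \<omega> in M. \<forall>s\<in>{0..T}. Z0 s \<omega> = Z s \<omega>"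
    and Zm: "case_prod Z \<in> borel_measurable (borel \<Otimes>\<^sub>M M)"
    and S: "\<And>k. step_integrand T (n k) (\<tau> k) (H k)"
    and lim: "\<And>\<delta>. \<delta> > 0 \<Longrightarrow> (\<lambda>k. prob {\<omega>\<in>space M. ennreal \<delta> <
        (\<integral>\<^sup>+s\<in>{0..T}. ennreal ((elementary_process (n k) (\<tau> k) (H k) s \<omega> - Z s \<omega>)\<^sup>2) \<partial>lborel)}) \<longlonglongrightarrow> 0"
    and t: "t \<in> {0..T}" and \<epsilon>: "\<epsilon> > 0"
  shows "(\<lambda>k. prob {\<omega>\<in>space M. \<epsilon> < \<bar>elementary_integral W (n k) (\<tau> k) (H k) t \<omega> - Y t \<omega>\<bar>}) \<longlonglongrightarrow> 0"
proof (rule LIMSEQ_I)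
  fix e :: real assume e: "0 < e"
  \<comment> \<open>Solves \<open>4 * \<delta> / (\<epsilon>/2)\<^sup>2 = e / 2\<close>, the last
    term of the Lenglart bound with \<open>\<epsilon>/2\<close> in place of
    \<open>\<epsilon>\<close>.\<close>
  define \<delta> where "\<delta> = e * (\<epsilon>/2)\<^sup>2 / 8"
  have \<delta>: "\<delta> > 0" "4 * \<delta> / (\<epsilon>/2)\<^sup>2 = e / 2" using e \<epsilon> by (auto simp: \<delta>_def)
  let ?G = "\<lambda>k. {\<omega>\<in>space M. ennreal \<delta> <
        (\<integral>\<^sup>+s\<in>{0..T}. ennreal ((elementary_process (n k) (\<tau> k) (H k) s \<omega> - Z s \<omega>)\<^sup>2) \<partial>lborel)}"
  obtain N where N: "\<And>k. k \<ge> N \<Longrightarrow> prob (?G k) < e / 2"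
    using LIMSEQ_D[OF lim[OF \<delta>(1)], of "e/2"] e by auto
  have "prob {\<omega>\<in>space M. \<epsilon> < \<bar>elementary_integral W (n k) (\<tau> k) (H k) t \<omega> - Y t \<omega>\<bar>} < e" if "k \<ge> N" for k
    using ito_integral_lenglart[OF ito Z Zm S t \<delta>(1), of "\<epsilon>/2" k] N[OF that] \<epsilon> \<delta>(2) by simp
  then show "\<exists>N. \<forall>k\<ge>N. norm (prob {\<omega>\<in>space M. \<epsilon> < \<bar>elementary_integral W (n k) (\<tau> k) (H k) t \<omega> - Y t \<omega>\<bar>} - 0) < e"
    by auto
qed

end

section \<open>Riemann sums on uniform grids\<close>

definition uniform_grid :: "real \<Rightarrow> nat \<Rightarrow> nat \<Rightarrow> real" where
  "uniform_grid T n i = real i * T / real (Suc n)"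

text \<open>The value at the left end point of a cell is known when the cell begins, so Riemann sums
  of adapted processes are step integrands. Taking \<open>Suc n\<close> cells makes every index
  \<open>n\<close> admissible.\<close>

definition riemann_process :: "real \<Rightarrow> (real \<Rightarrow> 'w \<Rightarrow> real) \<Rightarrow> nat \<Rightarrow> real \<Rightarrow> 'w \<Rightarrow> real" where
  "riemann_process T G n = elementary_process (Suc n) (uniform_grid T n) (\<lambda>i. G (uniform_grid T n i))"

lemma uniform_grid_bounds:
  assumes "0 < T" "i \<le> Suc n" shows "uniform_grid T n i \<in> {0..T}"
proof -
  have "real i * T \<le> real (Suc n) * T" using assms by (intro mult_right_mono) auto
  then show ?thesis using assms by (simp add: uniform_grid_def divide_le_eq mult.commute)
qed

lemma uniform_grid_mono: "0 < T \<Longrightarrow> uniform_grid T n i < uniform_grid T n (Suc i)"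
  by (simp add: uniform_grid_def divide_strict_right_mono)

lemma uniform_grid_cell:
  assumes T: "0 < T" and s: "s \<in> {0<..T}"
  obtains i where "i < Suc n" "uniform_grid T n i < s" "s \<le> uniform_grid T n (Suc i)"
    "s - uniform_grid T n i \<le> T / real (Suc n)"
proof -
  define x where "x = s * real (Suc n) / T"
  have x: "0 < x" "x \<le> real (Suc n)"
    using assms by (auto simp: x_def divide_le_eq mult.commute intro!: mult_right_mono)
  \<comment> \<open>The cells are open on the left and closed on the right, hence the ceiling minus
    one and not the floor.\<close>
  define i where "i = nat (\<lceil>x\<rceil> - 1)"
  have c: "1 \<le> \<lceil>x\<rceil>" "\<lceil>x\<rceil> \<le> int (Suc n)" using x by (simp_all add: ceiling_le_iff)
  have ri: "real i = of_int \<lceil>x\<rceil> - 1" using c by (simp add: i_def)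
  have 1: "real i < x" "x \<le> real i + 1" unfolding ri by linarith+
  have e: "s = x * T / real (Suc n)" using T by (simp add: x_def del: of_nat_Suc)
  show thesis
  proof
    show "i < Suc n" using c by (simp add: i_def)
    show a: "uniform_grid T n i < s" unfolding uniform_grid_def e using 1 T
      by (intro divide_strict_right_mono mult_strict_right_mono) auto
    show b: "s \<le> uniform_grid T n (Suc i)"unfolding uniform_grid_def e using 1 T
      by (intro divide_right_mono mult_right_mono) auto
    have "uniform_grid T n (Suc i) - uniform_grid T n i = T / real (Suc n)"
      by (simp add: uniform_grid_def diff_divide_distrib[symmetric] left_diff_distrib[symmetric])
    then show "s - uniform_grid T n i \<le> T / real (Suc n)" using b by linarith
  qed
qed

lemma riemann_process_cell:
  assumes "0 < T" "i < Suc n" "uniform_grid T n i < s" "s \<le> uniform_grid T n (Suc i)"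
  shows "riemann_process T G n s \<omega> = G (uniform_grid T n i) \<omega>"
  unfolding riemann_process_def
  by (rule elementary_process_eq)
    (use assms(2-4) uniform_grid_mono[OF assms(1), of n, THEN less_imp_le] in simp_all)

lemma riemann_process_bound:
  assumes "0 < T" "\<And>r. r \<in> {0..T} \<Longrightarrow> \<bar>G r \<omega>\<bar> \<le> C" "s \<in> {0<..T}"
  shows "\<bar>riemann_process T G n s \<omega>\<bar> \<le> C"
proof -
  from uniform_grid_cell[OF assms(1,3), of n] obtain i where i: "i < Suc n" "uniform_grid T n i < s" "s \<le> uniform_grid T n (Suc i)" .
  then show ?thesis
    using riemann_process_cell[OF assms(1) i, of G \<omega>] assms(2)[OF uniform_grid_bounds[OF assms(1), of i n]] by simp
qed

text \<open>The sampled time lies strictly to the left of \<open>s\<close>, at most one cell length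
  away, so only the left limit of the path matters. This admits integrands that are merely
  left-continuous, such as a continuous process cut off when a decreasing event ends.\<close>

lemma riemann_process_tendsto:
  assumes T: "0 < T" and s: "s \<in> {0<..T}" and G: "((\<lambda>r. G r \<omega>) \<longlongrightarrow> G s \<omega>) (at_left s)"
  shows "(\<lambda>n. riemann_process T G n s \<omega>) \<longlonglongrightarrow> G s \<omega>"
proof -
  have "\<exists>r. r < s \<and> s - r \<le> T / real (Suc n) \<and> riemann_process T G n s \<omega> = G r \<omega>" for n
  proof -
    from uniform_grid_cell[OF T s, of n] obtain i where
      i: "i < Suc n" "uniform_grid T n i < s" "s \<le> uniform_grid T n (Suc i)"
      and "s - uniform_grid T n i \<le> T / real (Suc n)" .
    then show ?thesis
      using riemann_process_cell[OF T i, of G \<omega>] by (intro exI[of _ "uniform_grid T n i"]) auto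
  qed
  then have "\<forall>n. \<exists>r. r < s \<and> s - r \<le> T / real (Suc n) \<and> riemann_process T G n s \<omega> = G r \<omega>" ..
  from choice[OF this] obtain \<kappa> where \<kappa>: "\<And>n. \<kappa> n < s" "\<And>n. s - \<kappa> n \<le> T / real (Suc n)"
    "\<And>n. riemann_process T G n s \<omega> = G (\<kappa> n) \<omega>" by blast
  have 0: "(\<lambda>n. T / real (Suc n)) \<longlonglongrightarrow> 0"
    using tendsto_mult[OF tendsto_const[of T] LIMSEQ_inverse_real_of_nat] by (simp add: divide_inverse)
  have "(\<lambda>n. s - \<kappa> n) \<longlonglongrightarrow> 0"
  proof (rule tendsto_sandwich[OF _ _ tendsto_const 0])
    show "eventually (\<lambda>n. 0 \<le> s - \<kappa> n) sequentially"
      using \<kappa>(1) by (intro always_eventually allI) (simp add: less_imp_le)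
    show "eventually (\<lambda>n. s - \<kappa> n \<le> T / real (Suc n)) sequentially"
      using \<kappa>(2) by (intro always_eventually allI)
  qed
  from tendsto_diff[OF tendsto_const[of s] this] have "\<kappa> \<longlonglongrightarrow> s" by simp
  then have "filterlim \<kappa> (at_left s) sequentially"
    unfolding filterlim_at using \<kappa>(1) by (simp add: less_imp_neq)
  from filterlim_compose[OF G this] show ?thesis using \<kappa>(3) by simp
qed

text \<open>The assumptions leave out \<open>s = 0\<close>, where the Riemann processes vanish
  whatever the integrand; this single time has measure zero.\<close>

lemma nn_integral_square_dist_tendsto_0:
  fixes f :: "nat \<Rightarrow> real \<Rightarrow> real"
  assumes [measurable]: "\<And>n. (\<lambda>s. f n s) \<in> borel_measurable borel" "g \<in> borel_measurable borel"
    and f: "\<And>n s. s \<in> {0<..T} \<Longrightarrow> \<bar>f n s\<bar> \<le> C" and g: "\<And>s. s \<in> {0<..T} \<Longrightarrow> \<bar>g s\<bar> \<le> C"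
    and lim: "\<And>s. s \<in> {0<..T} \<Longrightarrow> (\<lambda>n. f n s) \<longlonglongrightarrow> g s"
  shows "(\<lambda>n. \<integral>\<^sup>+s\<in>{0..T}. ennreal ((f n s - g s)\<^sup>2) \<partial>lborel) \<longlonglongrightarrow> 0"
proof -
  have "(\<lambda>n. \<integral>\<^sup>+s\<in>{0..T}. ennreal ((f n s - g s)\<^sup>2) \<partial>lborel) \<longlonglongrightarrow> (\<integral>\<^sup>+s. 0 \<partial>(lborel :: real measure))"
  proof (rule nn_integral_dominated_convergence[where w="\<lambda>s. ennreal ((2 * C)\<^sup>2) * indicator {0..T} s"])
    have "AE s in lborel. s \<noteq> (0::real)" by (rule AE_lborel_singleton)
    then show "AE s in lborel. ennreal ((f n s - g s)\<^sup>2) * indicator {0..T} s \<le> ennreal ((2 * C)\<^sup>2) * indicator {0..T} s" for n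
    proof eventually_elim
      case (elim s)
      show ?case
      proof (cases "s \<in> {0<..T}")
        case True
        have "\<bar>f n s - g s\<bar> ^ 2 \<le> (2 * C)\<^sup>2" using f[OF True, of n] g[OF True] by (intro power_mono) auto
        then show ?thesis using True by (simp add: ennreal_leI)
      qed (use elim in \<open>auto simp: indicator_def\<close>)
    qed
    show "(\<integral>\<^sup>+s\<in>{0..T}. ennreal ((2 * C)\<^sup>2) \<partial>lborel) < \<infinity>"
      by (subst nn_integral_cmult_indicator) (auto simp: ennreal_mult_less_top emeasure_lborel_Icc_eq)
    have "AE s in lborel. s \<noteq> (0::real)" by (rule AE_lborel_singleton)
    then show "AE s in lborel. (\<lambda>n. ennreal ((f n s - g s)\<^sup>2) * indicator {0..T} s) \<longlonglongrightarrow> 0"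
    proof eventually_elim
      case (elim s)
      show ?case
      proof (cases "s \<in> {0<..T}")
        case True
        have "(\<lambda>n. (f n s - g s)\<^sup>2) \<longlonglongrightarrow> (g s - g s)\<^sup>2" by (intro tendsto_intros lim True)
        then have "(\<lambda>n. ennreal ((f n s - g s)\<^sup>2)) \<longlonglongrightarrow> ennreal ((g s - g s)\<^sup>2)" by (rule tendsto_ennrealI)
        then show ?thesis using True by simp
      qed (use elim in \<open>auto simp: indicator_def\<close>)
    qed
  qed auto
  then show ?thesis by simp
qed

section \<open>Mean-square distance of processes\<close>

context brownian_motion begin

lemma riemann_step:
  assumes "0 < T" "\<And>s. s \<in> {0..T} \<Longrightarrow> G s \<in> borel_measurable (F s)"
  shows "step_integrand T (Suc n) (uniform_grid T n) (\<lambda>i. G (uniform_grid T n i))"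
  unfolding step_integrand_def
  using uniform_grid_bounds[OF assms(1), of _ n] uniform_grid_mono[OF assms(1), of n] assms(2)
  by (auto intro: less_imp_le)

text \<open>The squared distance in \<open>L2\<close> over \<open>[0,T]\<close> times the sample
  space, taken in the extended reals so that no integrability has to be shown beforehand. Being a
  square, it satisfies the triangle inequality only with factors 2.\<close>

definition process_distance :: "real \<Rightarrow> (real \<Rightarrow> 'w \<Rightarrow> real) \<Rightarrow> (real \<Rightarrow> 'w \<Rightarrow> real) \<Rightarrow> ennreal" where
  "process_distance T G H = (\<integral>\<^sup>+\<omega>. (\<integral>\<^sup>+s\<in>{0..T}. ennreal ((G s \<omega> - H s \<omega>)\<^sup>2) \<partial>lborel) \<partial>M)"

lemma measurable_section:
  "case_prod G \<in> borel_measurable (borel \<Otimes>\<^sub>M M) \<Longrightarrow> \<omega> \<in> space M \<Longrightarrow> (\<lambda>s. G s \<omega>) \<in> borel_measurable borel"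
  using measurable_compose[OF measurable_Pair2'[of \<omega> M borel], of "case_prod G" borel] by simp

lemma process_distance_triangle:
  assumes [measurable]: "case_prod G \<in> borel_measurable (borel \<Otimes>\<^sub>M M)" "case_prod H \<in> borel_measurable (borel \<Otimes>\<^sub>M M)"
    "case_prod K \<in> borel_measurable (borel \<Otimes>\<^sub>M M)"
  shows "process_distance T G K \<le> 2 * process_distance T G H + 2 * process_distance T K H"
proof -
  have "process_distance T G K \<le> (\<integral>\<^sup>+\<omega>. 2 * (\<integral>\<^sup>+s\<in>{0..T}. ennreal ((G s \<omega> - H s \<omega>)\<^sup>2) \<partial>lborel) + 2 * (\<integral>\<^sup>+s\<in>{0..T}. ennreal ((K s \<omega> - H s \<omega>)\<^sup>2) \<partial>lborel) \<partial>M)"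
    unfolding process_distance_def
    by (rule nn_integral_mono, rule nn_integral_square_triangle) (auto intro: measurable_section assms)
  also have "\<dots> = 2 * process_distance T G H + 2 * process_distance T K H"
    unfolding process_distance_def by (subst nn_integral_add) (auto simp: nn_integral_cmult)
  finally show ?thesis .
qed

text \<open>For a bounded integrand dominated convergence applies twice, in time for each path and
  then over the sample space.\<close>

lemma riemann_distance_tendsto_0:
  assumes T: "0 < T" and F: "\<And>s. s \<in> {0..T} \<Longrightarrow> G s \<in> borel_measurable (F s)"
    and Gm[measurable]: "case_prod G \<in> borel_measurable (borel \<Otimes>\<^sub>M M)"
    and C: "\<And>s \<omega>. s \<in> {0..T} \<Longrightarrow> \<omega> \<in> space M \<Longrightarrow> \<bar>G s \<omega>\<bar> \<le> C"
    and left: "\<And>s \<omega>. s \<in> {0<..T} \<Longrightarrow> \<omega> \<in> space M \<Longrightarrow> ((\<lambda>r. G r \<omega>) \<longlongrightarrow> G s \<omega>) (at_left s)"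
  shows "(\<lambda>n. process_distance T (riemann_process T G n) G) \<longlonglongrightarrow> 0"
proof -
  have [measurable]: "case_prod (riemann_process T G n) \<in> borel_measurable (borel \<Otimes>\<^sub>M M)" for n
    unfolding riemann_process_def by (rule step_process_measurable[OF riemann_step[OF T F]])
  have "(\<lambda>n. process_distance T (riemann_process T G n) G) \<longlonglongrightarrow> (\<integral>\<^sup>+\<omega>. 0 \<partial>M)"
    unfolding process_distance_def
  proof (rule nn_integral_dominated_convergence[where w="\<lambda>_. ennreal ((2 * C)\<^sup>2) * ennreal T"])
    show "AE \<omega> in M. (\<integral>\<^sup>+s\<in>{0..T}. ennreal ((riemann_process T G n s \<omega> - G s \<omega>)\<^sup>2) \<partial>lborel) \<le> ennreal ((2 * C)\<^sup>2) * ennreal T" for n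
    proof (rule AE_I2)
      fix \<omega> assume \<omega>: "\<omega> \<in> space M"
      have "AE s in lborel. s \<noteq> (0::real)" by (rule AE_lborel_singleton)
      then have "(\<integral>\<^sup>+s\<in>{0..T}. ennreal ((riemann_process T G n s \<omega> - G s \<omega>)\<^sup>2) \<partial>lborel) \<le> (\<integral>\<^sup>+s\<in>{0..T}. ennreal ((2 * C)\<^sup>2) \<partial>lborel)"
      proof (intro nn_integral_mono_AE, eventually_elim)
        case (elim s)
        show ?case
        proof (cases "s \<in> {0<..T}")
          case True
          have "\<bar>riemann_process T G n s \<omega> - G s \<omega>\<bar> ^ 2 \<le> (2 * C)\<^sup>2"
          proof (rule power_mono)
            have "\<bar>riemann_process T G n s \<omega>\<bar> \<le> C" using riemann_process_bound[OF T _ True, of G \<omega> C n] C \<omega> by blast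
            moreover have "\<bar>G s \<omega>\<bar> \<le> C" using C[of s \<omega>] True \<omega> by simp
            ultimately show "\<bar>riemann_process T G n s \<omega> - G s \<omega>\<bar> \<le> 2 * C" by linarith
          qed simp
          then show ?thesis using True by (simp add: ennreal_leI)
        qed (use elim in \<open>auto simp: indicator_def\<close>)
      qed
      also have "\<dots> = ennreal ((2 * C)\<^sup>2) * ennreal T" using T by (subst nn_integral_cmult_indicator) auto
      finally show "(\<integral>\<^sup>+s\<in>{0..T}. ennreal ((riemann_process T G n s \<omega> - G s \<omega>)\<^sup>2) \<partial>lborel) \<le> ennreal ((2 * C)\<^sup>2) * ennreal T" .
    qed
    show "AE \<omega> in M. (\<lambda>n. \<integral>\<^sup>+s\<in>{0..T}. ennreal ((riemann_process T G n s \<omega> - G s \<omega>)\<^sup>2) \<partial>lborel) \<longlonglongrightarrow> 0"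
    proof (rule AE_I2, rule nn_integral_square_dist_tendsto_0[where C=C])
      fix \<omega> n s assume \<omega>: "\<omega> \<in> space M"
      show "(\<lambda>s. G s \<omega>) \<in> borel_measurable borel" using measurable_section[OF Gm \<omega>] .
      show "(\<lambda>s. riemann_process T G n s \<omega>) \<in> borel_measurable borel" unfolding riemann_process_def by measurable
      assume s: "s \<in> {0<..T}"
      show "\<bar>riemann_process T G n s \<omega>\<bar> \<le> C" using riemann_process_bound[OF T _ s, of G] C \<omega> by blast
      show "\<bar>G s \<omega>\<bar> \<le> C" using C s \<omega> by auto
      show "(\<lambda>n. riemann_process T G n s \<omega>) \<longlonglongrightarrow> G s \<omega>" using riemann_process_tendsto[of T s G \<omega>, OF T s left[OF s \<omega>]] .
    qed
  qed (auto simp: ennreal_mult_less_top emeasure_space_1)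
  then show ?thesis by simp
qed

lemma step_isometry_nn:
  assumes S: "step_integrand T n \<tau> H" and sq: "\<forall>i<n. sq_int (H i)" and t: "t \<in> {0..T}"
  shows "(\<integral>\<^sup>+\<omega>. ennreal ((elementary_integral W n \<tau> H t \<omega>)\<^sup>2) \<partial>M) = process_distance t (elementary_process n \<tau> H) (\<lambda>_ _. 0)"
proof -
  have t0: "0 \<le> t" using t by simp
  have "(\<integral>\<^sup>+\<omega>. ennreal ((elementary_integral W n \<tau> H t \<omega>)\<^sup>2) \<partial>M) = ennreal (\<Sum>i<n. (\<integral>\<omega>. (H i \<omega>)\<^sup>2 \<partial>M) * (min (\<tau> (Suc i)) t - min (\<tau> i) t))"
    using step_integral_isometry[OF S sq t0] by (subst nn_integral_eq_integral) (auto simp: sq_int_def)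
  also have "\<dots> = ennreal (\<integral>\<omega>. (\<Sum>i<n. (H i \<omega>)\<^sup>2 * (min (\<tau> (Suc i)) t - min (\<tau> i) t)) \<partial>M)"
    using sq by (subst Bochner_Integration.integral_sum) (auto simp: sq_int_def)
  also have "\<dots> = (\<integral>\<^sup>+\<omega>. ennreal (\<Sum>i<n. (H i \<omega>)\<^sup>2 * (min (\<tau> (Suc i)) t - min (\<tau> i) t)) \<partial>M)"
  proof (rule nn_integral_eq_integral[symmetric])
    show "integrable M (\<lambda>\<omega>. \<Sum>i<n. (H i \<omega>)\<^sup>2 * (min (\<tau> (Suc i)) t - min (\<tau> i) t))"
      by (intro Bochner_Integration.integrable_sum integrable_mult_left sq_int_square) (use sq in auto)
    have "min (\<tau> i) t \<le> min (\<tau> (Suc i)) t" if "i < n" for i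
      using step_integrand_bounds(3)[OF S, of i] that by (intro min.mono) auto
    then show "AE \<omega> in M. 0 \<le> (\<Sum>i<n. (H i \<omega>)\<^sup>2 * (min (\<tau> (Suc i)) t - min (\<tau> i) t))"
      by (intro AE_I2 sum_nonneg mult_nonneg_nonneg) (simp_all add: diff_ge_0_iff_ge del: min.bounded_iff)
  qed
  also have "\<dots> = process_distance t (elementary_process n \<tau> H) (\<lambda>_ _. 0)"
    by (simp add: process_distance_def elementary_process_sq_integral[OF S t])
  finally show ?thesis .
qed

end

text \<open>Continuity of the norm in \<open>L2\<close>, through the pointwise bound
  \<open>\<bar>f\<^sup>2 - g\<^sup>2\<bar> \<le> \<eta> g\<^sup>2 + (1 + 1/\<eta>) (f -
  g)\<^sup>2\<close> with small \<open>\<eta>\<close>. Extended integrals allow finitely many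
  \<open>f n\<close> to fail square integrability.\<close>

lemma square_norm_tendsto:
  fixes f :: "nat \<Rightarrow> 'a \<Rightarrow> real" and g :: "'a \<Rightarrow> real"
  assumes [measurable]: "\<And>n. f n \<in> borel_measurable N" "g \<in> borel_measurable N"
    and g: "(\<integral>\<^sup>+x. ennreal ((g x)\<^sup>2) \<partial>N) < \<infinity>"
    and lim: "(\<lambda>n. \<integral>\<^sup>+x. ennreal ((f n x - g x)\<^sup>2) \<partial>N) \<longlonglongrightarrow> 0"
  shows "(\<lambda>n. \<integral>\<^sup>+x. ennreal ((f n x)\<^sup>2) \<partial>N) \<longlonglongrightarrow> (\<integral>\<^sup>+x. ennreal ((g x)\<^sup>2) \<partial>N)"
proof -
  define d where "d = (\<lambda>n. \<integral>x. (f n x - g x)\<^sup>2 \<partial>N)"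
  define b where "b = (\<integral>x. (g x)\<^sup>2 \<partial>N)"
  have ig: "integrable N (\<lambda>x. (g x)\<^sup>2)" using g by (intro integrableI_nonneg) auto
  have b0: "0 \<le> b" by (simp add: b_def)
  have "eventually (\<lambda>n. (\<integral>\<^sup>+x. ennreal ((f n x - g x)\<^sup>2) \<partial>N) < 1) sequentially"
    using order_tendstoD(2)[OF lim, of 1] by simp
  then have ev: "eventually (\<lambda>n. integrable N (\<lambda>x. (f n x - g x)\<^sup>2)) sequentially"
  proof eventually_elim
    case (elim n)
    then show ?case using less_trans[OF elim ennreal_one_less_top] by (intro integrableI_nonneg) auto
  qed
  have "(\<lambda>n. enn2real (\<integral>\<^sup>+x. ennreal ((f n x - g x)\<^sup>2) \<partial>N)) \<longlonglongrightarrow> 0"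
    by (rule tendsto_enn2real) (use lim in simp_all)
  then have d0: "d \<longlonglongrightarrow> 0" unfolding d_def by (simp add: integral_eq_nn_integral)
  have "(\<lambda>n. \<integral>x. (f n x)\<^sup>2 \<partial>N) \<longlonglongrightarrow> b"
  proof (rule LIMSEQ_I)
    fix e :: real assume e: "0 < e"
    \<comment> \<open>Chosen to make \<open>\<eta> * b < e / 2\<close>; the summand 1 covers
      \<open>b = 0\<close>.\<close>
    define \<eta> where "\<eta> = e / (2 * (b + 1))"
    have \<eta>: "0 < \<eta>" "\<eta> * b < e / 2" using e b0 by (auto simp: \<eta>_def field_simps)
    have "(\<lambda>n. (1 + 1 / \<eta>) * d n) \<longlonglongrightarrow> (1 + 1 / \<eta>) * 0" by (intro tendsto_intros d0)
    then have "eventually (\<lambda>n. (1 + 1 / \<eta>) * d n < e / 2) sequentially"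
      using e by (auto dest: order_tendstoD(2)[of _ _ _ "e/2"])
    with ev have "eventually (\<lambda>n. norm ((\<integral>x. (f n x)\<^sup>2 \<partial>N) - b) < e) sequentially"
    proof eventually_elim
      case (elim n)
      have pt: "\<bar>(f n x)\<^sup>2 - (g x)\<^sup>2\<bar> \<le> \<eta> * (g x)\<^sup>2 + (1 + 1 / \<eta>) * (f n x - g x)\<^sup>2" for x
      proof -
        define h where "h = f n x - g x"
        have fx: "f n x = g x + h" by (simp add: h_def)
        have am: "2 * (\<bar>g x\<bar> * \<bar>h\<bar>) \<le> \<eta> * (g x)\<^sup>2 + (1 / \<eta>) * h\<^sup>2"
        proof -
          have "0 \<le> (\<eta> * \<bar>g x\<bar> - \<bar>h\<bar>)\<^sup>2 / \<eta>" using \<eta> by simp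
          also have "\<dots> = \<eta> * (g x)\<^sup>2 + (1 / \<eta>) * h\<^sup>2 - 2 * (\<bar>g x\<bar> * \<bar>h\<bar>)"
            using \<eta> by (simp add: power2_diff power_mult_distrib field_simps power2_eq_square)
          finally show ?thesis by simp
        qed
        have "\<bar>(f n x)\<^sup>2 - (g x)\<^sup>2\<bar> = \<bar>h\<^sup>2 + 2 * (g x * h)\<bar>" unfolding fx by (simp add: power2_sum)
        also have "\<dots> \<le> h\<^sup>2 + 2 * (\<bar>g x\<bar> * \<bar>h\<bar>)" using abs_triangle_ineq[of "h\<^sup>2" "2 * (g x * h)"] by (simp add: abs_mult)
        also have "\<dots> \<le> \<eta> * (g x)\<^sup>2 + (1 + 1 / \<eta>) * h\<^sup>2" using am by (simp add: distrib_right)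
        finally show ?thesis by (simp add: h_def)
      qed
      have ifn: "integrable N (\<lambda>x. (f n x)\<^sup>2)"
      proof (rule Bochner_Integration.integrable_bound)
        show "integrable N (\<lambda>x. (g x)\<^sup>2 + (\<eta> * (g x)\<^sup>2 + (1 + 1 / \<eta>) * (f n x - g x)\<^sup>2))" using ig elim by auto
        show "AE x in N. norm ((f n x)\<^sup>2) \<le> norm ((g x)\<^sup>2 + (\<eta> * (g x)\<^sup>2 + (1 + 1 / \<eta>) * (f n x - g x)\<^sup>2))"
        proof (rule AE_I2)
          fix x
          have "(f n x)\<^sup>2 \<le> (g x)\<^sup>2 + (\<eta> * (g x)\<^sup>2 + (1 + 1 / \<eta>) * (f n x - g x)\<^sup>2)" using pt[of x] by linarith
          then show "norm ((f n x)\<^sup>2) \<le> norm ((g x)\<^sup>2 + (\<eta> * (g x)\<^sup>2 + (1 + 1 / \<eta>) * (f n x - g x)\<^sup>2))"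
            by (smt (verit) real_norm_def zero_le_power2)
        qed
      qed measurable
      have "norm ((\<integral>x. (f n x)\<^sup>2 \<partial>N) - b) = \<bar>\<integral>x. (f n x)\<^sup>2 - (g x)\<^sup>2 \<partial>N\<bar>"
        unfolding b_def using ifn ig by simp
      also have "\<dots> \<le> (\<integral>x. \<bar>(f n x)\<^sup>2 - (g x)\<^sup>2\<bar> \<partial>N)" by (rule integral_abs_bound)
      also have "\<dots> \<le> (\<integral>x. \<eta> * (g x)\<^sup>2 + (1 + 1 / \<eta>) * (f n x - g x)\<^sup>2 \<partial>N)"
        by (rule integral_mono) (use ifn ig elim pt in auto)
      also have "\<dots> = \<eta> * b + (1 + 1 / \<eta>) * d n"
        unfolding b_def d_def using ig elim by simp
      also have "\<dots> < e" using \<eta>(2) elim(2) by linarith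
      finally show ?case .
    qed
    then show "\<exists>no. \<forall>n\<ge>no. norm ((\<integral>x. (f n x)\<^sup>2 \<partial>N) - b) < e" by (simp add: eventually_sequentially)
  qed
  then have "(\<lambda>n. ennreal (\<integral>x. (f n x)\<^sup>2 \<partial>N)) \<longlonglongrightarrow> ennreal b" by (rule tendsto_ennrealI)
  moreover have "eventually (\<lambda>n. ennreal (\<integral>x. (f n x)\<^sup>2 \<partial>N) = (\<integral>\<^sup>+x. ennreal ((f n x)\<^sup>2) \<partial>N)) sequentially"
    using ev
  proof eventually_elim
    case (elim n)
    have "integrable N (\<lambda>x. (f n x)\<^sup>2)"
    proof (rule Bochner_Integration.integrable_bound)
      show "integrable N (\<lambda>x. 2 * (f n x - g x)\<^sup>2 + 2 * (g x)\<^sup>2)" using ig elim by auto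
      have "(f n x)\<^sup>2 \<le> 2 * (f n x - g x)\<^sup>2 + 2 * (g x)\<^sup>2" for x
        using zero_le_power2[of "f n x - 2 * g x"] by (simp add: power2_eq_square algebra_simps)
      then show "AE x in N. norm ((f n x)\<^sup>2) \<le> norm (2 * (f n x - g x)\<^sup>2 + 2 * (g x)\<^sup>2)" by simp
    qed measurable
    then show ?case by (simp add: nn_integral_eq_integral)
  qed
  ultimately have "(\<lambda>n. \<integral>\<^sup>+x. ennreal ((f n x)\<^sup>2) \<partial>N) \<longlonglongrightarrow> ennreal b"
    by (rule Lim_transform_eventually)
  then show ?thesis unfolding b_def using ig by (simp add: nn_integral_eq_integral)
qed

context brownian_motion begin

text \<open>Written over the product space, the distance is open to
  \<open>square_norm_tendsto\<close> and to dominated convergence.\<close>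

lemma process_distance_product:
  assumes [measurable]: "case_prod G \<in> borel_measurable (borel \<Otimes>\<^sub>M M)" "case_prod H \<in> borel_measurable (borel \<Otimes>\<^sub>M M)"
  shows "process_distance t G H = (\<integral>\<^sup>+x. ennreal ((indicator {0..t} (snd x) * G (snd x) (fst x) - indicator {0..t} (snd x) * H (snd x) (fst x))\<^sup>2) \<partial>(M \<Otimes>\<^sub>M lborel))"
proof -
  have "process_distance t G H = (\<integral>\<^sup>+\<omega>. (\<integral>\<^sup>+s. ennreal ((indicator {0..t} s * G s \<omega> - indicator {0..t} s * H s \<omega>)\<^sup>2) \<partial>lborel) \<partial>M)"
    unfolding process_distance_def
    by (intro nn_integral_cong) (auto simp: indicator_def)
  also have "\<dots> = (\<integral>\<^sup>+x. ennreal ((indicator {0..t} (snd x) * G (snd x) (fst x) - indicator {0..t} (snd x) * H (snd x) (fst x))\<^sup>2) \<partial>(M \<Otimes>\<^sub>M lborel))"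
    by (subst lborel.nn_integral_fst[symmetric]) simp_all
  finally show ?thesis .
qed

lemma process_distance_mono:
  assumes "t \<le> T" shows "process_distance t G H \<le> process_distance T G H"
  unfolding process_distance_def
  by (intro nn_integral_mono) (use assms in \<open>auto simp: indicator_def\<close>)

lemma process_norm_tendsto:
  assumes Sm: "\<And>n. case_prod (S n) \<in> borel_measurable (borel \<Otimes>\<^sub>M M)" and Gm: "case_prod G \<in> borel_measurable (borel \<Otimes>\<^sub>M M)"
    and fin: "process_distance T G (\<lambda>_ _. 0) < \<infinity>" and lim: "(\<lambda>n. process_distance T (S n) G) \<longlonglongrightarrow> 0" and t: "t \<le> T"
  shows "(\<lambda>n. process_distance t (S n) (\<lambda>_ _. 0)) \<longlonglongrightarrow> process_distance t G (\<lambda>_ _. 0)"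
proof -
  note [measurable] = Sm Gm
  have 0: "case_prod (\<lambda>_ _. 0::real) \<in> borel_measurable (borel \<Otimes>\<^sub>M M)" by simp
  let ?f = "\<lambda>n x. indicator {0..t} (snd x) * S n (snd x) (fst x)" and ?g = "\<lambda>x. indicator {0..t} (snd x) * G (snd x) (fst x)"
  have e1: "process_distance t (S n) (\<lambda>_ _. 0) = (\<integral>\<^sup>+x. ennreal ((?f n x)\<^sup>2) \<partial>(M \<Otimes>\<^sub>M lborel))" for n
    using process_distance_product[OF Sm 0] by simp
  have e2: "process_distance t G (\<lambda>_ _. 0) = (\<integral>\<^sup>+x. ennreal ((?g x)\<^sup>2) \<partial>(M \<Otimes>\<^sub>M lborel))"
    using process_distance_product[OF Gm 0] by simp
  have e3: "process_distance t (S n) G = (\<integral>\<^sup>+x. ennreal ((?f n x - ?g x)\<^sup>2) \<partial>(M \<Otimes>\<^sub>M lborel))" for n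
    by (rule process_distance_product[OF Sm Gm])
  have "(\<lambda>n. process_distance t (S n) G) \<longlonglongrightarrow> 0"
    by (rule tendsto_sandwich[OF _ _ tendsto_const lim]) (auto intro!: always_eventually process_distance_mono[OF t])
  moreover have "process_distance t G (\<lambda>_ _. 0) < \<infinity>" using process_distance_mono[OF t] fin by (rule le_less_trans)
  ultimately show ?thesis unfolding e1 e2 e3
    by (intro square_norm_tendsto) measurable
qed

end

lemma at_left_within: "at s within {a..<s} = at_left s" if "a < s" for a s :: real
  by (rule at_within_nhd[of s "{a<..}"]) (use that in auto)

context brownian_motion begin

text \<open>A continuous path is bounded on \<open>[0,T]\<close>, but by a constant that depends on
  the path. The convergence is therefore pathwise and leads to convergence in probability, not in
  mean.\<close>

lemma riemann_path_tendsto: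
  assumes T: "0 < T" and Gm: "case_prod G \<in> borel_measurable (borel \<Otimes>\<^sub>M M)" and \<omega>: "\<omega> \<in> space M"
    and cont: "continuous_on {0..T} (\<lambda>s. G s \<omega>)"
  shows "(\<lambda>n. \<integral>\<^sup>+s\<in>{0..T}. ennreal ((riemann_process T G n s \<omega> - G s \<omega>)\<^sup>2) \<partial>lborel) \<longlonglongrightarrow> 0"
proof -
  have "compact ((\<lambda>s. G s \<omega>) ` {0..T})" using cont by (rule compact_continuous_image) simp
  from compact_imp_bounded[OF this] obtain C where "\<forall>x\<in>(\<lambda>s. G s \<omega>) ` {0..T}. norm x \<le> C"
    unfolding bounded_iff ..
  then have C: "\<bar>G s \<omega>\<bar> \<le> C" if "s \<in> {0..T}" for s using that by auto
  show ?thesis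
  proof (rule nn_integral_square_dist_tendsto_0[where C=C])
    fix n s
    show "(\<lambda>s. G s \<omega>) \<in> borel_measurable borel" using measurable_section[OF Gm \<omega>] .
    show "(\<lambda>s. riemann_process T G n s \<omega>) \<in> borel_measurable borel" unfolding riemann_process_def by measurable
    assume s: "s \<in> {0<..T}"
    show "\<bar>riemann_process T G n s \<omega>\<bar> \<le> C" using riemann_process_bound[of T G \<omega> C s n] T C s by simp
    show "\<bar>G s \<omega>\<bar> \<le> C" using C[of s] s by auto
    have "((\<lambda>r. G r \<omega>) \<longlongrightarrow> G s \<omega>) (at s within {0..T})" using cont s by (auto simp: continuous_on_def)
    then have "((\<lambda>r. G r \<omega>) \<longlongrightarrow> G s \<omega>) (at s within {0..<s})"
      by (rule tendsto_within_subset) (use s in auto)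
    moreover have "at s within {0..<s} = at_left s" using at_left_within s by simp
    ultimately have "((\<lambda>r. G r \<omega>) \<longlongrightarrow> G s \<omega>) (at_left s)" by simp
    then show "(\<lambda>n. riemann_process T G n s \<omega>) \<longlonglongrightarrow> G s \<omega>" using riemann_process_tendsto[of T s G \<omega>, OF T s] by simp
  qed
qed

text \<open>Localisation without stopping times: the predicate \<open>P s\<close> is a decreasing family of events
  on which \<open>Z\<close> is bounded, so that on \<open>P t\<close> the Riemann sums of \<open>Z\<close> up to time \<open>t\<close> agree with those
  of the bounded process \<open>1\<^bsub>P\<^esub> Z\<close>.\<close>

lemma ito_integral_localized:
  assumes T: "0 < T" and ito: "ito_integral M F W T Z0 Y" and Z0: "AE \<omega> in M. \<forall>s\<in>{0..T}. Z0 s \<omega> = Z s \<omega>"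
    and Zm: "case_prod Z \<in> borel_measurable (borel \<Otimes>\<^sub>M M)"
    and ZF: "\<And>s. s \<in> {0..T} \<Longrightarrow> Z s \<in> borel_measurable (F s)"
    and cont: "\<And>\<omega>. \<omega> \<in> space M \<Longrightarrow> continuous_on {0..T} (\<lambda>s. Z s \<omega>)"
    and Pm: "Measurable.pred (borel \<Otimes>\<^sub>M M) (case_prod P)"
    and PF: "\<And>s. s \<in> {0..T} \<Longrightarrow> Measurable.pred (F s) (P s)"
    and anti: "\<And>r s \<omega>. 0 \<le> r \<Longrightarrow> r \<le> s \<Longrightarrow> s \<le> T \<Longrightarrow> P s \<omega> \<Longrightarrow> P r \<omega>"
    and left: "\<And>s \<omega>. s \<in> {0<..T} \<Longrightarrow> \<omega> \<in> space M \<Longrightarrow> (\<forall>r\<in>{0..<s}. P r \<omega>) \<Longrightarrow> P s \<omega>"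
    and bound: "\<And>s \<omega>. s \<in> {0..T} \<Longrightarrow> \<omega> \<in> space M \<Longrightarrow> P s \<omega> \<Longrightarrow> \<bar>Z s \<omega>\<bar> \<le> C"
    and t: "t \<in> {0..T}"
  shows "(\<integral>\<^sup>+\<omega>. ennreal (of_bool (P t \<omega>) * (Y t \<omega>)\<^sup>2) \<partial>M) \<le> process_distance t (\<lambda>s \<omega>. of_bool (P s \<omega>) * Z s \<omega>) (\<lambda>_ _. 0)"
proof -
  define G where "G = (\<lambda>s \<omega>. of_bool (P s \<omega>) * Z s \<omega>)"
  note [measurable] = Zm Pm
  have Gm: "case_prod G \<in> borel_measurable (borel \<Otimes>\<^sub>M M)" unfolding G_def split_beta' by measurable
  have GF: "G s \<in> borel_measurable (F s)" if "s \<in> {0..T}" for s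
    unfolding G_def using ZF[OF that] PF[OF that] by measurable
  have Gbound: "\<bar>G s \<omega>\<bar> \<le> max C 0" if "s \<in> {0..T}" "\<omega> \<in> space M" for s \<omega>
    using bound[OF that] by (auto simp: G_def)
  have Gleft: "((\<lambda>r. G r \<omega>) \<longlongrightarrow> G s \<omega>) (at_left s)" if s: "s \<in> {0<..T}" and \<omega>: "\<omega> \<in> space M" for s \<omega>
  proof -
    have eq: "at s within {0..<s} = at_left s" using at_left_within s by simp
    have "((\<lambda>r. Z r \<omega>) \<longlongrightarrow> Z s \<omega>) (at s within {0..T})" using cont[OF \<omega>] s by (auto simp: continuous_on_def)
    then have Zl: "((\<lambda>r. Z r \<omega>) \<longlongrightarrow> Z s \<omega>) (at_left s)"
      unfolding eq[symmetric] by (rule tendsto_within_subset) (use s in auto)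
    \<comment> \<open>A decreasing event changes its truth value at most once along a path. By
      \<open>left\<close> it cannot fail first at \<open>s\<close> itself, so just before
      \<open>s\<close> it is constant with the value that it has at \<open>s\<close>.\<close>
    obtain r0 where r0: "0 \<le> r0" "r0 < s" "\<And>r. r0 \<le> r \<Longrightarrow> r < s \<Longrightarrow> P r \<omega> = P s \<omega>"
    proof (cases "P s \<omega>")
      case True
      have "P r \<omega> = P s \<omega>" if "0 \<le> r" "r < s" for r
        using anti[of r s \<omega>] that True s by auto
      then show thesis using that[of 0] s by auto
    next
      case False
      then have "\<not> (\<forall>r\<in>{0..<s}. P r \<omega>)" using left[OF s \<omega>] by blast
      then obtain r where "r \<in> {0..<s}" and P: "\<not> P r \<omega>" by blast
      then have r: "0 \<le> r" "r < s" "\<not> P r \<omega>" by auto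
      have "P r' \<omega> = P s \<omega>" if "r \<le> r'" "r' < s" for r'
        using anti[of r r' \<omega>] that r False s by auto
      then show thesis using that[of r] r by auto
    qed
    have ev: "eventually (\<lambda>r. P r \<omega> = P s \<omega>) (at_left s)"
      unfolding eventually_at_left[OF \<open>r0 < s\<close>] using r0 by (intro exI[of _ r0]) auto
    have "((\<lambda>r. of_bool (P s \<omega>) * Z r \<omega>) \<longlongrightarrow> G s \<omega>) (at_left s)"
      unfolding G_def by (intro tendsto_intros Zl)
    moreover have "eventually (\<lambda>r. of_bool (P s \<omega>) * Z r \<omega> = G r \<omega>) (at_left s)"
      using ev by eventually_elim (simp add: G_def)
    ultimately show ?thesis by (rule Lim_transform_eventually)
  qed
  let ?I = "\<lambda>K n. elementary_integral W (Suc n) (uniform_grid T n) (\<lambda>i. K (uniform_grid T n i)) t"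
  have t0: "0 \<le> t" using t by simp
  have SZ: "step_integrand T (Suc n) (uniform_grid T n) (\<lambda>i. Z (uniform_grid T n i))" for n by (rule riemann_step[OF T ZF])
  have SG: "step_integrand T (Suc n) (uniform_grid T n) (\<lambda>i. G (uniform_grid T n i))" for n by (rule riemann_step[OF T GF])
  have IZ: "?I Z n \<in> borel_measurable M" and IG: "?I G n \<in> borel_measurable M" for n
    using step_integral_measurable[OF SZ t0] step_integral_measurable[OF SG t0] measurable_F_M by blast+
  have Ym: "Y t \<in> borel_measurable M" using ito_integral_measurable[OF ito t] measurable_F_M by blast
  have [measurable]: "case_prod (riemann_process T Z n) \<in> borel_measurable (borel \<Otimes>\<^sub>M M)" for n
    unfolding riemann_process_def by (rule step_process_measurable[OF SZ])
  have RG: "case_prod (riemann_process T G n) \<in> borel_measurable (borel \<Otimes>\<^sub>M M)" for n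
    unfolding riemann_process_def by (rule step_process_measurable[OF SG])
  have "(\<lambda>n. prob {\<omega>\<in>space M. \<epsilon> < \<bar>?I Z n \<omega> - Y t \<omega>\<bar>}) \<longlonglongrightarrow> 0" if "\<epsilon> > 0" for \<epsilon>
  proof (rule ito_integral_in_prob[OF ito Z0 Zm SZ _ t that])
    fix \<delta> :: real assume \<delta>: "\<delta> > 0"
    show "(\<lambda>k. prob {\<omega>\<in>space M. ennreal \<delta> < (\<integral>\<^sup>+s\<in>{0..T}. ennreal ((elementary_process (Suc k) (uniform_grid T k)
      (\<lambda>i. Z (uniform_grid T k i)) s \<omega> - Z s \<omega>)\<^sup>2) \<partial>lborel)}) \<longlonglongrightarrow> 0"
      unfolding riemann_process_def[symmetric]
      by (rule prob_gt_tendsto_0[OF _ _ \<delta>]) (measurable, rule riemann_path_tendsto[OF T Zm _ cont])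
  qed
  from converge_in_prob_AE_subseq[OF IZ Ym this] obtain r where r: "strict_mono r" "AE \<omega> in M. (\<lambda>n. ?I Z (r n) \<omega>) \<longlonglongrightarrow> Y t \<omega>" .
  have agree: "?I Z n \<omega> = ?I G n \<omega>" if "P t \<omega>" for n \<omega>
    unfolding elementary_integral_def
  proof (intro sum.cong refl)
    fix i assume i: "i \<in> {..<Suc n}"
    show "Z (uniform_grid T n i) \<omega> * (W (min (uniform_grid T n (Suc i)) t) \<omega> - W (min (uniform_grid T n i) t) \<omega>)
      = G (uniform_grid T n i) \<omega> * (W (min (uniform_grid T n (Suc i)) t) \<omega> - W (min (uniform_grid T n i) t) \<omega>)"
    proof (cases "uniform_grid T n i \<le> t")
      case True
      then have "P (uniform_grid T n i) \<omega>" using anti[OF _ True _ that] uniform_grid_bounds[OF T, of i n] i t by auto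
      then show ?thesis by (simp add: G_def)
    next
      case False
      then show ?thesis using uniform_grid_mono[OF T, of n i] by simp
    qed
  qed
  have Gsq: "sq_int (G (uniform_grid T n i))" if "i < Suc n" for n i
  proof (rule sq_int_bounded)
    show "G (uniform_grid T n i) \<in> borel_measurable M"
      using GF[OF uniform_grid_bounds[OF T, of i n]] measurable_F_M that by auto
    show "\<bar>G (uniform_grid T n i) \<omega>\<bar> \<le> max C 0" if "\<omega> \<in> space M" for \<omega>
      using Gbound[OF uniform_grid_bounds[OF T, of i n] that] \<open>i < Suc n\<close> by auto
  qed
  have iso: "(\<integral>\<^sup>+\<omega>. ennreal ((?I G n \<omega>)\<^sup>2) \<partial>M) = process_distance t (riemann_process T G n) (\<lambda>_ _. 0)" for n
    unfolding riemann_process_def by (rule step_isometry_nn[OF SG _ t]) (use Gsq in auto)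
  have fin: "process_distance T G (\<lambda>_ _. 0) < \<infinity>"
  proof -
    have "process_distance T G (\<lambda>_ _. 0) \<le> (\<integral>\<^sup>+\<omega>. (\<integral>\<^sup>+s\<in>{0..T}. ennreal ((max C 0)\<^sup>2) \<partial>lborel) \<partial>M)"
      unfolding process_distance_def
    proof (intro nn_integral_mono)
      fix \<omega> s assume \<omega>: "\<omega> \<in> space M"
      have "(G s \<omega> - 0)\<^sup>2 \<le> (max C 0)\<^sup>2" if "s \<in> {0..T}"
        using power_mono[OF Gbound[OF that \<omega>], of 2] by simp
      then show "ennreal ((G s \<omega> - 0)\<^sup>2) * indicator {0..T} s \<le> ennreal ((max C 0)\<^sup>2) * indicator {0..T} s"
        by (auto simp: indicator_def intro: ennreal_leI)
    qed
    also have "\<dots> = (\<integral>\<^sup>+\<omega>. ennreal ((max C 0)\<^sup>2) * ennreal T \<partial>M)"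
      using T by (subst nn_integral_cmult_indicator) auto
    also have "\<dots> < \<infinity>" by (simp add: emeasure_space_1 ennreal_mult_less_top)
    finally show ?thesis .
  qed
  have lim: "(\<lambda>n. process_distance t (riemann_process T G n) (\<lambda>_ _. 0)) \<longlonglongrightarrow> process_distance t G (\<lambda>_ _. 0)"
    using process_norm_tendsto[OF RG Gm fin riemann_distance_tendsto_0[of T G "max C 0", OF T GF Gm Gbound Gleft]] t by simp
  have "(\<integral>\<^sup>+\<omega>. ennreal (of_bool (P t \<omega>) * (Y t \<omega>)\<^sup>2) \<partial>M) \<le> (\<integral>\<^sup>+\<omega>. liminf (\<lambda>n. ennreal ((?I G (r n) \<omega>)\<^sup>2)) \<partial>M)"
  proof (rule nn_integral_mono_AE)
    show "AE \<omega> in M. ennreal (of_bool (P t \<omega>) * (Y t \<omega>)\<^sup>2) \<le> liminf (\<lambda>n. ennreal ((?I G (r n) \<omega>)\<^sup>2))"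
      using r(2)
    proof eventually_elim
      case (elim \<omega>)
      show ?case
      proof (cases "P t \<omega>")
        case True
        have "(\<lambda>n. ennreal ((?I Z (r n) \<omega>)\<^sup>2)) \<longlonglongrightarrow> ennreal ((Y t \<omega>)\<^sup>2)"
          by (intro tendsto_ennrealI tendsto_power elim)
        then have "liminf (\<lambda>n. ennreal ((?I G (r n) \<omega>)\<^sup>2)) = ennreal ((Y t \<omega>)\<^sup>2)"
          unfolding agree[OF True] by (rule lim_imp_Liminf[OF sequentially_bot])
        then show ?thesis using True by simp
      qed simp
    qed
  qed
  \<comment> \<open>Fatou's lemma, after the complement of \<open>P t\<close> has been dropped,
    gives an upper bound only; this is all that a Gronwall argument requires.\<close>
  also have "\<dots> \<le> liminf (\<lambda>n. \<integral>\<^sup>+\<omega>. ennreal ((?I G (r n) \<omega>)\<^sup>2) \<partial>M)"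
    by (rule nn_integral_liminf) (use IG in measurable)
  also have "\<dots> = process_distance t G (\<lambda>_ _. 0)"
    unfolding iso using LIMSEQ_subseq_LIMSEQ[OF lim r(1)]
    by (intro lim_imp_Liminf[OF sequentially_bot]) (simp add: comp_def)
  finally show ?thesis unfolding G_def .
qed

section \<open>Isometry and martingale property for square-integrable integrands\<close>

lemma sq_int_nn: "sq_int f \<Longrightarrow> (\<integral>\<^sup>+\<omega>. ennreal ((f \<omega>)\<^sup>2) \<partial>M) = ennreal (\<integral>\<omega>. (f \<omega>)\<^sup>2 \<partial>M)"
  by (simp add: nn_integral_eq_integral sq_int_def)

lemma sq_int_iff_nn: "f \<in> borel_measurable M \<Longrightarrow> sq_int f \<longleftrightarrow> (\<integral>\<^sup>+\<omega>. ennreal ((f \<omega>)\<^sup>2) \<partial>M) < \<infinity>"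
  unfolding sq_int_def by (auto simp: integrable_iff_bounded)

lemma square_dist_triangle:
  assumes [measurable]: "f \<in> borel_measurable M" "g \<in> borel_measurable M" "h \<in> borel_measurable M"
  shows "(\<integral>\<^sup>+\<omega>. ennreal ((f \<omega> - h \<omega>)\<^sup>2) \<partial>M) \<le> 2 * (\<integral>\<^sup>+\<omega>. ennreal ((f \<omega> - g \<omega>)\<^sup>2) \<partial>M) + 2 * (\<integral>\<^sup>+\<omega>. ennreal ((h \<omega> - g \<omega>)\<^sup>2) \<partial>M)"
proof -
  have "(\<integral>\<^sup>+\<omega>. ennreal ((f \<omega> - h \<omega>)\<^sup>2) \<partial>M) \<le> (\<integral>\<^sup>+\<omega>. 2 * ennreal ((f \<omega> - g \<omega>)\<^sup>2) + 2 * ennreal ((h \<omega> - g \<omega>)\<^sup>2) \<partial>M)"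
    by (intro nn_integral_mono ennreal_square_add_le)
  also have "\<dots> = 2 * (\<integral>\<^sup>+\<omega>. ennreal ((f \<omega> - g \<omega>)\<^sup>2) \<partial>M) + 2 * (\<integral>\<^sup>+\<omega>. ennreal ((h \<omega> - g \<omega>)\<^sup>2) \<partial>M)"
    by (subst nn_integral_add) (auto simp: nn_integral_cmult)
  finally show ?thesis .
qed

lemma step_integral_distance:
  assumes S1: "step_integrand T n1 \<tau>1 H1" and S2: "step_integrand T n2 \<tau>2 H2"
    and sq: "\<forall>i<n1. sq_int (H1 i)" "\<forall>i<n2. sq_int (H2 i)" and t: "t \<in> {0..T}"
  shows "(\<integral>\<^sup>+\<omega>. ennreal ((elementary_integral W n1 \<tau>1 H1 t \<omega> - elementary_integral W n2 \<tau>2 H2 t \<omega>)\<^sup>2) \<partial>M)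
    = process_distance t (elementary_process n1 \<tau>1 H1) (elementary_process n2 \<tau>2 H2)"
proof -
  obtain m p K where K: "step_integrand T m p K" "\<And>i. i < m \<Longrightarrow> p i < p (Suc i)" "\<forall>i<m. sq_int (K i)"
    and eq: "\<And>\<omega> h. stieltjes_sum m p (\<lambda>i. K i \<omega>) h
       = stieltjes_sum n1 \<tau>1 (\<lambda>i. H1 i \<omega>) h - stieltjes_sum n2 \<tau>2 (\<lambda>i. H2 i \<omega>) h"
    using step_integrand_diff[OF S1 S2] sq by metis
  have eqI: "elementary_integral W n1 \<tau>1 H1 t \<omega> - elementary_integral W n2 \<tau>2 H2 t \<omega> = elementary_integral W m p K t \<omega>" for \<omega>
    unfolding elementary_integral_stieltjes by (rule eq[symmetric])
  have eqP: "elementary_process n1 \<tau>1 H1 s \<omega> - elementary_process n2 \<tau>2 H2 s \<omega> = elementary_process m p K s \<omega> - 0" for s \<omega>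
    using eq S1 S2 K(2) by (simp add: elementary_process_stieltjes step_integrand_def less_imp_le)
  show ?thesis unfolding eqI step_isometry_nn[OF K(1,3) t] process_distance_def eqP ..
qed

text \<open>Polarisation: the expectation of \<open>f * X\<close> is recovered from the norms of
  \<open>X\<close> and of \<open>f + X\<close>, and both norms pass to the limit.\<close>

lemma orthogonal_limit:
  assumes f: "sq_int f" and X: "\<And>k. sq_int (X k)" and Y: "sq_int Y"
    and lim: "(\<lambda>k. \<integral>\<^sup>+\<omega>. ennreal ((X k \<omega> - Y \<omega>)\<^sup>2) \<partial>M) \<longlonglongrightarrow> 0" and orth: "\<And>k. (\<integral>\<omega>. f \<omega> * X k \<omega> \<partial>M) = 0"
  shows "(\<integral>\<omega>. f \<omega> * Y \<omega> \<partial>M) = 0"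
proof -
  have pol: "(\<integral>\<omega>. (f \<omega> + g \<omega>)\<^sup>2 \<partial>M) = (\<integral>\<omega>. (f \<omega>)\<^sup>2 \<partial>M) + (\<integral>\<omega>. (g \<omega>)\<^sup>2 \<partial>M) + 2 * (\<integral>\<omega>. f \<omega> * g \<omega> \<partial>M)" if "sq_int g" for g
    using sq_int_square[OF f] sq_int_square[OF that] sq_int_mult[OF f that] by (simp add: power2_sum mult.assoc)
  have fm: "f \<in> borel_measurable M" and Ym: "Y \<in> borel_measurable M" and Xm: "\<And>k. X k \<in> borel_measurable M"
    using f Y X sq_int_measurable by auto
  have "(\<lambda>k. \<integral>\<^sup>+\<omega>. ennreal ((X k \<omega>)\<^sup>2) \<partial>M) \<longlonglongrightarrow> (\<integral>\<^sup>+\<omega>. ennreal ((Y \<omega>)\<^sup>2) \<partial>M)"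
    by (rule square_norm_tendsto[OF Xm Ym _ lim]) (simp add: sq_int_nn[OF Y])
  then have 1: "(\<lambda>k. \<integral>\<omega>. (X k \<omega>)\<^sup>2 \<partial>M) \<longlonglongrightarrow> (\<integral>\<omega>. (Y \<omega>)\<^sup>2 \<partial>M)"
    unfolding sq_int_nn[OF X] sq_int_nn[OF Y] by (simp add: tendsto_ennreal_iff)
  note fX = sq_int_add[OF f X] and fY = sq_int_add[OF f Y]
  have "(\<lambda>k. \<integral>\<^sup>+\<omega>. ennreal ((f \<omega> + X k \<omega>)\<^sup>2) \<partial>M) \<longlonglongrightarrow> (\<integral>\<^sup>+\<omega>. ennreal ((f \<omega> + Y \<omega>)\<^sup>2) \<partial>M)"
    by (rule square_norm_tendsto[OF sq_int_measurable[OF fX] sq_int_measurable[OF fY]]) (use sq_int_nn[OF fY] lim in simp_all)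
  then have 2: "(\<lambda>k. \<integral>\<omega>. (f \<omega> + X k \<omega>)\<^sup>2 \<partial>M) \<longlonglongrightarrow> (\<integral>\<omega>. (f \<omega> + Y \<omega>)\<^sup>2 \<partial>M)"
    unfolding sq_int_nn[OF fX] sq_int_nn[OF fY] by (simp add: tendsto_ennreal_iff)
  have "(\<lambda>k. (\<integral>\<omega>. (f \<omega>)\<^sup>2 \<partial>M) + (\<integral>\<omega>. (X k \<omega>)\<^sup>2 \<partial>M)) \<longlonglongrightarrow> (\<integral>\<omega>. (f \<omega>)\<^sup>2 \<partial>M) + (\<integral>\<omega>. (Y \<omega>)\<^sup>2 \<partial>M)"
    by (intro tendsto_intros 1)
  with 2 have "(\<integral>\<omega>. (f \<omega> + Y \<omega>)\<^sup>2 \<partial>M) = (\<integral>\<omega>. (f \<omega>)\<^sup>2 \<partial>M) + (\<integral>\<omega>. (Y \<omega>)\<^sup>2 \<partial>M)"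
    unfolding pol[OF X] orth using LIMSEQ_unique by force
  then show ?thesis using pol[OF Y] by simp
qed

text \<open>A diagonal choice: \<open>Z\<close> is cut off at level \<open>k\<close>, and the
  cut-off process is replaced by a Riemann process so fine that the error is below
  \<open>1 / (k + 1)\<close>. The cut-off makes the coefficients bounded, hence square
  integrable.\<close>

lemma bounded_step_approximation:
  assumes T: "0 < T" and Zm: "case_prod Z \<in> borel_measurable (borel \<Otimes>\<^sub>M M)"
    and ZF: "\<And>s. s \<in> {0..T} \<Longrightarrow> Z s \<in> borel_measurable (F s)"
    and cont: "\<And>\<omega>. \<omega> \<in> space M \<Longrightarrow> continuous_on {0..T} (\<lambda>s. Z s \<omega>)"
    and fin: "process_distance T Z (\<lambda>_ _. 0) < \<infinity>"
  obtains n \<tau> H where "\<And>k::nat. step_integrand T (n k) (\<tau> k) (H k)" "\<And>k. \<forall>i<n k. sq_int (H k i)"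
    "(\<lambda>k. process_distance T (elementary_process (n k) (\<tau> k) (H k)) Z) \<longlonglongrightarrow> 0"
proof -
  define G where "G = (\<lambda>(k::nat) s \<omega>. max (- real k) (min (real k) (Z s \<omega>)))"
  note [measurable] = Zm
  have Gm: "case_prod (G k) \<in> borel_measurable (borel \<Otimes>\<^sub>M M)" for k unfolding G_def split_beta' by measurable
  have GF: "G k s \<in> borel_measurable (F s)" if "s \<in> {0..T}" for k s
    unfolding G_def using ZF[OF that] by measurable
  have Gbound: "\<bar>G k s \<omega>\<bar> \<le> real k" for k s \<omega> by (auto simp: G_def)
  have Gleft: "((\<lambda>r. G k r \<omega>) \<longlongrightarrow> G k s \<omega>) (at_left s)" if s: "s \<in> {0<..T}" and \<omega>: "\<omega> \<in> space M" for s \<omega> k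
  proof -
    have "((\<lambda>r. Z r \<omega>) \<longlongrightarrow> Z s \<omega>) (at s within {0..T})" using cont[OF \<omega>] s by (auto simp: continuous_on_def)
    then have "((\<lambda>r. Z r \<omega>) \<longlongrightarrow> Z s \<omega>) (at s within {0..<s})"
      by (rule tendsto_within_subset) (use s in auto)
    then have "((\<lambda>r. Z r \<omega>) \<longlongrightarrow> Z s \<omega>) (at_left s)" using at_left_within[of 0 s] s by simp
    then show ?thesis unfolding G_def by (intro tendsto_max tendsto_min tendsto_const)
  qed
  have "\<exists>n. process_distance T (riemann_process T (G k) n) (G k) < ennreal (1 / real (Suc k))" for k
  proof -
    have "(\<lambda>n. process_distance T (riemann_process T (G k) n) (G k)) \<longlonglongrightarrow> 0"
      by (rule riemann_distance_tendsto_0[of T "G k" "real k", OF T GF Gm Gbound Gleft])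
    from order_tendstoD(2)[OF this, of "ennreal (1 / real (Suc k))"]
    show ?thesis using eventually_happens by fastforce
  qed
  then have "\<forall>k. \<exists>n. process_distance T (riemann_process T (G k) n) (G k) < ennreal (1 / real (Suc k))" ..
  from choice[OF this] obtain \<nu> where \<nu>: "\<And>k. process_distance T (riemann_process T (G k) (\<nu> k)) (G k) < ennreal (1 / real (Suc k))" by blast
  have SG: "step_integrand T (Suc (\<nu> k)) (uniform_grid T (\<nu> k)) (\<lambda>i. G k (uniform_grid T (\<nu> k) i))" for k
    by (rule riemann_step[OF T GF])
  have Rm: "case_prod (riemann_process T (G k) (\<nu> k)) \<in> borel_measurable (borel \<Otimes>\<^sub>M M)" for k
    unfolding riemann_process_def by (rule step_process_measurable[OF SG])
  \<comment> \<open>The squared cut-off error is dominated by \<open>Z\<^sup>2\<close>, which is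
    integrable by \<open>fin\<close>, and at each point it is zero once \<open>k\<close> exceeds
    \<open>\<bar>Z\<bar>\<close>.\<close>
  have clamp: "(\<lambda>k. process_distance T Z (G k)) \<longlonglongrightarrow> 0"
  proof -
    note [measurable] = Gm
    have 0: "case_prod (\<lambda>_ _. 0::real) \<in> borel_measurable (borel \<Otimes>\<^sub>M M)" by simp
    have "(\<lambda>k. \<integral>\<^sup>+x. ennreal ((indicator {0..T} (snd x) * Z (snd x) (fst x) - indicator {0..T} (snd x) * G k (snd x) (fst x))\<^sup>2) \<partial>(M \<Otimes>\<^sub>M lborel))
      \<longlonglongrightarrow> (\<integral>\<^sup>+x. 0 \<partial>(M \<Otimes>\<^sub>M (lborel :: real measure)))"
    proof (rule nn_integral_dominated_convergence[where w="\<lambda>x. ennreal ((indicator {0..T} (snd x) * Z (snd x) (fst x))\<^sup>2)"])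
      show "(\<integral>\<^sup>+x. ennreal ((indicator {0..T} (snd x) * Z (snd x) (fst x))\<^sup>2) \<partial>(M \<Otimes>\<^sub>M lborel)) < \<infinity>"
        using fin process_distance_product[OF Zm 0] by simp
      have le: "(a - max (- real k) (min (real k) a))\<^sup>2 \<le> a\<^sup>2" for a :: real and k
        unfolding abs_le_square_iff[symmetric] by (auto simp: max_def min_def abs_if)
      show "AE x in M \<Otimes>\<^sub>M lborel. ennreal ((indicator {0..T} (snd x) * Z (snd x) (fst x) - indicator {0..T} (snd x) * G k (snd x) (fst x))\<^sup>2)
         \<le> ennreal ((indicator {0..T} (snd x) * Z (snd x) (fst x))\<^sup>2)" for k
        using le by (intro AE_I2) (auto simp: indicator_def G_def intro!: ennreal_leI)
      show "AE x in M \<Otimes>\<^sub>M lborel. (\<lambda>k. ennreal ((indicator {0..T} (snd x) * Z (snd x) (fst x) - indicator {0..T} (snd x) * G k (snd x) (fst x))\<^sup>2)) \<longlonglongrightarrow> 0"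
      proof (rule AE_I2, rule tendsto_eventually)
        fix x
        obtain K where K: "\<bar>Z (snd x) (fst x)\<bar> \<le> real K" using real_arch_simple by blast
        have "G k (snd x) (fst x) = Z (snd x) (fst x)" if "K \<le> k" for k
        proof -
          have "real K \<le> real k" using that by simp
          then show ?thesis using K by (auto simp: G_def max_def min_def)
        qed
        then show "eventually (\<lambda>k. ennreal ((indicator {0..T} (snd x) * Z (snd x) (fst x) - indicator {0..T} (snd x) * G k (snd x) (fst x))\<^sup>2) = 0) sequentially"
          unfolding eventually_sequentially by (intro exI[of _ K]) auto
      qed
    qed auto
    then show ?thesis unfolding process_distance_product[OF Zm Gm] by simp
  qed
  have lim: "(\<lambda>k. process_distance T (riemann_process T (G k) (\<nu> k)) Z) \<longlonglongrightarrow> 0"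
  proof (rule tendsto_sandwich[OF _ _ tendsto_const])
    have "(\<lambda>k. ennreal (1 / real (Suc k))) \<longlonglongrightarrow> ennreal 0"
      using LIMSEQ_inverse_real_of_nat by (intro tendsto_ennrealI) (simp add: inverse_eq_divide)
    then have "(\<lambda>k. 2 * ennreal (1 / real (Suc k)) + 2 * process_distance T Z (G k)) \<longlonglongrightarrow> 2 * 0 + 2 * 0"
      using clamp by (intro tendsto_add ennreal_tendsto_cmult) auto
    then show "(\<lambda>k. 2 * ennreal (1 / real (Suc k)) + 2 * process_distance T Z (G k)) \<longlonglongrightarrow> 0" by simp
    show "eventually (\<lambda>k. process_distance T (riemann_process T (G k) (\<nu> k)) Z \<le> 2 * ennreal (1 / real (Suc k)) + 2 * process_distance T Z (G k)) sequentially"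
    proof (intro always_eventually allI)
      fix k
      have "process_distance T (riemann_process T (G k) (\<nu> k)) Z \<le> 2 * process_distance T (riemann_process T (G k) (\<nu> k)) (G k) + 2 * process_distance T Z (G k)"
        by (rule process_distance_triangle[OF Rm Gm Zm])
      also have "\<dots> \<le> 2 * ennreal (1 / real (Suc k)) + 2 * process_distance T Z (G k)"
        using \<nu>[of k] by (intro add_mono mult_left_mono order_refl) auto
      finally show "process_distance T (riemann_process T (G k) (\<nu> k)) Z \<le> 2 * ennreal (1 / real (Suc k)) + 2 * process_distance T Z (G k)" .
    qed
  qed simp
  show thesis
  proof (rule that)
    show "step_integrand T (Suc (\<nu> k)) (uniform_grid T (\<nu> k)) (\<lambda>i. G k (uniform_grid T (\<nu> k) i))" for k by (rule SG)
    show "\<forall>i<Suc (\<nu> k). sq_int (G k (uniform_grid T (\<nu> k) i))" for k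
    proof (intro allI impI, rule sq_int_bounded)
      fix i assume "i < Suc (\<nu> k)"
      then show "G k (uniform_grid T (\<nu> k) i) \<in> borel_measurable M"
        using GF[OF uniform_grid_bounds[OF T, of i "\<nu> k"]] measurable_F_M by auto
    qed (rule Gbound)
    show "(\<lambda>k. process_distance T (elementary_process (Suc (\<nu> k)) (uniform_grid T (\<nu> k)) (\<lambda>i. G k (uniform_grid T (\<nu> k) i))) Z) \<longlonglongrightarrow> 0"
      using lim unfolding riemann_process_def .
  qed
qed

text \<open>Convergence in probability is upgraded to mean square: along an almost surely convergent
  subsequence \<open>r\<close>, Fatou's lemma bounds the distance to \<open>Y\<close> by distances
  between two step integrals, which the isometry controls. The share of the second one vanishes in
  the limit, so the bound holds for each single \<open>k\<close>.\<close>

lemma ito_integral_approximation: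
  assumes ito: "ito_integral M F W T Z0 Y" and Z0: "AE \<omega> in M. \<forall>s\<in>{0..T}. Z0 s \<omega> = Z s \<omega>"
    and Zm: "case_prod Z \<in> borel_measurable (borel \<Otimes>\<^sub>M M)"
    and S: "\<And>k. step_integrand T (n k) (\<tau> k) (H k)" and sq: "\<And>k. \<forall>i<n k. sq_int (H k i)"
    and lim: "(\<lambda>k. process_distance T (elementary_process (n k) (\<tau> k) (H k)) Z) \<longlonglongrightarrow> 0"
    and t: "t \<in> {0..T}"
  shows "(\<integral>\<^sup>+\<omega>. ennreal ((elementary_integral W (n k) (\<tau> k) (H k) t \<omega> - Y t \<omega>)\<^sup>2) \<partial>M)
    \<le> 2 * process_distance T (elementary_process (n k) (\<tau> k) (H k)) Z"
proof -
  let ?I = "\<lambda>k. elementary_integral W (n k) (\<tau> k) (H k) t" and ?S = "\<lambda>k. elementary_process (n k) (\<tau> k) (H k)"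
  have t0: "0 \<le> t" using t by simp
  have Im: "?I k \<in> borel_measurable M" for k using step_integral_measurable[OF S t0] measurable_F_M by blast
  have Ym: "Y t \<in> borel_measurable M" using ito_integral_measurable[OF ito t] measurable_F_M by blast
  have Sm: "case_prod (?S k) \<in> borel_measurable (borel \<Otimes>\<^sub>M M)" for k by (rule step_process_measurable[OF S])
  note [measurable] = Zm Sm
  have prob0: "(\<lambda>k. prob {\<omega>\<in>space M. ennreal \<delta> < (\<integral>\<^sup>+s\<in>{0..T}. ennreal ((?S k s \<omega> - Z s \<omega>)\<^sup>2) \<partial>lborel)}) \<longlonglongrightarrow> 0"
    if \<delta>: "\<delta> > 0" for \<delta> :: real
  proof -
    let ?G = "\<lambda>k \<omega>. \<integral>\<^sup>+s\<in>{0..T}. ennreal ((?S k s \<omega> - Z s \<omega>)\<^sup>2) \<partial>lborel"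
    have le: "1 \<le> ennreal (1 / \<delta>) * x" if "ennreal \<delta> < x" for x
    proof -
      have "ennreal (1 / \<delta>) * ennreal \<delta> = ennreal (1 / \<delta> * \<delta>)"
        by (rule ennreal_mult[symmetric]) (use \<delta> in auto)
      then have "1 = ennreal (1 / \<delta>) * ennreal \<delta>" using \<delta> by simp
      also have "\<dots> \<le> ennreal (1 / \<delta>) * x" by (rule mult_left_mono) (use that in auto)
      finally show ?thesis .
    qed
    have Markov: "emeasure M {\<omega>\<in>space M. ennreal \<delta> < ?G k \<omega>} \<le> ennreal (1 / \<delta>) * process_distance T (?S k) Z" for k
    proof -
      have "emeasure M {\<omega>\<in>space M. ennreal \<delta> < ?G k \<omega>} \<le> emeasure M {\<omega>\<in>space M. 1 \<le> ennreal (1 / \<delta>) * ?G k \<omega>}"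
      proof (rule emeasure_mono)
        show "{\<omega>\<in>space M. ennreal \<delta> < ?G k \<omega>} \<subseteq> {\<omega>\<in>space M. 1 \<le> ennreal (1 / \<delta>) * ?G k \<omega>}"
          by (rule Collect_mono) (auto intro: le)
      qed measurable
      also have "\<dots> \<le> ennreal (1 / \<delta>) * (\<integral>\<^sup>+\<omega>. ?G k \<omega> * indicator (space M) \<omega> \<partial>M)"
        by (rule nn_integral_Markov_inequality) measurable
      also have "(\<integral>\<^sup>+\<omega>. ?G k \<omega> * indicator (space M) \<omega> \<partial>M) = process_distance T (?S k) Z"
        unfolding process_distance_def by (rule nn_integral_cong) simp
      finally show ?thesis .
    qed
    have "(\<lambda>k. ennreal (1 / \<delta>) * process_distance T (?S k) Z) \<longlonglongrightarrow> ennreal (1 / \<delta>) * 0"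
      by (rule ennreal_tendsto_cmult[OF _ lim]) simp
    then have L: "(\<lambda>k. ennreal (1 / \<delta>) * process_distance T (?S k) Z) \<longlonglongrightarrow> 0" by simp
    have "(\<lambda>k. emeasure M {\<omega>\<in>space M. ennreal \<delta> < ?G k \<omega>}) \<longlonglongrightarrow> 0"
      by (rule tendsto_sandwich[OF _ _ tendsto_const L]) (simp_all add: Markov)
    then have "(\<lambda>k. enn2real (emeasure M {\<omega>\<in>space M. ennreal \<delta> < ?G k \<omega>})) \<longlonglongrightarrow> 0"
      by (intro tendsto_enn2real) simp_all
    then show ?thesis by (simp add: measure_def)
  qed
  have "(\<lambda>k. prob {\<omega>\<in>space M. \<epsilon> < \<bar>?I k \<omega> - Y t \<omega>\<bar>}) \<longlonglongrightarrow> 0" if "\<epsilon> > 0" for \<epsilon>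
    by (rule ito_integral_in_prob[OF ito Z0 Zm S prob0 t that])
  from converge_in_prob_AE_subseq[OF Im Ym this] obtain r where r: "strict_mono r" "AE \<omega> in M. (\<lambda>l. ?I (r l) \<omega>) \<longlonglongrightarrow> Y t \<omega>" .
  have dist: "(\<integral>\<^sup>+\<omega>. ennreal ((?I k \<omega> - ?I l \<omega>)\<^sup>2) \<partial>M) \<le> 2 * process_distance T (?S k) Z + 2 * process_distance T (?S l) Z" for l
  proof -
    have "(\<integral>\<^sup>+\<omega>. ennreal ((?I k \<omega> - ?I l \<omega>)\<^sup>2) \<partial>M) = process_distance t (?S k) (?S l)"
      by (rule step_integral_distance[OF S S sq sq t])
    also have "\<dots> \<le> process_distance T (?S k) (?S l)" using t by (intro process_distance_mono) auto
    also have "\<dots> \<le> 2 * process_distance T (?S k) Z + 2 * process_distance T (?S l) Z"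
      by (rule process_distance_triangle[OF Sm Zm Sm])
    finally show ?thesis .
  qed
  have "(\<integral>\<^sup>+\<omega>. ennreal ((?I k \<omega> - Y t \<omega>)\<^sup>2) \<partial>M) = (\<integral>\<^sup>+\<omega>. liminf (\<lambda>l. ennreal ((?I k \<omega> - ?I (r l) \<omega>)\<^sup>2)) \<partial>M)"
  proof (rule nn_integral_cong_AE)
    show "AE \<omega> in M. ennreal ((?I k \<omega> - Y t \<omega>)\<^sup>2) = liminf (\<lambda>l. ennreal ((?I k \<omega> - ?I (r l) \<omega>)\<^sup>2))"
      using r(2)
    proof eventually_elim
      case (elim \<omega>)
      have "(\<lambda>l. ennreal ((?I k \<omega> - ?I (r l) \<omega>)\<^sup>2)) \<longlonglongrightarrow> ennreal ((?I k \<omega> - Y t \<omega>)\<^sup>2)"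
        by (intro tendsto_ennrealI tendsto_power tendsto_diff tendsto_const elim)
      then show ?case by (rule lim_imp_Liminf[OF sequentially_bot, symmetric])
    qed
  qed
  also have "\<dots> \<le> liminf (\<lambda>l. \<integral>\<^sup>+\<omega>. ennreal ((?I k \<omega> - ?I (r l) \<omega>)\<^sup>2) \<partial>M)"
    by (rule nn_integral_liminf) (use Im in measurable)
  also have "\<dots> \<le> liminf (\<lambda>l. 2 * process_distance T (?S k) Z + 2 * process_distance T (?S (r l)) Z)"
    by (intro Liminf_mono always_eventually allI dist)
  also have "\<dots> = 2 * process_distance T (?S k) Z + 2 * 0"
  proof (rule lim_imp_Liminf[OF sequentially_bot])
    have "(\<lambda>l. process_distance T (?S (r l)) Z) \<longlonglongrightarrow> 0"
      using LIMSEQ_subseq_LIMSEQ[OF lim r(1)] by (simp add: comp_def)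
    from tendsto_add[OF tendsto_const ennreal_tendsto_cmult[OF _ this, of 2]]
    show "(\<lambda>l. 2 * process_distance T (?S k) Z + 2 * process_distance T (?S (r l)) Z) \<longlonglongrightarrow> 2 * process_distance T (?S k) Z + 2 * 0"
      by simp
  qed
  finally show ?thesis by simp
qed

lemma square_dist_diff_tendsto:
  assumes [measurable]: "\<And>k. f k \<in> borel_measurable M" "\<And>k. g k \<in> borel_measurable M"
      "f' \<in> borel_measurable M" "g' \<in> borel_measurable M"
    and f: "(\<lambda>k. \<integral>\<^sup>+\<omega>. ennreal ((f k \<omega> - f' \<omega>)\<^sup>2) \<partial>M) \<longlonglongrightarrow> 0"
    and g: "(\<lambda>k. \<integral>\<^sup>+\<omega>. ennreal ((g k \<omega> - g' \<omega>)\<^sup>2) \<partial>M) \<longlonglongrightarrow> 0"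
  shows "(\<lambda>k. \<integral>\<^sup>+\<omega>. ennreal ((f k \<omega> - g k \<omega> - (f' \<omega> - g' \<omega>))\<^sup>2) \<partial>M) \<longlonglongrightarrow> 0"
proof -
  have eq: "f k \<omega> - g k \<omega> - (f' \<omega> - g' \<omega>) = (f k \<omega> - f' \<omega>) - (g k \<omega> - g' \<omega>)" for k \<omega> by simp
  have le: "(\<integral>\<^sup>+\<omega>. ennreal ((f k \<omega> - g k \<omega> - (f' \<omega> - g' \<omega>))\<^sup>2) \<partial>M)
     \<le> 2 * (\<integral>\<^sup>+\<omega>. ennreal ((f k \<omega> - f' \<omega>)\<^sup>2) \<partial>M) + 2 * (\<integral>\<^sup>+\<omega>. ennreal ((g k \<omega> - g' \<omega>)\<^sup>2) \<partial>M)" for k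
  proof -
    have "(\<integral>\<^sup>+\<omega>. ennreal ((f k \<omega> - g k \<omega> - (f' \<omega> - g' \<omega>))\<^sup>2) \<partial>M) = (\<integral>\<^sup>+\<omega>. ennreal (((f k \<omega> - f' \<omega>) - (g k \<omega> - g' \<omega>))\<^sup>2) \<partial>M)"
      by (rule nn_integral_cong) (subst eq, rule refl)
    also have "\<dots> \<le> 2 * (\<integral>\<^sup>+\<omega>. ennreal ((f k \<omega> - f' \<omega>)\<^sup>2) \<partial>M) + 2 * (\<integral>\<^sup>+\<omega>. ennreal ((g k \<omega> - g' \<omega>)\<^sup>2) \<partial>M)"
      using square_dist_triangle[of "\<lambda>\<omega>. f k \<omega> - f' \<omega>" "\<lambda>_. 0" "\<lambda>\<omega>. g k \<omega> - g' \<omega>"] by simp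
    finally show ?thesis .
  qed
  have 1: "(\<lambda>k. 2 * (\<integral>\<^sup>+\<omega>. ennreal ((f k \<omega> - f' \<omega>)\<^sup>2) \<partial>M)) \<longlonglongrightarrow> 2 * 0"
    by (rule ennreal_tendsto_cmult[OF _ f]) simp
  have 2: "(\<lambda>k. 2 * (\<integral>\<^sup>+\<omega>. ennreal ((g k \<omega> - g' \<omega>)\<^sup>2) \<partial>M)) \<longlonglongrightarrow> 2 * 0"
    by (rule ennreal_tendsto_cmult[OF _ g]) simp
  have lim: "(\<lambda>k. 2 * (\<integral>\<^sup>+\<omega>. ennreal ((f k \<omega> - f' \<omega>)\<^sup>2) \<partial>M) + 2 * (\<integral>\<^sup>+\<omega>. ennreal ((g k \<omega> - g' \<omega>)\<^sup>2) \<partial>M)) \<longlonglongrightarrow> 0"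
    using tendsto_add[OF 1 2] by simp
  show ?thesis
    by (rule tendsto_sandwich[OF _ _ tendsto_const lim]) (simp_all add: le)
qed

lemma ito_integral_square_integrable:
  assumes T: "0 < T" and ito: "ito_integral M F W T Z0 Y" and Z0: "AE \<omega> in M. \<forall>s\<in>{0..T}. Z0 s \<omega> = Z s \<omega>"
    and Zm: "case_prod Z \<in> borel_measurable (borel \<Otimes>\<^sub>M M)"
    and ZF: "\<And>s. s \<in> {0..T} \<Longrightarrow> Z s \<in> borel_measurable (F s)"
    and cont: "\<And>\<omega>. \<omega> \<in> space M \<Longrightarrow> continuous_on {0..T} (\<lambda>s. Z s \<omega>)"
    and fin: "process_distance T Z (\<lambda>_ _. 0) < \<infinity>"
    and t: "t \<in> {0..T}"
  shows "sq_int (Y t)" "(\<integral>\<^sup>+\<omega>. ennreal ((Y t \<omega>)\<^sup>2) \<partial>M) = process_distance t Z (\<lambda>_ _. 0)"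
    "\<And>s f. s \<in> {0..t} \<Longrightarrow> f \<in> borel_measurable (F s) \<Longrightarrow> sq_int f \<Longrightarrow> (\<integral>\<omega>. f \<omega> * (Y t \<omega> - Y s \<omega>) \<partial>M) = 0"
proof -
  obtain n \<tau> H where
    S: "\<And>k::nat. step_integrand T (n k) (\<tau> k) (H k)" and sq: "\<And>k. \<forall>i<n k. sq_int (H k i)"
    and lim: "(\<lambda>k. process_distance T (elementary_process (n k) (\<tau> k) (H k)) Z) \<longlonglongrightarrow> 0"
    by (rule bounded_step_approximation[OF T Zm ZF cont fin]) (assumption | rule that)+
  let ?I = "\<lambda>k. elementary_integral W (n k) (\<tau> k) (H k)" and ?S = "\<lambda>k. elementary_process (n k) (\<tau> k) (H k)"
  have Isq: "sq_int (?I k s)" if "s \<in> {0..T}" for k s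
    using step_integral_isometry(1)[OF S sq] that by simp
  have Im: "?I k s \<in> borel_measurable M" if "s \<in> {0..T}" for k s using sq_int_measurable[OF Isq[OF that]] .
  have Ym: "Y s \<in> borel_measurable M" if "s \<in> {0..T}" for s using ito_integral_measurable[OF ito that] measurable_F_M by blast
  have Sm: "case_prod (?S k) \<in> borel_measurable (borel \<Otimes>\<^sub>M M)" for k by (rule step_process_measurable[OF S])
  have L2: "(\<lambda>k. \<integral>\<^sup>+\<omega>. ennreal ((?I k s \<omega> - Y s \<omega>)\<^sup>2) \<partial>M) \<longlonglongrightarrow> 0" if s: "s \<in> {0..T}" for s
  proof (rule tendsto_sandwich[OF _ _ tendsto_const])
    have "(\<lambda>k. 2 * process_distance T (?S k) Z) \<longlonglongrightarrow> 2 * 0" by (intro ennreal_tendsto_cmult lim) simp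
    then show "(\<lambda>k. 2 * process_distance T (?S k) Z) \<longlonglongrightarrow> 0" by simp
    show "eventually (\<lambda>k. (\<integral>\<^sup>+\<omega>. ennreal ((?I k s \<omega> - Y s \<omega>)\<^sup>2) \<partial>M) \<le> 2 * process_distance T (?S k) Z) sequentially"
      by (intro always_eventually allI ito_integral_approximation[OF ito Z0 Zm S sq lim s])
  qed simp
  have Ysq: "sq_int (Y s)" if s: "s \<in> {0..T}" for s
  proof -
    have "eventually (\<lambda>k. (\<integral>\<^sup>+\<omega>. ennreal ((?I k s \<omega> - Y s \<omega>)\<^sup>2) \<partial>M) < 1) sequentially"
      using order_tendstoD(2)[OF L2[OF s], of 1] by simp
    from eventually_happens'[OF sequentially_bot this]
    obtain k where k: "(\<integral>\<^sup>+\<omega>. ennreal ((?I k s \<omega> - Y s \<omega>)\<^sup>2) \<partial>M) < 1" ..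
    have "sq_int (\<lambda>\<omega>. ?I k s \<omega> - Y s \<omega>)"
      using Im[OF s] Ym[OF s] less_trans[OF k ennreal_one_less_top] by (subst sq_int_iff_nn) auto
    from sq_int_diff[OF Isq[OF s, of k] this] show ?thesis by simp
  qed
  show "sq_int (Y t)" by (rule Ysq[OF t])
  have lim1: "(\<lambda>k. \<integral>\<^sup>+\<omega>. ennreal ((?I k t \<omega>)\<^sup>2) \<partial>M) \<longlonglongrightarrow> (\<integral>\<^sup>+\<omega>. ennreal ((Y t \<omega>)\<^sup>2) \<partial>M)"
    by (rule square_norm_tendsto[OF Im[OF t] Ym[OF t] _ L2[OF t]]) (simp add: sq_int_nn[OF Ysq[OF t]])
  have "t \<le> T" using t by simp
  \<comment> \<open>Folding the isometry reads the norms of the step processes as second moments of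
    their integrals, so \<open>lim1\<close> and \<open>lim2\<close> are limits of one and the same
    sequence.\<close>
  note lim2 = process_norm_tendsto[OF Sm Zm fin lim this, folded step_isometry_nn[OF S sq t]]
  show "(\<integral>\<^sup>+\<omega>. ennreal ((Y t \<omega>)\<^sup>2) \<partial>M) = process_distance t Z (\<lambda>_ _. 0)"
    by (rule LIMSEQ_unique[OF lim1 lim2])
  show "(\<integral>\<omega>. f \<omega> * (Y t \<omega> - Y s \<omega>) \<partial>M) = 0" if s: "s \<in> {0..t}" and f: "f \<in> borel_measurable (F s)" "sq_int f" for s f
  proof -
    have sT: "s \<in> {0..T}" and st: "0 \<le> s" "s \<le> t" using s t by auto
    have "(\<lambda>k. \<integral>\<^sup>+\<omega>. ennreal ((?I k t \<omega> - ?I k s \<omega> - (Y t \<omega> - Y s \<omega>))\<^sup>2) \<partial>M) \<longlonglongrightarrow> 0"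
      by (rule square_dist_diff_tendsto[OF Im[OF t] Im[OF sT] Ym[OF t] Ym[OF sT] L2[OF t] L2[OF sT]])
    then show ?thesis
      by (rule orthogonal_limit[OF f(2) step_integral_martingale(1)[OF S sq st f] sq_int_diff[OF Ysq[OF t] Ysq[OF sT]]])
        (rule step_integral_martingale(2)[OF S sq st f])
  qed
qed

end

section \<open>Energy balance of linear Ito systems\<close>

lemma set_lebesgue_FTC:
  fixes f F :: "real \<Rightarrow> real"
  assumes "a \<le> b" "\<And>x. x \<in> {a..b} \<Longrightarrow> (F has_real_derivative f x) (at x within {a..b})" "continuous_on {a..b} f"
  shows "(LBINT x:{a..b}. f x) = F b - F a"
  unfolding set_lebesgue_integral_def
  by (rule integral_FTC_atLeastAtMost)
    (use assms in \<open>auto simp: has_real_derivative_iff_has_vector_derivative[symmetric]\<close>)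

text \<open>\<open>f\<close> is merely measurable and bounded, so no derivative is taken: with
  \<open>K\<close> the supremum of \<open>f s * exp (- c * s)\<close>, the inequality yields
  \<open>f s * exp (- c * s) \<le> K - (K - a) * exp (- c * s)\<close>. For \<open>K > a\<close> the
  right side stays below \<open>K\<close> by a fixed amount, against the choice of
  \<open>K\<close>.\<close>

lemma gronwall:
  fixes f :: "real \<Rightarrow> real"
  assumes f: "f \<in> borel_measurable borel" and bd: "\<And>t. t \<in> {0..T} \<Longrightarrow> 0 \<le> f t \<and> f t \<le> B"
    and le: "\<And>t. t \<in> {0..T} \<Longrightarrow> f t \<le> a + c * (LBINT s:{0..t}. f s)"
    and a: "0 \<le> a" and c: "0 \<le> c" and t: "t \<in> {0..T}"
  shows "f t \<le> a * exp (c * t)"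
proof -
  define K where "K = (SUP s\<in>{0..T}. f s * exp (- c * s))"
  have T: "0 \<le> T" using t by auto
  have B: "f s * exp (- c * s) \<le> B" if "s \<in> {0..T}" for s
  proof -
    have "f s * exp (- c * s) \<le> f s * 1" using bd[OF that] c that by (intro mult_left_mono) auto
    then show ?thesis using bd[OF that] by simp
  qed
  have bdd: "bdd_above ((\<lambda>s. f s * exp (- c * s)) ` {0..T})" using B by (intro bdd_aboveI[of _ B]) auto
  have fK: "f s \<le> K * exp (c * s)" if "s \<in> {0..T}" for s
  proof -
    have "f s * exp (- c * s) \<le> K" unfolding K_def by (rule cSUP_upper[OF that bdd])
    then have "f s * exp (- c * s) * exp (c * s) \<le> K * exp (c * s)" by (intro mult_right_mono) auto
    then show ?thesis using exp_minus_inverse[of "c * s"] by (simp add: mult.assoc mult.commute[of "exp (- (c * s))"])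
  qed
  have int: "set_integrable lborel {0..s} f" if "s \<in> {0..T}" for s
  proof -
    have "set_integrable lborel {0..s} (\<lambda>_. B)" by (rule borel_integrable_atLeastAtMost') simp
    then have iB: "integrable lborel (\<lambda>r. indicator {0..s} r *\<^sub>R B)" by (simp add: set_integrable_def)
    have le: "norm (indicator {0..s} r *\<^sub>R f r) \<le> norm (indicator {0..s} r *\<^sub>R B)" for r
      using bd[of r] that by (cases "r \<in> {0..s}") auto
    show ?thesis unfolding set_integrable_def
      by (rule Bochner_Integration.integrable_bound[OF iB _ AE_I2[OF le]]) (use f in measurable)
  qed
  have step: "f s * exp (- c * s) \<le> a * exp (- c * s) + K * (1 - exp (- c * s))" if s: "s \<in> {0..T}" for s
  proof -
    have i2: "set_integrable lborel {0..s} (\<lambda>r. K * exp (c * r))"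
      by (intro borel_integrable_atLeastAtMost' continuous_intros)
    have "c * (LBINT r:{0..s}. f r) \<le> c * (LBINT r:{0..s}. K * exp (c * r))"
      by (intro mult_left_mono c set_integral_mono int[OF s] i2 fK) (use s in auto)
    also have "\<dots> = (LBINT r:{0..s}. c * (K * exp (c * r)))" by simp
    also have "\<dots> = K * exp (c * s) - K * exp (c * 0)"
      by (rule set_lebesgue_FTC) (use s in \<open>auto intro!: derivative_eq_intros continuous_intros\<close>)
    finally have "f s \<le> a + K * (exp (c * s) - 1)" using le[OF s] by (simp add: right_diff_distrib)
    then have "f s * exp (- c * s) \<le> (a + K * (exp (c * s) - 1)) * exp (- c * s)" by (intro mult_right_mono) auto
    also have "\<dots> = a * exp (- c * s) + K * (1 - exp (- c * s))"
    proof -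
      have "(a + K * (E - 1)) * e = a * e + K * (1 - e)" if "E * e = 1" for E e :: real
        using that by (simp add: ring_distribs right_diff_distrib mult.assoc)
      then show ?thesis using exp_minus_inverse[of "c * s"] by simp
    qed
    finally show ?thesis .
  qed
  have "K \<le> a"
  proof (rule ccontr)
    assume "\<not> K \<le> a"
    \<comment> \<open>As \<open>exp (- c * s)\<close> is smallest at \<open>s = T\<close>, the gap
      is uniform in \<open>s\<close>.\<close>
    have "K \<le> K - (K - a) * exp (- c * T)"
      unfolding K_def
    proof (rule cSUP_least)
      show "{0..T} \<noteq> {}" using T by simp
      fix s assume s: "s \<in> {0..T}"
      have "exp (- c * T) \<le> exp (- c * s)" using s c by (auto intro: mult_left_mono)
      then have le': "(K - a) * exp (- c * T) \<le> (K - a) * exp (- c * s)" using \<open>\<not> K \<le> a\<close> by (intro mult_left_mono) auto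
      show "f s * exp (- c * s) \<le> (SUP s\<in>{0..T}. f s * exp (- c * s)) - ((SUP s\<in>{0..T}. f s * exp (- c * s)) - a) * exp (- c * T)"
      proof -
        have "a * exp (- c * s) + K * (1 - exp (- c * s)) = K - (K - a) * exp (- c * s)"
          by (simp add: right_diff_distrib left_diff_distrib)
        then show ?thesis
          using step[OF s] le' unfolding K_def[symmetric] by linarith
      qed
    qed
    moreover have "0 < (K - a) * exp (- c * T)" using \<open>\<not> K \<le> a\<close> by simp
    ultimately show False by linarith
  qed
  then have "K * exp (c * t) \<le> a * exp (c * t)" by (intro mult_right_mono) auto
  then show ?thesis using fK[OF t] by linarith
qed

text \<open>Cauchy-Schwarz in the form that the integral of \<open>(g s - m)\<^sup>2\<close> is
  nonnegative, \<open>m\<close> being the mean of \<open>g\<close>; \<open>t = 0\<close> is separate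
  because of the division.\<close>

lemma set_integral_square_le:
  fixes g :: "real \<Rightarrow> real"
  assumes g: "continuous_on {0..t} g" and t: "0 \<le> t"
  shows "(LBINT s:{0..t}. g s)\<^sup>2 \<le> t * (LBINT s:{0..t}. (g s)\<^sup>2)"
proof (cases "t = 0")
  case True
  have "continuous_on {0..0} g" using g True by simp
  from set_borel_integral_eq_integral(2)[OF borel_integrable_atLeastAtMost'[OF this]]
  have "(LBINT s:{0..0}. g s) = 0" by simp
  then show ?thesis using True by simp
next
  case False
  then have t0: "0 < t" using t by simp
  define m where "m = (LBINT s:{0..t}. g s) / t"
  have i1: "set_integrable lborel {0..t} g" by (rule borel_integrable_atLeastAtMost'[OF g])
  have i2: "set_integrable lborel {0..t} (\<lambda>s. (g s)\<^sup>2)" by (intro borel_integrable_atLeastAtMost' continuous_intros g)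
  have i3: "set_integrable lborel {0..t} (\<lambda>s. m\<^sup>2)" by (intro borel_integrable_atLeastAtMost' continuous_intros)
  have i4: "set_integrable lborel {0..t} (\<lambda>s. 2 * m * g s)" using i1 by simp
  have "0 \<le> (LBINT s:{0..t}. (g s - m)\<^sup>2)"
    unfolding set_lebesgue_integral_def by (rule Bochner_Integration.integral_nonneg) simp
  also have "\<dots> = (LBINT s:{0..t}. (g s)\<^sup>2 - 2 * m * g s + m\<^sup>2)"
    by (simp add: power2_diff algebra_simps)
  also have "\<dots> = (LBINT s:{0..t}. (g s)\<^sup>2) - 2 * m * (LBINT s:{0..t}. g s) + (LBINT s:{0..t}. m\<^sup>2)"
    using i1 i2 i3 i4 by (simp add: set_integral_add set_integral_diff)
  also have "(LBINT s:{0..t}. m\<^sup>2) = m\<^sup>2 * t"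
    using t by (simp add: set_lebesgue_integral_def)
  also have "(LBINT s:{0..t}. g s) = m * t" using t0 by (simp add: m_def)
  finally have "m\<^sup>2 * t \<le> (LBINT s:{0..t}. (g s)\<^sup>2)" by (simp add: power2_eq_square algebra_simps)
  then have "t * (m\<^sup>2 * t) \<le> t * (LBINT s:{0..t}. (g s)\<^sup>2)" using t by (intro mult_left_mono) auto
  moreover have "(LBINT s:{0..t}. g s) = m * t" using t0 by (simp add: m_def)
  ultimately show ?thesis by (simp add: power2_eq_square algebra_simps)
qed

lemma set_integral_square_eq:
  fixes g :: "real \<Rightarrow> real"
  assumes g: "continuous_on UNIV g" and t: "0 \<le> t"
  shows "(LBINT s:{0..t}. g s)\<^sup>2 = (LBINT s:{0..t}. 2 * (LBINT r:{0..s}. g r) * g s)"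
proof -
  define A where "A = (\<lambda>s. LBINT r:{0..s}. g r)"
  have gc: "continuous_on S g" for S by (rule continuous_on_subset[OF g]) simp
  have A: "A s = integral {0..s} g" for s
    unfolding A_def by (rule set_borel_integral_eq_integral(2)[OF borel_integrable_atLeastAtMost'[OF gc]])
  have dA: "(A has_real_derivative g s) (at s within {0..t})" if "s \<in> {0..t}" for s
    using integral_has_real_derivative[OF gc that] unfolding A[abs_def] .
  have cA: "continuous_on {0..t} A" by (rule DERIV_continuous_on[OF dA])
  have "(LBINT s:{0..t}. 2 * A s * g s) = (A t)\<^sup>2 - (A 0)\<^sup>2"
  proof (rule set_lebesgue_FTC[OF t])
    show "((\<lambda>s. (A s)\<^sup>2) has_real_derivative 2 * A s * g s) (at s within {0..t})" if "s \<in> {0..t}" for s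
      using dA[OF that] by (auto intro!: derivative_eq_intros)
    show "continuous_on {0..t} (\<lambda>s. 2 * A s * g s)" by (intro continuous_intros cA gc)
  qed
  moreover have "A 0 = 0" by (simp add: A)
  ultimately show ?thesis by (simp add: A_def)
qed

section \<open>Exchange of expectation and time integral, joint measurability\<close>

context prob_space begin

lemma expectation_time_integral:
  fixes G :: "real \<Rightarrow> 'a \<Rightarrow> real"
  assumes G: "case_prod G \<in> borel_measurable (borel \<Otimes>\<^sub>M M)"
    and bd: "\<And>s. s \<in> {0..t} \<Longrightarrow> (\<integral>\<^sup>+\<omega>. ennreal \<bar>G s \<omega>\<bar> \<partial>M) \<le> ennreal K"
  shows "integrable M (\<lambda>\<omega>. LBINT s:{0..t}. G s \<omega>)" "set_integrable lborel {0..t} (\<lambda>s. \<integral>\<omega>. G s \<omega> \<partial>M)"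
    "(\<integral>\<omega>. (LBINT s:{0..t}. G s \<omega>) \<partial>M) = (LBINT s:{0..t}. \<integral>\<omega>. G s \<omega> \<partial>M)"
proof -
  note [measurable] = G
  interpret P: pair_sigma_finite lborel M ..
  let ?h = "\<lambda>(s, \<omega>). indicator {0..t} s * G s \<omega>"
  have int: "integrable (lborel \<Otimes>\<^sub>M M) ?h"
  proof (rule integrableI_bounded)
    show "?h \<in> borel_measurable (lborel \<Otimes>\<^sub>M M)" by measurable
    have "(\<integral>\<^sup>+x. ennreal (norm (?h x)) \<partial>(lborel \<Otimes>\<^sub>M M)) = (\<integral>\<^sup>+s. (\<integral>\<^sup>+\<omega>. ennreal (norm (?h (s, \<omega>))) \<partial>M) \<partial>lborel)"
      by (rule nn_integral_fst[symmetric]) measurable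
    also have "\<dots> \<le> (\<integral>\<^sup>+s. ennreal K * indicator {0..t} s \<partial>lborel)"
      using bd by (intro nn_integral_mono) (auto simp: indicator_def)
    also have "\<dots> < \<infinity>" by (subst nn_integral_cmult_indicator) (auto simp: ennreal_mult_less_top emeasure_lborel_Icc_eq)
    finally show "(\<integral>\<^sup>+x. ennreal (norm (?h x)) \<partial>(lborel \<Otimes>\<^sub>M M)) < \<infinity>" .
  qed
  have eq1: "(\<integral>s. indicator {0..t} s * G s \<omega> \<partial>lborel) = (LBINT s:{0..t}. G s \<omega>)" for \<omega>
    by (simp add: set_lebesgue_integral_def)
  have eq2: "(\<integral>\<omega>. indicator {0..t} s * G s \<omega> \<partial>M) = indicator {0..t} s *\<^sub>R (\<integral>\<omega>. G s \<omega> \<partial>M)" for s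
    by (simp add: indicator_def)
  show "integrable M (\<lambda>\<omega>. LBINT s:{0..t}. G s \<omega>)"
    using P.integrable_snd[OF int] unfolding eq1 .
  show "set_integrable lborel {0..t} (\<lambda>s. \<integral>\<omega>. G s \<omega> \<partial>M)"
    using P.integrable_fst[OF int] unfolding eq2 set_integrable_def .
  show "(\<integral>\<omega>. (LBINT s:{0..t}. G s \<omega>) \<partial>M) = (LBINT s:{0..t}. \<integral>\<omega>. G s \<omega> \<partial>M)"
    using P.Fubini_integral[OF int] unfolding eq1 eq2 set_lebesgue_integral_def[symmetric] .
qed

text \<open>Rounding time down to multiples of \<open>1 / (n + 1)\<close> leaves countably many
  times, so the rounded process is jointly measurable; continuity of the paths makes it converge
  pointwise.\<close>

lemma continuous_process_measurable:
  fixes V :: "real \<Rightarrow> 'a \<Rightarrow> real"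
  assumes V: "\<And>s. V s \<in> borel_measurable M" and cont: "\<And>\<omega>. \<omega> \<in> space M \<Longrightarrow> continuous_on UNIV (\<lambda>s. V s \<omega>)"
  shows "case_prod V \<in> borel_measurable (borel \<Otimes>\<^sub>M M)"
proof -
  define u where "u = (\<lambda>(n::nat) (x :: real \<times> 'a). V (of_int \<lfloor>fst x * real (Suc n)\<rfloor> / real (Suc n)) (snd x))"
  have u_meas: "u n \<in> borel_measurable (borel \<Otimes>\<^sub>M M)" for n
    unfolding u_def
  proof (rule measurable_compose_countable[where f="\<lambda>i x. V (of_int i / real (Suc n)) (snd x)"])
    show "(\<lambda>x. V (of_int i / real (Suc n)) (snd x)) \<in> borel_measurable (borel \<Otimes>\<^sub>M M)" for i :: int
      using V by measurable
    show "(\<lambda>x. \<lfloor>fst x * real (Suc n)\<rfloor>) \<in> measurable (borel \<Otimes>\<^sub>M M) (count_space UNIV)" by measurable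
  qed
  have lim: "(\<lambda>n. u n x) \<longlonglongrightarrow> case_prod V x" if x: "x \<in> space (borel \<Otimes>\<^sub>M M)" for x
  proof -
  have \<omega>: "snd x \<in> space M" using x by (auto simp: space_pair_measure)
  have "(\<lambda>n. of_int \<lfloor>fst x * real (Suc n)\<rfloor> / real (Suc n)) \<longlonglongrightarrow> fst x"
  proof (rule tendsto_sandwich)
    show "eventually (\<lambda>n. fst x - 1 / real (Suc n) \<le> of_int \<lfloor>fst x * real (Suc n)\<rfloor> / real (Suc n)) sequentially"
    proof (intro always_eventually allI)
      fix n
      have "fst x * real (Suc n) - 1 \<le> of_int \<lfloor>fst x * real (Suc n)\<rfloor>" by linarith
      then have "(fst x * real (Suc n) - 1) / real (Suc n) \<le> of_int \<lfloor>fst x * real (Suc n)\<rfloor> / real (Suc n)"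
        by (intro divide_right_mono) auto
      then show "fst x - 1 / real (Suc n) \<le> of_int \<lfloor>fst x * real (Suc n)\<rfloor> / real (Suc n)"
        by (simp add: diff_divide_distrib del: of_nat_Suc)
    qed
    show "eventually (\<lambda>n. of_int \<lfloor>fst x * real (Suc n)\<rfloor> / real (Suc n) \<le> fst x) sequentially"
    proof (intro always_eventually allI)
      fix n
      have "of_int \<lfloor>fst x * real (Suc n)\<rfloor> / real (Suc n) \<le> fst x * real (Suc n) / real (Suc n)"
        by (intro divide_right_mono) auto
      then show "of_int \<lfloor>fst x * real (Suc n)\<rfloor> / real (Suc n) \<le> fst x" by (simp del: of_nat_Suc)
    qed
    have "(\<lambda>n. fst x - 1 / real (Suc n)) \<longlonglongrightarrow> fst x - 0"
      using LIMSEQ_inverse_real_of_nat by (intro tendsto_diff tendsto_const) (simp add: inverse_eq_divide)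
    then show "(\<lambda>n. fst x - 1 / real (Suc n)) \<longlonglongrightarrow> fst x" by simp
  qed simp
  moreover have "isCont (\<lambda>s. V s (snd x)) (fst x)" using cont[OF \<omega>] by (simp add: continuous_on_eq_continuous_at)
  ultimately have "(\<lambda>n. V (of_int \<lfloor>fst x * real (Suc n)\<rfloor> / real (Suc n)) (snd x)) \<longlonglongrightarrow> V (fst x) (snd x)"
    by (rule isCont_tendsto_compose[of "fst x" "\<lambda>s. V s (snd x)", rotated])
  then show ?thesis by (simp add: u_def split_beta')
  qed
  show ?thesis by (rule borel_measurable_LIMSEQ_real[OF lim u_meas])
qed

end

context brownian_motion begin

text \<open>Measurability is required for all real times and path continuity for all sample points,
  which gives joint measurability without exceptional sets; adaptedness concerns
  \<open>[0,T]\<close> only.\<close>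

definition regular_process :: "real \<Rightarrow> (real \<Rightarrow> 'w \<Rightarrow> real) \<Rightarrow> bool" where
  "regular_process T V \<longleftrightarrow> (\<forall>s. V s \<in> borel_measurable M) \<and> (\<forall>s\<in>{0..T}. V s \<in> borel_measurable (F s)) \<and>
     (\<forall>\<omega>\<in>space M. continuous_on UNIV (\<lambda>s. V s \<omega>))"

lemma regular_processD:
  assumes "regular_process T V"
  shows "case_prod V \<in> borel_measurable (borel \<Otimes>\<^sub>M M)" "V s \<in> borel_measurable M"
    "s \<in> {0..T} \<Longrightarrow> V s \<in> borel_measurable (F s)" "\<omega> \<in> space M \<Longrightarrow> continuous_on S (\<lambda>s. V s \<omega>)"
proof -
  show "case_prod V \<in> borel_measurable (borel \<Otimes>\<^sub>M M)"
    by (rule continuous_process_measurable) (use assms in \<open>auto simp: regular_process_def\<close>)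
  show "\<omega> \<in> space M \<Longrightarrow> continuous_on S (\<lambda>s. V s \<omega>)"
    using assms by (auto simp: regular_process_def intro: continuous_on_subset[of UNIV])
qed (use assms in \<open>auto simp: regular_process_def\<close>)

lemma sq_int_regular:
  assumes "regular_process T V" "(\<integral>\<^sup>+\<omega>. ennreal ((V s \<omega>)\<^sup>2) \<partial>M) \<le> ennreal K"
  shows "sq_int (V s)"
proof (subst sq_int_iff_nn)
  show "(\<integral>\<^sup>+\<omega>. ennreal ((V s \<omega>)\<^sup>2) \<partial>M) < \<infinity>"
    by (rule le_less_trans[OF assms(2)]) simp
qed (rule regular_processD[OF assms(1)])

lemma nn_integral_abs_mult_le:
  assumes [measurable]: "f \<in> borel_measurable M" "g \<in> borel_measurable M"
    and f: "(\<integral>\<^sup>+\<omega>. ennreal ((f \<omega>)\<^sup>2) \<partial>M) \<le> ennreal K" and g: "(\<integral>\<^sup>+\<omega>. ennreal ((g \<omega>)\<^sup>2) \<partial>M) \<le> ennreal L"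
    and KL: "0 \<le> K" "0 \<le> L"
  shows "(\<integral>\<^sup>+\<omega>. ennreal \<bar>f \<omega> * g \<omega>\<bar> \<partial>M) \<le> ennreal (K + L)"
proof -
  have le: "\<bar>a * b\<bar> \<le> a\<^sup>2 + b\<^sup>2" for a b :: real
  proof -
    have "2 * \<bar>a * b\<bar> \<le> a\<^sup>2 + b\<^sup>2"
      using sum_squares_bound[of "\<bar>a\<bar>" "\<bar>b\<bar>"] by (simp add: abs_mult)
    then show ?thesis using abs_ge_zero[of "a * b"] by linarith
  qed
  have "(\<integral>\<^sup>+\<omega>. ennreal \<bar>f \<omega> * g \<omega>\<bar> \<partial>M) \<le> (\<integral>\<^sup>+\<omega>. ennreal ((f \<omega>)\<^sup>2) + ennreal ((g \<omega>)\<^sup>2) \<partial>M)"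
    by (rule nn_integral_mono) (simp add: le flip: ennreal_plus)
  also have "\<dots> = (\<integral>\<^sup>+\<omega>. ennreal ((f \<omega>)\<^sup>2) \<partial>M) + (\<integral>\<^sup>+\<omega>. ennreal ((g \<omega>)\<^sup>2) \<partial>M)"
    by (rule nn_integral_add) measurable
  also have "\<dots> \<le> ennreal K + ennreal L" by (intro add_mono f g)
  finally show ?thesis using KL by simp
qed

lemma process_distance_swap:
  assumes [measurable]: "case_prod G \<in> borel_measurable (borel \<Otimes>\<^sub>M M)"
  shows "process_distance t G (\<lambda>_ _. 0) = (\<integral>\<^sup>+s\<in>{0..t}. (\<integral>\<^sup>+\<omega>. ennreal ((G s \<omega>)\<^sup>2) \<partial>M) \<partial>lborel)"
proof -
  interpret P: pair_sigma_finite lborel M ..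
  have "process_distance t G (\<lambda>_ _. 0) = (\<integral>\<^sup>+\<omega>. (\<integral>\<^sup>+s. ennreal ((G s \<omega>)\<^sup>2) * indicator {0..t} s \<partial>lborel) \<partial>M)"
    by (simp add: process_distance_def)
  also have "\<dots> = (\<integral>\<^sup>+s. (\<integral>\<^sup>+\<omega>. ennreal ((G s \<omega>)\<^sup>2) * indicator {0..t} s \<partial>M) \<partial>lborel)"
    by (rule P.Fubini') measurable
  also have "\<dots> = (\<integral>\<^sup>+s\<in>{0..t}. (\<integral>\<^sup>+\<omega>. ennreal ((G s \<omega>)\<^sup>2) \<partial>M) \<partial>lborel)"
    by (intro nn_integral_cong nn_integral_multc) measurable
  finally show ?thesis .
qed

lemma process_distance_le:
  assumes "case_prod G \<in> borel_measurable (borel \<Otimes>\<^sub>M M)" "0 \<le> t"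
    and "\<And>s. s \<in> {0..t} \<Longrightarrow> (\<integral>\<^sup>+\<omega>. ennreal ((G s \<omega>)\<^sup>2) \<partial>M) \<le> ennreal K"
  shows "process_distance t G (\<lambda>_ _. 0) \<le> ennreal (K * t)"
proof -
  have "process_distance t G (\<lambda>_ _. 0) \<le> (\<integral>\<^sup>+s\<in>{0..t}. ennreal K \<partial>lborel)"
    unfolding process_distance_swap[OF assms(1)]
    by (rule nn_integral_mono) (use assms(3) in \<open>auto simp: indicator_def\<close>)
  also have "\<dots> = ennreal K * ennreal t" using assms(2) by (subst nn_integral_cmult_indicator) auto
  finally show ?thesis using assms(2) by (simp add: ennreal_mult'')
qed

lemma time_integral_measurable:
  assumes D: "regular_process T D"
  shows "case_prod (\<lambda>t \<omega>. LBINT s:{0..t}. D s \<omega>) \<in> borel_measurable (borel \<Otimes>\<^sub>M M)"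
proof -
  note [measurable] = regular_processD(1)[OF D]
  \<comment> \<open>The moving domain of integration is turned into a factor of the integrand that
    is jointly measurable in both times.\<close>
  have "case_prod (\<lambda>t \<omega>. LBINT s:{0..t}. D s \<omega>) = (\<lambda>x. \<integral>s. of_bool (0 \<le> s \<and> s \<le> fst x) * D s (snd x) \<partial>lborel)"
    unfolding set_lebesgue_integral_def
    by (intro ext) (auto simp: split_beta' indicator_def intro!: Bochner_Integration.integral_cong)
  also have "\<dots> \<in> borel_measurable (borel \<Otimes>\<^sub>M M)" by measurable
  finally show ?thesis .
qed

lemma time_integral_square_le:
  assumes D: "regular_process T D" and t: "t \<in> {0..T}"
    and bd: "\<And>s. s \<in> {0..t} \<Longrightarrow> (\<integral>\<^sup>+\<omega>. ennreal ((D s \<omega>)\<^sup>2) \<partial>M) \<le> ennreal K"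
  shows "(\<integral>\<^sup>+\<omega>. ennreal ((LBINT s:{0..t}. D s \<omega>)\<^sup>2) \<partial>M) \<le> ennreal (t * (K * t))"
proof -
  note Dm = regular_processD(1)[OF D]
  have t0: "0 \<le> t" using t by simp
  have "(\<integral>\<^sup>+\<omega>. ennreal ((LBINT s:{0..t}. D s \<omega>)\<^sup>2) \<partial>M) \<le> (\<integral>\<^sup>+\<omega>. ennreal t * (\<integral>\<^sup>+s\<in>{0..t}. ennreal ((D s \<omega> - 0)\<^sup>2) \<partial>lborel) \<partial>M)"
  proof (rule nn_integral_mono)
    fix \<omega> assume \<omega>: "\<omega> \<in> space M"
    have c: "continuous_on {0..t} (\<lambda>s. D s \<omega>)" by (rule regular_processD(4)[OF D \<omega>])
    have i: "set_integrable lborel {0..t} (\<lambda>s. (D s \<omega>)\<^sup>2)" by (intro borel_integrable_atLeastAtMost' continuous_intros c)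
    have "ennreal ((LBINT s:{0..t}. D s \<omega>)\<^sup>2) \<le> ennreal (t * (LBINT s:{0..t}. (D s \<omega>)\<^sup>2))"
      by (rule ennreal_leI[OF set_integral_square_le[OF c t0]])
    also have "\<dots> = ennreal t * ennreal (LBINT s:{0..t}. (D s \<omega>)\<^sup>2)" using t0 by (simp add: ennreal_mult')
    also have "ennreal (LBINT s:{0..t}. (D s \<omega>)\<^sup>2) = (\<integral>\<^sup>+s. ennreal (indicator {0..t} s *\<^sub>R (D s \<omega>)\<^sup>2) \<partial>lborel)"
      unfolding set_lebesgue_integral_def
      by (rule nn_integral_eq_integral[symmetric]) (use i in \<open>auto simp: set_integrable_def\<close>)
    also have "\<dots> = (\<integral>\<^sup>+s\<in>{0..t}. ennreal ((D s \<omega> - 0)\<^sup>2) \<partial>lborel)"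
      by (rule nn_integral_cong) (simp add: indicator_def)
    finally show "ennreal ((LBINT s:{0..t}. D s \<omega>)\<^sup>2) \<le> ennreal t * (\<integral>\<^sup>+s\<in>{0..t}. ennreal ((D s \<omega> - 0)\<^sup>2) \<partial>lborel)" .
  qed
  also have "\<dots> = ennreal t * process_distance t D (\<lambda>_ _. 0)"
    unfolding process_distance_def
  proof (rule nn_integral_cmult)
    note [measurable] = Dm
    show "(\<lambda>\<omega>. \<integral>\<^sup>+s\<in>{0..t}. ennreal ((D s \<omega> - 0)\<^sup>2) \<partial>lborel) \<in> borel_measurable M" by measurable
  qed
  also have "\<dots> \<le> ennreal t * ennreal (K * t)"
    by (intro mult_left_mono process_distance_le[OF Dm t0 bd]) simp_all
  finally show ?thesis using t0 by (simp add: ennreal_mult')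
qed

lemma expectation_product_time_integral:
  fixes G H :: "real \<Rightarrow> 'w \<Rightarrow> real"
  assumes G: "case_prod G \<in> borel_measurable (borel \<Otimes>\<^sub>M M)" and H: "case_prod H \<in> borel_measurable (borel \<Otimes>\<^sub>M M)"
    and g: "\<And>s. s \<in> {0..t} \<Longrightarrow> (\<integral>\<^sup>+\<omega>. ennreal ((G s \<omega>)\<^sup>2) \<partial>M) \<le> ennreal K"
    and h: "\<And>s. s \<in> {0..t} \<Longrightarrow> (\<integral>\<^sup>+\<omega>. ennreal ((H s \<omega>)\<^sup>2) \<partial>M) \<le> ennreal L"
    and KL: "0 \<le> K" "0 \<le> L"
  shows "integrable M (\<lambda>\<omega>. LBINT s:{0..t}. G s \<omega> * H s \<omega>)" "set_integrable lborel {0..t} (\<lambda>s. \<integral>\<omega>. G s \<omega> * H s \<omega> \<partial>M)"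
    "(\<integral>\<omega>. (LBINT s:{0..t}. G s \<omega> * H s \<omega>) \<partial>M) = (LBINT s:{0..t}. \<integral>\<omega>. G s \<omega> * H s \<omega> \<partial>M)"
proof -
  note [measurable] = G H
  have m: "case_prod (\<lambda>s \<omega>. G s \<omega> * H s \<omega>) \<in> borel_measurable (borel \<Otimes>\<^sub>M M)" unfolding split_beta' by measurable
  have b: "(\<integral>\<^sup>+\<omega>. ennreal \<bar>G s \<omega> * H s \<omega>\<bar> \<partial>M) \<le> ennreal (K + L)" if "s \<in> {0..t}" for s
    by (rule nn_integral_abs_mult_le[OF _ _ g[OF that] h[OF that] KL]) measurable
  note E = expectation_time_integral[of "\<lambda>s \<omega>. G s \<omega> * H s \<omega>" t "K + L", OF m b]
  show "integrable M (\<lambda>\<omega>. LBINT s:{0..t}. G s \<omega> * H s \<omega>)" "set_integrable lborel {0..t} (\<lambda>s. \<integral>\<omega>. G s \<omega> * H s \<omega> \<partial>M)"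
    "(\<integral>\<omega>. (LBINT s:{0..t}. G s \<omega> * H s \<omega>) \<partial>M) = (LBINT s:{0..t}. \<integral>\<omega>. G s \<omega> * H s \<omega> \<partial>M)"
    using E by auto
qed

text \<open>Ito's formula for the square, in expectation: with \<open>A\<close> the integral of \<open>D\<close>, expand
  \<open>(x + A - Y)\<^sup>2\<close> and use the isometry for \<open>Y\<^sup>2\<close>, \<open>A\<^sup>2 = 2 \<integral> A D\<close>, and the martingale property in the
  form \<open>\<E>[A t * Y t] = \<integral> \<E>[D s * Y t] ds = \<integral> \<E>[D s * Y s] ds\<close>.\<close>

lemma energy_identity_expectation:
  assumes T: "0 < T" and U: "regular_process T U" and D: "regular_process T D" and Q: "regular_process T Q"
    and ito: "ito_integral M F W T Z0 Y" and Z0: "AE \<omega> in M. \<forall>s\<in>{0..T}. Z0 s \<omega> = Q s \<omega>"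
    and eq: "\<And>t. t \<in> {0..T} \<Longrightarrow> AE \<omega> in M. U t \<omega> = x + (LBINT s:{0..t}. D s \<omega>) - Y t \<omega>"
    and bU: "\<And>s. s \<in> {0..T} \<Longrightarrow> (\<integral>\<^sup>+\<omega>. ennreal ((U s \<omega>)\<^sup>2) \<partial>M) \<le> ennreal K"
    and bD: "\<And>s. s \<in> {0..T} \<Longrightarrow> (\<integral>\<^sup>+\<omega>. ennreal ((D s \<omega>)\<^sup>2) \<partial>M) \<le> ennreal K"
    and bQ: "\<And>s. s \<in> {0..T} \<Longrightarrow> (\<integral>\<^sup>+\<omega>. ennreal ((Q s \<omega>)\<^sup>2) \<partial>M) \<le> ennreal K"
    and K: "0 \<le> K" and t: "t \<in> {0..T}"
  shows "set_integrable lborel {0..t} (\<lambda>s. \<integral>\<omega>. U s \<omega> * D s \<omega> \<partial>M)" "set_integrable lborel {0..t} (\<lambda>s. \<integral>\<omega>. Q s \<omega> * Q s \<omega> \<partial>M)"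
    "(\<integral>\<omega>. (U t \<omega>)\<^sup>2 \<partial>M) = x\<^sup>2 + 2 * (LBINT s:{0..t}. \<integral>\<omega>. U s \<omega> * D s \<omega> \<partial>M) + (LBINT s:{0..t}. \<integral>\<omega>. Q s \<omega> * Q s \<omega> \<partial>M)"
proof -
  have t0: "0 \<le> t" and tT: "t \<le> T" using t by auto
  have sub: "s \<in> {0..T}" if "s \<in> {0..t}" for s using that tT by auto
  define A where "A = (\<lambda>s \<omega>. LBINT r:{0..s}. D r \<omega>)"
  note Um = regular_processD(1)[OF U] and Dm = regular_processD(1)[OF D] and Qm = regular_processD(1)[OF Q]
  have Am: "case_prod A \<in> borel_measurable (borel \<Otimes>\<^sub>M M)" unfolding A_def by (rule time_integral_measurable[OF D])
  note [measurable] = Um Dm Qm Am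
  define L where "L = T * (K * T)"
  have L0: "0 \<le> L" using T K by (simp add: L_def)
  have bA: "(\<integral>\<^sup>+\<omega>. ennreal ((A s \<omega>)\<^sup>2) \<partial>M) \<le> ennreal L" if s: "s \<in> {0..T}" for s
  proof -
    have "(\<integral>\<^sup>+\<omega>. ennreal ((A s \<omega>)\<^sup>2) \<partial>M) \<le> ennreal (s * (K * s))"
      unfolding A_def by (rule time_integral_square_le[OF D s]) (use bD s in auto)
    also have "\<dots> \<le> ennreal L" unfolding L_def using s T K by (intro ennreal_leI mult_mono) auto
    finally show ?thesis .
  qed
  have sqU: "sq_int (U s)" and sqD: "sq_int (D s)" and sqQ: "sq_int (Q s)" if "s \<in> {0..T}" for s
    using sq_int_regular[OF U bU[OF that]] sq_int_regular[OF D bD[OF that]] sq_int_regular[OF Q bQ[OF that]] by auto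
  have sqA: "sq_int (A s)" if "s \<in> {0..T}" for s
  proof (subst sq_int_iff_nn)
    show "(\<integral>\<^sup>+\<omega>. ennreal ((A s \<omega>)\<^sup>2) \<partial>M) < \<infinity>" by (rule le_less_trans[OF bA[OF that]]) simp
  qed measurable
  have fin: "process_distance T Q (\<lambda>_ _. 0) < \<infinity>"
    by (rule le_less_trans[OF process_distance_le[OF Qm _ bQ]]) (use T in auto)
  note ito_sq = ito_integral_square_integrable[OF T ito Z0 Qm regular_processD(3)[OF Q] regular_processD(4)[OF Q] fin]
  have sqY: "sq_int (Y s)" if "s \<in> {0..T}" for s by (rule ito_sq(1)) (use that in auto)
  have T0: "0 \<in> {0..T}" using T by simp
  \<comment> \<open>The definition of the integral does not mention its initial value; the isometry
    at time 0 determines it.\<close>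
  have Y0: "AE \<omega> in M. Y 0 \<omega> = 0"
  proof -
    have "(\<integral>\<^sup>+\<omega>. ennreal ((Y 0 \<omega>)\<^sup>2) \<partial>M) = process_distance 0 Q (\<lambda>_ _. 0)" by (rule ito_sq(2)) (use T in auto)
    also have "\<dots> \<le> ennreal (K * 0)" by (rule process_distance_le[OF Qm]) (use bQ T in auto)
    finally have "(\<integral>\<^sup>+\<omega>. ennreal ((Y 0 \<omega>)\<^sup>2) \<partial>M) = 0" by simp
    then have "AE \<omega> in M. ennreal ((Y 0 \<omega>)\<^sup>2) = 0"
      using sq_int_measurable[OF sqY[OF T0]] by (subst (asm) nn_integral_0_iff_AE) auto
    then show ?thesis by eventually_elim simp
  qed
  have mart: "(\<integral>\<omega>. f \<omega> * Y t \<omega> \<partial>M) = (\<integral>\<omega>. f \<omega> * Y s \<omega> \<partial>M)" if s: "s \<in> {0..t}" and f: "f \<in> borel_measurable (F s)" "sq_int f" for s f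
  proof -
    have "(\<integral>\<omega>. f \<omega> * (Y t \<omega> - Y s \<omega>) \<partial>M) = 0" by (rule ito_sq(3)[OF _ _ t s f]) auto
    then show ?thesis using sq_int_mult[OF f(2) sqY[OF t]] sq_int_mult[OF f(2) sqY[OF sub[OF s]]]
      by (simp add: right_diff_distrib)
  qed
  have EY: "(\<integral>\<omega>. Y t \<omega> \<partial>M) = 0"
  proof -
    have "(\<integral>\<omega>. 1 * Y t \<omega> \<partial>M) = (\<integral>\<omega>. 1 * Y 0 \<omega> \<partial>M)" by (rule mart) (use t0 sq_int_const in auto)
    also have "\<dots> = (\<integral>\<omega>. 0 \<partial>M)" by (rule integral_cong_AE) (use Y0 sq_int_measurable[OF sqY[OF T0]] in auto)
    finally show ?thesis by simp
  qed
  have b1: "(\<integral>\<^sup>+\<omega>. ennreal ((1::real)\<^sup>2) \<partial>M) \<le> ennreal 1" by (simp add: emeasure_space_1)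
  have m1: "case_prod (\<lambda>_ _. 1::real) \<in> borel_measurable (borel \<Otimes>\<^sub>M M)" by simp
  note e1 = expectation_product_time_integral[OF m1 Dm b1 bD[OF sub] zero_le_one K]
  note eAD = expectation_product_time_integral[OF Am Dm bA[OF sub] bD[OF sub] L0 K]
  note eUD = expectation_product_time_integral[OF Um Dm bU[OF sub] bD[OF sub] K K]
  note eQQ = expectation_product_time_integral[OF Qm Qm bQ[OF sub] bQ[OF sub] K K]
  obtain LY where LY: "(\<integral>\<^sup>+\<omega>. ennreal ((Y t \<omega>)\<^sup>2) \<partial>M) \<le> ennreal LY" "0 \<le> LY"
    using sq_int_nn[OF sqY[OF t]] by (intro that[of "\<integral>\<omega>. (Y t \<omega>)\<^sup>2 \<partial>M"]) auto
  \<comment> \<open>\<open>Y t\<close> is treated as a process constant in time, so that the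
    expectation of \<open>A t * Y t\<close> becomes the time integral of those of
    \<open>D s * Y t\<close>.\<close>
  have Ym: "case_prod (\<lambda>_. Y t) \<in> borel_measurable (borel \<Otimes>\<^sub>M M)"
    using sq_int_measurable[OF sqY[OF t]] unfolding split_beta' by measurable
  note eDY = expectation_product_time_integral[OF Dm Ym bD[OF sub] LY(1) K LY(2)]
  show iUD: "set_integrable lborel {0..t} (\<lambda>s. \<integral>\<omega>. U s \<omega> * D s \<omega> \<partial>M)" by (rule eUD(2))
  show iQQ: "set_integrable lborel {0..t} (\<lambda>s. \<integral>\<omega>. Q s \<omega> * Q s \<omega> \<partial>M)" by (rule eQQ(2))
  have EA: "(\<integral>\<omega>. A t \<omega> \<partial>M) = (LBINT s:{0..t}. \<integral>\<omega>. D s \<omega> \<partial>M)"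
    using e1(3) by (simp add: A_def)
  have iD: "set_integrable lborel {0..t} (\<lambda>s. \<integral>\<omega>. D s \<omega> \<partial>M)" using e1(2) by simp
  have EAA: "(\<integral>\<omega>. (A t \<omega>)\<^sup>2 \<partial>M) = 2 * (LBINT s:{0..t}. \<integral>\<omega>. A s \<omega> * D s \<omega> \<partial>M)"
  proof -
    have "(\<integral>\<omega>. (A t \<omega>)\<^sup>2 \<partial>M) = (\<integral>\<omega>. 2 * (LBINT s:{0..t}. A s \<omega> * D s \<omega>) \<partial>M)"
    proof (rule Bochner_Integration.integral_cong[OF refl])
      fix \<omega> assume "\<omega> \<in> space M"
      have "(A t \<omega>)\<^sup>2 = (LBINT s:{0..t}. 2 * A s \<omega> * D s \<omega>)"
        unfolding A_def by (rule set_integral_square_eq[OF regular_processD(4)[OF D \<open>\<omega> \<in> space M\<close>] t0])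
      then show "(A t \<omega>)\<^sup>2 = 2 * (LBINT s:{0..t}. A s \<omega> * D s \<omega>)" by (simp add: mult.assoc)
    qed
    also have "\<dots> = 2 * (LBINT s:{0..t}. \<integral>\<omega>. A s \<omega> * D s \<omega> \<partial>M)" using eAD(1,3) by simp
    finally show ?thesis .
  qed
  have EAY: "(\<integral>\<omega>. A t \<omega> * Y t \<omega> \<partial>M) = (LBINT s:{0..t}. \<integral>\<omega>. D s \<omega> * Y t \<omega> \<partial>M)"
    using eDY(3) by (simp add: A_def)
  \<comment> \<open>The martingale property moves \<open>Y t\<close> back to time \<open>s\<close>,
    where the equation expresses it as \<open>x + A s - U s\<close>. This is how the product
    \<open>U s * D s\<close> enters.\<close>
  have EDY: "(\<integral>\<omega>. D s \<omega> * Y t \<omega> \<partial>M) = x * (\<integral>\<omega>. D s \<omega> \<partial>M) + (\<integral>\<omega>. A s \<omega> * D s \<omega> \<partial>M) - (\<integral>\<omega>. U s \<omega> * D s \<omega> \<partial>M)"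
    if s: "s \<in> {0..t}" for s
  proof -
    have sT: "s \<in> {0..T}" using sub[OF s] .
    have "(\<integral>\<omega>. D s \<omega> * Y t \<omega> \<partial>M) = (\<integral>\<omega>. D s \<omega> * Y s \<omega> \<partial>M)"
      by (rule mart[OF s regular_processD(3)[OF D sT] sqD[OF sT]])
    also have "\<dots> = (\<integral>\<omega>. x * D s \<omega> + A s \<omega> * D s \<omega> - U s \<omega> * D s \<omega> \<partial>M)"
    proof (rule integral_cong_AE)
      show "(\<lambda>\<omega>. D s \<omega> * Y s \<omega>) \<in> borel_measurable M"
        using sq_int_measurable[OF sqY[OF sT]] by measurable
      show "AE \<omega> in M. D s \<omega> * Y s \<omega> = x * D s \<omega> + A s \<omega> * D s \<omega> - U s \<omega> * D s \<omega>"
        using eq[OF sT]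
      proof eventually_elim
        case (elim \<omega>)
        then have "Y s \<omega> = x + A s \<omega> - U s \<omega>" by (simp add: A_def)
        then show ?case by (simp add: ring_distribs mult.commute)
      qed
    qed measurable
    also have "\<dots> = x * (\<integral>\<omega>. D s \<omega> \<partial>M) + (\<integral>\<omega>. A s \<omega> * D s \<omega> \<partial>M) - (\<integral>\<omega>. U s \<omega> * D s \<omega> \<partial>M)"
      using sq_int_integrable[OF sqD[OF sT]] sq_int_mult[OF sqA[OF sT] sqD[OF sT]] sq_int_mult[OF sqU[OF sT] sqD[OF sT]] by simp
    finally show ?thesis .
  qed
  have EAY': "(\<integral>\<omega>. A t \<omega> * Y t \<omega> \<partial>M) = x * (LBINT s:{0..t}. \<integral>\<omega>. D s \<omega> \<partial>M) + (LBINT s:{0..t}. \<integral>\<omega>. A s \<omega> * D s \<omega> \<partial>M)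
    - (LBINT s:{0..t}. \<integral>\<omega>. U s \<omega> * D s \<omega> \<partial>M)"
  proof -
    have "(LBINT s:{0..t}. \<integral>\<omega>. D s \<omega> * Y t \<omega> \<partial>M) = (LBINT s:{0..t}. x * (\<integral>\<omega>. D s \<omega> \<partial>M) + (\<integral>\<omega>. A s \<omega> * D s \<omega> \<partial>M) - (\<integral>\<omega>. U s \<omega> * D s \<omega> \<partial>M))"
      by (rule set_lebesgue_integral_cong) (use EDY in auto)
    also have "\<dots> = x * (LBINT s:{0..t}. \<integral>\<omega>. D s \<omega> \<partial>M) + (LBINT s:{0..t}. \<integral>\<omega>. A s \<omega> * D s \<omega> \<partial>M)
    - (LBINT s:{0..t}. \<integral>\<omega>. U s \<omega> * D s \<omega> \<partial>M)"
      using iD eAD(2) iUD by simp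
    finally show ?thesis using EAY by simp
  qed
  have EYY: "(\<integral>\<omega>. (Y t \<omega>)\<^sup>2 \<partial>M) = (LBINT s:{0..t}. \<integral>\<omega>. Q s \<omega> * Q s \<omega> \<partial>M)"
  proof -
    have Qi: "(\<integral>\<^sup>+s\<in>{0..t}. ennreal ((Q s \<omega> - 0)\<^sup>2) \<partial>lborel) = ennreal (LBINT s:{0..t}. Q s \<omega> * Q s \<omega>)" if \<omega>: "\<omega> \<in> space M" for \<omega>
    proof -
      have "set_integrable lborel {0..t} (\<lambda>s. Q s \<omega> * Q s \<omega>)"
        by (intro borel_integrable_atLeastAtMost' continuous_intros regular_processD(4)[OF Q \<omega>])
      then have "(\<integral>\<^sup>+s. ennreal (indicator {0..t} s *\<^sub>R (Q s \<omega> * Q s \<omega>)) \<partial>lborel) = ennreal (LBINT s:{0..t}. Q s \<omega> * Q s \<omega>)"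
        unfolding set_lebesgue_integral_def by (intro nn_integral_eq_integral) (auto simp: set_integrable_def)
      moreover have "(\<integral>\<^sup>+s\<in>{0..t}. ennreal ((Q s \<omega> - 0)\<^sup>2) \<partial>lborel) = (\<integral>\<^sup>+s. ennreal (indicator {0..t} s *\<^sub>R (Q s \<omega> * Q s \<omega>)) \<partial>lborel)"
        by (rule nn_integral_cong) (simp add: indicator_def power2_eq_square)
      ultimately show ?thesis by simp
    qed
    have "ennreal (\<integral>\<omega>. (Y t \<omega>)\<^sup>2 \<partial>M) = process_distance t Q (\<lambda>_ _. 0)"
      unfolding sq_int_nn[OF sqY[OF t], symmetric] by (rule ito_sq(2)) (use t in auto)
    also have "\<dots> = (\<integral>\<^sup>+\<omega>. ennreal (LBINT s:{0..t}. Q s \<omega> * Q s \<omega>) \<partial>M)"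
      unfolding process_distance_def by (rule nn_integral_cong) (rule Qi)
    also have "\<dots> = ennreal (\<integral>\<omega>. (LBINT s:{0..t}. Q s \<omega> * Q s \<omega>) \<partial>M)"
      by (rule nn_integral_eq_integral[OF eQQ(1)]) (auto simp: set_lebesgue_integral_def intro!: AE_I2 Bochner_Integration.integral_nonneg)
    finally have "ennreal (\<integral>\<omega>. (Y t \<omega>)\<^sup>2 \<partial>M) = ennreal (LBINT s:{0..t}. \<integral>\<omega>. Q s \<omega> * Q s \<omega> \<partial>M)" using eQQ(3) by simp
    moreover have "0 \<le> (LBINT s:{0..t}. \<integral>\<omega>. Q s \<omega> * Q s \<omega> \<partial>M)"
      unfolding set_lebesgue_integral_def by (intro Bochner_Integration.integral_nonneg) simp
    ultimately show ?thesis by (simp add: ennreal_inj)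
  qed
  have "(\<integral>\<omega>. (U t \<omega>)\<^sup>2 \<partial>M) = (\<integral>\<omega>. x\<^sup>2 + (A t \<omega>)\<^sup>2 + (Y t \<omega>)\<^sup>2 + 2 * x * A t \<omega> - 2 * x * Y t \<omega> - 2 * (A t \<omega> * Y t \<omega>) \<partial>M)"
  proof (rule integral_cong_AE)
    show "(\<lambda>\<omega>. x\<^sup>2 + (A t \<omega>)\<^sup>2 + (Y t \<omega>)\<^sup>2 + 2 * x * A t \<omega> - 2 * x * Y t \<omega> - 2 * (A t \<omega> * Y t \<omega>)) \<in> borel_measurable M"
      using sq_int_measurable[OF sqY[OF t]] by measurable
    show "AE \<omega> in M. (U t \<omega>)\<^sup>2 = x\<^sup>2 + (A t \<omega>)\<^sup>2 + (Y t \<omega>)\<^sup>2 + 2 * x * A t \<omega> - 2 * x * Y t \<omega> - 2 * (A t \<omega> * Y t \<omega>)"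
      using eq[OF t]
    proof eventually_elim
      case (elim \<omega>)
      then have "U t \<omega> = x + A t \<omega> - Y t \<omega>" by (simp add: A_def)
      then show ?case by (simp add: power2_eq_square ring_distribs)
    qed
  qed measurable
  also have "\<dots> = x\<^sup>2 + (\<integral>\<omega>. (A t \<omega>)\<^sup>2 \<partial>M) + (\<integral>\<omega>. (Y t \<omega>)\<^sup>2 \<partial>M) + 2 * x * (\<integral>\<omega>. A t \<omega> \<partial>M) - 2 * x * (\<integral>\<omega>. Y t \<omega> \<partial>M) - 2 * (\<integral>\<omega>. A t \<omega> * Y t \<omega> \<partial>M)"
    using sq_int_integrable[OF sqA[OF t]] sq_int_integrable[OF sqY[OF t]] sq_int_mult[OF sqA[OF t] sqY[OF t]]
      sq_int_square[OF sqA[OF t]] sq_int_square[OF sqY[OF t]] by (simp add: prob_space)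
  \<comment> \<open>The mean of \<open>D\<close> cancels between the terms with
    \<open>2 * x\<close>, and the correlation of \<open>A\<close> and \<open>D\<close> between the
    square of \<open>A\<close> and the mixed term.\<close>
  finally show "(\<integral>\<omega>. (U t \<omega>)\<^sup>2 \<partial>M) = x\<^sup>2 + 2 * (LBINT s:{0..t}. \<integral>\<omega>. U s \<omega> * D s \<omega> \<partial>M) + (LBINT s:{0..t}. \<integral>\<omega>. Q s \<omega> * Q s \<omega> \<partial>M)"
    unfolding EAA EYY EY EAY' EA by (simp add: algebra_simps)
qed

text \<open>Scaling \<open>r \<in> [0,1]\<close> by \<open>s\<close> makes the times of the running bound independent of \<open>s\<close>, so that countably
  many of them suffice for all \<open>s\<close> at once.\<close>

lemma running_bound_measurable:
  assumes T: "0 < T" and V: "regular_process T V"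
  shows "Measurable.pred (borel \<Otimes>\<^sub>M M) (case_prod (\<lambda>s \<omega>. \<forall>r\<in>{0..1}. V (r * s) \<omega> \<le> R))"
    "s \<in> {0..T} \<Longrightarrow> Measurable.pred (F s) (\<lambda>\<omega>. \<forall>r\<in>{0..1}. V (r * s) \<omega> \<le> R)"
proof -
  \<comment> \<open>Clamping sends every rational to a point of \<open>[0,1]\<close>, so that the
    countable quantifier runs over a whole type.\<close>
  define cl where "cl = (\<lambda>q::rat. max 0 (min 1 (of_rat q :: real)))"
  have cl: "cl q \<in> {0..1}" for q by (auto simp: cl_def)
  have iff: "(\<forall>r\<in>{0..1}. V (r * s) \<omega> \<le> R) \<longleftrightarrow> (\<forall>q. V (cl q * s) \<omega> \<le> R)" if \<omega>: "\<omega> \<in> space M" for s \<omega>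
  proof
    assume q: "\<forall>q. V (cl q * s) \<omega> \<le> R"
    \<comment> \<open>Continuity makes the set of admissible \<open>r\<close> closed, so validity at
      rational points extends to all of them.\<close>
    have "continuous_on UNIV (\<lambda>r. V (max 0 (min 1 r) * s) \<omega>)"
      by (intro continuous_on_compose2[OF regular_processD(4)[OF V \<omega>, of UNIV]] continuous_intros) auto
    then have "closed {r. V (max 0 (min 1 r) * s) \<omega> \<le> R}"
      by (intro closed_Collect_le) auto
    moreover have "\<rat> \<subseteq> {r. V (max 0 (min 1 r) * s) \<omega> \<le> R}"
      using q by (auto simp: cl_def Rats_def)
    ultimately have "closure \<rat> \<subseteq> {r. V (max 0 (min 1 r) * s) \<omega> \<le> R}" by (rule closure_minimal[rotated])
    then have all: "V (max 0 (min 1 r) * s) \<omega> \<le> R" for r unfolding Rats_closure_real by auto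
    show "\<forall>r\<in>{0..1}. V (r * s) \<omega> \<le> R"
    proof
      fix r :: real assume "r \<in> {0..1}"
      then have "max 0 (min 1 r) = r" by auto
      then show "V (r * s) \<omega> \<le> R" using all[of r] by simp
    qed
  qed (use cl in auto)
  note [measurable] = regular_processD(1)[OF V]
  have "Measurable.pred (borel \<Otimes>\<^sub>M M) (\<lambda>x. \<forall>q. V (cl q * fst x) (snd x) \<le> R)" by measurable
  then show "Measurable.pred (borel \<Otimes>\<^sub>M M) (case_prod (\<lambda>s \<omega>. \<forall>r\<in>{0..1}. V (r * s) \<omega> \<le> R))"
  proof (rule measurable_cong[THEN iffD1, rotated])
    fix x :: "real \<times> 'w" assume "x \<in> space (borel \<Otimes>\<^sub>M M)"
    then have "snd x \<in> space M" by (auto simp: space_pair_measure)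
    from iff[OF this, of "fst x"]
    show "(\<forall>q. V (cl q * fst x) (snd x) \<le> R) = case_prod (\<lambda>s \<omega>. \<forall>r\<in>{0..1}. V (r * s) \<omega> \<le> R) x"
      by (simp add: split_beta')
  qed
  show "Measurable.pred (F s) (\<lambda>\<omega>. \<forall>r\<in>{0..1}. V (r * s) \<omega> \<le> R)" if s: "s \<in> {0..T}"
  proof -
    have "V (cl q * s) \<in> borel_measurable (F s)" for q
    proof -
      have "cl q * s \<le> 1 * s" by (rule mult_right_mono) (use cl[of q] s in auto)
      moreover have "0 \<le> cl q * s" using cl[of q] s by simp
      ultimately have "V (cl q * s) \<in> borel_measurable (F (cl q * s))" "cl q * s \<le> s" using s regular_processD(3)[OF V] by auto
      then show ?thesis by (rule measurable_F_mono)
    qed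
    then have "Measurable.pred (F s) (\<lambda>\<omega>. \<forall>q. V (cl q * s) \<omega> \<le> R)" by measurable
    then show ?thesis
      by (rule measurable_cong[THEN iffD1, rotated]) (simp only: space_F iff)
  qed
qed

text \<open>Gronwall on the event that the path has stayed below the level \<open>R\<close>. The bound does not depend on
  \<open>R\<close>, hence the second moments are finite.\<close>

lemma localized_system_bound:
  fixes x :: "'c \<Rightarrow> real"
  assumes T: "0 < T" and I: "finite I"
    and U: "\<And>c. c \<in> I \<Longrightarrow> regular_process T (U c)" and D: "\<And>c. c \<in> I \<Longrightarrow> regular_process T (D c)"
    and Q: "\<And>c. c \<in> I \<Longrightarrow> regular_process T (Q c)"
    and ito: "\<And>c. c \<in> I \<Longrightarrow> ito_integral M F W T (Z0 c) (Y c)"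
    and Z0: "\<And>c. c \<in> I \<Longrightarrow> AE \<omega> in M. \<forall>s\<in>{0..T}. Z0 c s \<omega> = Q c s \<omega>"
    and eq: "\<And>c t. c \<in> I \<Longrightarrow> t \<in> {0..T} \<Longrightarrow> AE \<omega> in M. U c t \<omega> = x c + (LBINT s:{0..t}. D c s \<omega>) - Y c t \<omega>"
    and bD: "\<And>s \<omega>. s \<in> {0..T} \<Longrightarrow> \<omega> \<in> space M \<Longrightarrow> (\<Sum>c\<in>I. (D c s \<omega>)\<^sup>2) \<le> K * (\<Sum>c\<in>I. (U c s \<omega>)\<^sup>2)"
    and bQ: "\<And>s \<omega>. s \<in> {0..T} \<Longrightarrow> \<omega> \<in> space M \<Longrightarrow> (\<Sum>c\<in>I. (Q c s \<omega>)\<^sup>2) \<le> K * (\<Sum>c\<in>I. (U c s \<omega>)\<^sup>2)"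
    and K: "0 \<le> K" and t: "t \<in> {0..T}" and R: "0 \<le> R"
  defines "V \<equiv> \<lambda>s \<omega>. \<Sum>c\<in>I. (U c s \<omega>)\<^sup>2"
  shows "(\<integral>\<^sup>+\<omega>. ennreal (of_bool (\<forall>r\<in>{0..1}. V (r * t) \<omega> \<le> R) * V t \<omega>) \<partial>M) \<le> ennreal (3 * (\<Sum>c\<in>I. (x c)\<^sup>2) * exp (3 * (T + 1) * K * T))"
proof -
  have V: "regular_process T V"
    unfolding regular_process_def V_def
  proof (intro conjI allI ballI)
    show "(\<lambda>\<omega>. \<Sum>c\<in>I. (U c s \<omega>)\<^sup>2) \<in> borel_measurable M" for s
      by (intro borel_measurable_sum borel_measurable_power regular_processD(2)[OF U])
    show "(\<lambda>\<omega>. \<Sum>c\<in>I. (U c s \<omega>)\<^sup>2) \<in> borel_measurable (F s)" if "s \<in> {0..T}" for s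
      by (intro borel_measurable_sum borel_measurable_power regular_processD(3)[OF U _ ] that)
    show "continuous_on UNIV (\<lambda>s. \<Sum>c\<in>I. (U c s \<omega>)\<^sup>2)" if "\<omega> \<in> space M" for \<omega>
      by (intro continuous_intros regular_processD(4)[OF U _ ] that)
  qed
  define P where "P = (\<lambda>s \<omega>. \<forall>r\<in>{0..1}. V (r * s) \<omega> \<le> R)"
  note Pm = running_bound_measurable(1)[OF T V, of R, folded P_def]
  have PF: "Measurable.pred (F s) (P s)" if "s \<in> {0..T}" for s
    using running_bound_measurable(2)[OF T V that, of R] by (simp add: P_def)
  \<comment> \<open>Rescaling by \<open>r / s\<close> places the times up to \<open>r\<close> among
    those up to \<open>s\<close>; \<open>s = 0\<close> is apart because of the division.\<close>
  have anti: "P r \<omega>" if "0 \<le> r" "r \<le> s" "s \<le> T" "P s \<omega>" for r s \<omega>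
  proof (cases "s = 0")
    case True then show ?thesis using that by simp
  next
    case False
    then have s: "0 < s" using that by simp
    show ?thesis unfolding P_def
    proof
      fix r' :: real assume r': "r' \<in> {0..1}"
      have "r' * r \<le> 1 * s" using r' that by (intro mult_mono) auto
      then have "r' * r / s \<in> {0..1}" using r' s that by (simp add: divide_le_eq)
      then have "V (r' * r / s * s) \<omega> \<le> R" using \<open>P s \<omega>\<close> unfolding P_def by blast
      then show "V (r' * r) \<omega> \<le> R" using s by simp
    qed
  qed
  have PV: "V s \<omega> \<le> R" if "P s \<omega>" for s \<omega> using that unfolding P_def by (auto dest: bspec[of _ _ 1])
  have left: "P s \<omega>" if s: "s \<in> {0<..T}" and \<omega>: "\<omega> \<in> space M" and all: "\<forall>r\<in>{0..<s}. P r \<omega>" for s \<omega>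
  proof -
    have lt: "V r \<omega> \<le> R" if "r \<in> {0..<s}" for r using PV all that by blast
    have "isCont (\<lambda>r. V r \<omega>) s" using regular_processD(4)[OF V \<omega>, of UNIV] by (simp add: continuous_on_eq_continuous_at)
    then have lim: "((\<lambda>r. V r \<omega>) \<longlongrightarrow> V s \<omega>) (at_left s)" by (auto simp: isCont_def intro: filterlim_mono at_le)
    have "eventually (\<lambda>r. V r \<omega> \<le> R) (at_left s)"
      using s lt by (auto simp: eventually_at_left[of 0 s] intro!: exI[of _ 0])
    then have Vs: "V s \<omega> \<le> R" using tendsto_upperbound[OF lim] by simp
    show ?thesis unfolding P_def
    proof
      fix r :: real assume r: "r \<in> {0..1}"
      show "V (r * s) \<omega> \<le> R"
      proof (cases "r = 1")
        case False
        then have "r * s < 1 * s" using r s by (intro mult_strict_right_mono) auto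
        then show ?thesis using lt[of "r * s"] r s by simp
      qed (use Vs in simp)
    qed
  qed
  note [measurable] = Pm regular_processD(1)[OF V]
  have Um: "case_prod (U c) \<in> borel_measurable (borel \<Otimes>\<^sub>M M)" and Dm: "case_prod (D c) \<in> borel_measurable (borel \<Otimes>\<^sub>M M)"
    and Qm: "case_prod (Q c) \<in> borel_measurable (borel \<Otimes>\<^sub>M M)" if "c \<in> I" for c
    using regular_processD(1)[OF U[OF that]] regular_processD(1)[OF D[OF that]] regular_processD(1)[OF Q[OF that]] by auto
  have V0: "0 \<le> V s \<omega>" for s \<omega> unfolding V_def by (intro sum_nonneg) simp
  \<comment> \<open>On the event \<open>P s\<close> the energy is at most \<open>R\<close>, so
    \<open>f\<close> is bounded from the start, as \<open>gronwall\<close> requires.\<close>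
  define f where "f = (\<lambda>s. \<integral>\<omega>. of_bool (P s \<omega>) * V s \<omega> \<partial>M)"
  have f_meas: "f \<in> borel_measurable borel" unfolding f_def by measurable
  have Pms: "Measurable.pred M (P s)" for s by measurable
  have int: "integrable M (\<lambda>\<omega>. of_bool (P s \<omega>) * V s \<omega>)" for s
    by (rule integrable_const_bound[of _ R]) (use PV V0 R in \<open>auto simp: of_bool_def\<close>)
  have f_nn: "(\<integral>\<^sup>+\<omega>. ennreal (of_bool (P s \<omega>) * V s \<omega>) \<partial>M) = ennreal (f s)" for s
    unfolding f_def by (rule nn_integral_eq_integral[OF int]) (use V0 in auto)
  have f_bd: "0 \<le> f s \<and> f s \<le> R" for s
  proof
    show "0 \<le> f s" unfolding f_def by (rule Bochner_Integration.integral_nonneg) (use V0 in auto)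
    have "f s \<le> (\<integral>\<omega>. R \<partial>M)" unfolding f_def
      by (rule integral_mono[OF int]) (use PV R in \<open>auto simp: of_bool_def\<close>)
    then show "f s \<le> R" by (simp add: prob_space)
  qed
  \<comment> \<open>\<open>K * V\<close> bounds only the sum of squares over all coordinates, so the
    coordinates are added up before estimating.\<close>
  have local: "(\<Sum>c\<in>I. process_distance t (\<lambda>s \<omega>. of_bool (P s \<omega>) * G c s \<omega>) (\<lambda>_ _. 0)) \<le> ennreal (K * (LBINT s:{0..t}. f s))"
    if G: "\<And>c. c \<in> I \<Longrightarrow> case_prod (G c) \<in> borel_measurable (borel \<Otimes>\<^sub>M M)"
      and bG: "\<And>s \<omega>. s \<in> {0..T} \<Longrightarrow> \<omega> \<in> space M \<Longrightarrow> (\<Sum>c\<in>I. (G c s \<omega>)\<^sup>2) \<le> K * V s \<omega>" and t: "t \<in> {0..T}" for G t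
  proof -
    let ?g = "\<lambda>c s \<omega>. of_bool (P s \<omega>) * G c s \<omega>"
    have m: "case_prod (?g c) \<in> borel_measurable (borel \<Otimes>\<^sub>M M)" if "c \<in> I" for c
      using G[OF that] Pm unfolding split_beta' by measurable
    have m2: "?g c s \<in> borel_measurable M" if "c \<in> I" for c s
    proof -
      note [measurable] = G[OF that]
      show ?thesis by measurable
    qed
    have "(\<Sum>c\<in>I. process_distance t (?g c) (\<lambda>_ _. 0)) = (\<Sum>c\<in>I. \<integral>\<^sup>+s\<in>{0..t}. (\<integral>\<^sup>+\<omega>. ennreal ((?g c s \<omega>)\<^sup>2) \<partial>M) \<partial>lborel)"
      by (rule sum.cong[OF refl]) (rule process_distance_swap[OF m])
    also have "\<dots> = (\<integral>\<^sup>+s. (\<Sum>c\<in>I. (\<integral>\<^sup>+\<omega>. ennreal ((?g c s \<omega>)\<^sup>2) \<partial>M) * indicator {0..t} s) \<partial>lborel)"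
    proof (rule nn_integral_sum[symmetric])
      fix c assume "c \<in> I"
      note [measurable] = G[OF \<open>c \<in> I\<close>]
      show "(\<lambda>s. (\<integral>\<^sup>+\<omega>. ennreal ((?g c s \<omega>)\<^sup>2) \<partial>M) * indicator {0..t} s) \<in> borel_measurable lborel" by measurable
    qed
    also have "\<dots> \<le> (\<integral>\<^sup>+s. ennreal (indicator {0..t} s *\<^sub>R (K * f s)) \<partial>lborel)"
    proof (rule nn_integral_mono)
      fix s
      show "(\<Sum>c\<in>I. (\<integral>\<^sup>+\<omega>. ennreal ((?g c s \<omega>)\<^sup>2) \<partial>M) * indicator {0..t} s) \<le> ennreal (indicator {0..t} s *\<^sub>R (K * f s))"
      proof (cases "s \<in> {0..t}")
        case True
        have "(\<Sum>c\<in>I. \<integral>\<^sup>+\<omega>. ennreal ((?g c s \<omega>)\<^sup>2) \<partial>M) = (\<integral>\<^sup>+\<omega>. (\<Sum>c\<in>I. ennreal ((?g c s \<omega>)\<^sup>2)) \<partial>M)"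
          by (rule nn_integral_sum[symmetric]) (use m2 in measurable)
        also have "\<dots> \<le> (\<integral>\<^sup>+\<omega>. ennreal K * ennreal (of_bool (P s \<omega>) * V s \<omega>) \<partial>M)"
        proof (rule nn_integral_mono)
          fix \<omega> assume "\<omega> \<in> space M"
          then have "(\<Sum>c\<in>I. (?g c s \<omega>)\<^sup>2) \<le> K * (of_bool (P s \<omega>) * V s \<omega>)"
            using bG[of s \<omega>] True t by (cases "P s \<omega>") auto
          then have "ennreal (\<Sum>c\<in>I. (?g c s \<omega>)\<^sup>2) \<le> ennreal (K * (of_bool (P s \<omega>) * V s \<omega>))" by (rule ennreal_leI)
          then show "(\<Sum>c\<in>I. ennreal ((?g c s \<omega>)\<^sup>2)) \<le> ennreal K * ennreal (of_bool (P s \<omega>) * V s \<omega>)"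
            using K by (simp add: sum_ennreal ennreal_mult')
        qed
        also have "\<dots> = ennreal K * ennreal (f s)"
          unfolding f_nn[symmetric] by (rule nn_integral_cmult) measurable
        finally show ?thesis using True K by (simp add: ennreal_mult')
      qed simp
    qed
    also have "\<dots> = ennreal (LBINT s:{0..t}. K * f s)"
      unfolding set_lebesgue_integral_def
    proof (rule nn_integral_eq_integral)
      have iR: "integrable lborel (\<lambda>s. indicator {0..t} s *\<^sub>R (K * R))"
        using borel_integrable_atLeastAtMost'[of 0 t "\<lambda>_. K * R"] by (simp add: set_integrable_def)
      have le: "norm (indicator {0..t} s *\<^sub>R (K * f s)) \<le> norm (indicator {0..t} s *\<^sub>R (K * R))" for s
        using f_bd[of s] K R by (auto simp: indicator_def abs_mult intro!: mult_left_mono)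
      show "integrable lborel (\<lambda>s. indicator {0..t} s *\<^sub>R (K * f s))"
        by (rule Bochner_Integration.integrable_bound[OF iR _ AE_I2[OF le]]) (use f_meas in measurable)
      show "AE s in lborel. 0 \<le> indicator {0..t} s *\<^sub>R (K * f s)" using f_bd K by (auto intro!: AE_I2)
    qed
    finally show ?thesis by simp
  qed
  \<comment> \<open>In \<open>U = x + A - Y\<close>, with \<open>A\<close> the time integral of
    \<open>D\<close>, the three squares cost a factor 3, Cauchy-Schwarz in time costs
    \<open>T\<close> for \<open>A\<close>, and the localised isometry bound costs 1 for
    \<open>Y\<close>. The resulting rate \<open>3 * (T + 1) * K\<close> is free of
    \<open>R\<close>.\<close>
  have step: "f t \<le> 3 * (\<Sum>c\<in>I. (x c)\<^sup>2) + 3 * (T + 1) * K * (LBINT s:{0..t}. f s)" if t: "t \<in> {0..T}" for t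
  proof -
    have t0: "0 \<le> t" using t by simp
    define J where "J = (LBINT s:{0..t}. f s)"
    have J0: "0 \<le> J" unfolding J_def set_lebesgue_integral_def
      by (rule Bochner_Integration.integral_nonneg) (use f_bd in auto)
    let ?p = "\<lambda>G c. process_distance t (\<lambda>s \<omega>. of_bool (P s \<omega>) * G c s \<omega>) (\<lambda>_ _. 0)"
    have Ym: "Y c t \<in> borel_measurable M" if "c \<in> I" for c
      using ito_integral_measurable[OF ito[OF that] t] measurable_F_M by blast
    have Am: "(\<lambda>\<omega>. LBINT s:{0..t}. D c s \<omega>) \<in> borel_measurable M" if "c \<in> I" for c
    proof -
      note [measurable] = time_integral_measurable[OF D[OF that]]
      show ?thesis by measurable
    qed
    have cA: "(\<integral>\<^sup>+\<omega>. ennreal (of_bool (P t \<omega>) * (LBINT s:{0..t}. D c s \<omega>)\<^sup>2) \<partial>M) \<le> ennreal T * ?p D c" if c: "c \<in> I" for c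
    proof -
      note [measurable] = Dm[OF c]
      have "(\<integral>\<^sup>+\<omega>. ennreal (of_bool (P t \<omega>) * (LBINT s:{0..t}. D c s \<omega>)\<^sup>2) \<partial>M)
        \<le> (\<integral>\<^sup>+\<omega>. ennreal T * (\<integral>\<^sup>+s\<in>{0..t}. ennreal ((of_bool (P s \<omega>) * D c s \<omega> - 0)\<^sup>2) \<partial>lborel) \<partial>M)"
      proof (rule nn_integral_mono)
        fix \<omega> assume \<omega>: "\<omega> \<in> space M"
        show "ennreal (of_bool (P t \<omega>) * (LBINT s:{0..t}. D c s \<omega>)\<^sup>2)
          \<le> ennreal T * (\<integral>\<^sup>+s\<in>{0..t}. ennreal ((of_bool (P s \<omega>) * D c s \<omega> - 0)\<^sup>2) \<partial>lborel)"
        proof (cases "P t \<omega>")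
          case True
          have cc: "continuous_on {0..t} (\<lambda>s. D c s \<omega>)" by (rule regular_processD(4)[OF D[OF c] \<omega>])
          have i: "set_integrable lborel {0..t} (\<lambda>s. (D c s \<omega>)\<^sup>2)" by (intro borel_integrable_atLeastAtMost' continuous_intros cc)
          have nn: "0 \<le> (LBINT s:{0..t}. (D c s \<omega>)\<^sup>2)" unfolding set_lebesgue_integral_def
            by (rule Bochner_Integration.integral_nonneg) simp
          have "(LBINT s:{0..t}. D c s \<omega>)\<^sup>2 \<le> t * (LBINT s:{0..t}. (D c s \<omega>)\<^sup>2)" by (rule set_integral_square_le[OF cc t0])
          also have "\<dots> \<le> T * (LBINT s:{0..t}. (D c s \<omega>)\<^sup>2)" using t nn by (intro mult_right_mono) auto
          finally have "ennreal ((LBINT s:{0..t}. D c s \<omega>)\<^sup>2) \<le> ennreal (T * (LBINT s:{0..t}. (D c s \<omega>)\<^sup>2))" by (rule ennreal_leI)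
          also have "\<dots> = ennreal T * ennreal (LBINT s:{0..t}. (D c s \<omega>)\<^sup>2)" using T by (simp add: ennreal_mult')
          also have "ennreal (LBINT s:{0..t}. (D c s \<omega>)\<^sup>2) = (\<integral>\<^sup>+s. ennreal (indicator {0..t} s *\<^sub>R (D c s \<omega>)\<^sup>2) \<partial>lborel)"
            unfolding set_lebesgue_integral_def
            by (rule nn_integral_eq_integral[symmetric]) (use i in \<open>auto simp: set_integrable_def\<close>)
          also have "\<dots> = (\<integral>\<^sup>+s\<in>{0..t}. ennreal ((of_bool (P s \<omega>) * D c s \<omega> - 0)\<^sup>2) \<partial>lborel)"
          proof (rule nn_integral_cong)
            fix s
            show "ennreal (indicator {0..t} s *\<^sub>R (D c s \<omega>)\<^sup>2) = ennreal ((of_bool (P s \<omega>) * D c s \<omega> - 0)\<^sup>2) * indicator {0..t} s"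
              using anti[of s t \<omega>] True t by (auto simp: indicator_def)
          qed
          finally show ?thesis using True by simp
        qed simp
      qed
      also have "\<dots> = ennreal T * ?p D c"
        unfolding process_distance_def by (rule nn_integral_cmult) measurable
      finally show ?thesis .
    qed
    have cY: "(\<integral>\<^sup>+\<omega>. ennreal (of_bool (P t \<omega>) * (Y c t \<omega>)\<^sup>2) \<partial>M) \<le> ?p Q c" if c: "c \<in> I" for c
    proof (rule ito_integral_localized[OF T ito[OF c] Z0[OF c] Qm[OF c] regular_processD(3)[OF Q[OF c]] regular_processD(4)[OF Q[OF c]] Pm PF])
      show "\<bar>Q c s \<omega>\<bar> \<le> sqrt (K * R)" if "s \<in> {0..T}" "\<omega> \<in> space M" "P s \<omega>" for s \<omega>
      proof (rule real_le_rsqrt)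
        have "(Q c s \<omega>)\<^sup>2 \<le> (\<Sum>c\<in>I. (Q c s \<omega>)\<^sup>2)" by (rule member_le_sum[OF c]) (use I in auto)
        also have "\<dots> \<le> K * V s \<omega>" using bQ[OF that(1,2)] by (simp add: V_def)
        also have "\<dots> \<le> K * R" by (intro mult_left_mono PV that(3) K)
        finally show "\<bar>Q c s \<omega>\<bar>\<^sup>2 \<le> K * R" by simp
      qed
    qed (use anti left t in auto)
    have pt: "ennreal (of_bool b * (a + d - y)\<^sup>2) \<le> ennreal (3 * a\<^sup>2) + 3 * ennreal (of_bool b * d\<^sup>2) + 3 * ennreal (of_bool b * y\<^sup>2)" for a d y :: real and b
    proof -
      \<comment> \<open>The right side exceeds the left by
        \<open>(a - d)\<^sup>2 + (a + y)\<^sup>2 + (d + y)\<^sup>2\<close>.\<close>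
      have "(a + d - y)\<^sup>2 \<le> 3 * a\<^sup>2 + 3 * d\<^sup>2 + 3 * y\<^sup>2"
        using zero_le_power2[of "a - d"] zero_le_power2[of "a + y"] zero_le_power2[of "d + y"] by (simp add: power2_eq_square algebra_simps)
      then have "of_bool b * (a + d - y)\<^sup>2 \<le> 3 * a\<^sup>2 + 3 * (of_bool b * d\<^sup>2) + 3 * (of_bool b * y\<^sup>2)" by (cases b) auto
      then have "ennreal (of_bool b * (a + d - y)\<^sup>2) \<le> ennreal (3 * a\<^sup>2 + 3 * (of_bool b * d\<^sup>2) + 3 * (of_bool b * y\<^sup>2))" by (rule ennreal_leI)
      then show ?thesis by (simp add: ennreal_mult)
    qed
    have c1: "(\<integral>\<^sup>+\<omega>. ennreal (of_bool (P t \<omega>) * (U c t \<omega>)\<^sup>2) \<partial>M) \<le> ennreal (3 * (x c)\<^sup>2) + 3 * (ennreal T * ?p D c) + 3 * ?p Q c" if c: "c \<in> I" for c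
    proof -
      note [measurable] = Ym[OF c] Am[OF c]
      have "(\<integral>\<^sup>+\<omega>. ennreal (of_bool (P t \<omega>) * (U c t \<omega>)\<^sup>2) \<partial>M)
         \<le> (\<integral>\<^sup>+\<omega>. ennreal (3 * (x c)\<^sup>2) + 3 * ennreal (of_bool (P t \<omega>) * (LBINT s:{0..t}. D c s \<omega>)\<^sup>2) + 3 * ennreal (of_bool (P t \<omega>) * (Y c t \<omega>)\<^sup>2) \<partial>M)"
      proof (rule nn_integral_mono_AE)
        show "AE \<omega> in M. ennreal (of_bool (P t \<omega>) * (U c t \<omega>)\<^sup>2) \<le> ennreal (3 * (x c)\<^sup>2) + 3 * ennreal (of_bool (P t \<omega>) * (LBINT s:{0..t}. D c s \<omega>)\<^sup>2) + 3 * ennreal (of_bool (P t \<omega>) * (Y c t \<omega>)\<^sup>2)"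
          using eq[OF c t] by eventually_elim (simp only: pt)
      qed
      also have "\<dots> = ennreal (3 * (x c)\<^sup>2) + 3 * (\<integral>\<^sup>+\<omega>. ennreal (of_bool (P t \<omega>) * (LBINT s:{0..t}. D c s \<omega>)\<^sup>2) \<partial>M) + 3 * (\<integral>\<^sup>+\<omega>. ennreal (of_bool (P t \<omega>) * (Y c t \<omega>)\<^sup>2) \<partial>M)"
        by (simp add: nn_integral_add nn_integral_cmult emeasure_space_1)
      also have "\<dots> \<le> ennreal (3 * (x c)\<^sup>2) + 3 * (ennreal T * ?p D c) + 3 * ?p Q c"
        by (intro add_mono mult_left_mono cA[OF c] cY[OF c] order_refl) simp_all
      finally show ?thesis .
    qed
    have "ennreal (f t) = (\<integral>\<^sup>+\<omega>. (\<Sum>c\<in>I. ennreal (of_bool (P t \<omega>) * (U c t \<omega>)\<^sup>2)) \<partial>M)"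
      unfolding f_nn[symmetric] by (rule nn_integral_cong) (simp add: V_def sum_distrib_left sum_ennreal)
    also have "\<dots> = (\<Sum>c\<in>I. \<integral>\<^sup>+\<omega>. ennreal (of_bool (P t \<omega>) * (U c t \<omega>)\<^sup>2) \<partial>M)"
      by (rule nn_integral_sum) (use regular_processD(2)[OF U] in measurable)
    also have "\<dots> \<le> (\<Sum>c\<in>I. ennreal (3 * (x c)\<^sup>2) + 3 * (ennreal T * ?p D c) + 3 * ?p Q c)"
      by (rule sum_mono) (rule c1)
    also have "\<dots> = ennreal (3 * (\<Sum>c\<in>I. (x c)\<^sup>2)) + 3 * (ennreal T * (\<Sum>c\<in>I. ?p D c)) + 3 * (\<Sum>c\<in>I. ?p Q c)"
      by (simp add: sum.distrib sum_distrib_left sum_ennreal)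
    also have "\<dots> \<le> ennreal (3 * (\<Sum>c\<in>I. (x c)\<^sup>2)) + 3 * (ennreal T * ennreal (K * J)) + 3 * ennreal (K * J)"
    proof (intro add_mono mult_left_mono order_refl)
      show "(\<Sum>c\<in>I. ?p D c) \<le> ennreal (K * J)" unfolding J_def
        by (rule local[OF Dm _ t]) (use bD in \<open>auto simp: V_def\<close>)
      show "(\<Sum>c\<in>I. ?p Q c) \<le> ennreal (K * J)" unfolding J_def
        by (rule local[OF Qm _ t]) (use bQ in \<open>auto simp: V_def\<close>)
    qed simp_all
    also have "\<dots> = ennreal (3 * (\<Sum>c\<in>I. (x c)\<^sup>2) + 3 * (T * (K * J)) + 3 * (K * J))"
      using K J0 T by (simp add: ennreal_mult sum_nonneg)
    finally have "f t \<le> 3 * (\<Sum>c\<in>I. (x c)\<^sup>2) + 3 * (T * (K * J)) + 3 * (K * J)"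
      using K J0 T by (subst (asm) ennreal_le_iff) (auto intro!: add_nonneg_nonneg mult_nonneg_nonneg sum_nonneg)
    then show ?thesis by (simp add: J_def algebra_simps)
  qed
  have "f t \<le> 3 * (\<Sum>c\<in>I. (x c)\<^sup>2) * exp (3 * (T + 1) * K * t)"
    by (rule gronwall[OF f_meas f_bd step _ _ t]) (use K T in \<open>auto intro!: mult_nonneg_nonneg sum_nonneg\<close>)
  also have "\<dots> \<le> 3 * (\<Sum>c\<in>I. (x c)\<^sup>2) * exp (3 * (T + 1) * K * T)"
    using t K T by (intro mult_left_mono) (auto intro!: mult_left_mono sum_nonneg)
  finally have "ennreal (f t) \<le> ennreal (3 * (\<Sum>c\<in>I. (x c)\<^sup>2) * exp (3 * (T + 1) * K * T))" by (rule ennreal_leI)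
  then show ?thesis using f_nn[of t] by (simp add: P_def)
qed

text \<open>A path is bounded on \<open>[0,T]\<close>, so the localising event with level
  \<open>n\<close> holds for all large \<open>n\<close>; Fatou's lemma then removes the
  localisation, since the bound is the same for all levels. With second moments finite, the energy
  identity applies to each coordinate and is summed.\<close>

lemma linear_system_energy:
  fixes x :: "'c \<Rightarrow> real"
  assumes T: "0 < T" and I: "finite I"
    and U: "\<And>c. c \<in> I \<Longrightarrow> regular_process T (U c)" and D: "\<And>c. c \<in> I \<Longrightarrow> regular_process T (D c)"
    and Q: "\<And>c. c \<in> I \<Longrightarrow> regular_process T (Q c)"
    and ito: "\<And>c. c \<in> I \<Longrightarrow> ito_integral M F W T (Z0 c) (Y c)"
    and Z0: "\<And>c. c \<in> I \<Longrightarrow> AE \<omega> in M. \<forall>s\<in>{0..T}. Z0 c s \<omega> = Q c s \<omega>"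
    and eq: "\<And>c t. c \<in> I \<Longrightarrow> t \<in> {0..T} \<Longrightarrow> AE \<omega> in M. U c t \<omega> = x c + (LBINT s:{0..t}. D c s \<omega>) - Y c t \<omega>"
    and bD: "\<And>s \<omega>. s \<in> {0..T} \<Longrightarrow> \<omega> \<in> space M \<Longrightarrow> (\<Sum>c\<in>I. (D c s \<omega>)\<^sup>2) \<le> K * (\<Sum>c\<in>I. (U c s \<omega>)\<^sup>2)"
    and bQ: "\<And>s \<omega>. s \<in> {0..T} \<Longrightarrow> \<omega> \<in> space M \<Longrightarrow> (\<Sum>c\<in>I. (Q c s \<omega>)\<^sup>2) \<le> K * (\<Sum>c\<in>I. (U c s \<omega>)\<^sup>2)"
    and K: "0 \<le> K"
  obtains B where "0 \<le> B"
    "\<And>s c. s \<in> {0..T} \<Longrightarrow> c \<in> I \<Longrightarrow> (\<integral>\<^sup>+\<omega>. ennreal ((U c s \<omega>)\<^sup>2) \<partial>M) \<le> ennreal B"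
    "\<And>s c. s \<in> {0..T} \<Longrightarrow> c \<in> I \<Longrightarrow> (\<integral>\<^sup>+\<omega>. ennreal ((D c s \<omega>)\<^sup>2) \<partial>M) \<le> ennreal B"
    "\<And>s c. s \<in> {0..T} \<Longrightarrow> c \<in> I \<Longrightarrow> (\<integral>\<^sup>+\<omega>. ennreal ((Q c s \<omega>)\<^sup>2) \<partial>M) \<le> ennreal B"
    "\<And>t. t \<in> {0..T} \<Longrightarrow> (\<integral>\<omega>. (\<Sum>c\<in>I. (U c t \<omega>)\<^sup>2) \<partial>M)
      = (\<Sum>c\<in>I. (x c)\<^sup>2) + (LBINT s:{0..t}. \<integral>\<omega>. (\<Sum>c\<in>I. 2 * (U c s \<omega> * D c s \<omega>) + (Q c s \<omega>)\<^sup>2) \<partial>M)"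
proof -
  define V where "V = (\<lambda>s \<omega>. \<Sum>c\<in>I. (U c s \<omega>)\<^sup>2)"
  define B0 where "B0 = 3 * (\<Sum>c\<in>I. (x c)\<^sup>2) * exp (3 * (T + 1) * K * T)"
  have B0: "0 \<le> B0" unfolding B0_def by (intro mult_nonneg_nonneg sum_nonneg) auto
  have Vm: "V s \<in> borel_measurable M" for s
    unfolding V_def by (intro borel_measurable_sum borel_measurable_power regular_processD(2)[OF U])
  have V0: "0 \<le> V s \<omega>" for s \<omega> unfolding V_def by (intro sum_nonneg) simp
  have bV: "(\<integral>\<^sup>+\<omega>. ennreal (V t \<omega>) \<partial>M) \<le> ennreal B0" if t: "t \<in> {0..T}" for t
  proof -
    define P where "P = (\<lambda>n::nat. \<lambda>\<omega>. \<forall>r\<in>{0..1}. V (r * t) \<omega> \<le> real n)"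
    have Vreg: "regular_process T V"
      unfolding regular_process_def V_def
    proof (intro conjI allI ballI)
      show "(\<lambda>\<omega>. \<Sum>c\<in>I. (U c s \<omega>)\<^sup>2) \<in> borel_measurable M" for s
        by (intro borel_measurable_sum borel_measurable_power regular_processD(2)[OF U])
      show "(\<lambda>\<omega>. \<Sum>c\<in>I. (U c s \<omega>)\<^sup>2) \<in> borel_measurable (F s)" if "s \<in> {0..T}" for s
        by (intro borel_measurable_sum borel_measurable_power regular_processD(3)[OF U _ ] that)
      show "continuous_on UNIV (\<lambda>s. \<Sum>c\<in>I. (U c s \<omega>)\<^sup>2)" if "\<omega> \<in> space M" for \<omega>
        by (intro continuous_intros regular_processD(4)[OF U _ ] that)
    qed
    have Pm: "Measurable.pred M (P n)" for n
    proof -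
      note [measurable] = running_bound_measurable(1)[OF T Vreg, of "real n"]
      show ?thesis unfolding P_def by measurable
    qed
    have "(\<integral>\<^sup>+\<omega>. ennreal (V t \<omega>) \<partial>M) = (\<integral>\<^sup>+\<omega>. liminf (\<lambda>n. ennreal (of_bool (P n \<omega>) * V t \<omega>)) \<partial>M)"
    proof (rule nn_integral_cong)
      fix \<omega> assume \<omega>: "\<omega> \<in> space M"
      have "compact ((\<lambda>s. V s \<omega>) ` {0..T})"
        by (intro compact_continuous_image regular_processD(4)[OF Vreg \<omega>]) simp
      from compact_imp_bounded[OF this] obtain C where C: "\<forall>y\<in>(\<lambda>s. V s \<omega>) ` {0..T}. norm y \<le> C"
        unfolding bounded_iff ..
      obtain n0 :: nat where n0: "C \<le> real n0" using real_arch_simple by blast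
      have "P n \<omega>" if "n0 \<le> n" for n
        unfolding P_def
      proof
        fix r :: real assume r: "r \<in> {0..1}"
        have "r * t \<le> 1 * t" by (rule mult_right_mono) (use r t in auto)
        moreover have "0 \<le> r * t" using r t by simp
        ultimately have "r * t \<in> {0..T}" using t by auto
        then have "norm (V (r * t) \<omega>) \<le> C" using C by blast
        moreover have "real n0 \<le> real n" using that by simp
        ultimately show "V (r * t) \<omega> \<le> real n" using n0 by simp
      qed
      then have "eventually (\<lambda>n. ennreal (of_bool (P n \<omega>) * V t \<omega>) = ennreal (V t \<omega>)) sequentially"
        unfolding eventually_sequentially by (intro exI[of _ n0]) auto
      then have "(\<lambda>n. ennreal (of_bool (P n \<omega>) * V t \<omega>)) \<longlonglongrightarrow> ennreal (V t \<omega>)" by (rule tendsto_eventually)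
      then show "ennreal (V t \<omega>) = liminf (\<lambda>n. ennreal (of_bool (P n \<omega>) * V t \<omega>))"
        by (rule lim_imp_Liminf[OF sequentially_bot, symmetric])
    qed
    also have "\<dots> \<le> liminf (\<lambda>n. \<integral>\<^sup>+\<omega>. ennreal (of_bool (P n \<omega>) * V t \<omega>) \<partial>M)"
      by (rule nn_integral_liminf) (use Pm Vm in measurable)
    also have "\<dots> \<le> liminf (\<lambda>n::nat. ennreal B0)"
    proof (intro Liminf_mono always_eventually allI)
      fix n
      show "(\<integral>\<^sup>+\<omega>. ennreal (of_bool (P n \<omega>) * V t \<omega>) \<partial>M) \<le> ennreal B0"
        unfolding P_def V_def B0_def
        by (rule localized_system_bound[OF T I U D Q ito Z0 eq bD bQ K t]) auto
    qed
    also have "\<dots> = ennreal B0" by (rule lim_imp_Liminf[OF sequentially_bot tendsto_const])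
    finally show ?thesis .
  qed
  \<comment> \<open>One constant for \<open>U\<close>, \<open>D\<close> and \<open>Q\<close>: the
    first needs \<open>B0\<close>, the others \<open>K * B0\<close>.\<close>
  define B where "B = max 1 K * B0"
  have B: "0 \<le> B" "B0 \<le> B" "K * B0 \<le> B" using B0 K by (auto simp: B_def mult_right_mono intro: order_trans[OF _ mult_right_mono[of 1]])
  have gen: "(\<integral>\<^sup>+\<omega>. ennreal ((G c s \<omega>)\<^sup>2) \<partial>M) \<le> ennreal B"
    if G: "\<And>\<omega>. \<omega> \<in> space M \<Longrightarrow> (\<Sum>c\<in>I. (G c s \<omega>)\<^sup>2) \<le> l * V s \<omega>" and s: "s \<in> {0..T}" and c: "c \<in> I"
      and L: "0 \<le> l" "l * B0 \<le> B" for G :: "'c \<Rightarrow> real \<Rightarrow> 'w \<Rightarrow> real" and l s c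
  proof -
    have "(\<integral>\<^sup>+\<omega>. ennreal ((G c s \<omega>)\<^sup>2) \<partial>M) \<le> (\<integral>\<^sup>+\<omega>. ennreal l * ennreal (V s \<omega>) \<partial>M)"
    proof (rule nn_integral_mono)
      fix \<omega> assume \<omega>: "\<omega> \<in> space M"
      have "(G c s \<omega>)\<^sup>2 \<le> (\<Sum>c\<in>I. (G c s \<omega>)\<^sup>2)" by (rule member_le_sum[OF c]) (use I in auto)
      also have "\<dots> \<le> l * V s \<omega>" by (rule G[OF \<omega>])
      finally have "ennreal ((G c s \<omega>)\<^sup>2) \<le> ennreal (l * V s \<omega>)" by (rule ennreal_leI)
      then show "ennreal ((G c s \<omega>)\<^sup>2) \<le> ennreal l * ennreal (V s \<omega>)" using L by (simp add: ennreal_mult')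
    qed
    also have "\<dots> = ennreal l * (\<integral>\<^sup>+\<omega>. ennreal (V s \<omega>) \<partial>M)" by (rule nn_integral_cmult) (use Vm in measurable)
    also have "\<dots> \<le> ennreal l * ennreal B0" by (intro mult_left_mono bV s) simp
    also have "\<dots> = ennreal (l * B0)" using L by (simp add: ennreal_mult')
    also have "\<dots> \<le> ennreal B" by (rule ennreal_leI[OF L(2)])
    finally show ?thesis .
  qed
  have bU': "(\<integral>\<^sup>+\<omega>. ennreal ((U c s \<omega>)\<^sup>2) \<partial>M) \<le> ennreal B" if "s \<in> {0..T}" "c \<in> I" for s c
  proof -
    have "(\<Sum>c\<in>I. (U c s \<omega>)\<^sup>2) \<le> 1 * V s \<omega>" if "\<omega> \<in> space M" for \<omega>
      using that by (simp add: V_def)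
    from gen[of U, OF this that] show ?thesis using B K by simp
  qed
  have bD': "(\<integral>\<^sup>+\<omega>. ennreal ((D c s \<omega>)\<^sup>2) \<partial>M) \<le> ennreal B" if "s \<in> {0..T}" "c \<in> I" for s c
  proof -
    have "(\<Sum>c\<in>I. (D c s \<omega>)\<^sup>2) \<le> K * V s \<omega>" if "\<omega> \<in> space M" for \<omega>
      using bD[OF \<open>s \<in> {0..T}\<close> that] by (simp add: V_def)
    from gen[of D, OF this that] show ?thesis using B K by simp
  qed
  have bQ': "(\<integral>\<^sup>+\<omega>. ennreal ((Q c s \<omega>)\<^sup>2) \<partial>M) \<le> ennreal B" if "s \<in> {0..T}" "c \<in> I" for s c
  proof -
    have "(\<Sum>c\<in>I. (Q c s \<omega>)\<^sup>2) \<le> K * V s \<omega>" if "\<omega> \<in> space M" for \<omega>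
      using bQ[OF \<open>s \<in> {0..T}\<close> that] by (simp add: V_def)
    from gen[of Q, OF this that] show ?thesis using B K by simp
  qed
  have E: "(\<integral>\<omega>. (\<Sum>c\<in>I. (U c t \<omega>)\<^sup>2) \<partial>M)
      = (\<Sum>c\<in>I. (x c)\<^sup>2) + (LBINT s:{0..t}. \<integral>\<omega>. (\<Sum>c\<in>I. 2 * (U c s \<omega> * D c s \<omega>) + (Q c s \<omega>)\<^sup>2) \<partial>M)" if t: "t \<in> {0..T}" for t
  proof -
    have sq: "sq_int (U c s)" "sq_int (D c s)" "sq_int (Q c s)" if "s \<in> {0..T}" "c \<in> I" for s c
      using sq_int_regular[OF U[OF that(2)] bU'[OF that]] sq_int_regular[OF D[OF that(2)] bD'[OF that]]
        sq_int_regular[OF Q[OF that(2)] bQ'[OF that]] by auto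
    note en = energy_identity_expectation[OF T U D Q ito Z0 eq bU' bD' bQ' B(1) t]
    have eqc: "(\<integral>\<omega>. (U c t \<omega>)\<^sup>2 \<partial>M) = (x c)\<^sup>2 + (2 * (LBINT s:{0..t}. \<integral>\<omega>. U c s \<omega> * D c s \<omega> \<partial>M) + (LBINT s:{0..t}. \<integral>\<omega>. Q c s \<omega> * Q c s \<omega> \<partial>M))"
      if c: "c \<in> I" for c
      using en(3)[OF c c c c c] c by simp
    have i1: "set_integrable lborel {0..t} (\<lambda>s. \<integral>\<omega>. U c s \<omega> * D c s \<omega> \<partial>M)" if c: "c \<in> I" for c
      using en(1)[OF c c c c c] c by simp
    have i2: "set_integrable lborel {0..t} (\<lambda>s. \<integral>\<omega>. Q c s \<omega> * Q c s \<omega> \<partial>M)" if c: "c \<in> I" for c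
      using en(2)[OF c c c c c] c by simp
    have "(\<integral>\<omega>. (\<Sum>c\<in>I. (U c t \<omega>)\<^sup>2) \<partial>M) = (\<Sum>c\<in>I. \<integral>\<omega>. (U c t \<omega>)\<^sup>2 \<partial>M)"
      by (rule Bochner_Integration.integral_sum) (use sq_int_square[OF sq(1)[OF t]] in auto)
    also have "\<dots> = (\<Sum>c\<in>I. (x c)\<^sup>2) + (\<Sum>c\<in>I. 2 * (LBINT s:{0..t}. \<integral>\<omega>. U c s \<omega> * D c s \<omega> \<partial>M) + (LBINT s:{0..t}. \<integral>\<omega>. Q c s \<omega> * Q c s \<omega> \<partial>M))"
      by (simp add: eqc sum.distrib)
    also have "(\<Sum>c\<in>I. 2 * (LBINT s:{0..t}. \<integral>\<omega>. U c s \<omega> * D c s \<omega> \<partial>M) + (LBINT s:{0..t}. \<integral>\<omega>. Q c s \<omega> * Q c s \<omega> \<partial>M))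
      = (\<Sum>c\<in>I. LBINT s:{0..t}. 2 * (\<integral>\<omega>. U c s \<omega> * D c s \<omega> \<partial>M) + (\<integral>\<omega>. Q c s \<omega> * Q c s \<omega> \<partial>M))"
      by (rule sum.cong[OF refl]) (simp add: i1 i2)
    also have "\<dots> = (LBINT s:{0..t}. (\<Sum>c\<in>I. 2 * (\<integral>\<omega>. U c s \<omega> * D c s \<omega> \<partial>M) + (\<integral>\<omega>. Q c s \<omega> * Q c s \<omega> \<partial>M)))"
      unfolding set_lebesgue_integral_def scaleR_sum_right
      by (rule Bochner_Integration.integral_sum[symmetric])
        (use set_integral_add(1)[OF set_integrable_mult_right[of 2] , OF _ i2] i1 in \<open>auto simp: set_integrable_def\<close>)
    also have "\<dots> = (LBINT s:{0..t}. \<integral>\<omega>. (\<Sum>c\<in>I. 2 * (U c s \<omega> * D c s \<omega>) + (Q c s \<omega>)\<^sup>2) \<partial>M)"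
    proof (rule set_lebesgue_integral_cong)
      show "\<forall>s. s \<in> {0..t} \<longrightarrow> (\<Sum>c\<in>I. 2 * (\<integral>\<omega>. U c s \<omega> * D c s \<omega> \<partial>M) + (\<integral>\<omega>. Q c s \<omega> * Q c s \<omega> \<partial>M))
        = (\<integral>\<omega>. (\<Sum>c\<in>I. 2 * (U c s \<omega> * D c s \<omega>) + (Q c s \<omega>)\<^sup>2) \<partial>M)"
      proof (intro allI impI)
        fix s assume "s \<in> {0..t}"
        then have s: "s \<in> {0..T}" using t by auto
        have "(\<integral>\<omega>. (\<Sum>c\<in>I. 2 * (U c s \<omega> * D c s \<omega>) + (Q c s \<omega>)\<^sup>2) \<partial>M) = (\<Sum>c\<in>I. \<integral>\<omega>. 2 * (U c s \<omega> * D c s \<omega>) + (Q c s \<omega>)\<^sup>2 \<partial>M)"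
          by (rule Bochner_Integration.integral_sum) (use sq_int_mult[OF sq(1,2)[OF s]] sq_int_square[OF sq(3)[OF s]] in auto)
        also have "\<dots> = (\<Sum>c\<in>I. 2 * (\<integral>\<omega>. U c s \<omega> * D c s \<omega> \<partial>M) + (\<integral>\<omega>. Q c s \<omega> * Q c s \<omega> \<partial>M))"
          by (rule sum.cong[OF refl]) (use sq_int_mult[OF sq(1,2)[OF s]] sq_int_square[OF sq(3)[OF s]] in \<open>simp add: power2_eq_square\<close>)
        finally show "(\<Sum>c\<in>I. 2 * (\<integral>\<omega>. U c s \<omega> * D c s \<omega> \<partial>M) + (\<integral>\<omega>. Q c s \<omega> * Q c s \<omega> \<partial>M))
        = (\<integral>\<omega>. (\<Sum>c\<in>I. 2 * (U c s \<omega> * D c s \<omega>) + (Q c s \<omega>)\<^sup>2) \<partial>M)" by simp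
      qed
    qed simp
    finally show ?thesis .
  qed
  show thesis by (rule that[OF B(1) bU' bD' bQ' E])
qed

end

section \<open>The discrete energy identity\<close>

definition poly_inner :: "real \<Rightarrow> real \<Rightarrow> real poly \<Rightarrow> real poly \<Rightarrow> real" where
  "poly_inner a b p q = (LBINT x:{a..b}. poly p x * poly q x)"

lemma set_integrable_continuous_poly:
  fixes a b :: real
  assumes "continuous_on {a..b} f"
  shows "set_integrable lborel {a..b} (\<lambda>x. f x * poly p x)"
  by (intro borel_integrable_atLeastAtMost' continuous_intros assms)

lemma set_integral_poly_sum:
  fixes a b :: real
  assumes f: "continuous_on {a..b} f"
  shows "(LBINT x:{a..b}. f x * poly (\<Sum>i\<in>I. smult (c i) (p i)) x) = (\<Sum>i\<in>I. c i * (LBINT x:{a..b}. f x * poly (p i) x))"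
proof -
  have "(LBINT x:{a..b}. f x * poly (\<Sum>i\<in>I. smult (c i) (p i)) x) = (LBINT x:{a..b}. (\<Sum>i\<in>I. c i * (f x * poly (p i) x)))"
    by (simp add: poly_sum sum_distrib_left mult_ac)
  also have "\<dots> = (\<Sum>i\<in>I. LBINT x:{a..b}. c i * (f x * poly (p i) x))"
    unfolding set_lebesgue_integral_def scaleR_sum_right
    by (rule Bochner_Integration.integral_sum)
      (use set_integrable_mult_right[OF set_integrable_continuous_poly[OF f]] in \<open>simp add: set_integrable_def\<close>)
  finally show ?thesis by simp
qed

lemma poly_inner_sum_right:
  "poly_inner a b p (\<Sum>i\<in>I. smult (c i) (q i)) = (\<Sum>i\<in>I. c i * poly_inner a b p (q i))"
  unfolding poly_inner_def by (rule set_integral_poly_sum) (intro continuous_intros)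

lemma poly_inner_commute: "poly_inner a b p q = poly_inner a b q p"
  by (simp add: poly_inner_def mult.commute)

lemma poly_inner_smult: "poly_inner a b p (smult c q) = c * poly_inner a b p q"
  using poly_inner_sum_right[of a b p "\<lambda>_. c" "\<lambda>_. q" "{()}"] by simp

lemma poly_inner_add: "poly_inner a b p (q + r) = poly_inner a b p q + poly_inner a b p r"
  using poly_inner_sum_right[of a b p "\<lambda>_. 1" "\<lambda>i. if i then q else r" "{True, False}"] by simp

lemma poly_inner_diff: "poly_inner a b p (q - r) = poly_inner a b p q - poly_inner a b p r"
proof -
  have "q - r = q + smult (- 1) r" by simp
  then show ?thesis by (simp only: poly_inner_add poly_inner_smult)
qed

text \<open>A vanishing integral of the continuous \<open>p\<^sup>2\<close> makes \<open>p\<close>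
  zero on a whole interval, hence at infinitely many points.\<close>

lemma poly_inner_pos:
  assumes "a < b" "p \<noteq> 0" shows "0 < poly_inner a b p p"
proof -
  have c: "continuous_on {a..b} (\<lambda>x. poly p x * poly p x)" by (intro continuous_intros)
  have e: "poly_inner a b p p = integral {a..b} (\<lambda>x. poly p x * poly p x)"
    unfolding poly_inner_def by (rule set_borel_integral_eq_integral(2)[OF borel_integrable_atLeastAtMost'[OF c]])
  have "0 \<le> poly_inner a b p p" unfolding poly_inner_def set_lebesgue_integral_def
    by (rule Bochner_Integration.integral_nonneg) simp
  moreover have "poly_inner a b p p \<noteq> 0"
  proof
    assume "poly_inner a b p p = 0"
    then have "\<forall>x\<in>{a..b}. poly p x * poly p x = 0"
      using integral_eq_0_iff[OF c assms(1)] e by simp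
    then have "{a..b} \<subseteq> {x. poly p x = 0}" by auto
    moreover have "infinite {a..b}" using assms(1) infinite_Icc by blast
    ultimately show False using poly_roots_finite[OF assms(2)] finite_subset by blast
  qed
  ultimately show ?thesis by simp
qed

text \<open>Gram--Schmidt. Only the expansion property is recorded: it already yields Parseval's identity.\<close>

lemma poly_frame_exists:
  assumes ab: "a < b"
  shows "\<exists>e. (\<forall>i<n. \<forall>m\<ge>n. coeff (e i) m = 0) \<and>
    (\<forall>p. (\<forall>m\<ge>n. coeff p m = 0) \<longrightarrow> p = (\<Sum>i<n. smult (poly_inner a b p (e i)) (e i)))"
proof (induction n)
  case 0
  then show ?case by (auto simp: poly_eq_iff)
next
  case (Suc n)
  then obtain e where e: "\<And>i m. i < n \<Longrightarrow> n \<le> m \<Longrightarrow> coeff (e i) m = 0"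
    and ex: "\<And>p. \<forall>m\<ge>n. coeff p m = 0 \<Longrightarrow> p = (\<Sum>i<n. smult (poly_inner a b p (e i)) (e i))" by blast
  define w where "w = (monom 1 n :: real poly)"
  define r where "r = w - (\<Sum>i<n. smult (poly_inner a b w (e i)) (e i))"
  \<comment> \<open>\<open>r\<close> is \<open>w\<close> minus its projection. Inserting the
    expansion of \<open>p\<close> shows that \<open>w\<close> and its projection have the same inner
    product with \<open>p\<close>.\<close>
  have orth: "poly_inner a b p r = 0" if p: "\<forall>m\<ge>n. coeff p m = 0" for p
  proof -
    have "poly_inner a b p (\<Sum>i<n. smult (poly_inner a b w (e i)) (e i)) = (\<Sum>i<n. poly_inner a b w (e i) * poly_inner a b p (e i))"
      by (rule poly_inner_sum_right)
    also have "\<dots> = poly_inner a b w (\<Sum>i<n. smult (poly_inner a b p (e i)) (e i))"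
      unfolding poly_inner_sum_right by (simp add: mult.commute)
    also have "\<dots> = poly_inner a b w p" using ex[OF p] by simp
    finally show ?thesis unfolding r_def poly_inner_diff by (simp add: poly_inner_commute)
  qed
  have cr: "coeff r m = (if m = n then 1 else 0)" if "n \<le> m" for m
    using e that by (simp add: r_def w_def coeff_sum coeff_diff)
  have "r \<noteq> 0" using cr[OF order_refl] by auto
  then have rr: "0 < poly_inner a b r r" by (rule poly_inner_pos[OF ab])
  define s where "s = sqrt (poly_inner a b r r)"
  have s: "0 < s" "s * s = poly_inner a b r r" using rr by (auto simp: s_def)
  define e' where "e' = e(n := smult (1 / s) r)"
  have "coeff (e' i) m = 0" if "i < Suc n" "Suc n \<le> m" for i m
    using that e[of i m] cr[of m] by (auto simp: e'_def)
  moreover have "p = (\<Sum>i<Suc n. smult (poly_inner a b p (e' i)) (e' i))" if p: "\<forall>m\<ge>Suc n. coeff p m = 0" for p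
  proof -
    define c where "c = coeff p n"
    \<comment> \<open>\<open>r\<close> has coefficient 1 at degree \<open>n\<close>, so subtracting
      \<open>c\<close> times it brings \<open>p\<close> into the range of the induction
      hypothesis.\<close>
    define p' where "p' = p - smult c r"
    have p'0: "\<forall>m\<ge>n. coeff p' m = 0"
    proof (intro allI impI)
      fix m assume "n \<le> m"
      then show "coeff p' m = 0" using cr[of m] p by (cases "m = n") (auto simp: p'_def c_def)
    qed
    have pp: "p = p' + smult c r" by (simp add: p'_def)
    have ei: "poly_inner a b p (e i) = poly_inner a b p' (e i)" if "i < n" for i
    proof -
      have "poly_inner a b (e i) p = poly_inner a b (e i) p' + c * poly_inner a b (e i) r"
        unfolding pp poly_inner_add poly_inner_smult ..
      moreover have "poly_inner a b (e i) r = 0" by (rule orth) (use e that in auto)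
      ultimately show ?thesis by (simp add: poly_inner_commute)
    qed
    have er: "poly_inner a b p r = c * (s * s)"
    proof -
      have "poly_inner a b r p = poly_inner a b r p' + c * poly_inner a b r r"
        unfolding pp poly_inner_add poly_inner_smult ..
      then show ?thesis using orth[OF p'0] s by (simp add: poly_inner_commute)
    qed
    have "(\<Sum>i<Suc n. smult (poly_inner a b p (e' i)) (e' i)) = (\<Sum>i<n. smult (poly_inner a b p (e i)) (e i)) + smult (1 / s * poly_inner a b p r) (smult (1 / s) r)"
      by (simp add: e'_def poly_inner_smult)
    also have "(\<Sum>i<n. smult (poly_inner a b p (e i)) (e i)) = p'"
      using ex[OF p'0] ei by simp
    also have "smult (1 / s * poly_inner a b p r) (smult (1 / s) r) = smult c r"
      using s(1) er by simp
    finally show ?thesis using pp by simp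
  qed
  ultimately show ?case by blast
qed

lemma poly_basis_exists:
  assumes "a < b"
  obtains e where "\<And>i. i \<le> k \<Longrightarrow> degree (e i) \<le> k"
    "\<And>p. degree p \<le> k \<Longrightarrow> p = (\<Sum>i\<le>k. smult (poly_inner a b p (e i)) (e i))"
proof -
  from poly_frame_exists[OF assms, of "Suc k"] obtain e where
    e: "\<And>i m. i < Suc k \<Longrightarrow> Suc k \<le> m \<Longrightarrow> coeff (e i) m = 0"
    and ex: "\<And>p. \<forall>m\<ge>Suc k. coeff p m = 0 \<Longrightarrow> p = (\<Sum>i<Suc k. smult (poly_inner a b p (e i)) (e i))" by blast
  show thesis
  proof (rule that[of e])
    show "degree (e i) \<le> k" if "i \<le> k" for i using e[of i] that by (intro degree_le) auto
    show "p = (\<Sum>i\<le>k. smult (poly_inner a b p (e i)) (e i))" if "degree p \<le> k" for p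
      using ex[of p] that by (simp add: lessThan_Suc_atMost coeff_eq_0)
  qed
qed

section \<open>Energy identities on a cell and at an interface\<close>

lemma C2D:
  assumes "C2 \<sigma>"
  shows "(\<sigma> has_real_derivative deriv \<sigma> x) (at x)" "(deriv \<sigma> has_real_derivative deriv (deriv \<sigma>) x) (at x)"
    "continuous_on S \<sigma>" "continuous_on S (deriv \<sigma>)" "continuous_on S (deriv (deriv \<sigma>))"
proof -
  show d1: "(\<sigma> has_real_derivative deriv \<sigma> x) (at x)" for x
    using assms DERIV_deriv_iff_real_differentiable by (auto simp: C2_def)
  show d2: "(deriv \<sigma> has_real_derivative deriv (deriv \<sigma>) x) (at x)" for x
    using assms DERIV_deriv_iff_real_differentiable by (auto simp: C2_def)
  show "continuous_on S \<sigma>" by (intro continuous_at_imp_continuous_on ballI DERIV_isCont[OF d1])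
  show "continuous_on S (deriv \<sigma>)" by (intro continuous_at_imp_continuous_on ballI DERIV_isCont[OF d2])
  show "continuous_on S (deriv (deriv \<sigma>))" using assms continuous_on_subset by (auto simp: C2_def)
qed

lemma deriv_square:
  assumes "C2 \<sigma>"
  shows "deriv (\<lambda>x. (\<sigma> x)\<^sup>2) = (\<lambda>x. 2 * \<sigma> x * deriv \<sigma> x)"
    "deriv (deriv (\<lambda>x. (\<sigma> x)\<^sup>2)) x = 2 * (deriv \<sigma> x)\<^sup>2 + 2 * \<sigma> x * deriv (deriv \<sigma>) x"
proof -
  note C2D[OF assms, derivative_intros]
  show 1: "deriv (\<lambda>x. (\<sigma> x)\<^sup>2) = (\<lambda>x. 2 * \<sigma> x * deriv \<sigma> x)"
    by (intro ext DERIV_imp_deriv) (auto intro!: derivative_eq_intros C2D(1)[OF assms])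
  show "deriv (deriv (\<lambda>x. (\<sigma> x)\<^sup>2)) x = 2 * (deriv \<sigma> x)\<^sup>2 + 2 * \<sigma> x * deriv (deriv \<sigma>) x"
    unfolding 1 by (intro DERIV_imp_deriv)
      (auto intro!: derivative_eq_intros C2D(1,2)[OF assms] simp: power2_eq_square)
qed

lemma deriv_mult_poly:
  assumes "C2 \<sigma>"
  shows "deriv (\<lambda>y. \<sigma> y * poly p y) x = deriv \<sigma> x * poly p x + \<sigma> x * poly (pderiv p) x"
    "deriv (\<lambda>y. deriv \<sigma> y * poly p y) x = deriv (deriv \<sigma>) x * poly p x + deriv \<sigma> x * poly (pderiv p) x"
  by (intro DERIV_imp_deriv; auto intro!: derivative_eq_intros C2D(1,2)[OF assms] poly_DERIV)+

text \<open>The function differentiated is \<open>(\<sigma>\<^sup>2)' p\<^sup>2 / 4\<close>. Its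
  derivative contains \<open>\<sigma> \<sigma>' p p'\<close> and so removes the only term with
  \<open>p'\<close> from the volume integral; substituting \<open>\<sigma> \<sigma>'' =
  (\<sigma>\<^sup>2)''/2 - (\<sigma>')\<^sup>2\<close> in the rest leaves the weight.\<close>

lemma cell_energy_a:
  assumes \<sigma>: "C2 \<sigma>" and ab: "a \<le> b"
  shows "- (LBINT x:{a..b}. deriv (\<lambda>y. deriv \<sigma> y * poly p y) x * \<sigma> x * poly p x)
    = (LBINT x:{a..b}. ((deriv \<sigma> x)\<^sup>2 - 1/4 * deriv (deriv (\<lambda>x. (\<sigma> x)\<^sup>2)) x) * (poly p x)\<^sup>2)
      - (1/4 * (2 * \<sigma> b * deriv \<sigma> b) * (poly p b)\<^sup>2 - 1/4 * (2 * \<sigma> a * deriv \<sigma> a) * (poly p a)\<^sup>2)"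
proof -
  note c = C2D(3-5)[OF \<sigma>]
  let ?F = "\<lambda>x. 1/4 * (2 * \<sigma> x * deriv \<sigma> x) * (poly p x)\<^sup>2"
  let ?f = "\<lambda>x. ((deriv \<sigma> x)\<^sup>2 - 1/4 * (2 * (deriv \<sigma> x)\<^sup>2 + 2 * \<sigma> x * deriv (deriv \<sigma>) x)) * (poly p x)\<^sup>2"
  let ?g = "\<lambda>x. (deriv (deriv \<sigma>) x * poly p x + deriv \<sigma> x * poly (pderiv p) x) * \<sigma> x * poly p x"
  have "(LBINT x:{a..b}. ?f x + ?g x) = ?F b - ?F a"
  proof (rule set_lebesgue_FTC[OF ab])
    show "(?F has_real_derivative ?f x + ?g x) (at x within {a..b})" for x
      by (rule has_field_derivative_at_within)
        (auto intro!: derivative_eq_intros C2D(1,2)[OF \<sigma>] poly_DERIV simp: power2_eq_square algebra_simps)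
    show "continuous_on {a..b} (\<lambda>x. ?f x + ?g x)" by (intro continuous_intros c)
  qed
  moreover have "(LBINT x:{a..b}. ?f x + ?g x) = (LBINT x:{a..b}. ?f x) + (LBINT x:{a..b}. ?g x)"
    by (intro set_integral_add borel_integrable_atLeastAtMost' continuous_intros c)
  ultimately show ?thesis
    unfolding deriv_mult_poly[OF \<sigma>] deriv_square(2)[OF \<sigma>] by linarith
qed

text \<open>Up to sign, the volume term of \<open>form_b\<close> tested with \<open>p\<close> and
  that of the equation for \<open>q\<close> tested with \<open>q\<close> add up to the derivative of
  \<open>\<sigma> p q\<close>; only values at the cell ends remain.\<close>

lemma cell_energy_b:
  assumes \<sigma>: "C2 \<sigma>" and ab: "a \<le> b"
  shows "- (LBINT x:{a..b}. deriv (\<lambda>y. \<sigma> y * poly p y) x * poly q x) - (LBINT x:{a..b}. poly (pderiv q) x * \<sigma> x * poly p x)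
    = - (\<sigma> b * poly p b * poly q b - \<sigma> a * poly p a * poly q a)"
proof -
  note c = C2D(3-5)[OF \<sigma>]
  let ?f = "\<lambda>x. (deriv \<sigma> x * poly p x + \<sigma> x * poly (pderiv p) x) * poly q x"
  let ?g = "\<lambda>x. poly (pderiv q) x * \<sigma> x * poly p x"
  have "(LBINT x:{a..b}. ?f x + ?g x) = \<sigma> b * poly p b * poly q b - \<sigma> a * poly p a * poly q a"
  proof (rule set_lebesgue_FTC[OF ab])
    show "((\<lambda>x. \<sigma> x * poly p x * poly q x) has_real_derivative ?f x + ?g x) (at x within {a..b})" for x
      by (rule has_field_derivative_at_within)
        (auto intro!: derivative_eq_intros C2D(1,2)[OF \<sigma>] poly_DERIV simp: algebra_simps)
    show "continuous_on {a..b} (\<lambda>x. ?f x + ?g x)" by (intro continuous_intros c)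
  qed
  moreover have "(LBINT x:{a..b}. ?f x + ?g x) = (LBINT x:{a..b}. ?f x) + (LBINT x:{a..b}. ?g x)"
    by (intro set_integral_add borel_integrable_atLeastAtMost' continuous_intros c)
  ultimately show ?thesis unfolding deriv_mult_poly[OF \<sigma>] by linarith
qed

text \<open>Summation by parts over the mesh: \<open>A (Suc j)\<close> stands for what cell
  \<open>j\<close> contributes at its right end, \<open>B j\<close> at its left end. Regrouped by
  interfaces they pair as \<open>A j - B j\<close>, apart from the two end points.\<close>

lemma interface_sum:
  fixes A B :: "nat \<Rightarrow> real"
  shows "(\<Sum>j<N. A (Suc j) - B j) = A N - A 0 + (\<Sum>j<N. A j - B j)"
  by (induction N) auto

lemma jump_boundary:
  assumes "0 < N" shows "jump N X v 0 = 0" "jump N X v N = 0"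
  using assms by (auto simp: jump_def tr_plus_def tr_minus_def)

text \<open>Times \<open>b\<close>, the upwind value is \<open>b\<close> times the average plus
  \<open>\<bar>b\<bar>/2\<close> times the jump. The average part cancels against the boundary term
  of the volume integral; the jump part carries the coefficient \<open>\<gamma>/2 + g\<close> and
  gives the dissipation.\<close>

lemma interface_a:
  fixes b up um \<gamma> g :: real
  shows "- 1/4 * b * um\<^sup>2 + 1/2 * b * (\<gamma> * (if b \<ge> 0 then up else um) + (1 - \<gamma>) * (1/2 * (up + um)) + g * sgn b * (up - um)) * um
     - (- 1/4 * b * up\<^sup>2 + 1/2 * b * (\<gamma> * (if b \<ge> 0 then up else um) + (1 - \<gamma>) * (1/2 * (up + um)) + g * sgn b * (up - um)) * up)
    = - 1/4 * (\<gamma> + 2 * g) * \<bar>b\<bar> * (up - um)\<^sup>2"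
proof -
  have "b * (if b \<ge> 0 then up else um) = b * (1/2 * (up + um)) + \<bar>b\<bar> * (1/2 * (up - um))"
    by (cases "b \<ge> 0") (simp_all add: field_simps)
  moreover have "b * sgn b = \<bar>b\<bar>" by (simp add: abs_sgn mult.commute)
  ultimately have b: "b * (if b \<ge> 0 then up else um) = b * (1/2 * (up + um)) + \<bar>b\<bar> * (1/2 * (up - um))"
    "b * sgn b = \<bar>b\<bar>" by auto
  have "b * (\<gamma> * (if b \<ge> 0 then up else um) + (1 - \<gamma>) * (1/2 * (up + um)) + g * sgn b * (up - um))
    = \<gamma> * (b * (if b \<ge> 0 then up else um)) + (1 - \<gamma>) * (b * (1/2 * (up + um))) + g * ((b * sgn b) * (up - um))"
    by (simp add: distrib_left mult_ac)
  also have "\<dots> = b * (1/2 * (up + um)) + \<bar>b\<bar> * ((1/2 * \<gamma> + g) * (up - um))"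
    unfolding b by (simp add: field_simps)
  finally have F: "b * (\<gamma> * (if b \<ge> 0 then up else um) + (1 - \<gamma>) * (1/2 * (up + um)) + g * sgn b * (up - um))
    = b * (1/2 * (up + um)) + \<bar>b\<bar> * ((1/2 * \<gamma> + g) * (up - um))" .
  have "- 1/4 * b * um\<^sup>2 + 1/2 * (b * (1/2 * (up + um)) + c * ((1/2 * \<gamma> + g) * (up - um))) * um
     - (- 1/4 * b * up\<^sup>2 + 1/2 * (b * (1/2 * (up + um)) + c * ((1/2 * \<gamma> + g) * (up - um))) * up)
    = - 1/4 * (\<gamma> + 2 * g) * c * (up - um)\<^sup>2" for c
    by (simp add: power2_eq_square field_simps)
  from this[of "\<bar>b\<bar>"] show ?thesis unfolding F[symmetric] by (simp only: mult.assoc)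
qed

text \<open>The fluxes for \<open>u\<close> and \<open>q\<close> weight the two traces in opposite
  ways, \<open>\<theta>\<close> against \<open>1 - \<theta>\<close>, so the consistent parts cancel.
  In the stabilisation terms \<open>s * sgn s = \<bar>s\<bar>\<close> produces the squares of both
  jumps.\<close>

lemma interface_b:
  fixes s up um qp qm \<theta> hu hq :: real
  shows "(- s * um * qm + s * ((1 - \<theta>) * qm + \<theta> * qp + hq * sgn s * (up - um)) * um + s * (\<theta> * um + (1 - \<theta>) * up + hu * sgn s * (qp - qm)) * qm)
     - (- s * up * qp + s * ((1 - \<theta>) * qm + \<theta> * qp + hq * sgn s * (up - um)) * up + s * (\<theta> * um + (1 - \<theta>) * up + hu * sgn s * (qp - qm)) * qp)
    = - \<bar>s\<bar> * (hu * (qp - qm)\<^sup>2 + hq * (up - um)\<^sup>2)"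
proof -
  have s: "s * sgn s = \<bar>s\<bar>" by (simp add: abs_sgn mult.commute)
  have "?thesis \<longleftrightarrow> (s * sgn s) * (hq * (up - um)) * (um - up) + (s * sgn s) * (hu * (qp - qm)) * (qm - qp)
     = - \<bar>s\<bar> * (hu * (qp - qm)\<^sup>2 + hq * (up - um)\<^sup>2)"
    by (simp add: algebra_simps)
  then show ?thesis unfolding s by (simp add: power2_eq_square algebra_simps)
qed

lemma discrete_energy_identity:
  assumes \<sigma>: "C2 \<sigma>" and mesh: "mesh N X"
    and q: "\<And>j. j < N \<Longrightarrow> (LBINT x:{X j..X (Suc j)}. poly (q j) x * poly (q j) x)
        = - (LBINT x:{X j..X (Suc j)}. poly (pderiv (q j)) x * \<sigma> x * poly (u j) x)
          + \<sigma> (X (Suc j)) * flux_u \<sigma> \<theta> \<eta>u N X u q (Suc j) * tr_minus X q (Suc j)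
          - \<sigma> (X j) * flux_u \<sigma> \<theta> \<eta>u N X u q j * tr_plus N X q j"
    and b0: "\<sigma> (X 0) * tr_plus N X u 0 = 0" and bN: "\<sigma> (X N) * tr_minus X u N = 0"
  shows "(\<Sum>j<N. 2 * (form_a \<sigma> \<gamma> \<gamma>t N X j u u + form_b \<sigma> \<theta> \<eta>q N X j u q u) + poly_inner (X j) (X (Suc j)) (q j) (q j))
    = (\<Sum>j<N. LBINT x:{X j..X (Suc j)}. ((deriv \<sigma> x)\<^sup>2 - 1/4 * deriv (deriv (\<lambda>x. (\<sigma> x)\<^sup>2)) x) * (poly (u j) x)\<^sup>2)
      - 1/4 * (\<Sum>j<N. (\<gamma> + 2 * \<gamma>t) * (\<bar>deriv (\<lambda>x. (\<sigma> x)\<^sup>2) (X j)\<bar> * (jump N X u j)\<^sup>2))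
      - (\<Sum>j<N. \<bar>\<sigma> (X j)\<bar> * (\<eta>u * (jump N X q j)\<^sup>2 + \<eta>q * (jump N X u j)\<^sup>2))"
proof -
  have N: "0 < N" and XX: "\<And>j. j < N \<Longrightarrow> X j \<le> X (Suc j)" using mesh by (auto simp: mesh_def less_imp_le)
  let ?b = "\<lambda>i. 2 * \<sigma> (X i) * deriv \<sigma> (X i)"
  let ?um = "tr_minus X u" and ?up = "tr_plus N X u" and ?qm = "tr_minus X q" and ?qp = "tr_plus N X q"
  let ?F = "\<lambda>i. flux_a \<sigma> \<gamma> \<gamma>t N X u i" and ?Fu = "\<lambda>i. flux_u \<sigma> \<theta> \<eta>u N X u q i" and ?Fq = "\<lambda>i. flux_q \<sigma> \<theta> \<eta>q N X u q i"
  \<comment> \<open>\<open>A i\<close> and \<open>B i\<close> collect all terms at interface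
    \<open>i\<close>, seen from the cell on its left and on its right: boundary terms of the volume
    integrals and numerical fluxes.\<close>
  define A where "A = (\<lambda>i. (- 1/4 * ?b i * (?um i)\<^sup>2 + 1/2 * ?b i * ?F i * ?um i)
     + (- \<sigma> (X i) * ?um i * ?qm i + \<sigma> (X i) * ?Fq i * ?um i + \<sigma> (X i) * ?Fu i * ?qm i))"
  define B where "B = (\<lambda>i. (- 1/4 * ?b i * (?up i)\<^sup>2 + 1/2 * ?b i * ?F i * ?up i)
     + (- \<sigma> (X i) * ?up i * ?qp i + \<sigma> (X i) * ?Fq i * ?up i + \<sigma> (X i) * ?Fu i * ?qp i))"
  let ?w = "\<lambda>j. LBINT x:{X j..X (Suc j)}. ((deriv \<sigma> x)\<^sup>2 - 1/4 * deriv (deriv (\<lambda>x. (\<sigma> x)\<^sup>2)) x) * (poly (u j) x)\<^sup>2"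
  have cell: "2 * (form_a \<sigma> \<gamma> \<gamma>t N X j u u + form_b \<sigma> \<theta> \<eta>q N X j u q u) + poly_inner (X j) (X (Suc j)) (q j) (q j)
    = ?w j + (A (Suc j) - B j)" if j: "j < N" for j
  proof -
    have m: "tr_minus X v (Suc j) = poly (v j) (X (Suc j))" "tr_plus N X v j = poly (v j) (X j)" for v
      using j by (auto simp: tr_minus_def tr_plus_def)
    have 1: "2 * form_a \<sigma> \<gamma> \<gamma>t N X j u u = ?w j - (1/4 * ?b (Suc j) * (?um (Suc j))\<^sup>2 - 1/4 * ?b j * (?up j)\<^sup>2)
       + 1/2 * (?b (Suc j) * ?F (Suc j) * ?um (Suc j) - ?b j * ?F j * ?up j)"
    proof -
      have "2 * form_a \<sigma> \<gamma> \<gamma>t N X j u u = - (LBINT x:{X j..X (Suc j)}. deriv (\<lambda>y. deriv \<sigma> y * poly (u j) y) x * \<sigma> x * poly (u j) x)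
        + 1/2 * (?b (Suc j) * ?F (Suc j) * ?um (Suc j) - ?b j * ?F j * ?up j)"
        unfolding form_a_def deriv_square(1)[OF \<sigma>] by simp
      also have "\<dots> = ?w j - (1/4 * ?b (Suc j) * (?um (Suc j))\<^sup>2 - 1/4 * ?b j * (?up j)\<^sup>2)
       + 1/2 * (?b (Suc j) * ?F (Suc j) * ?um (Suc j) - ?b j * ?F j * ?up j)"
        unfolding cell_energy_a[OF \<sigma> XX[OF j]] m ..
      finally show ?thesis .
    qed
    have 2: "2 * form_b \<sigma> \<theta> \<eta>q N X j u q u + poly_inner (X j) (X (Suc j)) (q j) (q j)
      = - (\<sigma> (X (Suc j)) * ?um (Suc j) * ?qm (Suc j) - \<sigma> (X j) * ?up j * ?qp j)
        + (\<sigma> (X (Suc j)) * ?Fq (Suc j) * ?um (Suc j) - \<sigma> (X j) * ?Fq j * ?up j)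
        + (\<sigma> (X (Suc j)) * ?Fu (Suc j) * ?qm (Suc j) - \<sigma> (X j) * ?Fu j * ?qp j)"
    proof -
      have "2 * form_b \<sigma> \<theta> \<eta>q N X j u q u + poly_inner (X j) (X (Suc j)) (q j) (q j)
        = (- (LBINT x:{X j..X (Suc j)}. deriv (\<lambda>y. \<sigma> y * poly (u j) y) x * poly (q j) x) - (LBINT x:{X j..X (Suc j)}. poly (pderiv (q j)) x * \<sigma> x * poly (u j) x))
        + (\<sigma> (X (Suc j)) * ?Fq (Suc j) * ?um (Suc j) - \<sigma> (X j) * ?Fq j * ?up j)
        + (\<sigma> (X (Suc j)) * ?Fu (Suc j) * ?qm (Suc j) - \<sigma> (X j) * ?Fu j * ?qp j)"
        unfolding form_b_def poly_inner_def q[OF j] by simp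
      also have "\<dots> = - (\<sigma> (X (Suc j)) * ?um (Suc j) * ?qm (Suc j) - \<sigma> (X j) * ?up j * ?qp j)
        + (\<sigma> (X (Suc j)) * ?Fq (Suc j) * ?um (Suc j) - \<sigma> (X j) * ?Fq j * ?up j)
        + (\<sigma> (X (Suc j)) * ?Fu (Suc j) * ?qm (Suc j) - \<sigma> (X j) * ?Fu j * ?qp j)"
        unfolding cell_energy_b[OF \<sigma> XX[OF j]] m ..
      finally show ?thesis .
    qed
    show ?thesis using 1 2 unfolding A_def B_def by (simp add: algebra_simps)
  qed
  have AB: "A i - B i = - 1/4 * ((\<gamma> + 2 * \<gamma>t) * (\<bar>?b i\<bar> * (jump N X u i)\<^sup>2)) - \<bar>\<sigma> (X i)\<bar> * (\<eta>u * (jump N X q i)\<^sup>2 + \<eta>q * (jump N X u i)\<^sup>2)" for i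
    using interface_a[of "?b i" "?um i" \<gamma> "?up i" \<gamma>t] interface_b[of "\<sigma> (X i)" "?um i" "?qm i" \<theta> "?qp i" \<eta>q "?up i" \<eta>u]
    unfolding A_def B_def flux_a_def flux_u_def flux_q_def upwind_def average_def jump_def deriv_square(1)[OF \<sigma>] by linarith
  \<comment> \<open>At an end point the jumps vanish and the fluxes of \<open>u\<close> reduce to
    the trace, so every term has the factor \<open>\<sigma> u\<close>, which is zero there by
    hypothesis.\<close>
  have bd: "A i = 0" if "\<sigma> (X i) * ?um i = 0" "?up i = ?um i" "?qp i = ?qm i" for i
  proof -
    have F: "?F i = ?um i" using that by (simp add: flux_a_def upwind_def average_def jump_def algebra_simps)
    have Fu: "?Fu i = ?um i" using that by (simp add: flux_u_def jump_def algebra_simps)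
    show ?thesis using that(1) unfolding A_def F Fu by (auto simp: power2_eq_square)
  qed
  have "A N = 0" using bN jump_boundary(2)[OF N, of X] by (intro bd) (auto simp: jump_def)
  moreover have "A 0 = 0"
  proof (rule bd)
    show "?up 0 = ?um 0" "?qp 0 = ?qm 0" using jump_boundary(1)[OF N, of X u] jump_boundary(1)[OF N, of X q] by (auto simp: jump_def)
    then show "\<sigma> (X 0) * ?um 0 = 0" using b0 by simp
  qed
  ultimately have "(\<Sum>j<N. A (Suc j) - B j) = (\<Sum>j<N. A j - B j)" using interface_sum[of A B N] by simp
  moreover have "(\<Sum>j<N. 2 * (form_a \<sigma> \<gamma> \<gamma>t N X j u u + form_b \<sigma> \<theta> \<eta>q N X j u q u) + poly_inner (X j) (X (Suc j)) (q j) (q j))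
    = (\<Sum>j<N. ?w j) + (\<Sum>j<N. A (Suc j) - B j)"
    unfolding sum.distrib[symmetric] by (rule sum.cong[OF refl]) (simp only: cell lessThan_iff)
  moreover have "(\<Sum>j<N. A j - B j) = - (1/4 * (\<Sum>j<N. (\<gamma> + 2 * \<gamma>t) * (\<bar>?b j\<bar> * (jump N X u j)\<^sup>2))) - (\<Sum>j<N. \<bar>\<sigma> (X j)\<bar> * (\<eta>u * (jump N X q j)\<^sup>2 + \<eta>q * (jump N X u j)\<^sup>2))"
    unfolding AB sum_subtractf sum_distrib_left by (simp add: sum_negf)
  ultimately show ?thesis unfolding deriv_square(1)[OF \<sigma>] by simp
qed

section \<open>Coordinates on the space of broken polynomials\<close>

locale dg_frame =
  fixes N k :: nat and X :: "nat \<Rightarrow> real" and e :: "nat \<Rightarrow> nat \<Rightarrow> real poly"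
  assumes mesh: "mesh N X"
    and e_degree: "\<And>j i. j < N \<Longrightarrow> i \<le> k \<Longrightarrow> degree (e j i) \<le> k"
    and e_expand: "\<And>j p. j < N \<Longrightarrow> degree p \<le> k \<Longrightarrow> p = (\<Sum>i\<le>k. smult (poly_inner (X j) (X (Suc j)) p (e j i)) (e j i))"
begin

definition idx :: "(nat \<times> nat) set" where "idx = {..<N} \<times> {..k}"

text \<open>The scheme is posed cell by cell, so with index \<open>c\<close> only the polynomial on
  cell \<open>fst c\<close> is looked at; repeating it on all cells keeps the degree bound
  everywhere.\<close>

definition test :: "nat \<times> nat \<Rightarrow> bpoly" where "test c = (\<lambda>_. e (fst c) (snd c))"

definition co :: "nat \<times> nat \<Rightarrow> bpoly \<Rightarrow> real" where
  "co c v = poly_inner (X (fst c)) (X (Suc (fst c))) (v (fst c)) (e (fst c) (snd c))"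

text \<open>A linear functional on \<open>dg_space\<close>, encoded by its coefficients:
  boundedness, measurability and path continuity then come down to finitely many
  coordinates.\<close>

definition lin :: "(bpoly \<Rightarrow> real) \<Rightarrow> bool" where
  "lin \<Phi> \<longleftrightarrow> (\<exists>\<alpha>. \<forall>v\<in>dg_space N k. \<Phi> v = (\<Sum>c\<in>idx. \<alpha> c * co c v))"

lemma finite_idx: "finite idx" by (simp add: idx_def)

lemma N_pos: "0 < N" and X_less: "j < N \<Longrightarrow> X j < X (Suc j)"
  using mesh by (auto simp: mesh_def)

lemma test_dg_space: "c \<in> idx \<Longrightarrow> test c \<in> dg_space N k"
  unfolding dg_space_def test_def using e_degree
  by (auto simp: idx_def)

lemma sum_idx: "(\<Sum>c\<in>idx. f c) = (\<Sum>j<N. \<Sum>i\<le>k. f (j, i))"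
  unfolding idx_def by (simp add: sum.cartesian_product)

lemma expand:
  assumes "v \<in> dg_space N k" "j < N"
  shows "v j = (\<Sum>i\<le>k. smult (co (j, i) v) (e j i))"
  unfolding co_def fst_conv snd_conv using e_expand[OF assms(2), of "v j"] assms by (auto simp: dg_space_def)

lemma poly_expand:
  assumes "v \<in> dg_space N k" "j < N"
  shows "poly (v j) y = (\<Sum>i\<le>k. co (j, i) v * poly (e j i) y)"
  by (subst expand[OF assms]) (simp add: poly_sum)

text \<open>The expansion is inserted into one factor only; the other factor then produces the
  coordinates a second time.\<close>

lemma parseval:
  assumes "v \<in> dg_space N k" "j < N"
  shows "poly_inner (X j) (X (Suc j)) (v j) (v j) = (\<Sum>i\<le>k. (co (j, i) v)\<^sup>2)"
proof -
  have "poly_inner (X j) (X (Suc j)) (v j) (v j) = poly_inner (X j) (X (Suc j)) (v j) (\<Sum>i\<le>k. smult (co (j, i) v) (e j i))"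
    using expand[OF assms] by simp
  also have "\<dots> = (\<Sum>i\<le>k. (co (j, i) v)\<^sup>2)"
    unfolding poly_inner_sum_right by (simp add: co_def power2_eq_square)
  finally show ?thesis .
qed

lemma lin_add: "lin \<Phi> \<Longrightarrow> lin \<Psi> \<Longrightarrow> lin (\<lambda>v. \<Phi> v + \<Psi> v)"
proof -
  assume "lin \<Phi>" "lin \<Psi>"
  then obtain \<alpha> \<beta> where "\<forall>v\<in>dg_space N k. \<Phi> v = (\<Sum>c\<in>idx. \<alpha> c * co c v)" "\<forall>v\<in>dg_space N k. \<Psi> v = (\<Sum>c\<in>idx. \<beta> c * co c v)"
    unfolding lin_def by blast
  then show ?thesis unfolding lin_def
    by (intro exI[of _ "\<lambda>c. \<alpha> c + \<beta> c"]) (simp add: distrib_right sum.distrib)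
qed

lemma lin_cmult: "lin \<Phi> \<Longrightarrow> lin (\<lambda>v. a * \<Phi> v)"
proof -
  assume "lin \<Phi>"
  then obtain \<alpha> where "\<forall>v\<in>dg_space N k. \<Phi> v = (\<Sum>c\<in>idx. \<alpha> c * co c v)" unfolding lin_def by blast
  then show ?thesis unfolding lin_def
    by (intro exI[of _ "\<lambda>c. a * \<alpha> c"]) (simp add: sum_distrib_left mult.assoc)
qed

lemma lin_multr: "lin \<Phi> \<Longrightarrow> lin (\<lambda>v. \<Phi> v * a)"
  using lin_cmult[of \<Phi> a] by (simp add: mult.commute)

lemma lin_minus: "lin \<Phi> \<Longrightarrow> lin (\<lambda>v. - \<Phi> v)"
  using lin_cmult[of \<Phi> "-1"] by simp

lemma lin_diff: "lin \<Phi> \<Longrightarrow> lin \<Psi> \<Longrightarrow> lin (\<lambda>v. \<Phi> v - \<Psi> v)"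
  using lin_add[of \<Phi> "\<lambda>v. - \<Psi> v"] lin_minus[of \<Psi>] by simp

lemma lin_cell:
  assumes j: "j < N" and \<Phi>: "\<And>v. v \<in> dg_space N k \<Longrightarrow> \<Phi> v = (\<Sum>i\<le>k. co (j, i) v * a i)"
  shows "lin \<Phi>"
  unfolding lin_def
proof (intro exI ballI)
  fix v assume v: "v \<in> dg_space N k"
  have "(\<Sum>c\<in>idx. (if fst c = j then a (snd c) else 0) * co c v) = (\<Sum>l<N. if l = j then (\<Sum>i\<le>k. a i * co (j, i) v) else 0)"
    unfolding sum_idx by (intro sum.cong refl) auto
  also have "\<dots> = (\<Sum>i\<le>k. a i * co (j, i) v)" using j by simp
  finally show "\<Phi> v = (\<Sum>c\<in>idx. (if fst c = j then a (snd c) else 0) * co c v)"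
    using \<Phi>[OF v] by (simp add: mult.commute)
qed

lemma lin_point: "j < N \<Longrightarrow> lin (\<lambda>v. poly (v j) y)"
  by (rule lin_cell[of j _ "\<lambda>i. poly (e j i) y"]) (auto simp: poly_expand)

lemma lin_integral:
  assumes j: "j < N" and f: "continuous_on UNIV f"
  shows "lin (\<lambda>v. LBINT x:{X j..X (Suc j)}. f x * poly (v j) x)"
proof (rule lin_cell[OF j])
  fix v assume v: "v \<in> dg_space N k"
  have c: "continuous_on {X j..X (Suc j)} f" using f by (rule continuous_on_subset) simp
  have "(LBINT x:{X j..X (Suc j)}. f x * poly (v j) x) = (LBINT x:{X j..X (Suc j)}. f x * poly (\<Sum>i\<le>k. smult (co (j, i) v) (e j i)) x)"
    using expand[OF v j] by simp
  then show "(LBINT x:{X j..X (Suc j)}. f x * poly (v j) x) = (\<Sum>i\<le>k. co (j, i) v * (LBINT x:{X j..X (Suc j)}. f x * poly (e j i) x))"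
    unfolding set_integral_poly_sum[OF c] .
qed

lemma lin_tr_minus: "i \<le> N \<Longrightarrow> lin (\<lambda>v. tr_minus X v i)"
  unfolding tr_minus_def using N_pos by (cases "i = 0") (auto intro: lin_point)

lemma lin_tr_plus: "i \<le> N \<Longrightarrow> lin (\<lambda>v. tr_plus N X v i)"
  unfolding tr_plus_def using N_pos by (cases "i = N") (auto intro: lin_point)

lemma lin_jump: "i \<le> N \<Longrightarrow> lin (\<lambda>v. jump N X v i)"
  unfolding jump_def by (intro lin_diff lin_tr_minus lin_tr_plus)

lemma lin_upwind: "i \<le> N \<Longrightarrow> lin (\<lambda>v. upwind N X v b i)"
  unfolding upwind_def using lin_tr_plus lin_tr_minus by (cases "b \<ge> 0") auto

lemma lin_flux_a: "i \<le> N \<Longrightarrow> lin (\<lambda>v. flux_a \<sigma> \<gamma> \<gamma>t N X v i)"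
  unfolding flux_a_def average_def
  by (intro lin_add lin_cmult lin_jump lin_tr_plus lin_tr_minus lin_upwind)

lemma lin_form_a:
  assumes \<sigma>: "C2 \<sigma>" and j: "j < N"
  shows "lin (\<lambda>u. form_a \<sigma> \<gamma> \<gamma>t N X j u \<phi>)"
  unfolding form_a_def
proof (intro lin_add lin_cmult lin_diff lin_multr lin_flux_a lin_integral[OF j])
  show "continuous_on UNIV (\<lambda>x. deriv (\<lambda>y. deriv \<sigma> y * poly (\<phi> j) y) x * \<sigma> x)"
    unfolding deriv_mult_poly[OF \<sigma>] by (intro continuous_intros C2D(3-5)[OF \<sigma>])
qed (use j in auto)

text \<open>\<open>form_b\<close> depends on \<open>u\<close> only through the jump term with
  \<open>\<eta>q\<close>; separating it gives one functional of \<open>u\<close> and one of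
  \<open>q\<close>.\<close>

lemma form_b_split:
  assumes \<sigma>: "C2 \<sigma>" and j: "j < N"
  obtains \<Phi> \<Psi> where "lin \<Phi>" "lin \<Psi>" "\<And>u q. form_b \<sigma> \<theta> \<eta>q N X j u q \<phi> = \<Phi> u + \<Psi> q"
proof (rule that)
  let ?s = "\<lambda>i. \<eta>q * sgn (\<sigma> (X i))"
  show "lin (\<lambda>u. 1/2 * (\<sigma> (X (Suc j)) * (?s (Suc j) * jump N X u (Suc j)) * tr_minus X \<phi> (Suc j)
     - \<sigma> (X j) * (?s j * jump N X u j) * tr_plus N X \<phi> j))"
    by (intro lin_cmult lin_diff lin_multr lin_jump) (use j in auto)
  show "lin (\<lambda>q. - 1/2 * (LBINT x:{X j..X (Suc j)}. deriv (\<lambda>y. \<sigma> y * poly (\<phi> j) y) x * poly (q j) x)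
     + 1/2 * (\<sigma> (X (Suc j)) * ((1 - \<theta>) * tr_minus X q (Suc j) + \<theta> * tr_plus N X q (Suc j)) * tr_minus X \<phi> (Suc j)
     - \<sigma> (X j) * ((1 - \<theta>) * tr_minus X q j + \<theta> * tr_plus N X q j) * tr_plus N X \<phi> j))"
  proof (intro lin_add lin_cmult lin_diff lin_multr lin_tr_minus lin_tr_plus lin_integral[OF j])
    show "continuous_on UNIV (\<lambda>x. deriv (\<lambda>y. \<sigma> y * poly (\<phi> j) y) x)"
      unfolding deriv_mult_poly[OF \<sigma>] by (intro continuous_intros C2D(3-5)[OF \<sigma>])
  qed (use j in auto)
  show "form_b \<sigma> \<theta> \<eta>q N X j u q \<phi> = 1/2 * (\<sigma> (X (Suc j)) * (?s (Suc j) * jump N X u (Suc j)) * tr_minus X \<phi> (Suc j)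
     - \<sigma> (X j) * (?s j * jump N X u j) * tr_plus N X \<phi> j)
     + (- 1/2 * (LBINT x:{X j..X (Suc j)}. deriv (\<lambda>y. \<sigma> y * poly (\<phi> j) y) x * poly (q j) x)
     + 1/2 * (\<sigma> (X (Suc j)) * ((1 - \<theta>) * tr_minus X q (Suc j) + \<theta> * tr_plus N X q (Suc j)) * tr_minus X \<phi> (Suc j)
     - \<sigma> (X j) * ((1 - \<theta>) * tr_minus X q j + \<theta> * tr_plus N X q j) * tr_plus N X \<phi> j))" for u q
    unfolding form_b_def flux_q_def by (simp add: ring_distribs mult_ac)
qed

text \<open>Cauchy-Schwarz in the coordinates.\<close>

lemma lin_bound:
  assumes "lin \<Phi>"
  obtains C where "0 \<le> C" "\<And>v. v \<in> dg_space N k \<Longrightarrow> (\<Phi> v)\<^sup>2 \<le> C * (\<Sum>c\<in>idx. (co c v)\<^sup>2)"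
proof -
  from assms obtain \<alpha> where \<alpha>: "\<forall>v\<in>dg_space N k. \<Phi> v = (\<Sum>c\<in>idx. \<alpha> c * co c v)" unfolding lin_def by blast
  show thesis
  proof (rule that)
    show "0 \<le> (\<Sum>c\<in>idx. (\<alpha> c)\<^sup>2)" by (intro sum_nonneg) simp
    show "(\<Phi> v)\<^sup>2 \<le> (\<Sum>c\<in>idx. (\<alpha> c)\<^sup>2) * (\<Sum>c\<in>idx. (co c v)\<^sup>2)" if "v \<in> dg_space N k" for v
      using Cauchy_Schwarz_ineq_sum[of \<alpha> "\<lambda>c. co c v" idx] \<alpha> that by simp
  qed
qed

lemma lin_bound_family:
  assumes "\<And>c. c \<in> idx \<Longrightarrow> lin (\<Phi> c)"
  obtains C where "0 \<le> C" "\<And>v. v \<in> dg_space N k \<Longrightarrow> (\<Sum>c\<in>idx. (\<Phi> c v)\<^sup>2) \<le> C * (\<Sum>c\<in>idx. (co c v)\<^sup>2)"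
proof -
  have "\<forall>c\<in>idx. \<exists>C\<ge>0. \<forall>v\<in>dg_space N k. (\<Phi> c v)\<^sup>2 \<le> C * (\<Sum>c\<in>idx. (co c v)\<^sup>2)"
    using lin_bound[OF assms] by metis
  from bchoice[OF this] obtain C where C: "\<forall>c\<in>idx. 0 \<le> C c \<and> (\<forall>v\<in>dg_space N k. (\<Phi> c v)\<^sup>2 \<le> C c * (\<Sum>c\<in>idx. (co c v)\<^sup>2))" by blast
  show thesis
  proof (rule that)
    show "0 \<le> (\<Sum>c\<in>idx. C c)" using C by (intro sum_nonneg) auto
    show "(\<Sum>c\<in>idx. (\<Phi> c v)\<^sup>2) \<le> (\<Sum>c\<in>idx. C c) * (\<Sum>c\<in>idx. (co c v)\<^sup>2)" if "v \<in> dg_space N k" for v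
      unfolding sum_distrib_right using C that by (intro sum_mono) auto
  qed
qed

lemma pderiv_sum_smult: "pderiv (\<Sum>i\<in>I. smult (c i) (p i)) = (\<Sum>i\<in>I. smult (c i) (pderiv (p i)))"
  by (induction I rule: infinite_finite_induct) (auto simp: pderiv_add pderiv_smult)

lemma integral_deriv_expand:
  fixes g :: "real \<Rightarrow> real"
  assumes c: "continuous_on UNIV s" "continuous_on UNIV s'" "continuous_on UNIV g"
  shows "(LBINT x:{a..b}. (s' x * poly (\<Sum>i\<in>I. smult (c i) (p i)) x + s x * poly (pderiv (\<Sum>i\<in>I. smult (c i) (p i))) x) * g x)
    = (\<Sum>i\<in>I. c i * (LBINT x:{a..b}. (s' x * poly (p i) x + s x * poly (pderiv (p i)) x) * g x))"
proof -
  note cs = continuous_on_subset[OF c(1) subset_UNIV] continuous_on_subset[OF c(2) subset_UNIV] continuous_on_subset[OF c(3) subset_UNIV]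
  have split: "(LBINT x:{a..b}. (s' x * poly r x + s x * poly (pderiv r) x) * g x)
    = (LBINT x:{a..b}. (s' x * g x) * poly r x) + (LBINT x:{a..b}. (s x * g x) * poly (pderiv r) x)" for r
  proof -
    have "(LBINT x:{a..b}. (s' x * poly r x + s x * poly (pderiv r) x) * g x) = (LBINT x:{a..b}. (s' x * g x) * poly r x + (s x * g x) * poly (pderiv r) x)"
      by (simp only: distrib_left distrib_right mult_ac)
    also have "\<dots> = (LBINT x:{a..b}. (s' x * g x) * poly r x) + (LBINT x:{a..b}. (s x * g x) * poly (pderiv r) x)"
      by (intro set_integral_add borel_integrable_atLeastAtMost' continuous_intros cs)
    finally show ?thesis .
  qed
  have 1: "continuous_on {a..b} (\<lambda>x. s' x * g x)" "continuous_on {a..b} (\<lambda>x. s x * g x)" by (intro continuous_intros cs)+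
  show ?thesis
    unfolding split
    unfolding pderiv_sum_smult set_integral_poly_sum[OF 1(1)] set_integral_poly_sum[OF 1(2)]
    by (simp add: sum.distrib distrib_left)
qed

text \<open>The scheme provides an equation, with its own stochastic integral, for each
  deterministic test function. The random \<open>u\<close> becomes available as a test function
  through this linearity.\<close>

lemma form_test_expand:
  assumes \<sigma>: "C2 \<sigma>" and j: "j < N" and u: "u \<in> dg_space N k"
  shows "form_a \<sigma> \<gamma> \<gamma>t N X j u u = (\<Sum>i\<le>k. co (j, i) u * form_a \<sigma> \<gamma> \<gamma>t N X j u (test (j, i)))"
    "form_b \<sigma> \<theta> \<eta>q N X j u q u = (\<Sum>i\<le>k. co (j, i) u * form_b \<sigma> \<theta> \<eta>q N X j u q (test (j, i)))"
proof -
  note c = C2D(3-5)[OF \<sigma>, of UNIV]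
  have m: "tr_minus X v (Suc j) = poly (v j) (X (Suc j))" "tr_plus N X v j = poly (v j) (X j)" for v
    using j by (auto simp: tr_minus_def tr_plus_def)
  have t: "test (j, i) j = e j i" for i by (simp add: test_def)
  have cg: "continuous_on UNIV (\<lambda>x. \<sigma> x * poly (u j) x)" by (intro continuous_intros c)
  have cq: "continuous_on UNIV (\<lambda>x. poly (q j) x)" by (intro continuous_intros)
  note u' = expand[OF u j]
  have pt: "poly (u j) y = (\<Sum>i\<le>k. co (j, i) u * poly (e j i) y)" for y by (rule poly_expand[OF u j])
  have I1: "(LBINT x:{X j..X (Suc j)}. deriv (\<lambda>y. deriv \<sigma> y * poly (u j) y) x * \<sigma> x * poly (u j) x)
     = (\<Sum>i\<le>k. co (j, i) u * (LBINT x:{X j..X (Suc j)}. deriv (\<lambda>y. deriv \<sigma> y * poly (e j i) y) x * \<sigma> x * poly (u j) x))"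
    using integral_deriv_expand[OF c(2,3) cg, of "X j" "X (Suc j)" "\<lambda>i. co (j, i) u" "e j" "{..k}"]
    unfolding u'[symmetric] deriv_mult_poly[OF \<sigma>] by (simp only: mult.assoc)
  have I2: "(LBINT x:{X j..X (Suc j)}. deriv (\<lambda>y. \<sigma> y * poly (u j) y) x * poly (q j) x)
     = (\<Sum>i\<le>k. co (j, i) u * (LBINT x:{X j..X (Suc j)}. deriv (\<lambda>y. \<sigma> y * poly (e j i) y) x * poly (q j) x))"
    using integral_deriv_expand[OF c(1,2) cq, of "X j" "X (Suc j)" "\<lambda>i. co (j, i) u" "e j" "{..k}"]
    unfolding u'[symmetric] deriv_mult_poly[OF \<sigma>] .
  have gen: "A * (\<Sum>i\<le>k. co (j, i) u * J i) + B * (G * (\<Sum>i\<le>k. co (j, i) u * poly (e j i) y) - H * (\<Sum>i\<le>k. co (j, i) u * poly (e j i) z))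
    = (\<Sum>i\<le>k. co (j, i) u * (A * J i + B * (G * poly (e j i) y - H * poly (e j i) z)))" for A B G H y z :: real and J
    unfolding sum_distrib_left sum_subtractf[symmetric] sum.distrib[symmetric]
    by (rule sum.cong[OF refl]) (simp add: algebra_simps)
  show "form_a \<sigma> \<gamma> \<gamma>t N X j u u = (\<Sum>i\<le>k. co (j, i) u * form_a \<sigma> \<gamma> \<gamma>t N X j u (test (j, i)))"
    unfolding form_a_def m t I1 gen[symmetric] pt[symmetric] ..
  show "form_b \<sigma> \<theta> \<eta>q N X j u q u = (\<Sum>i\<le>k. co (j, i) u * form_b \<sigma> \<theta> \<eta>q N X j u q (test (j, i)))"
    unfolding form_b_def m t I2 gen[symmetric] pt[symmetric] ..
qed

text \<open>Testing the auxiliary equation with \<open>q\<close> itself, the \<open>\<eta>u\<close> terms sum up to \<open>- \<Sum> \<bar>\<sigma>\<bar> \<eta>u \<lbrakk>q\<rbrakk>\<^sup>2 \<le> 0\<close>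
  and can be dropped.\<close>

lemma auxiliary_bound:
  assumes \<sigma>: "C2 \<sigma>" and \<eta>: "0 \<le> \<eta>u"
  obtains C where "0 \<le> C" "\<And>u q. u \<in> dg_space N k \<Longrightarrow> q \<in> dg_space N k \<Longrightarrow>
    (\<And>\<psi> j. \<psi> \<in> dg_space N k \<Longrightarrow> j < N \<Longrightarrow> (LBINT x:{X j..X (Suc j)}. poly (\<psi> j) x * poly (q j) x)
        = - (LBINT x:{X j..X (Suc j)}. poly (pderiv (\<psi> j)) x * \<sigma> x * poly (u j) x)
          + \<sigma> (X (Suc j)) * flux_u \<sigma> \<theta> \<eta>u N X u q (Suc j) * tr_minus X \<psi> (Suc j)
          - \<sigma> (X j) * flux_u \<sigma> \<theta> \<eta>u N X u q j * tr_plus N X \<psi> j)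
    \<Longrightarrow> (\<Sum>c\<in>idx. (co c q)\<^sup>2) \<le> C * (\<Sum>c\<in>idx. (co c u)\<^sup>2)"
proof -
  \<comment> \<open>The right-hand side of the equation for \<open>q\<close> without the
    \<open>\<eta>u\<close> terms: a functional of \<open>u\<close> alone.\<close>
  define L where "L = (\<lambda>c u. - (LBINT x:{X (fst c)..X (Suc (fst c))}. (poly (pderiv (test c (fst c))) x * \<sigma> x) * poly (u (fst c)) x)
    + \<sigma> (X (Suc (fst c))) * (\<theta> * tr_minus X u (Suc (fst c)) + (1 - \<theta>) * tr_plus N X u (Suc (fst c))) * tr_minus X (test c) (Suc (fst c))
    - \<sigma> (X (fst c)) * (\<theta> * tr_minus X u (fst c) + (1 - \<theta>) * tr_plus N X u (fst c)) * tr_plus N X (test c) (fst c))"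
  have "lin (L c)" if "c \<in> idx" for c
    unfolding L_def
  proof (intro lin_add lin_minus lin_cmult lin_diff lin_multr lin_tr_minus lin_tr_plus lin_integral)
    show "continuous_on UNIV (\<lambda>x. poly (pderiv (test c (fst c))) x * \<sigma> x)"
      by (intro continuous_intros C2D(3)[OF \<sigma>])
  qed (use that in \<open>auto simp: idx_def\<close>)
  from lin_bound_family[of L, OF this] obtain C where C: "0 \<le> C"
    "\<And>v. v \<in> dg_space N k \<Longrightarrow> (\<Sum>c\<in>idx. (L c v)\<^sup>2) \<le> C * (\<Sum>c\<in>idx. (co c v)\<^sup>2)" by blast
  show thesis
  proof (rule that[OF C(1)])
    fix u q :: bpoly
    assume u: "u \<in> dg_space N k" and q: "q \<in> dg_space N k"
      and eq: "\<And>\<psi> j. \<psi> \<in> dg_space N k \<Longrightarrow> j < N \<Longrightarrow> (LBINT x:{X j..X (Suc j)}. poly (\<psi> j) x * poly (q j) x)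
        = - (LBINT x:{X j..X (Suc j)}. poly (pderiv (\<psi> j)) x * \<sigma> x * poly (u j) x)
          + \<sigma> (X (Suc j)) * flux_u \<sigma> \<theta> \<eta>u N X u q (Suc j) * tr_minus X \<psi> (Suc j)
          - \<sigma> (X j) * flux_u \<sigma> \<theta> \<eta>u N X u q j * tr_plus N X \<psi> j"
    \<comment> \<open>The \<open>\<eta>u\<close> terms of the flux, tested with the frame. They
      depend on \<open>q\<close> itself and are controlled by their sign.\<close>
    define J where "J = (\<lambda>c. (\<eta>u * \<bar>\<sigma> (X (Suc (fst c)))\<bar> * jump N X q (Suc (fst c))) * poly (e (fst c) (snd c)) (X (Suc (fst c)))
      - (\<eta>u * \<bar>\<sigma> (X (fst c))\<bar> * jump N X q (fst c)) * poly (e (fst c) (snd c)) (X (fst c)))"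
    have coq: "co c q = L c u + J c" if c: "c \<in> idx" for c
    proof -
      obtain j i where ji: "c = (j, i)" "j < N" "i \<le> k" using c by (auto simp: idx_def)
      then have fc: "fst c = j" "snd c = i" by auto
      have m: "tr_minus X (test c) (Suc j) = poly (e j i) (X (Suc j))" "tr_plus N X (test c) j = poly (e j i) (X j)"
        using ji by (auto simp: tr_minus_def tr_plus_def test_def)
      have s: "a * (A + \<eta>u * sgn a * jj) * p = a * A * p + (\<eta>u * \<bar>a\<bar> * jj) * p" for a A jj p :: real
      proof -
        have "a * (A + \<eta>u * sgn a * jj) * p = a * A * p + (\<eta>u * (a * sgn a) * jj) * p" by (simp add: ring_distribs mult_ac)
        also have "a * sgn a = \<bar>a\<bar>" by (simp add: abs_sgn mult.commute)
        finally show ?thesis .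
      qed
      have "co c q = (LBINT x:{X j..X (Suc j)}. poly (test c j) x * poly (q j) x)"
        by (simp add: co_def ji test_def poly_inner_def mult.commute)
      also have "\<dots> = L c u + J c"
        unfolding eq[OF test_dg_space[OF c] ji(2)] flux_u_def s L_def J_def fc m by simp
      finally show ?thesis .
    qed
    have J: "(\<Sum>c\<in>idx. co c q * J c) \<le> 0"
    proof -
      define A where "A = (\<lambda>i. (\<eta>u * \<bar>\<sigma> (X i)\<bar> * jump N X q i) * tr_minus X q i)"
      define B where "B = (\<lambda>i. (\<eta>u * \<bar>\<sigma> (X i)\<bar> * jump N X q i) * tr_plus N X q i)"
      have "(\<Sum>i\<le>k. co (j, i) q * J (j, i)) = A (Suc j) - B j" if j: "j < N" for j
      proof -
        have m: "tr_minus X q (Suc j) = poly (q j) (X (Suc j))" "tr_plus N X q j = poly (q j) (X j)"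
          using j by (auto simp: tr_minus_def tr_plus_def)
        show ?thesis unfolding A_def B_def m poly_expand[OF q j] J_def
          by (simp add: sum_distrib_left sum_subtractf[symmetric] right_diff_distrib mult_ac)
      qed
      then have "(\<Sum>c\<in>idx. co c q * J c) = (\<Sum>j<N. A (Suc j) - B j)" unfolding sum_idx by simp
      also have "\<dots> = A N - A 0 + (\<Sum>j<N. A j - B j)" by (rule interface_sum)
      also have "\<dots> = (\<Sum>j<N. A j - B j)" using jump_boundary[OF N_pos] by (simp add: A_def)
      also have "\<dots> = (\<Sum>j<N. - (\<eta>u * \<bar>\<sigma> (X j)\<bar> * (jump N X q j)\<^sup>2))"
        by (intro sum.cong refl) (simp add: A_def B_def jump_def power2_eq_square algebra_simps)
      also have "\<dots> \<le> 0" using \<eta> by (intro sum_nonpos) simp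
      finally show ?thesis by simp
    qed
    have "(\<Sum>c\<in>idx. (co c q)\<^sup>2) = (\<Sum>c\<in>idx. co c q * L c u) + (\<Sum>c\<in>idx. co c q * J c)"
      unfolding sum.distrib[symmetric] using coq by (intro sum.cong refl) (simp add: power2_eq_square distrib_left[symmetric])
    also have "\<dots> \<le> (\<Sum>c\<in>idx. co c q * L c u)" using J by simp
    \<comment> \<open>Young's inequality; half of the left-hand side is then absorbed.\<close>
    also have "\<dots> \<le> (\<Sum>c\<in>idx. 1/2 * (co c q)\<^sup>2 + 1/2 * (L c u)\<^sup>2)"
    proof (rule sum_mono)
      fix c
      show "co c q * L c u \<le> 1/2 * (co c q)\<^sup>2 + 1/2 * (L c u)\<^sup>2" using sum_squares_bound[of "co c q" "L c u"] by simp
    qed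
    also have "\<dots> = 1/2 * (\<Sum>c\<in>idx. (co c q)\<^sup>2) + 1/2 * (\<Sum>c\<in>idx. (L c u)\<^sup>2)" by (simp add: sum.distrib sum_distrib_left)
    finally have "(\<Sum>c\<in>idx. (co c q)\<^sup>2) \<le> (\<Sum>c\<in>idx. (L c u)\<^sup>2)" by simp
    also have "\<dots> \<le> C * (\<Sum>c\<in>idx. (co c u)\<^sup>2)" by (rule C(2)[OF u])
    finally show "(\<Sum>c\<in>idx. (co c q)\<^sup>2) \<le> C * (\<Sum>c\<in>idx. (co c u)\<^sup>2)" .
  qed
qed

end

section \<open>The function \<open>dg_fun\<close> on the real line and its \<open>L2\<close>
  norm\<close>

lemma half_open_cell_integral:
  fixes h :: "real \<Rightarrow> real"
  assumes "a \<le> b" "continuous_on {a..b} h"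
  shows "integrable lborel (\<lambda>x. indicator {a..<b} x * h x)" "(\<integral>x. indicator {a..<b} x * h x \<partial>lborel) = (LBINT x:{a..b}. h x)"
proof -
  have i: "set_integrable lborel {a..b} h" by (rule borel_integrable_atLeastAtMost'[OF assms(2)])
  have "set_integrable lborel {a..<b} h" by (rule set_integrable_subset[OF i]) auto
  then show 1: "integrable lborel (\<lambda>x. indicator {a..<b} x * h x)" by (simp add: set_integrable_def)
  have "AE x in lborel. x \<noteq> b" by (rule AE_lborel_singleton)
  then have ae: "AE x in lborel. indicator {a..<b} x * h x = indicator {a..b} x *\<^sub>R h x"
    by eventually_elim (auto simp: indicator_def)
  show "(\<integral>x. indicator {a..<b} x * h x \<partial>lborel) = (LBINT x:{a..b}. h x)"
    unfolding set_lebesgue_integral_def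
    by (rule integral_cong_AE[OF _ _ ae]) (use 1 i in \<open>auto simp: set_integrable_def dest: borel_measurable_integrable\<close>)
qed

context dg_frame begin

lemma X_mono: "i \<le> j \<Longrightarrow> j \<le> N \<Longrightarrow> X i \<le> X j"
  by (rule weak_grid_le[of N X]) (auto intro: less_imp_le[OF X_less])

lemma dg_fun_cell:
  assumes "j < N" "x \<in> {X j..<X (Suc j)}"
  shows "(\<Sum>i<N. indicator {X i..<X (Suc i)} x * f i) = (f j :: real)"
proof -
  have "x \<notin> {X i..<X (Suc i)}" if "i < N" "i \<noteq> j" for i
  proof (cases "i < j")
    case True
    then show ?thesis using X_mono[of "Suc i" j] assms by auto
  next
    case False
    then show ?thesis using X_mono[of "Suc j" i] assms that by auto
  qed
  then have "(\<Sum>i<N. indicator {X i..<X (Suc i)} x * f i) = (\<Sum>i\<in>{j}. indicator {X i..<X (Suc i)} x * f i)"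
    using assms by (intro sum.mono_neutral_right) (auto simp: indicator_def)
  also have "\<dots> = indicator {X j..<X (Suc j)} x * f j" by (subst sum.insert) simp_all
  finally show ?thesis using assms by simp
qed

text \<open>The half-open cells are disjoint, so each point picks at most one summand.\<close>

lemma dg_fun_square: "(dg_fun N X v x)\<^sup>2 = (\<Sum>j<N. indicator {X j..<X (Suc j)} x * (poly (v j) x)\<^sup>2)"
proof (cases "\<exists>j<N. x \<in> {X j..<X (Suc j)}")
  case True
  then obtain j where j: "j < N" "x \<in> {X j..<X (Suc j)}" by auto
  show ?thesis unfolding dg_fun_def dg_fun_cell[OF j] ..
next
  case False
  then have 0: "indicator {X j..<X (Suc j)} x = (0::real)" if "j < N" for j using that by (auto simp: indicator_def)
  have "(\<Sum>j<N. indicator {X j..<X (Suc j)} x * f j) = 0" for f :: "nat \<Rightarrow> real"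
    by (rule sum.neutral) (simp add: 0)
  then show ?thesis unfolding dg_fun_def by simp
qed

lemma broken_integral:
  fixes h :: "nat \<Rightarrow> real \<Rightarrow> real"
  assumes h: "\<And>j. j < N \<Longrightarrow> continuous_on UNIV (h j)"
  shows "integrable lborel (\<lambda>x. \<Sum>j<N. indicator {X j..<X (Suc j)} x * h j x)"
    "(\<integral>x. (\<Sum>j<N. indicator {X j..<X (Suc j)} x * h j x) \<partial>lborel) = (\<Sum>j<N. LBINT x:{X j..X (Suc j)}. h j x)"
proof -
  note c = half_open_cell_integral[OF less_imp_le[OF X_less] continuous_on_subset[OF h subset_UNIV]]
  show "integrable lborel (\<lambda>x. \<Sum>j<N. indicator {X j..<X (Suc j)} x * h j x)"
    by (rule Bochner_Integration.integrable_sum) (use c(1) in auto)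
  have "(\<integral>x. (\<Sum>j<N. indicator {X j..<X (Suc j)} x * h j x) \<partial>lborel) = (\<Sum>j<N. \<integral>x. indicator {X j..<X (Suc j)} x * h j x \<partial>lborel)"
    by (rule Bochner_Integration.integral_sum) (use c(1) in auto)
  also have "\<dots> = (\<Sum>j<N. LBINT x:{X j..X (Suc j)}. h j x)" by (rule sum.cong) (use c(2) in auto)
  finally show "(\<integral>x. (\<Sum>j<N. indicator {X j..<X (Suc j)} x * h j x) \<partial>lborel) = (\<Sum>j<N. LBINT x:{X j..X (Suc j)}. h j x)" .
qed

lemma dg_fun_weighted:
  assumes w: "continuous_on UNIV w"
  shows "integrable lborel (\<lambda>x. w x * (dg_fun N X v x)\<^sup>2)"
    "(\<integral>x. w x * (dg_fun N X v x)\<^sup>2 \<partial>lborel) = (\<Sum>j<N. LBINT x:{X j..X (Suc j)}. w x * (poly (v j) x)\<^sup>2)"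
proof -
  have e: "w x * (dg_fun N X v x)\<^sup>2 = (\<Sum>j<N. indicator {X j..<X (Suc j)} x * (w x * (poly (v j) x)\<^sup>2))" for x
    unfolding dg_fun_square sum_distrib_left by (simp only: mult_ac)
  have c: "continuous_on UNIV (\<lambda>x. w x * (poly (v j) x)\<^sup>2)" for j by (intro continuous_intros w)
  show "integrable lborel (\<lambda>x. w x * (dg_fun N X v x)\<^sup>2)" unfolding e by (rule broken_integral(1)[OF c])
  show "(\<integral>x. w x * (dg_fun N X v x)\<^sup>2 \<partial>lborel) = (\<Sum>j<N. LBINT x:{X j..X (Suc j)}. w x * (poly (v j) x)\<^sup>2)"
    unfolding e by (rule broken_integral(2)[OF c])
qed

lemma dg_fun_measurable [measurable]: "dg_fun N X v \<in> borel_measurable borel"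
proof -
  have [measurable]: "(\<lambda>x. poly (v j) x) \<in> borel_measurable borel" for j
    by (intro borel_measurable_continuous_onI continuous_intros)
  show ?thesis unfolding dg_fun_def[abs_def] by measurable
qed

lemma L2_norm_dg_fun_integral: "(L2_norm (dg_fun N X v))\<^sup>2 = (\<integral>x. (dg_fun N X v x)\<^sup>2 \<partial>lborel)"
  unfolding L2_norm_def by (rule real_sqrt_pow2) (rule Bochner_Integration.integral_nonneg, simp)

lemma L2_norm_dg_fun:
  assumes v: "v \<in> dg_space N k"
  shows "(L2_norm (dg_fun N X v))\<^sup>2 = (\<Sum>c\<in>idx. (co c v)\<^sup>2)"
proof -
  have "(L2_norm (dg_fun N X v))\<^sup>2 = (\<Sum>j<N. LBINT x:{X j..X (Suc j)}. (poly (v j) x)\<^sup>2)"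
    unfolding L2_norm_dg_fun_integral using dg_fun_weighted(2)[of "\<lambda>_. 1" v] by simp
  also have "\<dots> = (\<Sum>j<N. poly_inner (X j) (X (Suc j)) (v j) (v j))"
    by (simp add: poly_inner_def power2_eq_square)
  also have "\<dots> = (\<Sum>c\<in>idx. (co c v)\<^sup>2)" unfolding sum_idx by (rule sum.cong[OF refl]) (simp add: parseval[OF v])
  finally show ?thesis .
qed

text \<open>Testing the projection with \<open>v\<close> itself shows that the integrals of
  \<open>f * v\<close> and of \<open>v\<^sup>2\<close> agree; the squared distance of
  \<open>f\<close> and \<open>v\<close>, which is nonnegative, is then the difference of the squared
  norms.\<close>

lemma L2_projection_norm:
  assumes f: "L2 f" and P: "L2_projection N X k f v"
  shows "(L2_norm (dg_fun N X v))\<^sup>2 \<le> (L2_norm f)\<^sup>2"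
proof -
  let ?v = "dg_fun N X v"
  have fm[measurable]: "f \<in> borel_measurable borel" and f2: "integrable lborel (\<lambda>x. (f x)\<^sup>2)" using f by (auto simp: L2_def)
  have v2: "integrable lborel (\<lambda>x. (?v x)\<^sup>2)" using dg_fun_weighted(1)[of "\<lambda>_. 1" v] by simp
  have fv: "integrable lborel (\<lambda>x. f x * ?v x)"
  proof (rule Bochner_Integration.integrable_bound)
    show "integrable lborel (\<lambda>x. (f x)\<^sup>2 + (?v x)\<^sup>2)" using f2 v2 by auto
    show "AE x in lborel. norm (f x * ?v x) \<le> norm ((f x)\<^sup>2 + (?v x)\<^sup>2)" by (simp add: abs_mult_le_squares)
  qed measurable
  have "(\<integral>x. (f x - ?v x) * ?v x \<partial>lborel) = 0"
    using P by (auto simp: L2_projection_def set_lebesgue_integral_def)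
  moreover have "(\<integral>x. (f x - ?v x) * ?v x \<partial>lborel) = (\<integral>x. f x * ?v x \<partial>lborel) - (\<integral>x. (?v x)\<^sup>2 \<partial>lborel)"
    using fv v2 by (simp add: left_diff_distrib power2_eq_square)
  ultimately have eq: "(\<integral>x. f x * ?v x \<partial>lborel) = (\<integral>x. (?v x)\<^sup>2 \<partial>lborel)" by simp
  have "0 \<le> (\<integral>x. (f x - ?v x)\<^sup>2 \<partial>lborel)" by (rule Bochner_Integration.integral_nonneg) simp
  also have "(\<integral>x. (f x - ?v x)\<^sup>2 \<partial>lborel) = (\<integral>x. (f x)\<^sup>2 + (?v x)\<^sup>2 - 2 * (f x * ?v x) \<partial>lborel)"
    by (simp add: power2_diff mult.assoc)
  also have "\<dots> = (\<integral>x. (f x)\<^sup>2 \<partial>lborel) + (\<integral>x. (?v x)\<^sup>2 \<partial>lborel) - 2 * (\<integral>x. f x * ?v x \<partial>lborel)"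
    using f2 v2 fv by simp
  finally have "(\<integral>x. (?v x)\<^sup>2 \<partial>lborel) \<le> (\<integral>x. (f x)\<^sup>2 \<partial>lborel)" unfolding eq by simp
  moreover have "(L2_norm f)\<^sup>2 = (\<integral>x. (f x)\<^sup>2 \<partial>lborel)"
    unfolding L2_norm_def by (rule real_sqrt_pow2) (rule Bochner_Integration.integral_nonneg, simp)
  ultimately show ?thesis unfolding L2_norm_dg_fun_integral by simp
qed

text \<open>\<open>dg_process\<close> speaks of polynomial coefficients. As fixed linear
  combinations of these, the coordinates inherit adaptedness and path continuity.\<close>

lemma co_coeff:
  assumes v: "v \<in> dg_space N k" and c: "c \<in> idx"
  shows "co c v = (\<Sum>m\<le>k. poly_inner (X (fst c)) (X (Suc (fst c))) (e (fst c) (snd c)) (monom 1 m) * coeff (v (fst c)) m)"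
proof -
  have d: "degree (v (fst c)) \<le> k" using v c by (auto simp: dg_space_def idx_def)
  have "v (fst c) = (\<Sum>m\<le>k. monom (coeff (v (fst c)) m) m)" using poly_as_sum_of_monoms'[OF d] by simp
  then have "v (fst c) = (\<Sum>m\<le>k. smult (coeff (v (fst c)) m) (monom 1 m))" by (simp add: smult_monom)
  then have "co c v = poly_inner (X (fst c)) (X (Suc (fst c))) (e (fst c) (snd c)) (\<Sum>m\<le>k. smult (coeff (v (fst c)) m) (monom 1 m))"
    unfolding co_def by (subst poly_inner_commute) simp
  then show ?thesis unfolding poly_inner_sum_right by (simp add: mult.commute)
qed

lemma test_integral_co:
  assumes "c \<in> idx"
  shows "(LBINT x:{X (fst c)..X (Suc (fst c))}. poly (test c (fst c)) x * poly (v (fst c)) x) = co c v"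
  by (simp add: co_def poly_inner_def test_def mult.commute)

end

section \<open>Moments of the LDG approximation\<close>

locale ldg_approximation = brownian_motion M F W + dg_frame N k X e
  for M :: "'w measure" and F :: "real \<Rightarrow> 'w measure" and W :: "real \<Rightarrow> 'w \<Rightarrow> real"
    and N k :: nat and X :: "nat \<Rightarrow> real" and e :: "nat \<Rightarrow> nat \<Rightarrow> real poly" +
  fixes T :: real and \<sigma> :: "real \<Rightarrow> real" and \<gamma> \<gamma>t \<theta> \<eta>u \<eta>q :: real
    and uh0 :: bpoly and uh qh :: "real \<Rightarrow> 'w \<Rightarrow> bpoly"
  assumes T_pos: "0 < T" and \<sigma>_C2: "C2 \<sigma>" and \<eta>u_nonneg: "0 \<le> \<eta>u"
    and uh0_dg_space: "uh0 \<in> dg_space N k"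
    and solution: "ldg_solution M F W T \<sigma> N X k \<gamma> \<gamma>t \<theta> \<eta>u \<eta>q uh0 uh qh"
    and boundary: "no_boundary_transport M T \<sigma> N X uh"
begin

definition flux_equation :: "bpoly \<Rightarrow> bpoly \<Rightarrow> bool" where
  "flux_equation u q \<longleftrightarrow> (\<forall>\<psi>\<in>dg_space N k. \<forall>j<N.
        (LBINT x:{X j..X (Suc j)}. poly (\<psi> j) x * poly (q j) x)
        = - (LBINT x:{X j..X (Suc j)}. poly (pderiv (\<psi> j)) x * \<sigma> x * poly (u j) x)
          + \<sigma> (X (Suc j)) * flux_u \<sigma> \<theta> \<eta>u N X u q (Suc j) * tr_minus X \<psi> (Suc j)
          - \<sigma> (X j) * flux_u \<sigma> \<theta> \<eta>u N X u q j * tr_plus N X \<psi> j)"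

definition closed_boundary :: "bpoly \<Rightarrow> bool" where
  "closed_boundary u \<longleftrightarrow> \<sigma> (X 0) * tr_plus N X u 0 = 0 \<and> \<sigma> (X N) * tr_minus X u N = 0"

lemma zero_solution:
  "(\<lambda>_. 0) \<in> dg_space N k" "flux_equation (\<lambda>_. 0) (\<lambda>_. 0)" "closed_boundary (\<lambda>_. 0)"
  by (auto simp: dg_space_def flux_equation_def closed_boundary_def flux_u_def jump_def tr_plus_def tr_minus_def)

text \<open>On a null event the solution is replaced by zero, which also solves the discrete equations, so
  that the equations and path continuity hold for every sample point. Null events belong to \<open>F 0\<close>, so
  adaptedness is not lost.\<close>

lemma regular_modification:
  obtains u q where "\<And>s \<omega>. u s \<omega> \<in> dg_space N k" "\<And>s \<omega>. q s \<omega> \<in> dg_space N k"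
    "\<And>j i. j < N \<Longrightarrow> i \<le> k \<Longrightarrow> regular_process T (\<lambda>s \<omega>. coeff (u s \<omega> j) i)"
    "\<And>j i. j < N \<Longrightarrow> i \<le> k \<Longrightarrow> regular_process T (\<lambda>s \<omega>. coeff (q s \<omega> j) i)"
    "AE \<omega> in M. \<forall>s\<in>{0..T}. u s \<omega> = uh s \<omega> \<and> q s \<omega> = qh s \<omega>"
    "\<And>s \<omega>. flux_equation (u s \<omega>) (q s \<omega>)" "\<And>s \<omega>. closed_boundary (u s \<omega>)"
proof -
  define good where "good = (\<lambda>\<omega>. (\<forall>j\<in>{..<N}. \<forall>i\<in>{..k}. continuous_on {0..T} (\<lambda>t. coeff (uh t \<omega> j) i)) \<and>
     (\<forall>j\<in>{..<N}. \<forall>i\<in>{..k}. continuous_on {0..T} (\<lambda>t. coeff (qh t \<omega> j) i)) \<and>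
     (\<forall>t\<in>{0..T}. flux_equation (uh t \<omega>) (qh t \<omega>)) \<and> (\<forall>t\<in>{0..T}. closed_boundary (uh t \<omega>)))"
  have pu: "dg_process M F T N k uh" and pq: "dg_process M F T N k qh" using solution by (auto simp: ldg_solution_def)
  have cont: "AE \<omega> in M. \<forall>j\<in>{..<N}. \<forall>i\<in>{..k}. continuous_on {0..T} (\<lambda>t. coeff (v t \<omega> j) i)"
    if "dg_process M F T N k v" for v
    using that by (intro AE_finite_allI) (auto simp: dg_process_def continuous_adapted_def)
  have fl: "AE \<omega> in M. \<forall>t\<in>{0..T}. flux_equation (uh t \<omega>) (qh t \<omega>)"
    using solution by (simp add: ldg_solution_def flux_equation_def)
  have bd: "AE \<omega> in M. \<forall>t\<in>{0..T}. closed_boundary (uh t \<omega>)"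
    using boundary by (simp add: no_boundary_transport_def closed_boundary_def)
  have "AE \<omega> in M. good \<omega>" unfolding good_def using cont[OF pu] cont[OF pq] fl bd by eventually_elim blast
  \<comment> \<open>The set where \<open>good\<close> fails need not be measurable, so a null set
    covering it is taken instead; \<open>complete_F\<close> puts this null set into
    \<open>F 0\<close>.\<close>
  then obtain Z where Z: "Z \<in> null_sets M" "{\<omega>\<in>space M. \<not> good \<omega>} \<subseteq> Z" by (auto elim: AE_E simp: null_sets_def)
  define G where "G = space M - Z"
  have ZF: "Z \<in> sets (F 0)" using complete_F[OF Z(1)] by blast
  have GF: "G \<in> sets (F s)" if "0 \<le> s" for s
    using ZF sets_F_mono[OF that] sets.compl_sets[of Z "F s"] space_F[of s] unfolding G_def by auto
  have GM: "G \<in> sets M" using GF[of 0] sub_F[of 0] by (auto simp: subalgebra_def)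
  have Gg: "good \<omega>" "\<omega> \<in> space M" if "\<omega> \<in> G" for \<omega> using that Z(2) by (auto simp: G_def)
  \<comment> \<open>Freezing time outside \<open>[0,T]\<close> extends continuity of the paths to
    the whole line, as \<open>regular_process\<close> demands.\<close>
  define cl where "cl = (\<lambda>s. max 0 (min T s))"
  have cl: "cl s \<in> {0..T}" for s using T_pos by (auto simp: cl_def)
  have cl_id: "cl s = s" if "s \<in> {0..T}" for s using that by (auto simp: cl_def)
  define md where "md = (\<lambda>(v :: real \<Rightarrow> 'w \<Rightarrow> bpoly) s \<omega>. if \<omega> \<in> G then v (cl s) \<omega> else (\<lambda>_. 0))"
  have md_dg: "md v s \<omega> \<in> dg_space N k" if "dg_process M F T N k v" for v s \<omega>
    using that cl[of s] Gg zero_solution(1) by (auto simp: md_def dg_process_def)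
  have md_reg: "regular_process T (\<lambda>s \<omega>. coeff (md v s \<omega> j) i)"
    if v: "dg_process M F T N k v" and ji: "j < N" "i \<le> k"
      and cn: "\<And>\<omega>. \<omega> \<in> G \<Longrightarrow> continuous_on {0..T} (\<lambda>t. coeff (v t \<omega> j) i)" for v j i
  proof -
    have vF: "(\<lambda>\<omega>. coeff (v s \<omega> j) i) \<in> borel_measurable (F s)" if "s \<in> {0..T}" for s
      using v ji that by (auto simp: dg_process_def continuous_adapted_def)
    have e: "coeff (md v s \<omega> j) i = (if \<omega> \<in> G then coeff (v (cl s) \<omega> j) i else 0)" for s \<omega> by (simp add: md_def)
    have mF: "(\<lambda>\<omega>. coeff (md v s \<omega> j) i) \<in> borel_measurable (F (cl s))" for s
      unfolding e
      by (rule measurable_If_set[OF vF[OF cl]]) (use GF[of "cl s"] cl[of s] in \<open>auto intro: sets.Int\<close>)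
    show ?thesis unfolding regular_process_def
    proof (intro conjI allI ballI)
      show "(\<lambda>\<omega>. coeff (md v s \<omega> j) i) \<in> borel_measurable M" for s using measurable_F_M[OF mF] .
      show "(\<lambda>\<omega>. coeff (md v s \<omega> j) i) \<in> borel_measurable (F s)" if "s \<in> {0..T}" for s
        using mF[of s] cl_id[OF that] by simp
      show "continuous_on UNIV (\<lambda>s. coeff (md v s \<omega> j) i)" for \<omega>
      proof (cases "\<omega> \<in> G")
        case True
        have "continuous_on UNIV (\<lambda>s. coeff (v (cl s) \<omega> j) i)"
        proof (rule continuous_on_compose2[OF cn[OF True]])
          show "continuous_on UNIV cl" unfolding cl_def by (intro continuous_intros)
        qed (use cl in auto)
        then show ?thesis using True by (simp add: e)
      qed (simp add: e)
    qed
  qed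
  have cnu: "continuous_on {0..T} (\<lambda>t. coeff (uh t \<omega> j) i)" and cnq: "continuous_on {0..T} (\<lambda>t. coeff (qh t \<omega> j) i)"
    if "\<omega> \<in> G" "j < N" "i \<le> k" for \<omega> j i
    using Gg(1)[OF that(1)] that unfolding good_def by auto
  show thesis
  proof (rule that[of "md uh" "md qh"])
    show "md uh s \<omega> \<in> dg_space N k" "md qh s \<omega> \<in> dg_space N k" for s \<omega> by (rule md_dg pu pq)+
    show "regular_process T (\<lambda>s \<omega>. coeff (md uh s \<omega> j) i)" "regular_process T (\<lambda>s \<omega>. coeff (md qh s \<omega> j) i)"
      if "j < N" "i \<le> k" for j i
      by (rule md_reg[OF pu that cnu[OF _ that]], assumption) (rule md_reg[OF pq that cnq[OF _ that]], assumption)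
    show "AE \<omega> in M. \<forall>s\<in>{0..T}. md uh s \<omega> = uh s \<omega> \<and> md qh s \<omega> = qh s \<omega>"
    proof (rule AE_I'[OF Z(1)])
      show "{\<omega> \<in> space M. \<not> (\<forall>s\<in>{0..T}. md uh s \<omega> = uh s \<omega> \<and> md qh s \<omega> = qh s \<omega>)} \<subseteq> Z"
        by (auto simp: md_def G_def cl_id)
    qed
    show "flux_equation (md uh s \<omega>) (md qh s \<omega>)" "closed_boundary (md uh s \<omega>)" for s \<omega>
      using Gg(1)[of \<omega>] cl[of s] zero_solution unfolding md_def good_def by auto
  qed
qed

lemma regular_process_sum:
  assumes "\<And>c. c \<in> I \<Longrightarrow> regular_process T (V c)"
  shows "regular_process T (\<lambda>s \<omega>. \<Sum>c\<in>I. a c * V c s \<omega>)"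
  unfolding regular_process_def
proof (intro conjI allI ballI)
  show "(\<lambda>\<omega>. \<Sum>c\<in>I. a c * V c s \<omega>) \<in> borel_measurable M" for s
    by (intro borel_measurable_sum borel_measurable_times borel_measurable_const regular_processD(2)[OF assms])
  show "(\<lambda>\<omega>. \<Sum>c\<in>I. a c * V c s \<omega>) \<in> borel_measurable (F s)" if "s \<in> {0..T}" for s
    by (intro borel_measurable_sum borel_measurable_times borel_measurable_const regular_processD(3)[OF assms] that)
  show "continuous_on UNIV (\<lambda>s. \<Sum>c\<in>I. a c * V c s \<omega>)" if "\<omega> \<in> space M" for \<omega>
    by (intro continuous_intros regular_processD(4)[OF assms] that)
qed

lemma regular_process_add:
  assumes "regular_process T V" "regular_process T V'"
  shows "regular_process T (\<lambda>s \<omega>. V s \<omega> + V' s \<omega>)"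
  using regular_process_sum[of "{True, False}" "\<lambda>b. if b then V else V'" "\<lambda>_. 1"] assms by simp

lemma regular_process_co:
  assumes v: "\<And>s \<omega>. v s \<omega> \<in> dg_space N k"
    and reg: "\<And>j i. j < N \<Longrightarrow> i \<le> k \<Longrightarrow> regular_process T (\<lambda>s \<omega>. coeff (v s \<omega> j) i)" and c: "c \<in> idx"
  shows "regular_process T (\<lambda>s \<omega>. co c (v s \<omega>))"
  unfolding co_coeff[OF v c] by (rule regular_process_sum, rule reg) (use c in \<open>auto simp: idx_def\<close>)

lemma regular_process_lin:
  assumes v: "\<And>s \<omega>. v s \<omega> \<in> dg_space N k"
    and reg: "\<And>j i. j < N \<Longrightarrow> i \<le> k \<Longrightarrow> regular_process T (\<lambda>s \<omega>. coeff (v s \<omega> j) i)" and \<Phi>: "lin \<Phi>"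
  shows "regular_process T (\<lambda>s \<omega>. \<Phi> (v s \<omega>))"
proof -
  from \<Phi> obtain \<alpha> where \<alpha>: "\<forall>v\<in>dg_space N k. \<Phi> v = (\<Sum>c\<in>idx. \<alpha> c * co c v)" unfolding lin_def by blast
  have "\<Phi> (v s \<omega>) = (\<Sum>c\<in>idx. \<alpha> c * co c (v s \<omega>))" for s \<omega> using \<alpha> v by blast
  then show ?thesis using regular_process_sum[of idx "\<lambda>c s \<omega>. co c (v s \<omega>)" \<alpha>] regular_process_co[OF v reg] by simp
qed

end

context ldg_approximation begin

text \<open>The right-hand side of \<open>discrete_energy_identity\<close>. Besides the dissipative
  jump terms it contains the production term with the weight: its expectation is the full rate of
  change of the expected energy.\<close>

definition dissipation :: "bpoly \<Rightarrow> bpoly \<Rightarrow> real" where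
  "dissipation u q = (\<Sum>j<N. LBINT x:{X j..X (Suc j)}. ((deriv \<sigma> x)\<^sup>2 - 1/4 * deriv (deriv (\<lambda>x. (\<sigma> x)\<^sup>2)) x) * (poly (u j) x)\<^sup>2)
      - 1/4 * (\<Sum>j<N. (\<gamma> + 2 * \<gamma>t) * (\<bar>deriv (\<lambda>x. (\<sigma> x)\<^sup>2) (X j)\<bar> * (jump N X u j)\<^sup>2))
      - (\<Sum>j<N. \<bar>\<sigma> (X j)\<bar> * (\<eta>u * (jump N X q j)\<^sup>2 + \<eta>q * (jump N X u j)\<^sup>2))"

definition drift :: "nat \<times> nat \<Rightarrow> bpoly \<Rightarrow> bpoly \<Rightarrow> real" where
  "drift c u q = form_a \<sigma> \<gamma> \<gamma>t N X (fst c) u (test c) + form_b \<sigma> \<theta> \<eta>q N X (fst c) u q (test c)"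

text \<open>Linearity of the forms in the test function turns the coordinate sum of
  \<open>co c u * drift c u q\<close> into the forms tested with \<open>u\<close>, and Parseval
  gives the norm of \<open>q\<close>; the rest is the discrete identity.\<close>

lemma drift_energy:
  assumes u: "u \<in> dg_space N k" and q: "q \<in> dg_space N k" and eq: "flux_equation u q" and bd: "closed_boundary u"
  shows "(\<Sum>c\<in>idx. 2 * (co c u * drift c u q) + (co c q)\<^sup>2) = dissipation u q"
proof -
  have "(\<Sum>c\<in>idx. 2 * (co c u * drift c u q) + (co c q)\<^sup>2)
    = (\<Sum>j<N. 2 * (form_a \<sigma> \<gamma> \<gamma>t N X j u u + form_b \<sigma> \<theta> \<eta>q N X j u q u) + poly_inner (X j) (X (Suc j)) (q j) (q j))"
    unfolding sum_idx
  proof (intro sum.cong refl)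
    fix j assume "j \<in> {..<N}"
    then have j: "j < N" by simp
    show "(\<Sum>i\<le>k. 2 * (co (j, i) u * drift (j, i) u q) + (co (j, i) q)\<^sup>2)
      = 2 * (form_a \<sigma> \<gamma> \<gamma>t N X j u u + form_b \<sigma> \<theta> \<eta>q N X j u q u) + poly_inner (X j) (X (Suc j)) (q j) (q j)"
      unfolding form_test_expand[OF \<sigma>_C2 j u] parseval[OF q j] drift_def fst_conv
      by (simp add: sum.distrib sum_distrib_left distrib_left)
  qed
  also have "\<dots> = dissipation u q"
    unfolding dissipation_def
  proof (rule discrete_energy_identity[OF \<sigma>_C2 mesh])
    show "(LBINT x:{X j..X (Suc j)}. poly (q j) x * poly (q j) x)
        = - (LBINT x:{X j..X (Suc j)}. poly (pderiv (q j)) x * \<sigma> x * poly (u j) x)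
          + \<sigma> (X (Suc j)) * flux_u \<sigma> \<theta> \<eta>u N X u q (Suc j) * tr_minus X q (Suc j)
          - \<sigma> (X j) * flux_u \<sigma> \<theta> \<eta>u N X u q j * tr_plus N X q j" if "j < N" for j
      using eq that q unfolding flux_equation_def by blast
  qed (use bd in \<open>auto simp: closed_boundary_def\<close>)
  finally show ?thesis .
qed

lemma drift_split:
  obtains \<Phi> \<Psi> where "\<And>c. c \<in> idx \<Longrightarrow> lin (\<Phi> c)" "\<And>c. c \<in> idx \<Longrightarrow> lin (\<Psi> c)"
    "\<And>c u q. c \<in> idx \<Longrightarrow> drift c u q = \<Phi> c u + \<Psi> c q"
proof -
  have "\<forall>c\<in>idx. \<exists>p. lin (fst p) \<and> lin (snd p) \<and> (\<forall>u q. drift c u q = fst p u + snd p q)"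
  proof
    fix c assume c: "c \<in> idx"
    then have j: "fst c < N" by (auto simp: idx_def)
    obtain \<Phi> \<Psi> where P: "lin \<Phi>" "lin \<Psi>" "\<And>u q. form_b \<sigma> \<theta> \<eta>q N X (fst c) u q (test c) = \<Phi> u + \<Psi> q"
      using form_b_split[OF \<sigma>_C2 j] by blast
    have "lin (\<lambda>u. form_a \<sigma> \<gamma> \<gamma>t N X (fst c) u (test c) + \<Phi> u)" by (intro lin_add lin_form_a[OF \<sigma>_C2 j] P)
    with P(2,3) show "\<exists>p. lin (fst p) \<and> lin (snd p) \<and> (\<forall>u q. drift c u q = fst p u + snd p q)"
      by (intro exI[of _ "(\<lambda>u. form_a \<sigma> \<gamma> \<gamma>t N X (fst c) u (test c) + \<Phi> u, \<Psi>)"]) (simp add: drift_def)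
  qed
  from bchoice[OF this] obtain p where p: "\<forall>c\<in>idx. lin (fst (p c)) \<and> lin (snd (p c)) \<and> (\<forall>u q. drift c u q = fst (p c) u + snd (p c) q)" by blast
  show thesis by (rule that[of "\<lambda>c. fst (p c)" "\<lambda>c. snd (p c)"]) (use p in auto)
qed

lemma system_bounds:
  obtains K where "0 \<le> K"
    "\<And>u q. u \<in> dg_space N k \<Longrightarrow> q \<in> dg_space N k \<Longrightarrow> flux_equation u q \<Longrightarrow> (\<Sum>c\<in>idx. (co c q)\<^sup>2) \<le> K * (\<Sum>c\<in>idx. (co c u)\<^sup>2)"
    "\<And>u q. u \<in> dg_space N k \<Longrightarrow> q \<in> dg_space N k \<Longrightarrow> flux_equation u q \<Longrightarrow> (\<Sum>c\<in>idx. (drift c u q)\<^sup>2) \<le> K * (\<Sum>c\<in>idx. (co c u)\<^sup>2)"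
proof -
  obtain \<Phi> \<Psi> where P: "\<And>c. c \<in> idx \<Longrightarrow> lin (\<Phi> c)" "\<And>c. c \<in> idx \<Longrightarrow> lin (\<Psi> c)"
    "\<And>c u q. c \<in> idx \<Longrightarrow> drift c u q = \<Phi> c u + \<Psi> c q" by (rule drift_split) (assumption | rule that)+
  obtain C1 where C1: "0 \<le> C1" "\<And>v. v \<in> dg_space N k \<Longrightarrow> (\<Sum>c\<in>idx. (\<Phi> c v)\<^sup>2) \<le> C1 * (\<Sum>c\<in>idx. (co c v)\<^sup>2)"
    by (rule lin_bound_family[of \<Phi>, OF P(1)]) (assumption | rule that)+
  obtain C2 where C2: "0 \<le> C2" "\<And>v. v \<in> dg_space N k \<Longrightarrow> (\<Sum>c\<in>idx. (\<Psi> c v)\<^sup>2) \<le> C2 * (\<Sum>c\<in>idx. (co c v)\<^sup>2)"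
    by (rule lin_bound_family[of \<Psi>, OF P(2)]) (assumption | rule that)+
  obtain C3 where C3: "0 \<le> C3" "\<And>u q. u \<in> dg_space N k \<Longrightarrow> q \<in> dg_space N k \<Longrightarrow> flux_equation u q \<Longrightarrow> (\<Sum>c\<in>idx. (co c q)\<^sup>2) \<le> C3 * (\<Sum>c\<in>idx. (co c u)\<^sup>2)"
  proof (rule auxiliary_bound[OF \<sigma>_C2 \<eta>u_nonneg])
    fix C assume C: "0 \<le> C" "\<And>u q. u \<in> dg_space N k \<Longrightarrow> q \<in> dg_space N k \<Longrightarrow>
      (\<And>\<psi> j. \<psi> \<in> dg_space N k \<Longrightarrow> j < N \<Longrightarrow> (LBINT x:{X j..X (Suc j)}. poly (\<psi> j) x * poly (q j) x)
        = - (LBINT x:{X j..X (Suc j)}. poly (pderiv (\<psi> j)) x * \<sigma> x * poly (u j) x)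
          + \<sigma> (X (Suc j)) * flux_u \<sigma> \<theta> \<eta>u N X u q (Suc j) * tr_minus X \<psi> (Suc j)
          - \<sigma> (X j) * flux_u \<sigma> \<theta> \<eta>u N X u q j * tr_plus N X \<psi> j)
      \<Longrightarrow> (\<Sum>c\<in>idx. (co c q)\<^sup>2) \<le> C * (\<Sum>c\<in>idx. (co c u)\<^sup>2)"
    show thesis
    proof (rule that[OF C(1)])
      fix u q assume "u \<in> dg_space N k" "q \<in> dg_space N k" and eq: "flux_equation u q"
      then show "(\<Sum>c\<in>idx. (co c q)\<^sup>2) \<le> C * (\<Sum>c\<in>idx. (co c u)\<^sup>2)"
        by (intro C(2)) (simp_all add: flux_equation_def)
    qed
  qed
  \<comment> \<open>\<open>C3\<close> bounds \<open>q\<close> by \<open>u\<close>. The drift is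
    \<open>\<Phi> c u + \<Psi> c q\<close>; squaring the sum costs a factor 2, and
    \<open>C2 * C3\<close> accounts for passing from \<open>q\<close> to \<open>u\<close>.\<close>
  define K where "K = C3 + 2 * C1 + 2 * C2 * C3"
  have s0: "0 \<le> (\<Sum>c\<in>idx. (co c u)\<^sup>2)" for u by (intro sum_nonneg) simp
  show thesis
  proof (rule that[of K])
    show "0 \<le> K" using C1 C2 C3 by (simp add: K_def)
    fix u q assume u: "u \<in> dg_space N k" and q: "q \<in> dg_space N k" and eq: "flux_equation u q"
    let ?S = "\<Sum>c\<in>idx. (co c u)\<^sup>2"
    have Q: "(\<Sum>c\<in>idx. (co c q)\<^sup>2) \<le> C3 * ?S" by (rule C3(2)[OF u q eq])
    have "C3 * ?S \<le> K * ?S" using C1 C2 C3 s0 by (intro mult_right_mono) (auto simp: K_def)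
    with Q show "(\<Sum>c\<in>idx. (co c q)\<^sup>2) \<le> K * ?S" by simp
    have "(\<Sum>c\<in>idx. (drift c u q)\<^sup>2) \<le> (\<Sum>c\<in>idx. 2 * (\<Phi> c u)\<^sup>2 + 2 * (\<Psi> c q)\<^sup>2)"
    proof (rule sum_mono)
      fix c assume "c \<in> idx"
      have "(a + b)\<^sup>2 \<le> 2 * a\<^sup>2 + 2 * b\<^sup>2" for a b :: real
        using zero_le_power2[of "a - b"] by (simp add: power2_eq_square algebra_simps)
      then show "(drift c u q)\<^sup>2 \<le> 2 * (\<Phi> c u)\<^sup>2 + 2 * (\<Psi> c q)\<^sup>2" unfolding P(3)[OF \<open>c \<in> idx\<close>] .
    qed
    also have "\<dots> = 2 * (\<Sum>c\<in>idx. (\<Phi> c u)\<^sup>2) + 2 * (\<Sum>c\<in>idx. (\<Psi> c q)\<^sup>2)" by (simp add: sum.distrib sum_distrib_left)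
    also have "\<dots> \<le> 2 * (C1 * ?S) + 2 * (C2 * (C3 * ?S))"
      using C1(2)[OF u] order_trans[OF C2(2)[OF q] mult_left_mono[OF Q C2(1)]] by linarith
    also have "\<dots> = (2 * C1 + 2 * C2 * C3) * ?S" by (simp add: algebra_simps)
    also have "\<dots> \<le> K * ?S" using C3 s0 by (intro mult_right_mono) (auto simp: K_def)
    finally show "(\<Sum>c\<in>idx. (drift c u q)\<^sup>2) \<le> K * ?S" .
  qed
qed

lemma modified_energy:
  obtains u q B where "\<And>s \<omega>. u s \<omega> \<in> dg_space N k" "\<And>s \<omega>. q s \<omega> \<in> dg_space N k"
    "\<And>j i. j < N \<Longrightarrow> i \<le> k \<Longrightarrow> regular_process T (\<lambda>s \<omega>. coeff (u s \<omega> j) i)"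
    "\<And>j i. j < N \<Longrightarrow> i \<le> k \<Longrightarrow> regular_process T (\<lambda>s \<omega>. coeff (q s \<omega> j) i)"
    "AE \<omega> in M. \<forall>s\<in>{0..T}. u s \<omega> = uh s \<omega> \<and> q s \<omega> = qh s \<omega>"
    "0 \<le> B" "\<And>s c. s \<in> {0..T} \<Longrightarrow> c \<in> idx \<Longrightarrow> (\<integral>\<^sup>+\<omega>. ennreal ((co c (u s \<omega>))\<^sup>2) \<partial>M) \<le> ennreal B"
    "\<And>s c. s \<in> {0..T} \<Longrightarrow> c \<in> idx \<Longrightarrow> (\<integral>\<^sup>+\<omega>. ennreal ((co c (q s \<omega>))\<^sup>2) \<partial>M) \<le> ennreal B"
    "\<And>t. t \<in> {0..T} \<Longrightarrow> (\<integral>\<omega>. (\<Sum>c\<in>idx. (co c (u t \<omega>))\<^sup>2) \<partial>M)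
      = (\<Sum>c\<in>idx. (co c uh0)\<^sup>2) + (LBINT s:{0..t}. \<integral>\<omega>. dissipation (u s \<omega>) (q s \<omega>) \<partial>M)"
proof -
  obtain u q where u: "\<And>s \<omega>. u s \<omega> \<in> dg_space N k" and q: "\<And>s \<omega>. q s \<omega> \<in> dg_space N k"
    and ur: "\<And>j i. j < N \<Longrightarrow> i \<le> k \<Longrightarrow> regular_process T (\<lambda>s \<omega>. coeff (u s \<omega> j) i)"
    and qr: "\<And>j i. j < N \<Longrightarrow> i \<le> k \<Longrightarrow> regular_process T (\<lambda>s \<omega>. coeff (q s \<omega> j) i)"
    and ae: "AE \<omega> in M. \<forall>s\<in>{0..T}. u s \<omega> = uh s \<omega> \<and> q s \<omega> = qh s \<omega>"
    and fl: "\<And>s \<omega>. flux_equation (u s \<omega>) (q s \<omega>)" and bd: "\<And>s \<omega>. closed_boundary (u s \<omega>)"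
    by (rule regular_modification) (assumption | rule that)+
  obtain K where K: "0 \<le> K"
    "\<And>u q. u \<in> dg_space N k \<Longrightarrow> q \<in> dg_space N k \<Longrightarrow> flux_equation u q \<Longrightarrow> (\<Sum>c\<in>idx. (co c q)\<^sup>2) \<le> K * (\<Sum>c\<in>idx. (co c u)\<^sup>2)"
    "\<And>u q. u \<in> dg_space N k \<Longrightarrow> q \<in> dg_space N k \<Longrightarrow> flux_equation u q \<Longrightarrow> (\<Sum>c\<in>idx. (drift c u q)\<^sup>2) \<le> K * (\<Sum>c\<in>idx. (co c u)\<^sup>2)"
    by (rule system_bounds) (assumption | rule that)+
  define U where "U = (\<lambda>c s \<omega>. co c (u s \<omega>))"
  define Q where "Q = (\<lambda>c s \<omega>. co c (q s \<omega>))"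
  define D where "D = (\<lambda>c s \<omega>. drift c (u s \<omega>) (q s \<omega>))"
  have Ur: "regular_process T (U c)" and Qr: "regular_process T (Q c)" if "c \<in> idx" for c
    unfolding U_def Q_def using regular_process_co[OF u ur that] regular_process_co[OF q qr that] by auto
  obtain \<Phi> \<Psi> where P: "\<And>c. c \<in> idx \<Longrightarrow> lin (\<Phi> c)" "\<And>c. c \<in> idx \<Longrightarrow> lin (\<Psi> c)"
    "\<And>c u q. c \<in> idx \<Longrightarrow> drift c u q = \<Phi> c u + \<Psi> c q" by (rule drift_split) (assumption | rule that)+
  have Dr: "regular_process T (D c)" if c: "c \<in> idx" for c
    unfolding D_def P(3)[OF c]
    by (intro regular_process_add regular_process_lin[OF u ur P(1)[OF c]] regular_process_lin[OF q qr P(2)[OF c]])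
  define Z0 where "Z0 = (\<lambda>c s \<omega>. LBINT x:{X (fst c)..X (Suc (fst c))}. poly (test c (fst c)) x * poly (qh s \<omega> (fst c)) x)"
  have "\<forall>c\<in>idx. \<exists>Y. ito_integral M F W T (Z0 c) Y \<and>
          (AE \<omega> in M. \<forall>t\<in>{0..T}.
             (LBINT x:{X (fst c)..X (Suc (fst c))}. poly (test c (fst c)) x * poly (uh t \<omega> (fst c)) x)
             = (LBINT x:{X (fst c)..X (Suc (fst c))}. poly (test c (fst c)) x * poly (uh 0 \<omega> (fst c)) x)
               + (LBINT s:{0..t}. form_a \<sigma> \<gamma> \<gamma>t N X (fst c) (uh s \<omega>) (test c)
                                + form_b \<sigma> \<theta> \<eta>q N X (fst c) (uh s \<omega>) (qh s \<omega>) (test c))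
               - Y t \<omega>)"
  proof
    fix c assume c: "c \<in> idx"
    then have "fst c < N" by (auto simp: idx_def)
    then show "\<exists>Y. ito_integral M F W T (Z0 c) Y \<and>
          (AE \<omega> in M. \<forall>t\<in>{0..T}.
             (LBINT x:{X (fst c)..X (Suc (fst c))}. poly (test c (fst c)) x * poly (uh t \<omega> (fst c)) x)
             = (LBINT x:{X (fst c)..X (Suc (fst c))}. poly (test c (fst c)) x * poly (uh 0 \<omega> (fst c)) x)
               + (LBINT s:{0..t}. form_a \<sigma> \<gamma> \<gamma>t N X (fst c) (uh s \<omega>) (test c)
                                + form_b \<sigma> \<theta> \<eta>q N X (fst c) (uh s \<omega>) (qh s \<omega>) (test c))
               - Y t \<omega>)"
      using solution test_dg_space[OF c] unfolding ldg_solution_def Z0_def by blast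
  qed
  from bchoice[OF this] obtain Y where Y: "\<forall>c\<in>idx. ito_integral M F W T (Z0 c) (Y c) \<and>
          (AE \<omega> in M. \<forall>t\<in>{0..T}. co c (uh t \<omega>) = co c (uh 0 \<omega>) + (LBINT s:{0..t}. drift c (uh s \<omega>) (qh s \<omega>)) - Y c t \<omega>)"
    unfolding drift_def[symmetric] by (auto simp: test_integral_co)
  have Z0Q: "AE \<omega> in M. \<forall>s\<in>{0..T}. Z0 c s \<omega> = Q c s \<omega>" if "c \<in> idx" for c
    using ae by eventually_elim (simp add: Z0_def Q_def test_integral_co[OF that])
  have init: "AE \<omega> in M. \<forall>j<N. uh 0 \<omega> j = uh0 j" using solution by (simp add: ldg_solution_def)
  \<comment> \<open>The initial value is deterministic by \<open>init\<close>, so the constant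
    \<open>x\<close> of the abstract system is \<open>co c uh0\<close>.\<close>
  have eq: "AE \<omega> in M. U c t \<omega> = co c uh0 + (LBINT s:{0..t}. D c s \<omega>) - Y c t \<omega>" if c: "c \<in> idx" and t: "t \<in> {0..T}" for c t
    using ae init bspec[OF Y c, THEN conjunct2]
  proof eventually_elim
    case (elim \<omega>)
    have "co c (uh 0 \<omega>) = co c uh0" using elim(2) c by (auto simp: co_def idx_def)
    moreover have "(LBINT s:{0..t}. drift c (uh s \<omega>) (qh s \<omega>)) = (LBINT s:{0..t}. D c s \<omega>)"
      by (rule set_lebesgue_integral_cong) (use elim(1) t in \<open>auto simp: D_def\<close>)
    moreover have "U c t \<omega> = co c (uh t \<omega>)" using elim(1) t by (simp add: U_def)
    ultimately show ?case using elim(3) t by simp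
  qed
  have bD: "(\<Sum>c\<in>idx. (D c s \<omega>)\<^sup>2) \<le> K * (\<Sum>c\<in>idx. (U c s \<omega>)\<^sup>2)" for s \<omega>
    unfolding D_def U_def by (rule K(3)[OF u q fl])
  have bQ: "(\<Sum>c\<in>idx. (Q c s \<omega>)\<^sup>2) \<le> K * (\<Sum>c\<in>idx. (U c s \<omega>)\<^sup>2)" for s \<omega>
    unfolding Q_def U_def by (rule K(2)[OF u q fl])
  have ito: "ito_integral M F W T (Z0 c) (Y c)" if "c \<in> idx" for c using Y that by blast
  obtain B where B: "0 \<le> B"
    "\<And>s c. s \<in> {0..T} \<Longrightarrow> c \<in> idx \<Longrightarrow> (\<integral>\<^sup>+\<omega>. ennreal ((U c s \<omega>)\<^sup>2) \<partial>M) \<le> ennreal B"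
    "\<And>s c. s \<in> {0..T} \<Longrightarrow> c \<in> idx \<Longrightarrow> (\<integral>\<^sup>+\<omega>. ennreal ((Q c s \<omega>)\<^sup>2) \<partial>M) \<le> ennreal B"
    "\<And>t. t \<in> {0..T} \<Longrightarrow> (\<integral>\<omega>. (\<Sum>c\<in>idx. (U c t \<omega>)\<^sup>2) \<partial>M)
      = (\<Sum>c\<in>idx. (co c uh0)\<^sup>2) + (LBINT s:{0..t}. \<integral>\<omega>. (\<Sum>c\<in>idx. 2 * (U c s \<omega> * D c s \<omega>) + (Q c s \<omega>)\<^sup>2) \<partial>M)"
    by (rule linear_system_energy[OF T_pos finite_idx Ur Dr Qr ito Z0Q eq bD bQ K(1)]) (assumption | rule that)+
  have diss: "(\<Sum>c\<in>idx. 2 * (U c s \<omega> * D c s \<omega>) + (Q c s \<omega>)\<^sup>2) = dissipation (u s \<omega>) (q s \<omega>)" for s \<omega>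
    unfolding U_def D_def Q_def by (rule drift_energy[OF u q fl bd])
  show thesis
    by (rule that[OF u q ur qr ae B(1) B(2)[unfolded U_def] B(3)[unfolded Q_def] B(4)[unfolded diss, unfolded U_def]])
qed

end

text \<open>\<open>Linf_norm\<close> passes through \<open>real_of_ereal\<close>, which is faithful
  only for finite values. The essential supremum is below infinity by \<open>Linf\<close>, and
  nonnegative as soon as it bounds an absolute value at some point; such points exist because the
  real line is not a null set.\<close>

lemma Linf_AE_le:
  assumes "Linf g"
  shows "AE x in lborel. \<bar>g x\<bar> \<le> Linf_norm g" "0 \<le> Linf_norm g"
proof -
  let ?E = "esssup lborel (\<lambda>x. ereal \<bar>g x\<bar>)"
  have [measurable]: "g \<in> borel_measurable borel" and fin: "?E < \<infinity>" using assms by (auto simp: Linf_def)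
  have m: "(\<lambda>x. ereal \<bar>g x\<bar>) \<in> borel_measurable lborel" by measurable
  have ae: "AE x in lborel. ereal \<bar>g x\<bar> \<le> ?E" by (rule esssup_AE)
  have le: "\<bar>y\<bar> \<le> Linf_norm g" if "ereal \<bar>y\<bar> \<le> ?E" for y :: real
  proof -
    have "0 \<le> ?E" using order_trans[OF _ that, of 0] by simp
    then obtain r where r: "?E = ereal r" using fin by (cases ?E) auto
    then show ?thesis using that by (simp add: Linf_norm_def)
  qed
  show 1: "AE x in lborel. \<bar>g x\<bar> \<le> Linf_norm g" using ae by eventually_elim (rule le)
  show "0 \<le> Linf_norm g"
  proof (rule ccontr)
    assume n: "\<not> 0 \<le> Linf_norm g"
    have "AE x in lborel. x \<notin> (UNIV :: real set)" using 1 by eventually_elim (use n abs_ge_zero order_trans in blast)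
    then have "emeasure lborel (UNIV :: real set) = 0" using AE_iff_null_sets[of "UNIV :: real set" lborel] by (simp add: null_sets_def)
    then show False by (simp add: emeasure_lborel_UNIV)
  qed
qed

section \<open>Second moments of linear functionals and weighted integrals\<close>

context dg_frame begin

lemma lin_sum: "(\<And>i. i \<in> I \<Longrightarrow> lin (\<Phi> i)) \<Longrightarrow> lin (\<lambda>v. \<Sum>i\<in>I. \<Phi> i v)"
proof (induction I rule: infinite_finite_induct)
  case (insert i I)
  then show ?case by (simp add: lin_add)
qed (auto simp: lin_def intro!: exI[of _ "\<lambda>_. 0"])

lemma lin_dg_fun: "lin (\<lambda>v. dg_fun N X v x)"
  unfolding dg_fun_def by (intro lin_sum lin_cmult lin_point) simp

lemma lin_co: "c \<in> idx \<Longrightarrow> lin (co c)"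
  unfolding lin_def
  by (intro exI[of _ "\<lambda>d. if d = c then 1 else 0"]) (simp add: if_distrib[of "\<lambda>y. y * _"] finite_idx cong: if_cong)

lemma poly_square_expand:
  assumes "v \<in> dg_space N k" "j < N"
  shows "(poly (v j) x)\<^sup>2 = (\<Sum>a\<le>k. \<Sum>b\<le>k. (co (j, a) v * co (j, b) v) * (poly (e j a) x * poly (e j b) x))"
  unfolding poly_expand[OF assms] power2_eq_square sum_product by (intro sum.cong refl) (simp add: mult_ac)

lemma weighted_gram:
  assumes w: "continuous_on UNIV (w :: real \<Rightarrow> real)"
  shows "(LBINT x:{a..b}. w x * (\<Sum>i\<le>k. \<Sum>l\<le>k. m i l * (poly (e j i) x * poly (e j l) x)))
    = (\<Sum>i\<le>k. \<Sum>l\<le>k. m i l * (LBINT x:{a..b}. w x * (poly (e j i) x * poly (e j l) x)))"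
proof -
  have c: "set_integrable lborel {a..b} (\<lambda>x. m i l * (w x * (poly (e j i) x * poly (e j l) x)))" for i l
    by (intro borel_integrable_atLeastAtMost' continuous_intros continuous_on_subset[OF w subset_UNIV])
  have c': "integrable lborel (\<lambda>x. indicator {a..b} x *\<^sub>R (m i l * (w x * (poly (e j i) x * poly (e j l) x))))" for i l
    using c by (simp add: set_integrable_def)
  have "(LBINT x:{a..b}. w x * (\<Sum>i\<le>k. \<Sum>l\<le>k. m i l * (poly (e j i) x * poly (e j l) x)))
    = (LBINT x:{a..b}. (\<Sum>i\<le>k. \<Sum>l\<le>k. m i l * (w x * (poly (e j i) x * poly (e j l) x))))"
    by (simp only: sum_distrib_left mult_ac)
  also have "\<dots> = (\<Sum>i\<le>k. \<Sum>l\<le>k. LBINT x:{a..b}. m i l * (w x * (poly (e j i) x * poly (e j l) x)))"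
    unfolding set_lebesgue_integral_def scaleR_sum_right
    by (subst Bochner_Integration.integral_sum, rule Bochner_Integration.integrable_sum, rule c',
      rule sum.cong[OF refl], rule Bochner_Integration.integral_sum, rule c')
  finally show ?thesis by simp
qed

end

context ldg_approximation begin

abbreviation "weight \<equiv> \<lambda>x. (deriv \<sigma> x)\<^sup>2 - 1/4 * deriv (deriv (\<lambda>y. (\<sigma> y)\<^sup>2)) x"

lemma weight_continuous: "continuous_on S weight"
  unfolding deriv_square(2)[OF \<sigma>_C2] by (intro continuous_intros C2D(3-5)[OF \<sigma>_C2])

lemma lin_measurable:
  assumes v: "dg_process M F T N k v" and s: "s \<in> {0..T}" and \<Phi>: "lin \<Phi>"
  shows "(\<lambda>\<omega>. \<Phi> (v s \<omega>)) \<in> borel_measurable M"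
proof -
  from \<Phi> obtain \<alpha> where \<alpha>: "\<forall>v\<in>dg_space N k. \<Phi> v = (\<Sum>c\<in>idx. \<alpha> c * co c v)" unfolding lin_def by blast
  have dg: "v s \<omega> \<in> dg_space N k" if "\<omega> \<in> space M" for \<omega> using v s that by (auto simp: dg_process_def)
  have cm: "(\<lambda>\<omega>. coeff (v s \<omega> j) i) \<in> borel_measurable M" if "j < N" "i \<le> k" for j i
    using v s that measurable_F_M unfolding dg_process_def continuous_adapted_def by blast
  have "(\<lambda>\<omega>. \<Sum>c\<in>idx. \<alpha> c * (\<Sum>m\<le>k. poly_inner (X (fst c)) (X (Suc (fst c))) (e (fst c) (snd c)) (monom 1 m) * coeff (v s \<omega> (fst c)) m)) \<in> borel_measurable M"
    by (intro borel_measurable_sum borel_measurable_times borel_measurable_const cm) (auto simp: idx_def)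
  moreover have "\<Phi> (v s \<omega>) = (\<Sum>c\<in>idx. \<alpha> c * (\<Sum>m\<le>k. poly_inner (X (fst c)) (X (Suc (fst c))) (e (fst c) (snd c)) (monom 1 m) * coeff (v s \<omega> (fst c)) m))"
    if "\<omega> \<in> space M" for \<omega>
    using \<alpha> dg[OF that] by (simp add: co_coeff[OF dg[OF that]])
  ultimately show ?thesis by (simp cong: measurable_cong)
qed

end

text \<open>Couples a regular version \<open>v\<close>, whose coordinates have bounded second
  moments, with the given process \<open>vh\<close>. It is instantiated with \<open>uh\<close> and
  with \<open>qh\<close>.\<close>

locale moment_process = ldg_approximation +
  fixes v :: "real \<Rightarrow> 'a \<Rightarrow> bpoly" and vh and B :: real
  assumes v_dg: "\<And>s \<omega>. v s \<omega> \<in> dg_space N k"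
    and v_reg: "\<And>j i. j < N \<Longrightarrow> i \<le> k \<Longrightarrow> regular_process T (\<lambda>s \<omega>. coeff (v s \<omega> j) i)"
    and B_nonneg: "0 \<le> B"
    and v_bound: "\<And>s c. s \<in> {0..T} \<Longrightarrow> c \<in> idx \<Longrightarrow> (\<integral>\<^sup>+\<omega>. ennreal ((co c (v s \<omega>))\<^sup>2) \<partial>M) \<le> ennreal B"
    and vh_process: "dg_process M F T N k vh"
    and v_eq: "AE \<omega> in M. \<forall>s\<in>{0..T}. v s \<omega> = vh s \<omega>"
begin

lemma lin_regular: "lin \<Phi> \<Longrightarrow> regular_process T (\<lambda>s \<omega>. \<Phi> (v s \<omega>))"
  by (rule regular_process_lin[OF v_dg v_reg])

lemma lin_moment:
  assumes "lin \<Phi>"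
  obtains K where "0 \<le> K" "\<And>s. s \<in> {0..T} \<Longrightarrow> (\<integral>\<^sup>+\<omega>. ennreal ((\<Phi> (v s \<omega>))\<^sup>2) \<partial>M) \<le> ennreal K"
proof -
  from lin_bound[OF assms] obtain C where C: "0 \<le> C" "\<And>v. v \<in> dg_space N k \<Longrightarrow> (\<Phi> v)\<^sup>2 \<le> C * (\<Sum>c\<in>idx. (co c v)\<^sup>2)" by blast
  show thesis
  proof (rule that[of "C * (\<Sum>c\<in>idx. B)"])
    show "0 \<le> C * (\<Sum>c\<in>idx. B)" using C(1) B_nonneg by (intro mult_nonneg_nonneg sum_nonneg) auto
    fix s assume s: "s \<in> {0..T}"
    have m: "(\<lambda>\<omega>. co c (v s \<omega>)) \<in> borel_measurable M" if "c \<in> idx" for c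
      by (rule regular_processD(2)[OF lin_regular[OF lin_co[OF that]]])
    have "(\<integral>\<^sup>+\<omega>. ennreal ((\<Phi> (v s \<omega>))\<^sup>2) \<partial>M) \<le> (\<integral>\<^sup>+\<omega>. ennreal C * (\<Sum>c\<in>idx. ennreal ((co c (v s \<omega>))\<^sup>2)) \<partial>M)"
    proof (rule nn_integral_mono)
      fix \<omega>
      have "ennreal ((\<Phi> (v s \<omega>))\<^sup>2) \<le> ennreal (C * (\<Sum>c\<in>idx. (co c (v s \<omega>))\<^sup>2))" by (rule ennreal_leI[OF C(2)[OF v_dg]])
      then show "ennreal ((\<Phi> (v s \<omega>))\<^sup>2) \<le> ennreal C * (\<Sum>c\<in>idx. ennreal ((co c (v s \<omega>))\<^sup>2))"
        using C(1) by (simp add: ennreal_mult' sum_ennreal)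
    qed
    also have "\<dots> = ennreal C * (\<Sum>c\<in>idx. \<integral>\<^sup>+\<omega>. ennreal ((co c (v s \<omega>))\<^sup>2) \<partial>M)"
      by (subst nn_integral_cmult, (use m in measurable)[1], subst nn_integral_sum) (use m in auto)
    also have "\<dots> \<le> ennreal C * (\<Sum>c\<in>idx. ennreal B)"
      by (intro mult_left_mono sum_mono v_bound s) auto
    also have "\<dots> = ennreal (C * (\<Sum>c\<in>idx. B))" using C(1) B_nonneg by (subst sum_ennreal) (auto simp: ennreal_mult')
    finally show "(\<integral>\<^sup>+\<omega>. ennreal ((\<Phi> (v s \<omega>))\<^sup>2) \<partial>M) \<le> ennreal (C * (\<Sum>c\<in>idx. B))" .
  qed
qed

lemma lin_sq_int:
  assumes "lin \<Phi>" "s \<in> {0..T}" shows "sq_int (\<lambda>\<omega>. \<Phi> (v s \<omega>))"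
proof -
  from lin_moment[OF assms(1)] obtain K where "(\<integral>\<^sup>+\<omega>. ennreal ((\<Phi> (v s \<omega>))\<^sup>2) \<partial>M) \<le> ennreal K" using assms(2) by blast
  then show ?thesis by (rule sq_int_regular[OF lin_regular[OF assms(1)]])
qed

lemma lin_product_integrable: "lin \<Phi> \<Longrightarrow> lin \<Psi> \<Longrightarrow> s \<in> {0..T} \<Longrightarrow> integrable M (\<lambda>\<omega>. \<Phi> (v s \<omega>) * \<Psi> (v s \<omega>))"
  by (intro sq_int_mult lin_sq_int)

lemma lin_product_set_integrable:
  assumes \<Phi>: "lin \<Phi>" and \<Psi>: "lin \<Psi>" and t: "t \<in> {0..T}"
  shows "set_integrable lborel {0..t} (\<lambda>s. \<integral>\<omega>. \<Phi> (v s \<omega>) * \<Psi> (v s \<omega>) \<partial>M)"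
proof -
  from lin_moment[OF \<Phi>] obtain K where K: "0 \<le> K" "\<And>s. s \<in> {0..T} \<Longrightarrow> (\<integral>\<^sup>+\<omega>. ennreal ((\<Phi> (v s \<omega>))\<^sup>2) \<partial>M) \<le> ennreal K" by blast
  from lin_moment[OF \<Psi>] obtain L where L: "0 \<le> L" "\<And>s. s \<in> {0..T} \<Longrightarrow> (\<integral>\<^sup>+\<omega>. ennreal ((\<Psi> (v s \<omega>))\<^sup>2) \<partial>M) \<le> ennreal L" by blast
  show ?thesis
    by (rule expectation_product_time_integral(2)[OF regular_processD(1)[OF lin_regular[OF \<Phi>]] regular_processD(1)[OF lin_regular[OF \<Psi>]] _ _ K(1) L(1)])
      (use K(2) L(2) t in auto)
qed

text \<open>Measurability in time is at hand for the regular version \<open>v\<close>, while the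
  result speaks of \<open>vh\<close>; as both agree almost surely, their second moments coincide at
  every time.\<close>

lemma lin_square_transfer:
  assumes "lin \<Phi>" "s \<in> {0..T}"
  shows "(\<integral>\<omega>. (\<Phi> (vh s \<omega>))\<^sup>2 \<partial>M) = (\<integral>\<omega>. (\<Phi> (v s \<omega>))\<^sup>2 \<partial>M)"
proof (rule integral_cong_AE)
  show "(\<lambda>\<omega>. (\<Phi> (vh s \<omega>))\<^sup>2) \<in> borel_measurable M"
    using lin_measurable[OF vh_process assms(2,1)] by measurable
  show "(\<lambda>\<omega>. (\<Phi> (v s \<omega>))\<^sup>2) \<in> borel_measurable M"
    using regular_processD(2)[OF lin_regular[OF assms(1)]] by measurable
  show "AE \<omega> in M. (\<Phi> (vh s \<omega>))\<^sup>2 = (\<Phi> (v s \<omega>))\<^sup>2" using v_eq by eventually_elim (use assms(2) in simp)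
qed

lemma L2_norm_transfer:
  assumes s: "s \<in> {0..T}"
  shows "integrable M (\<lambda>\<omega>. (L2_norm (dg_fun N X (vh s \<omega>)))\<^sup>2)"
    "(\<integral>\<omega>. (L2_norm (dg_fun N X (vh s \<omega>)))\<^sup>2 \<partial>M) = (\<integral>\<omega>. (\<Sum>c\<in>idx. (co c (v s \<omega>))\<^sup>2) \<partial>M)"
proof -
  have dg: "vh s \<omega> \<in> dg_space N k" if "\<omega> \<in> space M" for \<omega> using vh_process s that by (auto simp: dg_process_def)
  have m1: "(\<lambda>\<omega>. \<Sum>c\<in>idx. (co c (vh s \<omega>))\<^sup>2) \<in> borel_measurable M"
    by (intro borel_measurable_sum borel_measurable_power lin_measurable[OF vh_process s] lin_co)
  have m2: "(\<lambda>\<omega>. \<Sum>c\<in>idx. (co c (v s \<omega>))\<^sup>2) \<in> borel_measurable M"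
    by (intro borel_measurable_sum borel_measurable_power regular_processD(2)[OF lin_regular[OF lin_co]])
  have i2: "integrable M (\<lambda>\<omega>. \<Sum>c\<in>idx. (co c (v s \<omega>))\<^sup>2)"
    by (intro Bochner_Integration.integrable_sum sq_int_square lin_sq_int[OF lin_co s])
  have ae: "AE \<omega> in M. (\<Sum>c\<in>idx. (co c (vh s \<omega>))\<^sup>2) = (\<Sum>c\<in>idx. (co c (v s \<omega>))\<^sup>2)"
    using v_eq by eventually_elim (use s in simp)
  have e: "(L2_norm (dg_fun N X (vh s \<omega>)))\<^sup>2 = (\<Sum>c\<in>idx. (co c (vh s \<omega>))\<^sup>2)" if "\<omega> \<in> space M" for \<omega>
    by (rule L2_norm_dg_fun[OF dg[OF that]])
  have "integrable M (\<lambda>\<omega>. \<Sum>c\<in>idx. (co c (vh s \<omega>))\<^sup>2)" using integrable_cong_AE[OF m1 m2 ae] i2 by simp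
  then show "integrable M (\<lambda>\<omega>. (L2_norm (dg_fun N X (vh s \<omega>)))\<^sup>2)"
    by (subst Bochner_Integration.integrable_cong[OF refl e]) auto
  have "(\<integral>\<omega>. (L2_norm (dg_fun N X (vh s \<omega>)))\<^sup>2 \<partial>M) = (\<integral>\<omega>. (\<Sum>c\<in>idx. (co c (vh s \<omega>))\<^sup>2) \<partial>M)"
    by (rule Bochner_Integration.integral_cong[OF refl e])
  also have "\<dots> = (\<integral>\<omega>. (\<Sum>c\<in>idx. (co c (v s \<omega>))\<^sup>2) \<partial>M)" by (rule integral_cong_AE[OF m1 m2 ae])
  finally show "(\<integral>\<omega>. (L2_norm (dg_fun N X (vh s \<omega>)))\<^sup>2 \<partial>M) = (\<integral>\<omega>. (\<Sum>c\<in>idx. (co c (v s \<omega>))\<^sup>2) \<partial>M)" .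
qed

lemma norm_set_integrable:
  assumes t: "t \<in> {0..T}"
  shows "set_integrable lborel {0..t} (\<lambda>s. \<integral>\<omega>. (\<Sum>c\<in>idx. (co c (v s \<omega>))\<^sup>2) \<partial>M)"
proof -
  have "set_integrable lborel {0..t} (\<lambda>s. \<Sum>c\<in>idx. \<integral>\<omega>. co c (v s \<omega>) * co c (v s \<omega>) \<partial>M)"
    unfolding set_integrable_def scaleR_sum_right
    by (rule Bochner_Integration.integrable_sum) (use lin_product_set_integrable[OF lin_co lin_co t] in \<open>auto simp: set_integrable_def\<close>)
  moreover have "(\<Sum>c\<in>idx. \<integral>\<omega>. co c (v s \<omega>) * co c (v s \<omega>) \<partial>M) = (\<integral>\<omega>. (\<Sum>c\<in>idx. (co c (v s \<omega>))\<^sup>2) \<partial>M)" if "s \<in> {0..t}" for s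
    by (subst Bochner_Integration.integral_sum) (use lin_product_integrable[OF lin_co lin_co] t that in \<open>auto simp: power2_eq_square\<close>)
  ultimately show ?thesis by (subst set_integrable_cong[OF refl refl, symmetric]) auto
qed

end

context ldg_approximation begin

definition weight_gram :: "nat \<Rightarrow> nat \<Rightarrow> nat \<Rightarrow> real" where
  "weight_gram j a b = (LBINT x:{X j..X (Suc j)}. weight x * (poly (e j a) x * poly (e j b) x))"

lemma weighted_cell_expand:
  assumes "v \<in> dg_space N k" "j < N"
  shows "(LBINT x:{X j..X (Suc j)}. weight x * (poly (v j) x)\<^sup>2)
    = (\<Sum>a\<le>k. \<Sum>b\<le>k. (co (j, a) v * co (j, b) v) * weight_gram j a b)"
  unfolding poly_square_expand[OF assms] weighted_gram[OF weight_continuous] weight_gram_def ..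

end

context moment_process begin

lemma lin_square_set_integrable:
  assumes "lin \<Phi>" "t \<in> {0..T}"
  shows "set_integrable lborel {0..t} (\<lambda>s. \<integral>\<omega>. (\<Phi> (v s \<omega>))\<^sup>2 \<partial>M)"
  using lin_product_set_integrable[OF assms(1,1,2)] by (simp add: power2_eq_square)

lemma idx_pair: "j < N \<Longrightarrow> a \<le> k \<Longrightarrow> (j, a) \<in> idx"
  by (simp add: idx_def)

text \<open>The space integral is a quadratic form in finitely many coordinates with the
  deterministic matrix \<open>weight_gram\<close>, so expectation and space integral are exchanged
  through finite sums of correlations.\<close>

lemma weighted_moment:
  assumes s: "s \<in> {0..T}"
  shows "integrable M (\<lambda>\<omega>. \<Sum>j<N. LBINT x:{X j..X (Suc j)}. weight x * (poly (v s \<omega> j) x)\<^sup>2)"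
    "(\<integral>\<omega>. (\<Sum>j<N. LBINT x:{X j..X (Suc j)}. weight x * (poly (v s \<omega> j) x)\<^sup>2) \<partial>M)
      = (\<Sum>j<N. \<Sum>a\<le>k. \<Sum>b\<le>k. (\<integral>\<omega>. co (j, a) (v s \<omega>) * co (j, b) (v s \<omega>) \<partial>M) * weight_gram j a b)"
proof -
  have e: "(\<Sum>j<N. LBINT x:{X j..X (Suc j)}. weight x * (poly (v s \<omega> j) x)\<^sup>2)
    = (\<Sum>j<N. \<Sum>a\<le>k. \<Sum>b\<le>k. (co (j, a) (v s \<omega>) * co (j, b) (v s \<omega>)) * weight_gram j a b)" for \<omega>
    by (rule sum.cong[OF refl], rule weighted_cell_expand[OF v_dg]) simp
  have i: "integrable M (\<lambda>\<omega>. (co (j, a) (v s \<omega>) * co (j, b) (v s \<omega>)) * weight_gram j a b)"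
    if "j \<in> {..<N}" "a \<in> {..k}" "b \<in> {..k}" for j a b
    by (intro Bochner_Integration.integrable_mult_left lin_product_integrable lin_co idx_pair s impI) (use that in auto)
  have i1: "integrable M (\<lambda>\<omega>. \<Sum>b\<le>k. (co (j, a) (v s \<omega>) * co (j, b) (v s \<omega>)) * weight_gram j a b)"
    if "j \<in> {..<N}" "a \<in> {..k}" for j a
    by (rule Bochner_Integration.integrable_sum, rule i[OF that])
  have i2: "integrable M (\<lambda>\<omega>. \<Sum>a\<le>k. \<Sum>b\<le>k. (co (j, a) (v s \<omega>) * co (j, b) (v s \<omega>)) * weight_gram j a b)"
    if "j \<in> {..<N}" for j
    by (rule Bochner_Integration.integrable_sum, rule i1[OF that])
  show "integrable M (\<lambda>\<omega>. \<Sum>j<N. LBINT x:{X j..X (Suc j)}. weight x * (poly (v s \<omega> j) x)\<^sup>2)"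
    unfolding e by (rule Bochner_Integration.integrable_sum, rule i2)
  have "(\<integral>\<omega>. (\<Sum>j<N. LBINT x:{X j..X (Suc j)}. weight x * (poly (v s \<omega> j) x)\<^sup>2) \<partial>M)
    = (\<Sum>j<N. \<integral>\<omega>. (\<Sum>a\<le>k. \<Sum>b\<le>k. (co (j, a) (v s \<omega>) * co (j, b) (v s \<omega>)) * weight_gram j a b) \<partial>M)"
    unfolding e by (rule Bochner_Integration.integral_sum, rule i2)
  also have "\<dots> = (\<Sum>j<N. \<Sum>a\<le>k. \<integral>\<omega>. (\<Sum>b\<le>k. (co (j, a) (v s \<omega>) * co (j, b) (v s \<omega>)) * weight_gram j a b) \<partial>M)"
    by (rule sum.cong[OF refl], rule Bochner_Integration.integral_sum, rule i1)
  also have "\<dots> = (\<Sum>j<N. \<Sum>a\<le>k. \<Sum>b\<le>k. \<integral>\<omega>. (co (j, a) (v s \<omega>) * co (j, b) (v s \<omega>)) * weight_gram j a b \<partial>M)"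
    by (rule sum.cong[OF refl], rule sum.cong[OF refl], rule Bochner_Integration.integral_sum, rule i)
  finally show "(\<integral>\<omega>. (\<Sum>j<N. LBINT x:{X j..X (Suc j)}. weight x * (poly (v s \<omega> j) x)\<^sup>2) \<partial>M)
      = (\<Sum>j<N. \<Sum>a\<le>k. \<Sum>b\<le>k. (\<integral>\<omega>. co (j, a) (v s \<omega>) * co (j, b) (v s \<omega>) \<partial>M) * weight_gram j a b)"
    by (simp only: integral_mult_left_zero)
qed

lemma weighted_moment_set_integrable:
  assumes t: "t \<in> {0..T}"
  shows "set_integrable lborel {0..t} (\<lambda>s. \<integral>\<omega>. (\<Sum>j<N. LBINT x:{X j..X (Suc j)}. weight x * (poly (v s \<omega> j) x)\<^sup>2) \<partial>M)"
proof -
  have i: "integrable lborel (\<lambda>s. indicator {0..t} s *\<^sub>R ((\<integral>\<omega>. co (j, a) (v s \<omega>) * co (j, b) (v s \<omega>) \<partial>M) * weight_gram j a b))"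
    if "j \<in> {..<N}" "a \<in> {..k}" "b \<in> {..k}" for j a b
    using lin_product_set_integrable[OF lin_co lin_co t, of "(j, a)" "(j, b)"] that
    by (simp add: set_integrable_def idx_pair mult.assoc[symmetric])
  have "set_integrable lborel {0..t} (\<lambda>s. \<Sum>j<N. \<Sum>a\<le>k. \<Sum>b\<le>k. (\<integral>\<omega>. co (j, a) (v s \<omega>) * co (j, b) (v s \<omega>) \<partial>M) * weight_gram j a b)"
    unfolding set_integrable_def scaleR_sum_right by (intro Bochner_Integration.integrable_sum i)
  then show ?thesis
    by (subst set_integrable_cong[OF refl refl weighted_moment(2)]) (use t in auto)
qed

text \<open>Both sides are the same sum of correlations times \<open>weight_gram\<close>: on the
  right, the second moment of the value at \<open>x\<close> is expanded under the space
  integral.\<close>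

lemma weighted_moment_integral:
  assumes s: "s \<in> {0..T}"
  shows "(\<integral>\<omega>. (\<Sum>j<N. LBINT x:{X j..X (Suc j)}. weight x * (poly (v s \<omega> j) x)\<^sup>2) \<partial>M)
      = (LBINT x. weight x * (\<integral>\<omega>. (dg_fun N X (vh s \<omega>) x)\<^sup>2 \<partial>M))"
proof -
  let ?m = "\<lambda>j a b. \<integral>\<omega>. co (j, a) (v s \<omega>) * co (j, b) (v s \<omega>) \<partial>M"
  have cell: "(\<integral>\<omega>. (poly (v s \<omega> j) x)\<^sup>2 \<partial>M) = (\<Sum>a\<le>k. \<Sum>b\<le>k. ?m j a b * (poly (e j a) x * poly (e j b) x))"
    if j: "j < N" for j x
  proof -
    have i: "integrable M (\<lambda>\<omega>. (co (j, a) (v s \<omega>) * co (j, b) (v s \<omega>)) * (poly (e j a) x * poly (e j b) x))"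
      if "a \<in> {..k}" "b \<in> {..k}" for a b
      by (intro Bochner_Integration.integrable_mult_left lin_product_integrable lin_co idx_pair s impI) (use that j in auto)
    have "(\<integral>\<omega>. (poly (v s \<omega> j) x)\<^sup>2 \<partial>M)
      = (\<Sum>a\<le>k. \<integral>\<omega>. (\<Sum>b\<le>k. (co (j, a) (v s \<omega>) * co (j, b) (v s \<omega>)) * (poly (e j a) x * poly (e j b) x)) \<partial>M)"
      unfolding poly_square_expand[OF v_dg j]
      by (rule Bochner_Integration.integral_sum, rule Bochner_Integration.integrable_sum, rule i)
    also have "\<dots> = (\<Sum>a\<le>k. \<Sum>b\<le>k. \<integral>\<omega>. (co (j, a) (v s \<omega>) * co (j, b) (v s \<omega>)) * (poly (e j a) x * poly (e j b) x) \<partial>M)"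
      by (rule sum.cong[OF refl], rule Bochner_Integration.integral_sum, rule i)
    finally show ?thesis by (simp only: integral_mult_left_zero)
  qed
  have "weight x * (\<integral>\<omega>. (dg_fun N X (vh s \<omega>) x)\<^sup>2 \<partial>M)
    = (\<Sum>j<N. indicator {X j..<X (Suc j)} x * (weight x * (\<Sum>a\<le>k. \<Sum>b\<le>k. ?m j a b * (poly (e j a) x * poly (e j b) x))))" for x
  proof -
    have "(\<integral>\<omega>. (dg_fun N X (vh s \<omega>) x)\<^sup>2 \<partial>M) = (\<integral>\<omega>. (\<Sum>j<N. indicator {X j..<X (Suc j)} x * (poly (v s \<omega> j) x)\<^sup>2) \<partial>M)"
      using lin_square_transfer[OF lin_dg_fun s, of x] unfolding dg_fun_square .
    also have "\<dots> = (\<Sum>j<N. \<integral>\<omega>. indicator {X j..<X (Suc j)} x * (poly (v s \<omega> j) x)\<^sup>2 \<partial>M)"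
      by (rule Bochner_Integration.integral_sum, rule Bochner_Integration.integrable_mult_right,
        rule sq_int_square[OF lin_sq_int[OF lin_point s]]) simp
    also have "\<dots> = (\<Sum>j<N. indicator {X j..<X (Suc j)} x * (\<Sum>a\<le>k. \<Sum>b\<le>k. ?m j a b * (poly (e j a) x * poly (e j b) x)))"
      by (rule sum.cong[OF refl]) (simp add: cell)
    finally show ?thesis by (simp only: sum_distrib_left mult.left_commute)
  qed
  then have "(LBINT x. weight x * (\<integral>\<omega>. (dg_fun N X (vh s \<omega>) x)\<^sup>2 \<partial>M))
    = (\<integral>x. (\<Sum>j<N. indicator {X j..<X (Suc j)} x * (weight x * (\<Sum>a\<le>k. \<Sum>b\<le>k. ?m j a b * (poly (e j a) x * poly (e j b) x)))) \<partial>lborel)"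
    by (simp only: set_lebesgue_integral_def indicator_UNIV scaleR_one)
  also have "\<dots> = (\<Sum>j<N. LBINT x:{X j..X (Suc j)}. weight x * (\<Sum>a\<le>k. \<Sum>b\<le>k. ?m j a b * (poly (e j a) x * poly (e j b) x)))"
    by (rule broken_integral(2)) (intro continuous_on_mult weight_continuous continuous_intros)
  also have "\<dots> = (\<Sum>j<N. \<Sum>a\<le>k. \<Sum>b\<le>k. ?m j a b * weight_gram j a b)"
    unfolding weighted_gram[OF weight_continuous] weight_gram_def ..
  finally show ?thesis unfolding weighted_moment(2)[OF s] ..
qed

end

section \<open>Energy identity and stability of the scheme\<close>

context ldg_approximation begin

lemma moment_energy:
  obtains u q B where "moment_process M F W N k X e T \<sigma> \<gamma> \<gamma>t \<theta> \<eta>u \<eta>q uh0 uh qh u uh B"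
    "moment_process M F W N k X e T \<sigma> \<gamma> \<gamma>t \<theta> \<eta>u \<eta>q uh0 uh qh q qh B"
    "\<And>t. t \<in> {0..T} \<Longrightarrow> (\<integral>\<omega>. (\<Sum>c\<in>idx. (co c (u t \<omega>))\<^sup>2) \<partial>M)
      = (\<Sum>c\<in>idx. (co c uh0)\<^sup>2) + (LBINT s:{0..t}. \<integral>\<omega>. dissipation (u s \<omega>) (q s \<omega>) \<partial>M)"
proof -
  obtain u q B where u: "\<And>s \<omega>. u s \<omega> \<in> dg_space N k" and q: "\<And>s \<omega>. q s \<omega> \<in> dg_space N k"
    and ur: "\<And>j i. j < N \<Longrightarrow> i \<le> k \<Longrightarrow> regular_process T (\<lambda>s \<omega>. coeff (u s \<omega> j) i)"
    and qr: "\<And>j i. j < N \<Longrightarrow> i \<le> k \<Longrightarrow> regular_process T (\<lambda>s \<omega>. coeff (q s \<omega> j) i)"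
    and ae: "AE \<omega> in M. \<forall>s\<in>{0..T}. u s \<omega> = uh s \<omega> \<and> q s \<omega> = qh s \<omega>"
    and B: "0 \<le> B" and ub: "\<And>s c. s \<in> {0..T} \<Longrightarrow> c \<in> idx \<Longrightarrow> (\<integral>\<^sup>+\<omega>. ennreal ((co c (u s \<omega>))\<^sup>2) \<partial>M) \<le> ennreal B"
    and qb: "\<And>s c. s \<in> {0..T} \<Longrightarrow> c \<in> idx \<Longrightarrow> (\<integral>\<^sup>+\<omega>. ennreal ((co c (q s \<omega>))\<^sup>2) \<partial>M) \<le> ennreal B"
    and en: "\<And>t. t \<in> {0..T} \<Longrightarrow> (\<integral>\<omega>. (\<Sum>c\<in>idx. (co c (u t \<omega>))\<^sup>2) \<partial>M)
      = (\<Sum>c\<in>idx. (co c uh0)\<^sup>2) + (LBINT s:{0..t}. \<integral>\<omega>. dissipation (u s \<omega>) (q s \<omega>) \<partial>M)"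
    by (rule modified_energy) (assumption | rule that)+
  have pu: "dg_process M F T N k uh" and pq: "dg_process M F T N k qh" using solution by (auto simp: ldg_solution_def)
  have ueq: "AE \<omega> in M. \<forall>s\<in>{0..T}. u s \<omega> = uh s \<omega>" using ae by eventually_elim simp
  have qeq: "AE \<omega> in M. \<forall>s\<in>{0..T}. q s \<omega> = qh s \<omega>" using ae by eventually_elim simp
  show thesis
  proof (rule that[of u B q])
    show "moment_process M F W N k X e T \<sigma> \<gamma> \<gamma>t \<theta> \<eta>u \<eta>q uh0 uh qh u uh B"
      by (intro moment_process.intro moment_process_axioms.intro ldg_approximation_axioms u ur B ub pu ueq)
    show "moment_process M F W N k X e T \<sigma> \<gamma> \<gamma>t \<theta> \<eta>u \<eta>q uh0 uh qh q qh B"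
      by (intro moment_process.intro moment_process_axioms.intro ldg_approximation_axioms q qr B qb pq qeq)
  qed (rule en)
qed

lemma energy_identity:
  assumes t: "t \<in> {0..T}"
  shows "integrable M (\<lambda>\<omega>. (L2_norm (dg_fun N X (uh t \<omega>)))\<^sup>2)" "integrable M (\<lambda>\<omega>. (L2_norm (dg_fun N X (qh t \<omega>)))\<^sup>2)"
    "set_integrable lborel {0..t} (\<lambda>s. \<integral>\<omega>. (L2_norm (dg_fun N X (uh s \<omega>)))\<^sup>2 \<partial>M)"
    "set_integrable lborel {0..t} (\<lambda>s. \<integral>\<omega>. (L2_norm (dg_fun N X (qh s \<omega>)))\<^sup>2 \<partial>M)"
    "(\<integral>\<omega>. (L2_norm (dg_fun N X (uh t \<omega>)))\<^sup>2 \<partial>M)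
        + 1/4 * (\<Sum>j<N. (\<gamma> + 2 * \<gamma>t) * (\<bar>deriv (\<lambda>x. (\<sigma> x)\<^sup>2) (X j)\<bar> *
              (LBINT s:{0..t}. \<integral>\<omega>. (jump N X (uh s \<omega>) j)\<^sup>2 \<partial>M)))
        + (\<Sum>j<N. \<bar>\<sigma> (X j)\<bar> *
              (LBINT s:{0..t}. \<eta>u * (\<integral>\<omega>. (jump N X (qh s \<omega>) j)\<^sup>2 \<partial>M)
                             + \<eta>q * (\<integral>\<omega>. (jump N X (uh s \<omega>) j)\<^sup>2 \<partial>M)))
      = (L2_norm (dg_fun N X uh0))\<^sup>2
        + (LBINT s:{0..t}. LBINT x. weight x * (\<integral>\<omega>. (dg_fun N X (uh s \<omega>) x)\<^sup>2 \<partial>M))"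
proof -
  obtain u q B where mu: "moment_process M F W N k X e T \<sigma> \<gamma> \<gamma>t \<theta> \<eta>u \<eta>q uh0 uh qh u uh B"
    and mq: "moment_process M F W N k X e T \<sigma> \<gamma> \<gamma>t \<theta> \<eta>u \<eta>q uh0 uh qh q qh B"
    and en: "\<And>t. t \<in> {0..T} \<Longrightarrow> (\<integral>\<omega>. (\<Sum>c\<in>idx. (co c (u t \<omega>))\<^sup>2) \<partial>M)
      = (\<Sum>c\<in>idx. (co c uh0)\<^sup>2) + (LBINT s:{0..t}. \<integral>\<omega>. dissipation (u s \<omega>) (q s \<omega>) \<partial>M)"
    by (rule moment_energy) (assumption | rule that)+
  interpret U: moment_process M F W N k X e T \<sigma> \<gamma> \<gamma>t \<theta> \<eta>u \<eta>q uh0 uh qh u uh B by (rule mu)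
  interpret Q: moment_process M F W N k X e T \<sigma> \<gamma> \<gamma>t \<theta> \<eta>u \<eta>q uh0 uh qh q qh B by (rule mq)
  have sT: "s \<in> {0..T}" if "s \<in> {0..t}" for s using that t by auto
  show "integrable M (\<lambda>\<omega>. (L2_norm (dg_fun N X (uh t \<omega>)))\<^sup>2)" "integrable M (\<lambda>\<omega>. (L2_norm (dg_fun N X (qh t \<omega>)))\<^sup>2)"
    using U.L2_norm_transfer(1)[OF t] Q.L2_norm_transfer(1)[OF t] by auto
  show "set_integrable lborel {0..t} (\<lambda>s. \<integral>\<omega>. (L2_norm (dg_fun N X (uh s \<omega>)))\<^sup>2 \<partial>M)"
    by (subst set_integrable_cong[OF refl refl U.L2_norm_transfer(2)[OF sT]]) (auto intro: U.norm_set_integrable[OF t])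
  show "set_integrable lborel {0..t} (\<lambda>s. \<integral>\<omega>. (L2_norm (dg_fun N X (qh s \<omega>)))\<^sup>2 \<partial>M)"
    by (subst set_integrable_cong[OF refl refl Q.L2_norm_transfer(2)[OF sT]]) (auto intro: Q.norm_set_integrable[OF t])
  define I where "I = (\<lambda>s. \<integral>\<omega>. (\<Sum>j<N. LBINT x:{X j..X (Suc j)}. weight x * (poly (u s \<omega> j) x)\<^sup>2) \<partial>M)"
  define Ju where "Ju = (\<lambda>j s. \<integral>\<omega>. (jump N X (u s \<omega>) j)\<^sup>2 \<partial>M)"
  define Jq where "Jq = (\<lambda>j s. \<integral>\<omega>. (jump N X (q s \<omega>) j)\<^sup>2 \<partial>M)"
  have Iint: "set_integrable lborel {0..t} I" unfolding I_def by (rule U.weighted_moment_set_integrable[OF t])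
  have Jint: "set_integrable lborel {0..t} (Ju j)" "set_integrable lborel {0..t} (Jq j)" if "j < N" for j
    using U.lin_square_set_integrable[OF lin_jump t] Q.lin_square_set_integrable[OF lin_jump t] that
    unfolding Ju_def Jq_def by auto
  have ju: "integrable M (\<lambda>\<omega>. (jump N X (u s \<omega>) j)\<^sup>2)" and jq: "integrable M (\<lambda>\<omega>. (jump N X (q s \<omega>) j)\<^sup>2)"
    if "j < N" "s \<in> {0..T}" for j s
    using that by (auto intro!: sq_int_square U.lin_sq_int Q.lin_sq_int lin_jump)
  have "(\<integral>\<omega>. dissipation (u s \<omega>) (q s \<omega>) \<partial>M)
    = I s - 1/4 * (\<Sum>j<N. (\<gamma> + 2 * \<gamma>t) * (\<bar>deriv (\<lambda>x. (\<sigma> x)\<^sup>2) (X j)\<bar> * Ju j s))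
      - (\<Sum>j<N. \<bar>\<sigma> (X j)\<bar> * (\<eta>u * Jq j s + \<eta>q * Ju j s))" if s: "s \<in> {0..T}" for s
  proof -
    let ?A = "\<lambda>\<omega>. \<Sum>j<N. LBINT x:{X j..X (Suc j)}. weight x * (poly (u s \<omega> j) x)\<^sup>2"
    let ?B = "\<lambda>\<omega>. \<Sum>j<N. (\<gamma> + 2 * \<gamma>t) * (\<bar>deriv (\<lambda>x. (\<sigma> x)\<^sup>2) (X j)\<bar> * (jump N X (u s \<omega>) j)\<^sup>2)"
    let ?C = "\<lambda>\<omega>. \<Sum>j<N. \<bar>\<sigma> (X j)\<bar> * (\<eta>u * (jump N X (q s \<omega>) j)\<^sup>2 + \<eta>q * (jump N X (u s \<omega>) j)\<^sup>2)"
    have iB: "integrable M (\<lambda>\<omega>. (\<gamma> + 2 * \<gamma>t) * (\<bar>deriv (\<lambda>x. (\<sigma> x)\<^sup>2) (X j)\<bar> * (jump N X (u s \<omega>) j)\<^sup>2))"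
      if "j \<in> {..<N}" for j
      by (intro Bochner_Integration.integrable_mult_right ju s) (use that in auto)
    have iC: "integrable M (\<lambda>\<omega>. \<bar>\<sigma> (X j)\<bar> * (\<eta>u * (jump N X (q s \<omega>) j)\<^sup>2 + \<eta>q * (jump N X (u s \<omega>) j)\<^sup>2))"
      if "j \<in> {..<N}" for j
      by (intro Bochner_Integration.integrable_mult_right Bochner_Integration.integrable_add ju jq s) (use that in auto)
    have A: "integrable M ?A" by (rule U.weighted_moment(1)[OF s])
    have B: "integrable M ?B" by (rule Bochner_Integration.integrable_sum) (rule iB)
    have C: "integrable M ?C" by (rule Bochner_Integration.integrable_sum) (rule iC)
    have "(\<integral>\<omega>. dissipation (u s \<omega>) (q s \<omega>) \<partial>M) = (\<integral>\<omega>. ?A \<omega> - 1/4 * ?B \<omega> - ?C \<omega> \<partial>M)"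
      unfolding dissipation_def ..
    also have "\<dots> = (\<integral>\<omega>. ?A \<omega> - 1/4 * ?B \<omega> \<partial>M) - (\<integral>\<omega>. ?C \<omega> \<partial>M)"
      by (rule Bochner_Integration.integral_diff[OF Bochner_Integration.integrable_diff[OF A Bochner_Integration.integrable_mult_right[OF B]] C])
    also have "(\<integral>\<omega>. ?A \<omega> - 1/4 * ?B \<omega> \<partial>M) = (\<integral>\<omega>. ?A \<omega> \<partial>M) - (\<integral>\<omega>. 1/4 * ?B \<omega> \<partial>M)"
      by (rule Bochner_Integration.integral_diff[OF A Bochner_Integration.integrable_mult_right[OF B]])
    also have "(\<integral>\<omega>. 1/4 * ?B \<omega> \<partial>M) = 1/4 * (\<integral>\<omega>. ?B \<omega> \<partial>M)" by (rule Bochner_Integration.integral_mult_right_zero)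
    also have "(\<integral>\<omega>. ?B \<omega> \<partial>M) = (\<Sum>j<N. (\<gamma> + 2 * \<gamma>t) * (\<bar>deriv (\<lambda>x. (\<sigma> x)\<^sup>2) (X j)\<bar> * Ju j s))"
      by (subst Bochner_Integration.integral_sum, rule iB) (simp_all add: Ju_def)
    also have "(\<integral>\<omega>. ?C \<omega> \<partial>M) = (\<Sum>j<N. \<bar>\<sigma> (X j)\<bar> * (\<eta>u * Jq j s + \<eta>q * Ju j s))"
      unfolding Ju_def Jq_def
    proof (subst Bochner_Integration.integral_sum, rule iC, assumption, rule sum.cong[OF refl])
      fix j assume j: "j \<in> {..<N}"
      then have "(\<integral>\<omega>. \<eta>u * (jump N X (q s \<omega>) j)\<^sup>2 + \<eta>q * (jump N X (u s \<omega>) j)\<^sup>2 \<partial>M)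
        = \<eta>u * (\<integral>\<omega>. (jump N X (q s \<omega>) j)\<^sup>2 \<partial>M) + \<eta>q * (\<integral>\<omega>. (jump N X (u s \<omega>) j)\<^sup>2 \<partial>M)"
        by (subst Bochner_Integration.integral_add) (auto intro!: Bochner_Integration.integrable_mult_right ju jq s)
      then show "(\<integral>\<omega>. \<bar>\<sigma> (X j)\<bar> * (\<eta>u * (jump N X (q s \<omega>) j)\<^sup>2 + \<eta>q * (jump N X (u s \<omega>) j)\<^sup>2) \<partial>M)
        = \<bar>\<sigma> (X j)\<bar> * (\<eta>u * (\<integral>\<omega>. (jump N X (q s \<omega>) j)\<^sup>2 \<partial>M) + \<eta>q * (\<integral>\<omega>. (jump N X (u s \<omega>) j)\<^sup>2 \<partial>M))"
        by simp
    qed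
    finally show ?thesis unfolding I_def .
  qed
  then have "(LBINT s:{0..t}. \<integral>\<omega>. dissipation (u s \<omega>) (q s \<omega>) \<partial>M)
    = (LBINT s:{0..t}. I s - 1/4 * (\<Sum>j<N. (\<gamma> + 2 * \<gamma>t) * (\<bar>deriv (\<lambda>x. (\<sigma> x)\<^sup>2) (X j)\<bar> * Ju j s))
      - (\<Sum>j<N. \<bar>\<sigma> (X j)\<bar> * (\<eta>u * Jq j s + \<eta>q * Ju j s)))"
    by (intro set_lebesgue_integral_cong) (use sT in auto)
  also have "\<dots> = (LBINT s:{0..t}. I s) - 1/4 * (\<Sum>j<N. (\<gamma> + 2 * \<gamma>t) * (\<bar>deriv (\<lambda>x. (\<sigma> x)\<^sup>2) (X j)\<bar> * (LBINT s:{0..t}. Ju j s)))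
      - (\<Sum>j<N. \<bar>\<sigma> (X j)\<bar> * (LBINT s:{0..t}. \<eta>u * Jq j s + \<eta>q * Ju j s))"
  proof -
    have sumI: "set_integrable lborel {0..t} (\<lambda>s. \<Sum>j<N. G j s)"
      "(LBINT s:{0..t}. \<Sum>j<N. G j s) = (\<Sum>j<N. LBINT s:{0..t}. G j s)"
      if "\<And>j. j < N \<Longrightarrow> set_integrable lborel {0..t} (G j)" for G :: "nat \<Rightarrow> real \<Rightarrow> real"
    proof -
      have i: "integrable lborel (\<lambda>s. indicator {0..t} s *\<^sub>R G j s)" if "j \<in> {..<N}" for j
        using \<open>\<And>j. j < N \<Longrightarrow> set_integrable lborel {0..t} (G j)\<close>[of j] that by (simp add: set_integrable_def)
      show "set_integrable lborel {0..t} (\<lambda>s. \<Sum>j<N. G j s)"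
        unfolding set_integrable_def scaleR_sum_right by (rule Bochner_Integration.integrable_sum) (rule i)
      show "(LBINT s:{0..t}. \<Sum>j<N. G j s) = (\<Sum>j<N. LBINT s:{0..t}. G j s)"
        unfolding set_lebesgue_integral_def scaleR_sum_right by (rule Bochner_Integration.integral_sum) (rule i)
    qed
    have b: "set_integrable lborel {0..t} (\<lambda>s. (\<gamma> + 2 * \<gamma>t) * (\<bar>deriv (\<lambda>x. (\<sigma> x)\<^sup>2) (X j)\<bar> * Ju j s))" if "j < N" for j
      by (intro set_integrable_mult_right Jint that)
    have c: "set_integrable lborel {0..t} (\<lambda>s. \<bar>\<sigma> (X j)\<bar> * (\<eta>u * Jq j s + \<eta>q * Ju j s))" if "j < N" for j
      by (intro set_integrable_mult_right set_integral_add(1) Jint that)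
    have B: "set_integrable lborel {0..t} (\<lambda>s. 1/4 * (\<Sum>j<N. (\<gamma> + 2 * \<gamma>t) * (\<bar>deriv (\<lambda>x. (\<sigma> x)\<^sup>2) (X j)\<bar> * Ju j s)))"
      by (intro set_integrable_mult_right sumI(1) b)
    have "(LBINT s:{0..t}. 1/4 * (\<Sum>j<N. (\<gamma> + 2 * \<gamma>t) * (\<bar>deriv (\<lambda>x. (\<sigma> x)\<^sup>2) (X j)\<bar> * Ju j s)))
      = 1/4 * (\<Sum>j<N. LBINT s:{0..t}. (\<gamma> + 2 * \<gamma>t) * (\<bar>deriv (\<lambda>x. (\<sigma> x)\<^sup>2) (X j)\<bar> * Ju j s))"
      using sumI(2)[of "\<lambda>j s. (\<gamma> + 2 * \<gamma>t) * (\<bar>deriv (\<lambda>x. (\<sigma> x)\<^sup>2) (X j)\<bar> * Ju j s)", OF b] by (simp only: set_integral_mult_right)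
    moreover have "(LBINT s:{0..t}. \<Sum>j<N. \<bar>\<sigma> (X j)\<bar> * (\<eta>u * Jq j s + \<eta>q * Ju j s))
      = (\<Sum>j<N. LBINT s:{0..t}. \<bar>\<sigma> (X j)\<bar> * (\<eta>u * Jq j s + \<eta>q * Ju j s))"
      by (rule sumI(2)) (rule c)
    ultimately show ?thesis
      using set_integral_diff(2)[OF set_integral_diff(1)[OF Iint B] sumI(1)[OF c]] set_integral_diff(2)[OF Iint B]
      by (simp only: set_integral_mult_right)
  qed
  \<comment> \<open>From here on the modifications \<open>u\<close> and \<open>q\<close> are
    replaced by the given \<open>uh\<close> and \<open>qh\<close>, whose second moments agree with
    theirs at every time.\<close>
  also have "(LBINT s:{0..t}. I s) = (LBINT s:{0..t}. LBINT x. weight x * (\<integral>\<omega>. (dg_fun N X (uh s \<omega>) x)\<^sup>2 \<partial>M))"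
  proof (rule set_lebesgue_integral_cong)
    show "\<forall>s. s \<in> {0..t} \<longrightarrow> I s = (LBINT x. weight x * (\<integral>\<omega>. (dg_fun N X (uh s \<omega>) x)\<^sup>2 \<partial>M))"
      unfolding I_def using U.weighted_moment_integral[OF sT] by blast
  qed simp
  also have "(\<Sum>j<N. (\<gamma> + 2 * \<gamma>t) * (\<bar>deriv (\<lambda>x. (\<sigma> x)\<^sup>2) (X j)\<bar> * (LBINT s:{0..t}. Ju j s)))
    = (\<Sum>j<N. (\<gamma> + 2 * \<gamma>t) * (\<bar>deriv (\<lambda>x. (\<sigma> x)\<^sup>2) (X j)\<bar> * (LBINT s:{0..t}. \<integral>\<omega>. (jump N X (uh s \<omega>) j)\<^sup>2 \<partial>M)))"
  proof (rule sum.cong[OF refl])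
    fix j assume j: "j \<in> {..<N}"
    have "(LBINT s:{0..t}. Ju j s) = (LBINT s:{0..t}. \<integral>\<omega>. (jump N X (uh s \<omega>) j)\<^sup>2 \<partial>M)"
      by (intro set_lebesgue_integral_cong) (use sT j in \<open>auto simp: Ju_def U.lin_square_transfer[OF lin_jump]\<close>)
    then show "(\<gamma> + 2 * \<gamma>t) * (\<bar>deriv (\<lambda>x. (\<sigma> x)\<^sup>2) (X j)\<bar> * (LBINT s:{0..t}. Ju j s))
      = (\<gamma> + 2 * \<gamma>t) * (\<bar>deriv (\<lambda>x. (\<sigma> x)\<^sup>2) (X j)\<bar> * (LBINT s:{0..t}. \<integral>\<omega>. (jump N X (uh s \<omega>) j)\<^sup>2 \<partial>M))"
      by (rule arg_cong)
  qed
  also have "(\<Sum>j<N. \<bar>\<sigma> (X j)\<bar> * (LBINT s:{0..t}. \<eta>u * Jq j s + \<eta>q * Ju j s))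
    = (\<Sum>j<N. \<bar>\<sigma> (X j)\<bar> * (LBINT s:{0..t}. \<eta>u * (\<integral>\<omega>. (jump N X (qh s \<omega>) j)\<^sup>2 \<partial>M) + \<eta>q * (\<integral>\<omega>. (jump N X (uh s \<omega>) j)\<^sup>2 \<partial>M)))"
  proof (rule sum.cong[OF refl])
    fix j assume j: "j \<in> {..<N}"
    have "(LBINT s:{0..t}. \<eta>u * Jq j s + \<eta>q * Ju j s)
      = (LBINT s:{0..t}. \<eta>u * (\<integral>\<omega>. (jump N X (qh s \<omega>) j)\<^sup>2 \<partial>M) + \<eta>q * (\<integral>\<omega>. (jump N X (uh s \<omega>) j)\<^sup>2 \<partial>M))"
      by (intro set_lebesgue_integral_cong) (use sT j in \<open>auto simp: Ju_def Jq_def U.lin_square_transfer[OF lin_jump] Q.lin_square_transfer[OF lin_jump]\<close>)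
    then show "\<bar>\<sigma> (X j)\<bar> * (LBINT s:{0..t}. \<eta>u * Jq j s + \<eta>q * Ju j s)
      = \<bar>\<sigma> (X j)\<bar> * (LBINT s:{0..t}. \<eta>u * (\<integral>\<omega>. (jump N X (qh s \<omega>) j)\<^sup>2 \<partial>M) + \<eta>q * (\<integral>\<omega>. (jump N X (uh s \<omega>) j)\<^sup>2 \<partial>M))"
      by (rule arg_cong)
  qed
  finally have D: "(LBINT s:{0..t}. \<integral>\<omega>. dissipation (u s \<omega>) (q s \<omega>) \<partial>M)
    = (LBINT s:{0..t}. LBINT x. weight x * (\<integral>\<omega>. (dg_fun N X (uh s \<omega>) x)\<^sup>2 \<partial>M))
      - 1/4 * (\<Sum>j<N. (\<gamma> + 2 * \<gamma>t) * (\<bar>deriv (\<lambda>x. (\<sigma> x)\<^sup>2) (X j)\<bar> * (LBINT s:{0..t}. \<integral>\<omega>. (jump N X (uh s \<omega>) j)\<^sup>2 \<partial>M)))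
      - (\<Sum>j<N. \<bar>\<sigma> (X j)\<bar> * (LBINT s:{0..t}. \<eta>u * (\<integral>\<omega>. (jump N X (qh s \<omega>) j)\<^sup>2 \<partial>M) + \<eta>q * (\<integral>\<omega>. (jump N X (uh s \<omega>) j)\<^sup>2 \<partial>M)))" .
  show "(\<integral>\<omega>. (L2_norm (dg_fun N X (uh t \<omega>)))\<^sup>2 \<partial>M)
        + 1/4 * (\<Sum>j<N. (\<gamma> + 2 * \<gamma>t) * (\<bar>deriv (\<lambda>x. (\<sigma> x)\<^sup>2) (X j)\<bar> *
              (LBINT s:{0..t}. \<integral>\<omega>. (jump N X (uh s \<omega>) j)\<^sup>2 \<partial>M)))
        + (\<Sum>j<N. \<bar>\<sigma> (X j)\<bar> *
              (LBINT s:{0..t}. \<eta>u * (\<integral>\<omega>. (jump N X (qh s \<omega>) j)\<^sup>2 \<partial>M)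
                             + \<eta>q * (\<integral>\<omega>. (jump N X (uh s \<omega>) j)\<^sup>2 \<partial>M)))
      = (L2_norm (dg_fun N X uh0))\<^sup>2
        + (LBINT s:{0..t}. LBINT x. weight x * (\<integral>\<omega>. (dg_fun N X (uh s \<omega>) x)\<^sup>2 \<partial>M))"
    unfolding U.L2_norm_transfer(2)[OF t] en[OF t] D L2_norm_dg_fun[OF uh0_dg_space] by (simp only: diff_add_cancel add_diff_eq)
qed

text \<open>As an integral over the real line the left-hand side admits bounds that hold only almost
  everywhere, such as those by \<open>Linf_norm\<close>. The sign of the second derivative is given
  up in favour of its absolute value.\<close>

lemma weighted_energy_le:
  assumes v: "v \<in> dg_space N k"
    and L: "Linf (deriv \<sigma>)" "Linf (deriv (deriv (\<lambda>x. (\<sigma> x)\<^sup>2)))"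
  shows "(\<Sum>j<N. LBINT x:{X j..X (Suc j)}. weight x * (poly (v j) x)\<^sup>2)
    \<le> ((Linf_norm (deriv \<sigma>))\<^sup>2 + 1/4 * Linf_norm (deriv (deriv (\<lambda>x. (\<sigma> x)\<^sup>2)))) * (\<Sum>c\<in>idx. (co c v)\<^sup>2)"
proof -
  let ?c = "(Linf_norm (deriv \<sigma>))\<^sup>2 + 1/4 * Linf_norm (deriv (deriv (\<lambda>x. (\<sigma> x)\<^sup>2)))"
  have "(\<Sum>j<N. LBINT x:{X j..X (Suc j)}. weight x * (poly (v j) x)\<^sup>2) = (\<integral>x. weight x * (dg_fun N X v x)\<^sup>2 \<partial>lborel)"
    by (rule dg_fun_weighted(2)[OF weight_continuous, symmetric])
  also have "\<dots> \<le> (\<integral>x. ?c * (dg_fun N X v x)\<^sup>2 \<partial>lborel)"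
  proof (rule integral_mono_AE[OF dg_fun_weighted(1)[OF weight_continuous] dg_fun_weighted(1)[OF continuous_on_const]])
    show "AE x in lborel. weight x * (dg_fun N X v x)\<^sup>2 \<le> ?c * (dg_fun N X v x)\<^sup>2"
      using Linf_AE_le(1)[OF L(1)] Linf_AE_le(1)[OF L(2)]
    proof eventually_elim
      case (elim x)
      have "(deriv \<sigma> x)\<^sup>2 \<le> (Linf_norm (deriv \<sigma>))\<^sup>2" using elim(1) by (simp add: abs_le_square_iff[symmetric])
      then have "weight x \<le> ?c" using elim(2) by linarith
      then show ?case by (rule mult_right_mono) simp
    qed
  qed
  also have "\<dots> = ?c * (\<Sum>c\<in>idx. (co c v)\<^sup>2)"
    unfolding L2_norm_dg_fun[OF v, symmetric] L2_norm_dg_fun_integral by (rule Bochner_Integration.integral_mult_right_zero)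
  finally show ?thesis .
qed

lemma dissipation_le:
  assumes "0 \<le> \<gamma>" "0 \<le> \<gamma>t" "0 \<le> \<eta>q"
  shows "dissipation u q \<le> (\<Sum>j<N. LBINT x:{X j..X (Suc j)}. weight x * (poly (u j) x)\<^sup>2)"
proof -
  have "0 \<le> (\<Sum>j<N. (\<gamma> + 2 * \<gamma>t) * (\<bar>deriv (\<lambda>x. (\<sigma> x)\<^sup>2) (X j)\<bar> * (jump N X u j)\<^sup>2))"
    using assms by (intro sum_nonneg mult_nonneg_nonneg) auto
  moreover have "0 \<le> (\<Sum>j<N. \<bar>\<sigma> (X j)\<bar> * (\<eta>u * (jump N X q j)\<^sup>2 + \<eta>q * (jump N X u j)\<^sup>2))"
    using assms \<eta>u_nonneg by (intro sum_nonneg mult_nonneg_nonneg add_nonneg_nonneg) auto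
  ultimately show ?thesis unfolding dissipation_def by linarith
qed

lemma energy_stability:
  assumes \<gamma>: "0 \<le> \<gamma>" "0 \<le> \<gamma>t" "0 \<le> \<eta>q"
    and L: "Linf (deriv \<sigma>)" "Linf (deriv (deriv (\<lambda>x. (\<sigma> x)\<^sup>2)))" and t: "t \<in> {0..T}"
  shows "(\<integral>\<omega>. (L2_norm (dg_fun N X (uh t \<omega>)))\<^sup>2 \<partial>M)
    \<le> (L2_norm (dg_fun N X uh0))\<^sup>2 * exp (((Linf_norm (deriv \<sigma>))\<^sup>2 + 1/4 * Linf_norm (deriv (deriv (\<lambda>x. (\<sigma> x)\<^sup>2)))) * t)"
proof -
  let ?c = "(Linf_norm (deriv \<sigma>))\<^sup>2 + 1/4 * Linf_norm (deriv (deriv (\<lambda>x. (\<sigma> x)\<^sup>2)))"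
  obtain u q B where mu: "moment_process M F W N k X e T \<sigma> \<gamma> \<gamma>t \<theta> \<eta>u \<eta>q uh0 uh qh u uh B"
    and mq: "moment_process M F W N k X e T \<sigma> \<gamma> \<gamma>t \<theta> \<eta>u \<eta>q uh0 uh qh q qh B"
    and en: "\<And>t. t \<in> {0..T} \<Longrightarrow> (\<integral>\<omega>. (\<Sum>c\<in>idx. (co c (u t \<omega>))\<^sup>2) \<partial>M)
      = (\<Sum>c\<in>idx. (co c uh0)\<^sup>2) + (LBINT s:{0..t}. \<integral>\<omega>. dissipation (u s \<omega>) (q s \<omega>) \<partial>M)"
    by (rule moment_energy) (assumption | rule that)+
  interpret U: moment_process M F W N k X e T \<sigma> \<gamma> \<gamma>t \<theta> \<eta>u \<eta>q uh0 uh qh u uh B by (rule mu)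
  define f where "f = (\<lambda>t. \<integral>\<omega>. (\<Sum>c\<in>idx. (co c (u t \<omega>))\<^sup>2) \<partial>M)"
  have c: "0 \<le> ?c" using Linf_AE_le(2)[OF L(2)] by simp
  have jm: "case_prod (\<lambda>t \<omega>. \<Sum>c\<in>idx. (co c (u t \<omega>))\<^sup>2) \<in> borel_measurable (borel \<Otimes>\<^sub>M M)"
    unfolding split_beta'
  proof (intro borel_measurable_sum borel_measurable_power)
    fix c assume "c \<in> idx"
    from regular_processD(1)[OF U.lin_regular[OF lin_co[OF this]]]
    show "(\<lambda>x. co c (u (fst x) (snd x))) \<in> borel_measurable (borel \<Otimes>\<^sub>M M)" by (simp add: split_beta')
  qed
  have fm: "f \<in> borel_measurable borel" unfolding f_def by (rule borel_measurable_lebesgue_integral[OF jm])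
  have sqi: "integrable M (\<lambda>\<omega>. (co c (u s \<omega>))\<^sup>2)" if "s \<in> {0..T}" "c \<in> idx" for s c
    by (rule sq_int_square[OF U.lin_sq_int[OF lin_co[OF that(2)] that(1)]])
  have fi: "integrable M (\<lambda>\<omega>. \<Sum>c\<in>idx. (co c (u s \<omega>))\<^sup>2)" if "s \<in> {0..T}" for s
    by (rule Bochner_Integration.integrable_sum) (rule sqi[OF that])
  \<comment> \<open>The a priori bound that \<open>gronwall\<close> asks for, from the moment bound
    of each coordinate.\<close>
  have fb: "0 \<le> f s \<and> f s \<le> (\<Sum>c\<in>idx. B)" if s: "s \<in> {0..T}" for s
  proof
    show "0 \<le> f s" unfolding f_def by (intro Bochner_Integration.integral_nonneg sum_nonneg) simp
    have "f s = (\<Sum>c\<in>idx. \<integral>\<omega>. (co c (u s \<omega>))\<^sup>2 \<partial>M)" unfolding f_def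
      by (rule Bochner_Integration.integral_sum) (rule sqi[OF s])
    also have "\<dots> \<le> (\<Sum>c\<in>idx. B)"
    proof (rule sum_mono)
      fix c assume c: "c \<in> idx"
      have "ennreal (\<integral>\<omega>. (co c (u s \<omega>))\<^sup>2 \<partial>M) = (\<integral>\<^sup>+\<omega>. ennreal ((co c (u s \<omega>))\<^sup>2) \<partial>M)"
        by (rule nn_integral_eq_integral[symmetric, OF sqi[OF s c]]) simp
      also have "\<dots> \<le> ennreal B" by (rule U.v_bound[OF s c])
      finally show "(\<integral>\<omega>. (co c (u s \<omega>))\<^sup>2 \<partial>M) \<le> B" using U.B_nonneg by (simp add: ennreal_le_iff)
    qed
    finally show "f s \<le> (\<Sum>c\<in>idx. B)" .
  qed
  have fint: "set_integrable lborel {0..t} f" if "t \<in> {0..T}" for t unfolding f_def by (rule U.norm_set_integrable[OF that])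
  have le: "f t \<le> (\<Sum>c\<in>idx. (co c uh0)\<^sup>2) + ?c * (LBINT s:{0..t}. f s)" if t: "t \<in> {0..T}" for t
  proof -
    \<comment> \<open>The jump terms are dropped under the expectation; the majorant is nonnegative
      and integrable, as this form of monotonicity requires.\<close>
    have ge: "(\<integral>\<omega>. dissipation (u s \<omega>) (q s \<omega>) \<partial>M) \<le> ?c * f s" if s: "s \<in> {0..T}" for s
    proof -
      have "(\<integral>\<omega>. dissipation (u s \<omega>) (q s \<omega>) \<partial>M) \<le> (\<integral>\<omega>. ?c * (\<Sum>c\<in>idx. (co c (u s \<omega>))\<^sup>2) \<partial>M)"
      proof (rule integral_mono_AE')
        show "integrable M (\<lambda>\<omega>. ?c * (\<Sum>c\<in>idx. (co c (u s \<omega>))\<^sup>2))" by (rule Bochner_Integration.integrable_mult_right[OF fi[OF s]])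
        show "AE \<omega> in M. dissipation (u s \<omega>) (q s \<omega>) \<le> ?c * (\<Sum>c\<in>idx. (co c (u s \<omega>))\<^sup>2)"
          by (rule AE_I2) (rule order_trans[OF dissipation_le[OF \<gamma>] weighted_energy_le[OF U.v_dg L]])
        show "AE \<omega> in M. 0 \<le> ?c * (\<Sum>c\<in>idx. (co c (u s \<omega>))\<^sup>2)"
          by (intro AE_I2 mult_nonneg_nonneg c sum_nonneg) simp
      qed
      also have "\<dots> = ?c * f s" unfolding f_def by (rule Bochner_Integration.integral_mult_right_zero)
      finally show ?thesis .
    qed
    have "(LBINT s:{0..t}. \<integral>\<omega>. dissipation (u s \<omega>) (q s \<omega>) \<partial>M) \<le> (LBINT s:{0..t}. ?c * f s)"
      unfolding set_lebesgue_integral_def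
    proof (rule integral_mono_AE')
      show "integrable lborel (\<lambda>s. indicator {0..t} s *\<^sub>R (?c * f s))"
        using set_integrable_mult_right[OF fint[OF t], of ?c] by (simp add: set_integrable_def)
      show "AE s in lborel. indicator {0..t} s *\<^sub>R (\<integral>\<omega>. dissipation (u s \<omega>) (q s \<omega>) \<partial>M) \<le> indicator {0..t} s *\<^sub>R (?c * f s)"
        by (rule AE_I2) (use ge t in \<open>auto simp: indicator_def\<close>)
      show "AE s in lborel. 0 \<le> indicator {0..t} s *\<^sub>R (?c * f s)"
        by (rule AE_I2) (use fb t c in \<open>auto simp: indicator_def\<close>)
    qed
    then show ?thesis using en[OF t] by (simp only: f_def[symmetric] set_integral_mult_right) (simp add: f_def)
  qed
  have "f t \<le> (\<Sum>c\<in>idx. (co c uh0)\<^sup>2) * exp (?c * t)"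
    by (rule gronwall[OF fm fb le _ c t]) (auto intro: sum_nonneg)
  then show ?thesis unfolding U.L2_norm_transfer(2)[OF t] L2_norm_dg_fun[OF uh0_dg_space] f_def .
qed

end

lemma dg_frame_exists:
  assumes "mesh N X"
  obtains e where "dg_frame N k X e"
proof -
  have "\<forall>j\<in>{..<N}. \<exists>e. (\<forall>i\<le>k. degree (e i) \<le> k) \<and>
    (\<forall>p. degree p \<le> k \<longrightarrow> p = (\<Sum>i\<le>k. smult (poly_inner (X j) (X (Suc j)) p (e i)) (e i)))"
  proof
    fix j assume "j \<in> {..<N}"
    then have "X j < X (Suc j)" using assms by (simp add: mesh_def)
    then obtain e where "\<And>i. i \<le> k \<Longrightarrow> degree (e i) \<le> k"
      "\<And>p. degree p \<le> k \<Longrightarrow> p = (\<Sum>i\<le>k. smult (poly_inner (X j) (X (Suc j)) p (e i)) (e i))"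
      by (rule poly_basis_exists) (assumption | rule that)+
    then show "\<exists>e. (\<forall>i\<le>k. degree (e i) \<le> k) \<and>
      (\<forall>p. degree p \<le> k \<longrightarrow> p = (\<Sum>i\<le>k. smult (poly_inner (X j) (X (Suc j)) p (e i)) (e i)))" by (intro exI[of _ e]) simp
  qed
  from bchoice[OF this] obtain e where e: "\<forall>j\<in>{..<N}. (\<forall>i\<le>k. degree (e j i) \<le> k) \<and>
    (\<forall>p. degree p \<le> k \<longrightarrow> p = (\<Sum>i\<le>k. smult (poly_inner (X j) (X (Suc j)) p (e j i)) (e j i)))" by blast
  have "dg_frame N k X e" by (rule dg_frame.intro) (use assms e in auto)
  then show thesis by (rule that)
qed

theorem theorem3p14:
  fixes M :: "'w measure" and F :: "real \<Rightarrow> 'w measure" and W :: "real \<Rightarrow> 'w \<Rightarrow> real"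
    and T :: real and \<sigma> ubar :: "real \<Rightarrow> real" and u :: "real \<Rightarrow> 'w \<Rightarrow> real \<Rightarrow> real"
    and N k :: nat and X :: "nat \<Rightarrow> real"
    and \<gamma> \<gamma>t \<theta> \<eta>u \<eta>q :: real
    and uh0 :: bpoly and uh qh :: "real \<Rightarrow> 'w \<Rightarrow> bpoly"
  assumes "brownian_motion M F W" and "T > 0"
    and "C2 \<sigma>"
    and "L2 ubar" and "compactly_supported ubar"
    and "mesh N X"
    and "exact_solution M F W T \<sigma> ubar u"
    and "AE \<omega> in M. \<forall>t\<in>{0..T}. AE x in lborel. x \<notin> {X 0..X N} \<longrightarrow> u t \<omega> x = 0"
    and "\<gamma> \<in> {0..1}" and "\<theta> \<in> {0..1}" and "\<gamma>t \<ge> 0" and "\<eta>u \<ge> 0" and "\<eta>q \<ge> 0"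
    and "L2_projection N X k ubar uh0"
    and "ldg_solution M F W T \<sigma> N X k \<gamma> \<gamma>t \<theta> \<eta>u \<eta>q uh0 uh qh"
    and "no_boundary_transport M T \<sigma> N X uh"
  shows "(\<forall>t\<in>{0<..T}.
      (\<forall>s\<in>{0..t}. integrable M (\<lambda>\<omega>. (L2_norm (dg_fun N X (uh s \<omega>)))\<^sup>2) \<and>
                  integrable M (\<lambda>\<omega>. (L2_norm (dg_fun N X (qh s \<omega>)))\<^sup>2)) \<and>
      set_integrable lborel {0..t} (\<lambda>s. \<integral>\<omega>. (L2_norm (dg_fun N X (uh s \<omega>)))\<^sup>2 \<partial>M) \<and>
      set_integrable lborel {0..t} (\<lambda>s. \<integral>\<omega>. (L2_norm (dg_fun N X (qh s \<omega>)))\<^sup>2 \<partial>M) \<and>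
      (\<integral>\<omega>. (L2_norm (dg_fun N X (uh t \<omega>)))\<^sup>2 \<partial>M)
        + 1/4 * (\<Sum>j<N. (\<gamma> + 2 * \<gamma>t) * (\<bar>deriv (\<lambda>x. (\<sigma> x)\<^sup>2) (X j)\<bar> *
              (LBINT s:{0..t}. \<integral>\<omega>. (jump N X (uh s \<omega>) j)\<^sup>2 \<partial>M)))
        + (\<Sum>j<N. \<bar>\<sigma> (X j)\<bar> *
              (LBINT s:{0..t}. \<eta>u * (\<integral>\<omega>. (jump N X (qh s \<omega>) j)\<^sup>2 \<partial>M)
                             + \<eta>q * (\<integral>\<omega>. (jump N X (uh s \<omega>) j)\<^sup>2 \<partial>M)))
      = (L2_norm (dg_fun N X uh0))\<^sup>2
        + (LBINT s:{0..t}. LBINT x.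
             ((deriv \<sigma> x)\<^sup>2 - 1/4 * deriv (deriv (\<lambda>y. (\<sigma> y)\<^sup>2)) x)
             * (\<integral>\<omega>. (dg_fun N X (uh s \<omega>) x)\<^sup>2 \<partial>M)))
    \<and> (Linf (deriv \<sigma>) \<and> Linf (deriv (deriv \<sigma>)) \<and> Linf (deriv (deriv (\<lambda>x. (\<sigma> x)\<^sup>2))) \<longrightarrow>
      (\<forall>t\<in>{0<..T}. (\<integral>\<omega>. (L2_norm (dg_fun N X (uh t \<omega>)))\<^sup>2 \<partial>M)
        \<le> (L2_norm ubar)\<^sup>2 *
           exp (((Linf_norm (deriv \<sigma>))\<^sup>2 + 1/4 * Linf_norm (deriv (deriv (\<lambda>x. (\<sigma> x)\<^sup>2)))) * t)))"
proof -
  obtain e where "dg_frame N k X e" using dg_frame_exists[OF assms(6)] .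
  then interpret ldg_approximation M F W N k X e T \<sigma> \<gamma> \<gamma>t \<theta> \<eta>u \<eta>q uh0 uh qh
    by (intro ldg_approximation.intro ldg_approximation_axioms.intro)
      (use assms in \<open>auto simp: L2_projection_def\<close>)
  have "0 \<le> \<gamma>" using assms(9) by simp
  note st = energy_stability[OF this assms(11,13)]
  show ?thesis
  proof (intro conjI ballI impI, goal_cases)
    case (1 t s)
    then have "s \<in> {0..T}" by auto
    then show ?case by (rule energy_identity(1))
  next
    case (2 t s)
    then have "s \<in> {0..T}" by auto
    then show ?case by (rule energy_identity(2))
  next
    case (3 t)
    then have "t \<in> {0..T}" by auto
    then show ?case by (rule energy_identity(3))
  next
    case (4 t)
    then have "t \<in> {0..T}" by auto
    then show ?case by (rule energy_identity(4))
  next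
    case (5 t)
    then have "t \<in> {0..T}" by auto
    then show ?case by (rule energy_identity(5))
  next
    case (6 t)
    then have "t \<in> {0..T}" by auto
    from 6(1) st[OF _ _ this] have "(\<integral>\<omega>. (L2_norm (dg_fun N X (uh t \<omega>)))\<^sup>2 \<partial>M)
      \<le> (L2_norm (dg_fun N X uh0))\<^sup>2 * exp (((Linf_norm (deriv \<sigma>))\<^sup>2 + 1/4 * Linf_norm (deriv (deriv (\<lambda>x. (\<sigma> x)\<^sup>2)))) * t)"
      by blast
    \<comment> \<open>The projection is a contraction, so the initial energy of the scheme is at
      most that of \<open>ubar\<close>.\<close>
    also have "\<dots> \<le> (L2_norm ubar)\<^sup>2 * exp (((Linf_norm (deriv \<sigma>))\<^sup>2 + 1/4 * Linf_norm (deriv (deriv (\<lambda>x. (\<sigma> x)\<^sup>2)))) * t)"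
      by (intro mult_right_mono L2_projection_norm[OF assms(4,14)]) simp
    finally show ?case .
  qed
qed
end
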